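(* Consider the $A_\infty$ structure $X$ on $\mathcal{H}=H(\mathcal{A}(\mathcal{Z}))$ and the $A_\infty$ morphism $f:\mathcal{H}\to\mathcal{A}=\mathcal{A}(\mathcal{Z})$ arising from a pair ordering $\preceq$ on an arc diagram $\mathcal{Z}$. Let $M=M_1\otimes\cdots\otimes M_n$ be a viable tensor product of nonzero homology classes of diagrams. (1) Suppose $M$ has no on-on doubly occupied matched pairs. If every valid distributive operation tree for $M$ is strictly $f$-distributive, and at least one such tree exists, then $\overline{f}_n(M)\ne0$. Moreover, $\overline{f}_n(M)$ is given by a single diagram $D$, which is tight at all matched pairs where $M$ is tight or critical, and crossed at all matched pairs where $M$ is twisted. (2) Suppose $M$ has no twisted or on-on doubly occupied matched pairs. If every valid distributive operation tree for $M$ is strictly $X$-distributive, and at least one such tree exists, then $X_n(M)\ne0$. Moreover, $X_n(M)$ is the homology class of the unique tight diagram with the H-data of $M$.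
   Context: All algebra is over $\mathbb{Z}_2$. An arc diagram $\mathcal{Z}=(\mathbf{Z},\mathbf{a},r)$ consists of oriented intervals $\mathbf{Z}=\{Z_1,\dots,Z_l\}$, distinct points $\mathbf{a}=(a_1,\dots,a_{2k})$ (places) in the interiors of the intervals, ordered along them, and a 2-to-1 map $r:\mathbf{a}\to\{1,\dots,k\}$ such that oriented surgery on $\mathbf{Z}$ at all $0$-spheres $r^{-1}(i)$ yields a 1-manifold with no circle components. The fibres $P=\{p,q\}$ of $r$ are the matched pairs, identified with $1,\dots,k$. Let $-\infty_i,+\infty_i$ be the start and end of $Z_i$ and $\mathbf{a}_{\pm\infty}=\mathbf{a}\cup\{\pm\infty_i\}$, partially ordered along the intervals; the places cut the intervals into steps. A strand diagram is a triple $(S,T,\phi)$ with $S,T\subseteq\mathbf{a}_{\pm\infty}$ and $\phi:S\to T$ a bijection with $\phi(x)\ge x$; it is drawn as strands in $[0,1]\times\mathbf{Z}$ from $\{0\}\times S$ to $\{1\}\times T$, meeting efficiently; crossings are inversions ($x<y$ with $\phi(x)>\phi(y)$), counted by $\mathrm{inv}$. The product of $(S,T,\phi)$ and $(U,V,\psi)$ is $(S,V,\psi\phi)$ if $T=U$ and $\mathrm{inv}(\psi\phi)=\mathrm{inv}(\phi)+\mathrm{inv}(\psi)$, and $0$ otherwise; $\partial$ is the sum of all resolutions of one crossing which lower the number of crossings by exactly $1$. $I(S)$ is the identity diagram on $S$. For a set $s$ of matched pairs let $I(s)=\sum_S I(S)$, over all $S\subseteq \mathbf{a}_{\pm\infty}$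 consisting of exactly one place of each pair in $s$, no other places, and any subset of $\{\pm\infty_i\}$. For $\mu=(S,T,\phi)$ without horizontal strands (fixed points) let $a(\mu)=\sum_U(S\cup U,T\cup U,\phi_U)$ over $U\subseteq\mathbf{a}_{\pm\infty}\setminus(S\cup T)$, $\phi_U$ extending $\phi$ by the identity. A diagram from $s$ to $t$ is a nonzero element $I(s)a(\mu)I(t)$; it is drawn as one picture with dotted horizontal strands at both places $p,q$ of every matched pair carrying a horizontal strand. The (augmented) strand algebra $\mathcal{A}=\mathcal{A}(\mathcal{Z})$ is the DGA with basis the diagrams; $\mathcal{H}=H(\mathcal{A})$, a DGA with zero differential. H-data is a triple $(h,s,t)$ with $h\in H_1(\mathbf{Z},\mathbf{a}_{\pm\infty})$ and $s,t$ sets of matched pairs. A diagram from $s$ to $t$ has H-data $(h,s,t)$, $h=\sum_x[x,\phi(x)]$; $\mathcal{A}(h,s,t)$ is the span of diagrams with this H-data and $\mathcal{H}(h,s,t)$ its homology, so $\mathcal{A}=\bigoplus\mathcal{A}(h,s,t)$, $\mathcal{H}=\bigoplus\mathcal{H}(h,s,t)$. The Maslov grading is $\iota(D)=\mathrm{inv}(\mu)-m(h,S)$ for any term $\mu=(S,T,\phi)$ of $D$, where $m(h,S)$ is the sum over places $a\in S\cap\mathbf{a}$ of the average multiplicity of $h$ on the two steps at $a$ (and $m$ is extended linearly to $0$-chains, ignoring $\pm\infty_i$). $h$ (and any H-data or diagram with H-grading $h$) is viable if $h$ has multiplicity $0$ or $1$ on every step. In a viable diagram every crossing involves a horizontal strand,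 hence lies at a matched pair. Cutting the intervals between consecutive places gives, for each matched pair $P=\{p,q\}$, the fragment $\mathcal{Z}_P$ (two intervals with one place each); cutting a viable diagram $D$ accordingly gives local diagrams $D_P\in\mathcal{A}(\mathcal{Z}_P)$. A viable diagram is tight if it has no crossings and is nonzero in homology, twisted if it has no crossings and is zero in homology, crossed if it has crossings; it has such a property at $P$ if $D_P$ does. Viable H-data is tight (resp. twisted) if some tight (resp. twisted) diagram has that H-data, and singular otherwise. Each $\mathcal{H}(h,s,t)$ is $0$ or $\mathbb{Z}_2$, nonzero exactly for tight $(h,s,t)$, with generator represented by any tight diagram with H-data $(h,s,t)$. A pair $P$ is 11 (on-on) if $P\in s$ and $P\in t$; it is once occupied at $p$ by $h$ if $h$ covers both steps at $p$ and neither step at the twin $q$; doubly occupied if $h$ covers all four steps at $p,q$. $\mathcal{F}\subset\mathcal{A}$ is the two-sided ideal spanned by diagrams that are non-viable or have a crossing at some doubly occupied pair. $\overline{f}$ denotes the composition of a map $f$ into $\mathcal{A}$ with $\mathcal{A}\to\mathcal{A}/\mathcal{F}$. For classes $M_i$ with H-data $(h_i,s_i,t_i)$, $M=M_1\otimes\cdots\otimes M_n$ has an idempotent mismatch if some $t_i\neq s_{i+1}$; $M$ is viable if it has no mismatch and $\sum h_i$ is viable. Its H-data is $(h,s,t)=(\sum h_i,s_1,t_n)$ (occupation and on-on status of pairs in $M$ refer to this H-data) and its Maslov grading is $\sum\iota(M_i)+\sum_{j<k}m(h_k,\partial h_j)$. A map preserves H-data if it sends such $M$ into the $(\sum h_i,s_1,t_n)$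 summand. Tightness of a viable tensor product $M$ of nonzero classes: let $D_i$ be (tight) diagrams representing $M_i$; $M$ is tight if $D_1\cdots D_n$ is nonzero and tight; twisted if $D_1\cdots D_n$ is nonzero and twisted; critical if $D_1\cdots D_n=0$ but $\mathcal{A}(h,s,t)\ne0$; singular if $\mathcal{A}(h,s,t)=0$. Exactly one holds, independently of the choice of $D_i$. $M$ is tight, twisted, critical or singular at a matched pair $P$ if $M_P=(M_1)_P\otimes\cdots\otimes(M_n)_P$ is so on $\mathcal{Z}_P$, where $(M_i)_P$ is the homology class of $(D_i)_P$. A pair ordering $\preceq$ is a total order on the set of matched pairs together with a total order on the two places of each matched pair. $f^{\preceq}:\mathcal{H}\to\mathcal{A}$ is the linear map sending, for each tight $(h,s,t)$, the generator of $\mathcal{H}(h,s,t)$ to the unique tight diagram with H-data $(h,s,t)$ in which, at each 11 doubly occupied pair, strands begin and end at the $\preceq$-smaller place of the pair. The operator $A^*_{\preceq}$ on $\bigoplus_{(h,s,t)\text{ twisted}}\mathcal{A}(h,s,t)$ is defined on diagrams $D\in\mathcal{A}(h,s,t)$ as follows: let $P=\{p,q\}$ be the $\preceq$-smallest 11 once occupied pair, $p$ its occupied place (a twisted $(h,s,t)$ has such a pair). If $D$ has a crossing at $P$, $A^*_{\preceq}D=0$. Otherwise one strand of $D$ ends at $p$ and another begins at $p$; $A^*_{\preceq}D$ is obtained by joining these into a single strand running past $p$ and adding dotted horizontal strands at $p$ and $q$. The $A_\infty$ structure $X$ on $\mathcal{H}$ and $A_\infty$ morphism $f:\mathcal{H}\to\mathcal{A}$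 ($\mathcal{A}$ having trivial $n$-ary operations for $n\ge3$) arising from $\preceq$ have $X_1=0$, $X_2$ multiplication, $f_1=f^{\preceq}$, and satisfy, for all tensor products $M$ of nonzero homology classes of diagrams: (a) if $M$ is not viable then $\overline{f}_n(M)=0$, $X_n(M)=0$, and if $M$ has an idempotent mismatch then $f_n(M)=0$; (b) $X_n,f_n$ preserve H-data and have Maslov degrees $n-2,n-1$; (c) for $n\ge2$, if $(f_1X_n-U_n)(M)=0$ then $f_n(M)=0$; (d) for $n\ge2$ and $M$ viable with twisted H-data, $f_n(M)=A^*_{\preceq}((f_1X_n-U_n)(M))$. Here $U_n(a_1\otimes\cdots\otimes a_n)=\sum_{j=1}^{n-1}f_j(a_1\otimes\cdots\otimes a_j)f_{n-j}(a_{j+1}\otimes\cdots\otimes a_n)+\sum_{2\le j\le n-1,\,0\le k\le n-j}f_{n-j+1}(a_1\otimes\cdots\otimes a_k\otimes X_j(a_{k+1}\otimes\cdots\otimes a_{k+j})\otimes\cdots\otimes a_n)$, $X_n=[U_n]$, and the morphism relations amount to $\partial f_n=f_1X_n-U_n$. Such $X$, $f$ exist, and the $X_n$ and $\overline{f}_n$ are uniquely determined by $\preceq$. An operation tree for $M=M_1\otimes\cdots\otimes M_n$ is a rooted plane binary tree with $n$ leaves, ordered left to right and labelled $M_1,\dots,M_n$, each non-leaf vertex being labelled by the tensor product of the labels of its two ordered children, such that every label is viable; so the root is labelled $M$. It is valid if no vertex label is singular. Let $v$ be a vertex of a valid operation tree, with $k$ leaves at or below it and label $M_v$, and let $N_v$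 be the number of matched pairs at which $M_v$ is twisted or critical. The vertex $v$ is distributive if $N_v\ge k-2$ and strictly distributive if $N_v=k-1$. A valid operation tree is distributive if all its vertices are distributive; strictly $f$-distributive if all its vertices are strictly distributive; strictly $X$-distributive if all its non-root vertices are strictly distributive and $N_{\mathrm{root}}=n-2$. *)

theory Defs
  imports Complex_Main "HOL-Library.Z2" "HOL-Library.Poly_Mapping" "HOL-Library.Set_Algebras"
begin

section \<open>Arc diagrams\<close>

text \<open>
  The points of the interval \<open>i\<close> that matter are \<open>(i, 0), \<dots>, (i, n + 1)\<close> with \<open>n = nplaces Z i\<close>:
  \<open>(i, 0)\<close> is the start of the interval, \<open>(i, n + 1)\<close> is its end, and the points in between are
  its places, in their order along the interval.
  A step is denoted by its starting point, so \<open>(i, j)\<close> also stands for the step from \<open>(i, j)\<close>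
  to \<open>(i, j + 1)\<close>.
\<close>

type_synonym 'i point = "'i \<times> nat"

record 'i arc_diagram =
  ivals :: "'i set"
  nplaces :: "'i \<Rightarrow> nat"
  npairs :: nat
  pairing :: "'i point \<Rightarrow> nat"

definition points :: "'i arc_diagram \<Rightarrow> 'i point set" where
  "points Z = {(i, j). i \<in> ivals Z \<and> j \<le> nplaces Z i + 1}"

definition places :: "'i arc_diagram \<Rightarrow> 'i point set" where
  "places Z = {(i, j). i \<in> ivals Z \<and> 1 \<le> j \<and> j \<le> nplaces Z i}"

definition steps :: "'i arc_diagram \<Rightarrow> 'i point set" where
  "steps Z = {(i, j). i \<in> ivals Z \<and> j \<le> nplaces Z i}"

definition pairs :: "'i arc_diagram \<Rightarrow> nat set" where
  "pairs Z = {1..npairs Z}"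

definition fibre :: "'i arc_diagram \<Rightarrow> nat \<Rightarrow> 'i point set" where
  "fibre Z P = {p \<in> places Z. pairing Z p = P}"

definition twin :: "'i arc_diagram \<Rightarrow> 'i point \<Rightarrow> 'i point" where
  "twin Z p = (THE q. q \<in> fibre Z (pairing Z p) \<and> q \<noteq> p)"

text \<open>
  After oriented surgery at all the matched pairs, the step ending at a place \<open>p\<close> is followed by
  the step starting at the twin of \<open>p\<close>. Circle components are the cycles of this relation.
\<close>

definition surgery_rel :: "'i arc_diagram \<Rightarrow> ('i point \<times> 'i point) set" where
  "surgery_rel Z = {((i, j), twin Z (i, j + 1)) | i j. (i, j + 1) \<in> places Z}"

definition arc_diagram :: "'i arc_diagram \<Rightarrow> bool" where
  "arc_diagram Z \<longleftrightarrow> finite (ivals Z) \<and> pairing Z ` places Z \<subseteq> pairs Z \<and>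
     (\<forall>P \<in> pairs Z. card (fibre Z P) = 2) \<and> acyclic (surgery_rel Z)"

definition pt_le :: "'i point \<Rightarrow> 'i point \<Rightarrow> bool" where
  "pt_le x y \<longleftrightarrow> fst x = fst y \<and> snd x \<le> snd y"

definition pt_less :: "'i point \<Rightarrow> 'i point \<Rightarrow> bool" where
  "pt_less x y \<longleftrightarrow> fst x = fst y \<and> snd x < snd y"

section \<open>Strand diagrams\<close>

text \<open>
  A strand diagram \<open>(S, T, \<phi>)\<close> is represented by the graph of \<open>\<phi>\<close>, so that \<open>S\<close> and \<open>T\<close> are the
  domain and the range of this relation.
\<close>

type_synonym 'i strands = "('i point \<times> 'i point) set"

definition strand_diagram :: "'i arc_diagram \<Rightarrow> 'i strands \<Rightarrow> bool" where
  "strand_diagram Z \<phi> \<longleftrightarrow> \<phi> \<subseteq> points Z \<times> points Z \<and> single_valued \<phi> \<and> single_valued (\<phi>\<inverse>) \<and>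
     (\<forall>(x, y) \<in> \<phi>. pt_le x y)"

definition crossings :: "'i strands \<Rightarrow> (('i point \<times> 'i point) \<times> ('i point \<times> 'i point)) set" where
  "crossings \<phi> = {((x, y), (x', y')). (x, y) \<in> \<phi> \<and> (x', y') \<in> \<phi> \<and> pt_less x x' \<and> pt_less y' y}"

definition inv_count :: "'i strands \<Rightarrow> nat" where
  "inv_count \<phi> = card (crossings \<phi>)"

definition resolve ::
    "'i strands \<Rightarrow> ('i point \<times> 'i point) \<times> ('i point \<times> 'i point) \<Rightarrow> 'i strands" where
  "resolve \<phi> c = (case c of ((x, y), (x', y')) \<Rightarrow>
     \<phi> - {(x, y), (x', y')} \<union> {(x, y'), (x', y)})"

text \<open>Elements of the free \<open>\<int>\<^sub>2\<close>-module on the strand diagrams.\<close>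

type_synonym 'i alg = "'i strands \<Rightarrow>\<^sub>0 bit"

definition strand_elt :: "'i strands \<Rightarrow> 'i alg" where
  "strand_elt \<phi> = Poly_Mapping.single \<phi> 1"

definition strand_mul :: "'i strands \<Rightarrow> 'i strands \<Rightarrow> 'i alg" where
  "strand_mul \<phi> \<psi> =
     (if Range \<phi> = Domain \<psi> \<and> inv_count (\<phi> O \<psi>) = inv_count \<phi> + inv_count \<psi>
      then strand_elt (\<phi> O \<psi>) else 0)"

definition strand_diff :: "'i strands \<Rightarrow> 'i alg" where
  "strand_diff \<phi> =
     (\<Sum>c \<in> {c \<in> crossings \<phi>. inv_count (resolve \<phi> c) + 1 = inv_count \<phi>}. strand_elt (resolve \<phi> c))"

definition mul :: "'i alg \<Rightarrow> 'i alg \<Rightarrow> 'i alg"  (infixl \<open>\<odot>\<close> 70) where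
  "a \<odot> b = (\<Sum>\<phi> \<in> Poly_Mapping.keys a. \<Sum>\<psi> \<in> Poly_Mapping.keys b. strand_mul \<phi> \<psi>)"

definition diff :: "'i alg \<Rightarrow> 'i alg" where
  "diff a = (\<Sum>\<phi> \<in> Poly_Mapping.keys a. strand_diff \<phi>)"

definition prod_alg :: "'i alg list \<Rightarrow> 'i alg" where
  "prod_alg as = foldl (\<odot>) (hd as) (tl as)"

definition span2 :: "'i alg set \<Rightarrow> 'i alg set" where
  "span2 B = {\<Sum>a \<in> F. a | F. finite F \<and> F \<subseteq> B}"

section \<open>The strand algebra\<close>

definition idem :: "'i arc_diagram \<Rightarrow> nat set \<Rightarrow> 'i alg" where
  "idem Z s =
     (\<Sum>S \<in> {S. S \<subseteq> points Z \<and> inj_on (pairing Z) (S \<inter> places Z) \<and> pairing Z ` (S \<inter> places Z) = s}.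
        strand_elt (Id_on S))"

definition fill :: "'i arc_diagram \<Rightarrow> 'i strands \<Rightarrow> 'i alg" where
  "fill Z \<mu> =
     (\<Sum>U \<in> {U. U \<subseteq> points Z - (Domain \<mu> \<union> Range \<mu>)}. strand_elt (\<mu> \<union> Id_on U))"

definition diag :: "'i arc_diagram \<Rightarrow> nat set \<Rightarrow> 'i strands \<Rightarrow> nat set \<Rightarrow> 'i alg" where
  "diag Z s \<mu> t = idem Z s \<odot> fill Z \<mu> \<odot> idem Z t"

definition presents :: "'i arc_diagram \<Rightarrow> 'i alg \<Rightarrow> nat set \<times> 'i strands \<times> nat set \<Rightarrow> bool" where
  "presents Z D = (\<lambda>(s, \<mu>, t). s \<subseteq> pairs Z \<and> t \<subseteq> pairs Z \<and>
     strand_diagram Z \<mu> \<and> (\<forall>x. (x, x) \<notin> \<mu>) \<and> D = diag Z s \<mu> t \<and> D \<noteq> 0)"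

definition diagram :: "'i arc_diagram \<Rightarrow> 'i alg \<Rightarrow> bool" where
  "diagram Z D \<longleftrightarrow> (\<exists>d. presents Z D d)"

text \<open>The presentation of a diagram is unique: \<open>\<mu>\<close> consists of the non-horizontal strands.\<close>

definition presentation :: "'i arc_diagram \<Rightarrow> 'i alg \<Rightarrow> nat set \<times> 'i strands \<times> nat set" where
  "presentation Z D = (THE d. presents Z D d)"

definition strand_alg :: "'i arc_diagram \<Rightarrow> 'i alg set" where
  "strand_alg Z = span2 {D. diagram Z D}"

definition boundaries :: "'i arc_diagram \<Rightarrow> 'i alg set" where
  "boundaries Z = diff ` strand_alg Z"

text \<open>
  Homology classes are cosets of the boundaries, added with the elementwise addition of sets.
  The zero class is \<open>cls Z 0\<close>, not the set \<open>0 = {0}\<close>.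
\<close>

definition cls :: "'i arc_diagram \<Rightarrow> 'i alg \<Rightarrow> 'i alg set" where
  "cls Z z = z +o boundaries Z"

definition homology :: "'i arc_diagram \<Rightarrow> 'i alg set set" where
  "homology Z = {cls Z z | z. z \<in> strand_alg Z \<and> diff z = 0}"

section \<open>H-data and Maslov grading\<close>

text \<open>
  An element of \<open>H\<^sub>1\<close> of the intervals relative to the points is given by its multiplicities on the
  steps (and is zero elsewhere).
\<close>

type_synonym 'i chain = "'i point \<Rightarrow> int"
type_synonym 'i hdata = "'i chain \<times> nat set \<times> nat set"

definition strand_chain :: "'i strands \<Rightarrow> 'i chain" where
  "strand_chain \<phi> z = (\<Sum>(x, y) \<in> \<phi>. if pt_le x z \<and> pt_less z y then 1 else 0)"

definition hdata :: "'i arc_diagram \<Rightarrow> 'i alg \<Rightarrow> 'i hdata" where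
  "hdata Z D = (case presentation Z D of (s, \<mu>, t) \<Rightarrow> (strand_chain \<mu>, s, t))"

definition alg_part :: "'i arc_diagram \<Rightarrow> 'i hdata \<Rightarrow> 'i alg set" where
  "alg_part Z d = span2 {D. diagram Z D \<and> hdata Z D = d}"

definition hom_part :: "'i arc_diagram \<Rightarrow> 'i hdata \<Rightarrow> 'i alg set set" where
  "hom_part Z d = {cls Z z | z. z \<in> alg_part Z d \<and> diff z = 0}"

definition viable_chain :: "'i arc_diagram \<Rightarrow> 'i chain \<Rightarrow> bool" where
  "viable_chain Z h \<longleftrightarrow> (\<forall>z \<in> steps Z. h z \<in> {0, 1})"

definition step_before :: "'i point \<Rightarrow> 'i point" where
  "step_before p = (fst p, snd p - 1)"

definition m_pair :: "'i arc_diagram \<Rightarrow> 'i chain \<Rightarrow> 'i chain \<Rightarrow> rat" where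
  "m_pair Z h c = (\<Sum>p \<in> places Z. of_int (c p) * ((of_int (h (step_before p)) + of_int (h p)) / 2))"

definition chain_boundary :: "'i chain \<Rightarrow> 'i chain" where
  "chain_boundary h p = (if snd p = 0 then 0 else h (step_before p)) - h p"

definition maslov_strands :: "'i arc_diagram \<Rightarrow> 'i strands \<Rightarrow> rat" where
  "maslov_strands Z \<phi> =
     of_nat (inv_count \<phi>) - m_pair Z (strand_chain \<phi>) (\<lambda>p. of_bool (p \<in> Domain \<phi>))"

text \<open>All the terms of a diagram have the same Maslov grading.\<close>

definition maslov :: "'i arc_diagram \<Rightarrow> 'i alg \<Rightarrow> rat" where
  "maslov Z D = maslov_strands Z (SOME \<phi>. \<phi> \<in> Poly_Mapping.keys D)"

definition homogeneous :: "'i arc_diagram \<Rightarrow> rat \<Rightarrow> 'i alg \<Rightarrow> bool" where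
  "homogeneous Z g a \<longleftrightarrow> (\<forall>\<phi> \<in> Poly_Mapping.keys a. maslov_strands Z \<phi> = g)"

section \<open>Tightness of diagrams\<close>

definition viable_diagram :: "'i arc_diagram \<Rightarrow> 'i alg \<Rightarrow> bool" where
  "viable_diagram Z D \<longleftrightarrow> diagram Z D \<and> viable_chain Z (fst (hdata Z D))"

text \<open>
  The picture of a diagram superimposes all its terms (this is how the dotted strands arise), so it
  has a crossing precisely if one of the terms has.
\<close>

definition has_crossing :: "'i alg \<Rightarrow> bool" where
  "has_crossing D \<longleftrightarrow> (\<exists>\<phi> \<in> Poly_Mapping.keys D. crossings \<phi> \<noteq> {})"

definition tight :: "'i arc_diagram \<Rightarrow> 'i alg \<Rightarrow> bool" where
  "tight Z D \<longleftrightarrow> viable_diagram Z D \<and> \<not> has_crossing D \<and> cls Z D \<noteq> cls Z 0"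

definition twisted :: "'i arc_diagram \<Rightarrow> 'i alg \<Rightarrow> bool" where
  "twisted Z D \<longleftrightarrow> viable_diagram Z D \<and> \<not> has_crossing D \<and> cls Z D = cls Z 0"

definition crossed :: "'i arc_diagram \<Rightarrow> 'i alg \<Rightarrow> bool" where
  "crossed Z D \<longleftrightarrow> viable_diagram Z D \<and> has_crossing D"

definition twisted_hdata :: "'i arc_diagram \<Rightarrow> 'i hdata \<Rightarrow> bool" where
  "twisted_hdata Z d \<longleftrightarrow> viable_chain Z (fst d) \<and> (\<exists>D. twisted Z D \<and> hdata Z D = d)"

text \<open>
  The fragment at a matched pair \<open>P\<close> has one interval, with one place, for each place of \<open>P\<close>; these
  intervals are labelled by the places of \<open>P\<close>. Cutting keeps of a strand on the interval of \<open>p\<close> only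
  the part that lies on the steps before and after \<open>p\<close>.
\<close>

definition fragment :: "'i arc_diagram \<Rightarrow> nat \<Rightarrow> 'i point arc_diagram" where
  "fragment Z P = \<lparr>ivals = fibre Z P, nplaces = (\<lambda>_. 1), npairs = 1, pairing = (\<lambda>_. 1)\<rparr>"

definition clamp :: "'i point \<Rightarrow> 'i point \<Rightarrow> 'i point point" where
  "clamp p x = (p, if snd x < snd p then 0 else if snd x = snd p then 1 else 2)"

definition cut_strands :: "'i arc_diagram \<Rightarrow> nat \<Rightarrow> 'i strands \<Rightarrow> 'i point strands" where
  "cut_strands Z P \<mu> =
     {(clamp p x, clamp p y) | p x y.
        p \<in> fibre Z P \<and> (x, y) \<in> \<mu> \<and> fst x = fst p \<and> clamp p x \<noteq> clamp p y}"

definition local_set :: "nat \<Rightarrow> nat set \<Rightarrow> nat set" where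
  "local_set P s = (if P \<in> s then {1} else {})"

definition cut :: "'i arc_diagram \<Rightarrow> nat \<Rightarrow> 'i alg \<Rightarrow> 'i point alg" where
  "cut Z P D = (case presentation Z D of (s, \<mu>, t) \<Rightarrow>
     diag (fragment Z P) (local_set P s) (cut_strands Z P \<mu>) (local_set P t))"

definition tight_at :: "'i arc_diagram \<Rightarrow> nat \<Rightarrow> 'i alg \<Rightarrow> bool" where
  "tight_at Z P D \<longleftrightarrow> tight (fragment Z P) (cut Z P D)"

definition crossed_at :: "'i arc_diagram \<Rightarrow> nat \<Rightarrow> 'i alg \<Rightarrow> bool" where
  "crossed_at Z P D \<longleftrightarrow> crossed (fragment Z P) (cut Z P D)"

section \<open>Occupation of matched pairs\<close>

definition on_on :: "nat \<Rightarrow> 'i hdata \<Rightarrow> bool" where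
  "on_on P = (\<lambda>(h, s, t). P \<in> s \<and> P \<in> t)"

definition once_occupied_at :: "'i arc_diagram \<Rightarrow> 'i point \<Rightarrow> 'i hdata \<Rightarrow> bool" where
  "once_occupied_at Z p = (\<lambda>(h, s, t).
     h (step_before p) = 1 \<and> h p = 1 \<and> h (step_before (twin Z p)) = 0 \<and> h (twin Z p) = 0)"

definition doubly_occupied :: "'i arc_diagram \<Rightarrow> nat \<Rightarrow> 'i hdata \<Rightarrow> bool" where
  "doubly_occupied Z P = (\<lambda>(h, s, t). \<forall>p \<in> fibre Z P. h (step_before p) = 1 \<and> h p = 1)"

definition crossing_ideal :: "'i arc_diagram \<Rightarrow> 'i alg set" where
  "crossing_ideal Z = span2 {D. diagram Z D \<and>
     (\<not> viable_diagram Z D \<or>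
      (\<exists>P \<in> pairs Z. doubly_occupied Z P (hdata Z D) \<and> crossed_at Z P D))}"

definition mod_F :: "'i arc_diagram \<Rightarrow> 'i alg \<Rightarrow> 'i alg set" where
  "mod_F Z a = a +o crossing_ideal Z"

section \<open>Tensor products of homology classes\<close>

text \<open>The tensor product of classes \<open>M\<^sub>1, \<dots>, M\<^sub>n\<close> is represented by the list of its factors.\<close>

definition diagram_classes :: "'i arc_diagram \<Rightarrow> 'i alg set set" where
  "diagram_classes Z = {cls Z D | D. diagram Z D \<and> diff D = 0 \<and> cls Z D \<noteq> cls Z 0}"

definition class_hdata :: "'i arc_diagram \<Rightarrow> 'i alg set \<Rightarrow> 'i hdata" where
  "class_hdata Z c = (THE d. c \<in> hom_part Z d)"

definition class_maslov :: "'i arc_diagram \<Rightarrow> 'i alg set \<Rightarrow> rat" where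
  "class_maslov Z c = maslov Z (SOME D. tight Z D \<and> cls Z D = c)"

definition tensor_hdata :: "'i arc_diagram \<Rightarrow> 'i alg set list \<Rightarrow> 'i hdata" where
  "tensor_hdata Z M =
     ((\<lambda>z. \<Sum>c\<leftarrow>M. fst (class_hdata Z c) z),
      fst (snd (class_hdata Z (hd M))), snd (snd (class_hdata Z (last M))))"

definition tensor_maslov :: "'i arc_diagram \<Rightarrow> 'i alg set list \<Rightarrow> rat" where
  "tensor_maslov Z M =
     (\<Sum>c\<leftarrow>M. class_maslov Z c) +
     (\<Sum>(j, k) \<in> {(j, k). j < k \<and> k < length M}.
        m_pair Z (fst (class_hdata Z (M ! k))) (chain_boundary (fst (class_hdata Z (M ! j)))))"

definition mismatch :: "'i arc_diagram \<Rightarrow> 'i alg set list \<Rightarrow> bool" where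
  "mismatch Z M \<longleftrightarrow> (\<exists>i. Suc i < length M \<and>
     snd (snd (class_hdata Z (M ! i))) \<noteq> fst (snd (class_hdata Z (M ! Suc i))))"

definition viable_tensor :: "'i arc_diagram \<Rightarrow> 'i alg set list \<Rightarrow> bool" where
  "viable_tensor Z M \<longleftrightarrow> \<not> mismatch Z M \<and> viable_chain Z (fst (tensor_hdata Z M))"

definition represents :: "'i arc_diagram \<Rightarrow> 'i alg list \<Rightarrow> 'i alg set list \<Rightarrow> bool" where
  "represents Z Ds M \<longleftrightarrow> list_all2 (\<lambda>D c. tight Z D \<and> cls Z D = c) Ds M"

text \<open>
  The following properties do not depend on the choice of the tight representatives \<open>Ds\<close>, which
  exist for all nonzero classes of diagrams.
\<close>

definition tight_tensor :: "'i arc_diagram \<Rightarrow> 'i alg set list \<Rightarrow> bool" where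
  "tight_tensor Z M \<longleftrightarrow> (\<exists>Ds. represents Z Ds M \<and> prod_alg Ds \<noteq> 0 \<and> tight Z (prod_alg Ds))"

definition twisted_tensor :: "'i arc_diagram \<Rightarrow> 'i alg set list \<Rightarrow> bool" where
  "twisted_tensor Z M \<longleftrightarrow> (\<exists>Ds. represents Z Ds M \<and> prod_alg Ds \<noteq> 0 \<and> twisted Z (prod_alg Ds))"

definition critical_tensor :: "'i arc_diagram \<Rightarrow> 'i alg set list \<Rightarrow> bool" where
  "critical_tensor Z M \<longleftrightarrow>
     (\<exists>Ds. represents Z Ds M \<and> prod_alg Ds = 0) \<and> alg_part Z (tensor_hdata Z M) \<noteq> {0}"

definition singular_tensor :: "'i arc_diagram \<Rightarrow> 'i alg set list \<Rightarrow> bool" where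
  "singular_tensor Z M \<longleftrightarrow> alg_part Z (tensor_hdata Z M) = {0}"

definition tensor_at ::
    "('i point arc_diagram \<Rightarrow> 'i point alg set list \<Rightarrow> bool) \<Rightarrow>
     'i arc_diagram \<Rightarrow> nat \<Rightarrow> 'i alg set list \<Rightarrow> bool" where
  "tensor_at \<Phi> Z P M \<longleftrightarrow> (\<exists>Ds. represents Z Ds M \<and>
     \<Phi> (fragment Z P) (map (\<lambda>D. cls (fragment Z P) (cut Z P D)) Ds))"

section \<open>Pair orderings and the A-infinity structure\<close>

record 'i pair_ordering =
  pair_order :: "(nat \<times> nat) set"
  place_order :: "nat \<Rightarrow> ('i point \<times> 'i point) set"

definition pair_ordering :: "'i arc_diagram \<Rightarrow> 'i pair_ordering \<Rightarrow> bool" where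
  "pair_ordering Z ord \<longleftrightarrow> linear_order_on (pairs Z) (pair_order ord) \<and>
     (\<forall>P \<in> pairs Z. linear_order_on (fibre Z P) (place_order ord P))"

definition smaller_place :: "'i arc_diagram \<Rightarrow> 'i pair_ordering \<Rightarrow> nat \<Rightarrow> 'i point" where
  "smaller_place Z ord P =
     (THE p. p \<in> fibre Z P \<and> (\<forall>q \<in> fibre Z P. (p, q) \<in> place_order ord P))"

text \<open>The tight diagrams in the image of the generators under \<open>f\<^sup>\<preceq>\<close>.\<close>

definition preferred :: "'i arc_diagram \<Rightarrow> 'i pair_ordering \<Rightarrow> 'i alg \<Rightarrow> bool" where
  "preferred Z ord D \<longleftrightarrow> tight Z D \<and>
     (\<forall>P \<in> pairs Z. on_on P (hdata Z D) \<and> doubly_occupied Z P (hdata Z D) \<longrightarrow>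
        (case presentation Z D of (s, \<mu>, t) \<Rightarrow>
           smaller_place Z ord P \<in> Domain \<mu> \<and> smaller_place Z ord P \<in> Range \<mu>))"

definition first_on_on_once_occupied ::
    "'i arc_diagram \<Rightarrow> 'i pair_ordering \<Rightarrow> 'i hdata \<Rightarrow> nat" where
  "first_on_on_once_occupied Z ord d =
     (let C = {P \<in> pairs Z. on_on P d \<and> (\<exists>p \<in> fibre Z P. once_occupied_at Z p d)}
      in THE P. P \<in> C \<and> (\<forall>Q \<in> C. (P, Q) \<in> pair_order ord))"

definition A_star_diagram :: "'i arc_diagram \<Rightarrow> 'i pair_ordering \<Rightarrow> 'i alg \<Rightarrow> 'i alg" where
  "A_star_diagram Z ord D =
     (let (s, \<mu>, t) = presentation Z D;
          P = first_on_on_once_occupied Z ord (hdata Z D);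
          p = (THE p. p \<in> fibre Z P \<and> once_occupied_at Z p (hdata Z D));
          x = (THE x. (x, p) \<in> \<mu>);
          y = (THE y. (p, y) \<in> \<mu>)
      in if crossed_at Z P D then 0
         else diag Z s (\<mu> - {(x, p), (p, y)} \<union> {(x, y)}) t)"

text \<open>
  Distinct diagrams have disjoint supports, so an element of the strand algebra is the sum of the
  diagrams whose support is contained in its own. Only the values on elements with twisted H-data
  are meaningful.
\<close>

definition A_star :: "'i arc_diagram \<Rightarrow> 'i pair_ordering \<Rightarrow> 'i alg \<Rightarrow> 'i alg" where
  "A_star Z ord a =
     (\<Sum>D \<in> {D. diagram Z D \<and> Poly_Mapping.keys D \<subseteq> Poly_Mapping.keys a}. A_star_diagram Z ord D)"

text \<open>
  Families of multilinear maps \<open>X\<^sub>n\<close> and \<open>f\<^sub>n\<close> (\<open>n \<ge> 1\<close>) are represented by single functions on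
  lists of homology classes, the number of arguments being the length of the list.
\<close>

definition insert_op ::
    "('i alg set list \<Rightarrow> 'i alg set) \<Rightarrow> nat \<Rightarrow> nat \<Rightarrow> 'i alg set list \<Rightarrow> 'i alg set list" where
  "insert_op X k j M = take k M @ [X (take j (drop k M))] @ drop (k + j) M"

definition multilinear ::
    "'i arc_diagram \<Rightarrow> 'b::plus set \<Rightarrow> ('i alg set list \<Rightarrow> 'b) \<Rightarrow> bool" where
  "multilinear Z B g \<longleftrightarrow>
     (\<forall>M. M \<noteq> [] \<and> set M \<subseteq> homology Z \<longrightarrow> g M \<in> B) \<and>
     (\<forall>K L a b. set K \<subseteq> homology Z \<and> set L \<subseteq> homology Z \<and> a \<in> homology Z \<and> b \<in> homology Z \<longrightarrow>
        g (K @ [a + b] @ L) = g (K @ [a] @ L) + g (K @ [b] @ L))"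

definition A_infinity_structure ::
    "'i arc_diagram \<Rightarrow> ('i alg set list \<Rightarrow> 'i alg set) \<Rightarrow> bool" where
  "A_infinity_structure Z X \<longleftrightarrow> multilinear Z (homology Z) X \<and>
     (\<forall>M. M \<noteq> [] \<and> set M \<subseteq> homology Z \<longrightarrow>
        (\<Sum>(j, k) \<in> {(j, k). 1 \<le> j \<and> j + k \<le> length M}. X (insert_op X k j M)) = cls Z 0)"

definition A_infinity_morphism ::
    "'i arc_diagram \<Rightarrow> ('i alg set list \<Rightarrow> 'i alg set) \<Rightarrow> ('i alg set list \<Rightarrow> 'i alg) \<Rightarrow> bool" where
  "A_infinity_morphism Z X f \<longleftrightarrow> multilinear Z (strand_alg Z) f \<and>
     (\<forall>M. M \<noteq> [] \<and> set M \<subseteq> homology Z \<longrightarrow>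
        (\<Sum>(j, k) \<in> {(j, k). 1 \<le> j \<and> j + k \<le> length M}. f (insert_op X k j M)) =
        diff (f M) + (\<Sum>j \<in> {1..<length M}. f (take j M) \<odot> f (drop j M)))"

definition U_op ::
    "('i alg set list \<Rightarrow> 'i alg set) \<Rightarrow> ('i alg set list \<Rightarrow> 'i alg) \<Rightarrow> 'i alg set list \<Rightarrow> 'i alg" where
  "U_op X f M =
     (\<Sum>j \<in> {1..<length M}. f (take j M) \<odot> f (drop j M)) +
     (\<Sum>(j, k) \<in> {(j, k). 2 \<le> j \<and> j < length M \<and> j + k \<le> length M}. f (insert_op X k j M))"

definition arises_from ::
    "'i arc_diagram \<Rightarrow> 'i pair_ordering \<Rightarrow>
     ('i alg set list \<Rightarrow> 'i alg set) \<Rightarrow> ('i alg set list \<Rightarrow> 'i alg) \<Rightarrow> bool" where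
  "arises_from Z ord X f \<longleftrightarrow>
     A_infinity_structure Z X \<and> A_infinity_morphism Z X f \<and>
     (\<forall>a \<in> homology Z. X [a] = cls Z 0) \<and>
     (\<forall>a b. a \<in> strand_alg Z \<and> diff a = 0 \<and> b \<in> strand_alg Z \<and> diff b = 0 \<longrightarrow>
        X [cls Z a, cls Z b] = cls Z (a \<odot> b)) \<and>
     (\<forall>D. preferred Z ord D \<longrightarrow> f [cls Z D] = D) \<and>
     (\<forall>M. M \<noteq> [] \<and> set M \<subseteq> homology Z \<longrightarrow> X M = cls Z (U_op X f M)) \<and>
     (\<forall>M. M \<noteq> [] \<and> set M \<subseteq> diagram_classes Z \<longrightarrow>
        (\<not> viable_tensor Z M \<longrightarrow> mod_F Z (f M) = mod_F Z 0 \<and> X M = cls Z 0) \<and>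
        (mismatch Z M \<longrightarrow> f M = 0) \<and>
        f M \<in> alg_part Z (tensor_hdata Z M) \<and>
        homogeneous Z (tensor_maslov Z M + of_nat (length M) - 1) (f M) \<and>
        (\<exists>z. z \<in> alg_part Z (tensor_hdata Z M) \<and> diff z = 0 \<and> X M = cls Z z \<and>
           homogeneous Z (tensor_maslov Z M + of_nat (length M) - 2) z) \<and>
        (length M \<ge> 2 \<and> f [X M] - U_op X f M = 0 \<longrightarrow> f M = 0) \<and>
        (length M \<ge> 2 \<and> viable_tensor Z M \<and> twisted_hdata Z (tensor_hdata Z M) \<longrightarrow>
           f M = A_star Z ord (f [X M] - U_op X f M)))"

section \<open>Operation trees\<close>

datatype 'c op_tree = Leaf 'c | Node "'c op_tree" "'c op_tree"

text \<open>The tensor product of the leaves of a subtree is the label of the root of that subtree.\<close>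

fun label :: "'c op_tree \<Rightarrow> 'c list" where
  "label (Leaf c) = [c]"
| "label (Node l r) = label l @ label r"

fun subtrees :: "'c op_tree \<Rightarrow> 'c op_tree set" where
  "subtrees (Leaf c) = {Leaf c}"
| "subtrees (Node l r) = insert (Node l r) (subtrees l \<union> subtrees r)"

definition operation_tree ::
    "'i arc_diagram \<Rightarrow> 'i alg set list \<Rightarrow> 'i alg set op_tree \<Rightarrow> bool" where
  "operation_tree Z M T \<longleftrightarrow> label T = M \<and> (\<forall>v \<in> subtrees T. viable_tensor Z (label v))"

definition valid_tree :: "'i arc_diagram \<Rightarrow> 'i alg set list \<Rightarrow> 'i alg set op_tree \<Rightarrow> bool" where
  "valid_tree Z M T \<longleftrightarrow>
     operation_tree Z M T \<and> (\<forall>v \<in> subtrees T. \<not> singular_tensor Z (label v))"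

definition twisted_critical_count :: "'i arc_diagram \<Rightarrow> 'i alg set list \<Rightarrow> nat" where
  "twisted_critical_count Z M =
     card {P \<in> pairs Z. tensor_at twisted_tensor Z P M \<or> tensor_at critical_tensor Z P M}"

text \<open>The subtractions in \<open>k - 1\<close> and \<open>k - 2\<close> are avoided, as they would be truncated.\<close>

definition distributive_vertex :: "'i arc_diagram \<Rightarrow> 'i alg set op_tree \<Rightarrow> bool" where
  "distributive_vertex Z v \<longleftrightarrow> twisted_critical_count Z (label v) + 2 \<ge> length (label v)"

definition strictly_distributive_vertex :: "'i arc_diagram \<Rightarrow> 'i alg set op_tree \<Rightarrow> bool" where
  "strictly_distributive_vertex Z v \<longleftrightarrow> twisted_critical_count Z (label v) + 1 = length (label v)"

definition valid_distributive ::
    "'i arc_diagram \<Rightarrow> 'i alg set list \<Rightarrow> 'i alg set op_tree \<Rightarrow> bool" where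
  "valid_distributive Z M T \<longleftrightarrow> valid_tree Z M T \<and> (\<forall>v \<in> subtrees T. distributive_vertex Z v)"

definition strictly_f_distributive ::
    "'i arc_diagram \<Rightarrow> 'i alg set list \<Rightarrow> 'i alg set op_tree \<Rightarrow> bool" where
  "strictly_f_distributive Z M T \<longleftrightarrow>
     valid_tree Z M T \<and> (\<forall>v \<in> subtrees T. strictly_distributive_vertex Z v)"

definition strictly_X_distributive ::
    "'i arc_diagram \<Rightarrow> 'i alg set list \<Rightarrow> 'i alg set op_tree \<Rightarrow> bool" where
  "strictly_X_distributive Z M T \<longleftrightarrow>
     valid_tree Z M T \<and> (\<forall>v \<in> subtrees T - {T}. strictly_distributive_vertex Z v) \<and>
     twisted_critical_count Z (label T) + 2 = length M"

end

theory Submission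
  imports Defs
begin

text \<open>
  The theorem holds because, away from on-on doubly occupied pairs, viable diagrams are so rigid that
  the recursion for \<open>f\<close> and \<open>X\<close> becomes a counting problem for the ways to split \<open>M\<close> into two factors.

  \<^bold>\<open>Diagrams.\<close> Fix viable H-data without on-on doubly occupied pairs. Call a place \<^emph>\<open>twisted\<close> if it is the
  occupied place of an on-on once occupied pair. There, a diagram has two possibilities: the strand
  passes the place and crosses the dotted strand, or it is \<^emph>\<open>broken\<close> there, one strand ending and another
  beginning. Everything else is determined by the H-data (\<open>thin_unique\<close>, \<open>broken_subset\<close>), so that a
  summand of the algebra is either zero or has a basis indexed by the subsets of the twisted places. The
  differential breaks strands (\<open>diff_dia\<close>), and joining the strands at a fixed twisted place is a
  contracting homotopy (\<open>twisted_acyclic\<close>). So the summand is acyclic if there are twisted places, and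
  otherwise it has at most one diagram, which is tight (\<open>diagram_classE\<close>).

  \<^bold>\<open>Products.\<close> The product of two such diagrams is zero or the concatenation of their strands
  (\<open>diag_mul_diag\<close>). The concatenation is broken where the factors are and, in addition, at the places
  whose outgoing step is covered by the left factor and whose incoming step is covered by the right one.
  A place is called \<^emph>\<open>inverted\<close> in a tensor product if some cut separates its two steps in this way. Between
  diagrams without broken places, the product can only vanish if there are no diagrams at all with the
  resulting H-data (\<open>matched_if_unbroken\<close>). Applied in the fragments, this shows that the pairs at which a
  tensor product with a valid tree is twisted or critical are those of its inverted places, of which no
  pair has two (\<open>twisted_critical_count\<close>, \<open>inverted_inj\<close>). Distributivity of a vertex thus compares the
  number of leaves with the number of inverted places.

  \<^bold>\<open>Operations.\<close> The operator \<open>A\<^sup>*\<close> joins strands at the first twisted place, so its square is zero, and the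
  terms of the recursion for \<open>f\<close> which contain some operation \<open>X\<close> drop out. What remains is the sum of
  the products \<open>f (take j M) \<odot> f (drop j M)\<close>: its class is \<open>X M\<close> if no place is twisted, its image under
  \<open>A\<^sup>*\<close> is \<open>f M\<close> otherwise, and \<open>f M = 0\<close> for untwisted \<open>M\<close> with at least two factors (\<open>f_twisted\<close>,
  \<open>X_untwisted\<close>, \<open>f_untwisted\<close>). By induction, every diagram in \<open>f M\<close> has as many broken places as there
  are inverted places in excess of \<open>length M - 1\<close> (\<open>broken_count\<close>), and a nonzero value of \<open>f\<close> comes with
  a valid distributive tree (\<open>distributive_tree_if_nonzero\<close>). Hence if all distributive trees are strict,
  at least below the root, each nonzero product in the sum comes from a splitting of \<open>M\<close> into two factors with strict trees. It is
  then a single diagram, whose broken places are those inverted across the splitting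
  (\<open>nonzero_term\<close>).

  \<^bold>\<open>Counting.\<close> Two different splittings of this kind do not invert the same places, since a strict
  tree of the longer left factor provides a place inverted across the smaller cut only (\<open>gap\<close>,
  \<open>separate_splittings\<close>). For part (2), every contributing splitting inverts no place, so there is exactly
  one, and \<open>X M\<close> is the class of its product (\<open>X_value\<close>). For part (1), every contributing splitting inverts
  exactly one place, and \<open>A\<^sup>*\<close> keeps those which invert the first twisted place. There is at most one of
  them; and there is one because the trees can be rotated: if all distributive trees are strict, the vertex which
  inverts a given twisted place can be moved up to the root (\<open>rotate_to_root\<close>). So \<open>f M\<close> is the single
  diagram without broken places, which is crossed at all twisted places (\<open>f_nonzero\<close>).
\<close>

section \<open>Linear algebra over the field with two elements\<close>

abbreviation lk :: "'i alg \<Rightarrow> 'i strands \<Rightarrow> bit" where "lk \<equiv> Poly_Mapping.lookup"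
abbreviation ks :: "'i alg \<Rightarrow> 'i strands set" where "ks \<equiv> Poly_Mapping.keys"

lemma bit_add_self [simp]: "(b::bit) + b = 0"
  by (cases b) auto

lemma alg_add_self [simp]: "(a :: 'i alg) + a = 0"
  by (rule poly_mapping_eqI) (simp add: lookup_add)

lemma alg_add_self_left [simp]: "(a :: 'i alg) + (a + b) = b"
  by (simp flip: add.assoc)

lemma alg_uminus [simp]: "- (a :: 'i alg) = a"
  by (metis alg_add_self minus_unique)

lemma alg_minus [simp]: "(a :: 'i alg) - b = a + b"
  by (metis alg_uminus diff_conv_add_uminus)

lemma lk_eq: "lk a \<phi> = of_bool (\<phi> \<in> ks a)"
  by (cases "lk a \<phi>") (auto simp: in_keys_iff)

lemma alg_eqI: "ks a = ks b \<Longrightarrow> a = b"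
  by (rule poly_mapping_eqI) (simp add: lk_eq)

lemma ks_add: "ks (a + b) = sym_diff (ks a) (ks b)"
  by (rule set_eqI, rename_tac \<phi>, case_tac "lk a \<phi>"; case_tac "lk b \<phi>") (auto simp: in_keys_iff lookup_add)

lemma sum_sym_diff:
  fixes F :: "'x \<Rightarrow> 'i alg"
  assumes "finite A" "finite B"
  shows "sum F (sym_diff A B) = sum F A + sum F B"
proof -
  have "sum F A = sum F (A - B) + sum F (A \<inter> B)"
    by (metis add.commute assms(1) sum.Int_Diff)
  moreover have "sum F B = sum F (B - A) + sum F (A \<inter> B)"
    by (metis add.commute assms(2) inf_commute sum.Int_Diff)
  moreover have "sum F (sym_diff A B) = sum F (A - B) + sum F (B - A)"
    by (rule sum.union_disjoint) (use assms in auto)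
  ultimately have "sum F A + sum F B = sum F (sym_diff A B) + (sum F (A \<inter> B) + sum F (A \<inter> B))"
    by (simp only: add_ac)
  then show ?thesis
    by (simp only: alg_add_self add_0_right)
qed

lemma ks_strand_elt [simp]: "ks (strand_elt \<phi>) = {\<phi>}"
  by (simp add: strand_elt_def)

lemma ks_sum_strand_elt: "finite K \<Longrightarrow> ks (\<Sum>\<phi>\<in>K. strand_elt \<phi>) = K"
  by (induction K rule: finite_induct) (auto simp: ks_add)

lemma sum_strand_elt_ks: "(\<Sum>\<phi>\<in>ks a. strand_elt \<phi>) = a"
  by (rule alg_eqI) (simp add: ks_sum_strand_elt)

definition extend :: "('i strands \<Rightarrow> 'j alg) \<Rightarrow> 'i alg \<Rightarrow> 'j alg" where
  "extend F a = (\<Sum>\<phi>\<in>ks a. F \<phi>)"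

lemma extend_add: "extend F (a + b) = extend F a + extend F b"
  unfolding extend_def ks_add by (rule sum_sym_diff) auto

lemma extend_0 [simp]: "extend F 0 = 0"
  by (simp add: extend_def)

lemma extend_sum: "extend F (\<Sum>i\<in>I. g i) = (\<Sum>i\<in>I. extend F (g i))"
  by (induction I rule: infinite_finite_induct) (auto simp: extend_add)

lemma extend_strand_elt [simp]: "extend F (strand_elt \<phi>) = F \<phi>"
  by (simp add: extend_def)

lemma extend_plus_fun: "extend (\<lambda>\<phi>. F \<phi> + G \<phi>) a = extend F a + extend G a"
  by (simp add: extend_def sum.distrib)

lemma diff_extend: "diff = extend strand_diff"
  by (rule ext) (simp add: diff_def extend_def)

lemma mul_extend: "a \<odot> b = extend (\<lambda>\<phi>. extend (strand_mul \<phi>) b) a"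
  by (simp add: mul_def extend_def)

lemma alg_diff_add: "diff (a + b) = diff a + diff b"
  by (simp add: diff_extend extend_add)

lemma diff_0 [simp]: "diff 0 = 0"
  by (simp add: diff_extend)

lemma diff_sum: "diff (\<Sum>i\<in>I. g i) = (\<Sum>i\<in>I. diff (g i))"
  by (simp add: diff_extend extend_sum)

lemma mul_add_left: "(a + b) \<odot> c = a \<odot> c + b \<odot> c"
  by (simp add: mul_extend extend_add)

lemma mul_add_right: "a \<odot> (b + c) = a \<odot> b + a \<odot> c"
  by (simp add: mul_extend extend_add extend_plus_fun)

lemma mul_0 [simp]: "0 \<odot> a = 0" "a \<odot> 0 = 0"
  by (simp_all add: mul_def)

lemma mul_sum_left: "(\<Sum>i\<in>I. g i) \<odot> c = (\<Sum>i\<in>I. g i \<odot> c)"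
  by (induction I rule: infinite_finite_induct) (auto simp: mul_add_left)

lemma mul_sum_right: "c \<odot> (\<Sum>i\<in>I. g i) = (\<Sum>i\<in>I. c \<odot> g i)"
  by (induction I rule: infinite_finite_induct) (auto simp: mul_add_right)

lemma mul_strand_elt: "strand_elt \<phi> \<odot> strand_elt \<psi> = strand_mul \<phi> \<psi>"
  by (simp add: mul_def)

lemma sum_inj_strand_elt:
  assumes "finite K" "inj_on g K"
  shows "ks (\<Sum>x\<in>K. strand_elt (g x)) = g ` K"
proof -
  have "(\<Sum>x\<in>K. strand_elt (g x)) = (\<Sum>\<phi>\<in>g ` K. strand_elt \<phi>)"
    using assms by (simp add: sum.reindex)
  then show ?thesis using assms by (simp add: ks_sum_strand_elt)
qed

section \<open>Strand diagrams\<close>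

lemma strand_diagram_le: "strand_diagram Z \<phi> \<Longrightarrow> (x, y) \<in> \<phi> \<Longrightarrow> fst x = fst y \<and> snd x \<le> snd y"
  by (auto simp: strand_diagram_def pt_le_def)

lemma strand_diagram_fun: "strand_diagram Z \<phi> \<Longrightarrow> (x, y) \<in> \<phi> \<Longrightarrow> (x, y') \<in> \<phi> \<Longrightarrow> y = y'"
  by (meson single_valuedD strand_diagram_def)

lemma strand_diagram_inj: "strand_diagram Z \<phi> \<Longrightarrow> (x, y) \<in> \<phi> \<Longrightarrow> (x', y) \<in> \<phi> \<Longrightarrow> x = x'"
  by (meson converseI single_valuedD strand_diagram_def)

lemma strand_diagram_points: "strand_diagram Z \<phi> \<Longrightarrow> (x, y) \<in> \<phi> \<Longrightarrow> x \<in> points Z \<and> y \<in> points Z"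
  by (auto simp: strand_diagram_def)

lemma pt_less_linear: "fst x = fst y \<Longrightarrow> x \<noteq> y \<Longrightarrow> pt_less x y \<or> pt_less y x"
  by (auto simp: pt_less_def prod_eq_iff)

lemma finite_crossings: "finite \<phi> \<Longrightarrow> finite (crossings \<phi>)"
  by (rule finite_subset[of _ "\<phi> \<times> \<phi>"]) (auto simp: crossings_def)

lemma strand_diagram_comp:
  assumes "strand_diagram Z \<phi>" "strand_diagram Z \<psi>"
  shows "strand_diagram Z (\<phi> O \<psi>)"
  unfolding strand_diagram_def
proof (intro conjI)
  show "\<phi> O \<psi> \<subseteq> points Z \<times> points Z"
    using assms by (auto dest: strand_diagram_points)
  show "single_valued (\<phi> O \<psi>)" "single_valued ((\<phi> O \<psi>)\<inverse>)"
    using assms by (auto simp: strand_diagram_def converse_relcomp intro: single_valued_relcomp)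
  show "\<forall>(x, y)\<in>\<phi> O \<psi>. pt_le x y"
    using assms by (fastforce simp: pt_le_def dest: strand_diagram_le)
qed

text \<open>
  A crossing of \<open>\<phi> O \<psi>\<close> is sent to the crossing of the same two strands in
  \<open>\<phi>\<close> if there is one, and to the one in \<open>\<psi>\<close> otherwise.
\<close>

definition lift_crossing :: "'i strands \<Rightarrow> ('i point \<times> 'i point) \<times> ('i point \<times> 'i point) \<Rightarrow>
    ('i point \<times> 'i point) \<times> ('i point \<times> 'i point) + ('i point \<times> 'i point) \<times> ('i point \<times> 'i point)" where
  "lift_crossing \<phi> c = (case c of ((x, z), (x', z')) \<Rightarrow>
     let y = (THE y. (x, y) \<in> \<phi>); y' = (THE y. (x', y) \<in> \<phi>) in
     if pt_less y' y then Inl ((x, y), (x', y')) else Inr ((y, z), (y', z')))"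

text \<open>
  A crossing of a composite happens in exactly one of the two halves, and the halves may have further
  crossings only where two strands cross twice.
\<close>

lemma
  assumes \<phi>: "strand_diagram Z \<phi>" and \<psi>: "strand_diagram Z \<psi>" and fin: "finite \<phi>" "finite \<psi>"
    and m: "Range \<phi> = Domain \<psi>"
  shows inv_count_comp_le: "inv_count (\<phi> O \<psi>) \<le> inv_count \<phi> + inv_count \<psi>"
    and inv_count_comp_eq:
      "(\<And>x y z x' y' z'. (x, y) \<in> \<phi> \<Longrightarrow> (y, z) \<in> \<psi> \<Longrightarrow> (x', y') \<in> \<phi> \<Longrightarrow> (y', z') \<in> \<psi> \<Longrightarrow>
         pt_less x x' \<Longrightarrow> pt_less y' y \<Longrightarrow> pt_less z z' \<Longrightarrow> False) \<Longrightarrow>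
       inv_count (\<phi> O \<psi>) = inv_count \<phi> + inv_count \<psi>"
proof -
  let ?C = "crossings \<phi> <+> crossings \<psi>"
  have the: "(THE y. (x, y) \<in> \<phi>) = y" if "(x, y) \<in> \<phi>" for x y
    using that strand_diagram_fun[OF \<phi>] by blast
  have lift: "lift_crossing \<phi> ((x, z), (x', z')) =
      (if pt_less y' y then Inl ((x, y), (x', y')) else Inr ((y, z), (y', z')))"
    if "(x, y) \<in> \<phi>" "(x', y') \<in> \<phi>" for x y z x' y' z'
    using that by (simp add: lift_crossing_def the)
  have sub: "lift_crossing \<phi> ` crossings (\<phi> O \<psi>) \<subseteq> ?C"
  proof
    fix e assume "e \<in> lift_crossing \<phi> ` crossings (\<phi> O \<psi>)"
    then obtain x z x' z' where e: "e = lift_crossing \<phi> ((x, z), (x', z'))"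
      and c: "((x, z), (x', z')) \<in> crossings (\<phi> O \<psi>)" by auto
    then obtain y y' where y: "(x, y) \<in> \<phi>" "(y, z) \<in> \<psi>" "(x', y') \<in> \<phi>" "(y', z') \<in> \<psi>"
      and l: "pt_less x x'" "pt_less z' z" by (auto simp: crossings_def)
    have "x \<noteq> x'" using l by (auto simp: pt_less_def)
    then have "y \<noteq> y'" using y strand_diagram_inj[OF \<phi>] by blast
    moreover have "fst y = fst y'"
      using strand_diagram_le[OF \<phi> y(1)] strand_diagram_le[OF \<phi> y(3)] l by (simp add: pt_less_def)
    ultimately have "\<not> pt_less y' y \<Longrightarrow> pt_less y y'"
      using pt_less_linear by blast
    then show "e \<in> ?C" using y l unfolding e lift[OF y(1,3)] by (auto simp: crossings_def)
  qed
  have inj: "inj_on (lift_crossing \<phi>) (crossings (\<phi> O \<psi>))"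
  proof (rule inj_onI)
    fix c d assume c: "c \<in> crossings (\<phi> O \<psi>)" and d: "d \<in> crossings (\<phi> O \<psi>)"
      and eq: "lift_crossing \<phi> c = lift_crossing \<phi> d"
    obtain x z x' z' y y' where c': "c = ((x, z), (x', z'))"
      and y: "(x, y) \<in> \<phi>" "(y, z) \<in> \<psi>" "(x', y') \<in> \<phi>" "(y', z') \<in> \<psi>"
      using c by (auto simp: crossings_def)
    obtain u w u' w' v v' where d': "d = ((u, w), (u', w'))"
      and v: "(u, v) \<in> \<phi>" "(v, w) \<in> \<psi>" "(u', v') \<in> \<phi>" "(v', w') \<in> \<psi>"
      using d by (auto simp: crossings_def)
    have "y = v \<and> y' = v'" using eq unfolding c' d' lift[OF y(1,3)] lift[OF v(1,3)]
      by (auto split: if_splits)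
    then show "c = d" unfolding c' d'
      using y v strand_diagram_inj[OF \<phi>] strand_diagram_fun[OF \<psi>] by blast
  qed
  have finC: "finite ?C" using fin by (simp add: finite_crossings)
  have cardC: "card ?C = inv_count \<phi> + inv_count \<psi>"
    using fin by (simp add: card_Plus finite_crossings inv_count_def)
  show "inv_count (\<phi> O \<psi>) \<le> inv_count \<phi> + inv_count \<psi>"
    using card_inj_on_le[OF inj sub finC] cardC by (simp add: inv_count_def)
  assume dbl: "\<And>x y z x' y' z'. (x, y) \<in> \<phi> \<Longrightarrow> (y, z) \<in> \<psi> \<Longrightarrow> (x', y') \<in> \<phi> \<Longrightarrow> (y', z') \<in> \<psi> \<Longrightarrow>
         pt_less x x' \<Longrightarrow> pt_less y' y \<Longrightarrow> pt_less z z' \<Longrightarrow> False"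
  have "?C \<subseteq> lift_crossing \<phi> ` crossings (\<phi> O \<psi>)"
  proof
    fix e assume "e \<in> ?C"
    then consider x y x' y' where "e = Inl ((x, y), (x', y'))" "((x, y), (x', y')) \<in> crossings \<phi>"
      | y z y' z' where "e = Inr ((y, z), (y', z'))" "((y, z), (y', z')) \<in> crossings \<psi>" by auto
    then show "e \<in> lift_crossing \<phi> ` crossings (\<phi> O \<psi>)"
    proof cases
      case 1
      then have y: "(x, y) \<in> \<phi>" "(x', y') \<in> \<phi>" "pt_less x x'" "pt_less y' y"
        by (auto simp: crossings_def)
      then obtain z z' where z: "(y, z) \<in> \<psi>" "(y', z') \<in> \<psi>" using m by blast
      have "y \<noteq> y'" using y by (auto simp: pt_less_def)
      then have "z \<noteq> z'" using z strand_diagram_inj[OF \<psi>] by blast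
      moreover have "fst z = fst z'"
        using strand_diagram_le[OF \<psi> z(1)] strand_diagram_le[OF \<psi> z(2)] y by (simp add: pt_less_def)
      ultimately have "pt_less z' z" using dbl[OF y(1) z(1) y(2) z(2) y(3,4)] pt_less_linear
        by blast
      then have "((x, z), (x', z')) \<in> crossings (\<phi> O \<psi>)" using y z by (auto simp: crossings_def)
      moreover have "e = lift_crossing \<phi> ((x, z), (x', z'))" using 1 lift[OF y(1,2)] y(4) by simp
      ultimately show ?thesis by blast
    next
      case 2
      then have z: "(y, z) \<in> \<psi>" "(y', z') \<in> \<psi>" "pt_less y y'" "pt_less z' z"
        by (auto simp: crossings_def)
      then obtain x x' where y: "(x, y) \<in> \<phi>" "(x', y') \<in> \<phi>" using m by blast
      have "y \<noteq> y'" using z by (auto simp: pt_less_def)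
      then have "x \<noteq> x'" using y strand_diagram_fun[OF \<phi>] by blast
      moreover have "fst x = fst x'"
        using strand_diagram_le[OF \<phi> y(1)] strand_diagram_le[OF \<phi> y(2)] z by (simp add: pt_less_def)
      ultimately have "pt_less x x'" using dbl[OF y(2) z(2) y(1) z(1) _ z(3,4)] pt_less_linear
        by blast
      then have "((x, z), (x', z')) \<in> crossings (\<phi> O \<psi>)" using y z by (auto simp: crossings_def)
      moreover have "e = lift_crossing \<phi> ((x, z), (x', z'))"
        using 2 lift[OF y(1,2)] z(3) by (simp add: pt_less_def)
      ultimately show ?thesis by blast
    qed
  qed
  then have "lift_crossing \<phi> ` crossings (\<phi> O \<psi>) = ?C" using sub by blast
  then show "inv_count (\<phi> O \<psi>) = inv_count \<phi> + inv_count \<psi>"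
    using card_image[OF inj] cardC by (simp add: inv_count_def)
qed

text \<open>
  By subadditivity of the number of inversions, either way of bracketing gives a nonzero result just if
  the number of inversions of the triple composite is the sum of those of the three factors.
\<close>

lemma strand_mul_assoc:
  assumes "strand_diagram Z \<phi>" "strand_diagram Z \<psi>" "strand_diagram Z \<chi>"
    and "finite \<phi>" "finite \<psi>" "finite \<chi>"
  shows "strand_mul \<phi> \<psi> \<odot> strand_elt \<chi> = strand_elt \<phi> \<odot> strand_mul \<psi> \<chi>"
proof (cases "Range \<phi> = Domain \<psi> \<and> Range \<psi> = Domain \<chi>")
  case True
  then have r: "Range (\<phi> O \<psi>) = Domain \<chi>" "Range \<phi> = Domain (\<psi> O \<chi>)" by blast+
  have "inv_count (\<phi> O \<psi>) \<le> inv_count \<phi> + inv_count \<psi>"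
    "inv_count (\<psi> O \<chi>) \<le> inv_count \<psi> + inv_count \<chi>"
    "inv_count ((\<phi> O \<psi>) O \<chi>) \<le> inv_count (\<phi> O \<psi>) + inv_count \<chi>"
    "inv_count (\<phi> O (\<psi> O \<chi>)) \<le> inv_count \<phi> + inv_count (\<psi> O \<chi>)"
    using True r
    by (simp_all only: inv_count_comp_le[of Z] strand_diagram_comp finite_relcomp assms)
  moreover have "Range \<phi> = Domain \<psi>" "Range \<psi> = Domain \<chi>" using True by blast+
  ultimately show ?thesis using r by (simp add: strand_mul_def mul_strand_elt O_assoc)
next
  case False
  show ?thesis
  proof (cases "Range \<phi> = Domain \<psi>")
    case True
    then have "Range \<psi> \<noteq> Domain \<chi>" using False by blast
    moreover have "Range (\<phi> O \<psi>) = Range \<psi>" using True by blast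
    ultimately show ?thesis by (simp add: strand_mul_def mul_strand_elt)
  next
    case f: False
    show ?thesis
    proof (cases "Range \<psi> = Domain \<chi>")
      case True
      then have "Domain (\<psi> O \<chi>) = Domain \<psi>" by blast
      then show ?thesis using f by (simp add: strand_mul_def mul_strand_elt)
    qed (use f in \<open>simp add: strand_mul_def mul_strand_elt\<close>)
  qed
qed

lemma mul_assoc:
  assumes "\<And>\<phi>. \<phi> \<in> ks a \<union> ks b \<union> ks c \<Longrightarrow> strand_diagram Z \<phi> \<and> finite \<phi>"
  shows "(a \<odot> b) \<odot> c = a \<odot> (b \<odot> c)"
proof -
  have "(a \<odot> b) \<odot> c = (\<Sum>\<phi>\<in>ks a. \<Sum>\<psi>\<in>ks b. \<Sum>\<chi>\<in>ks c. strand_mul \<phi> \<psi> \<odot> strand_elt \<chi>)"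
    by (simp add: mul_def[of a b] mul_sum_left)
      (simp flip: mul_sum_right add: sum_strand_elt_ks)
  also have "\<dots> = (\<Sum>\<phi>\<in>ks a. \<Sum>\<psi>\<in>ks b. \<Sum>\<chi>\<in>ks c. strand_elt \<phi> \<odot> strand_mul \<psi> \<chi>)"
    using assms by (intro sum.cong refl strand_mul_assoc[of Z]) auto
  also have "\<dots> = a \<odot> (b \<odot> c)"
    by (simp add: mul_def[of b c] flip: mul_sum_right)
      (simp add: sum_strand_elt_ks flip: mul_sum_left)
  finally show ?thesis .
qed

section \<open>Strands and the steps they cover\<close>

text \<open>
  A strand covers the steps over which it runs; recall that a step is denoted by its starting point.
\<close>

definition covers :: "'i point \<times> 'i point \<Rightarrow> 'i point \<Rightarrow> bool" where
  "covers a z \<longleftrightarrow> pt_le (fst a) z \<and> pt_less z (snd a)"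

definition cov :: "'i strands \<Rightarrow> 'i point \<Rightarrow> bool" where
  "cov \<phi> z \<longleftrightarrow> (\<exists>a\<in>\<phi>. covers a z)"

text \<open>
  No step is covered twice. For strand diagrams this is viability, see \<open>viable_iff_thin\<close>.
\<close>

definition thin :: "'i strands \<Rightarrow> bool" where
  "thin \<phi> \<longleftrightarrow> (\<forall>a\<in>\<phi>. \<forall>b\<in>\<phi>. \<forall>z. covers a z \<and> covers b z \<longrightarrow> a = b)"

text \<open>
  In a set of nonhorizontal strands, these are the points at which one strand ends and another one begins.
  The two strands could be joined, and would then pass this point.
\<close>

definition broken :: "'i strands \<Rightarrow> 'i point set" where
  "broken \<mu> = Domain \<mu> \<inter> Range \<mu>"

definition moving :: "'i arc_diagram \<Rightarrow> 'i strands \<Rightarrow> bool" where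
  "moving Z \<mu> \<longleftrightarrow> strand_diagram Z \<mu> \<and> (\<forall>x. (x, x) \<notin> \<mu>)"

definition nonhorizontal :: "'i strands \<Rightarrow> 'i strands" where
  "nonhorizontal \<phi> = {(x, y) \<in> \<phi>. x \<noteq> y}"

lemma covers_iff: "covers (x, y) z \<longleftrightarrow> fst z = fst x \<and> fst y = fst x \<and> snd x \<le> snd z \<and> snd z < snd y"
  by (auto simp: covers_def pt_le_def pt_less_def)

lemma strand_chain_card:
  assumes "finite \<phi>"
  shows "strand_chain \<phi> z = int (card {a \<in> \<phi>. covers a z})"
proof -
  have "strand_chain \<phi> z = (\<Sum>a\<in>\<phi>. if covers a z then 1 else 0)"
    unfolding strand_chain_def by (rule sum.cong) (auto simp: covers_def)
  then show ?thesis using assms by (simp flip: sum.inter_filter)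
qed

lemma thinD: "thin \<phi> \<Longrightarrow> a \<in> \<phi> \<Longrightarrow> b \<in> \<phi> \<Longrightarrow> covers a z \<Longrightarrow> covers b z \<Longrightarrow> a = b"
  unfolding thin_def by blast

lemma strand_chain_thin:
  assumes "finite \<phi>" "thin \<phi>"
  shows "strand_chain \<phi> = (\<lambda>z. of_bool (cov \<phi> z))"
proof
  fix z
  show "strand_chain \<phi> z = of_bool (cov \<phi> z)"
  proof (cases "cov \<phi> z")
    case True
    then obtain a where "a \<in> \<phi>" "covers a z" by (auto simp: cov_def)
    then have "{a \<in> \<phi>. covers a z} = {a}" using thinD[OF assms(2)] by blast
    then show ?thesis using True by (simp add: strand_chain_card assms)
  next
    case False
    then have "{a \<in> \<phi>. covers a z} = {}" by (auto simp: cov_def)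
    then show ?thesis using False by (simp add: strand_chain_card assms del: Collect_empty_eq)
  qed
qed

lemma moving_less: "moving Z \<mu> \<Longrightarrow> (x, y) \<in> \<mu> \<Longrightarrow> fst x = fst y \<and> snd x < snd y"
  unfolding moving_def by (metis le_neq_implies_less prod.expand strand_diagram_le)

lemma moving_diagram: "moving Z \<mu> \<Longrightarrow> strand_diagram Z \<mu>"
  by (simp add: moving_def)

lemma moving_cov_start: "moving Z \<mu> \<Longrightarrow> (p, y) \<in> \<mu> \<Longrightarrow> covers (p, y) p"
  by (auto simp: covers_iff dest: moving_less)

lemma moving_cov_end: "moving Z \<mu> \<Longrightarrow> (x, p) \<in> \<mu> \<Longrightarrow> covers (x, p) (step_before p)"
  by (auto simp: covers_iff step_before_def dest: moving_less)

lemma moving_Domain_cov: "moving Z \<mu> \<Longrightarrow> p \<in> Domain \<mu> \<Longrightarrow> cov \<mu> p"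
  by (auto simp: cov_def intro: moving_cov_start)

lemma moving_Range_cov: "moving Z \<mu> \<Longrightarrow> p \<in> Range \<mu> \<Longrightarrow> cov \<mu> (step_before p) \<and> 0 < snd p"
  unfolding cov_def by (blast intro: moving_cov_end dest: moving_less gr_implies_not0)

lemma cov_pass:
  assumes "moving Z \<mu>" "thin \<mu>" "cov \<mu> p" "p \<notin> Domain \<mu>"
  obtains x y where "(x, y) \<in> \<mu>" "covers (x, y) p" "covers (x, y) (step_before p)" "pt_less x p"
    "pt_less p y" "p \<notin> Range \<mu>" "cov \<mu> (step_before p)" "0 < snd p"
proof -
  obtain x y where xy: "(x, y) \<in> \<mu>" "covers (x, y) p" using assms(3) by (auto simp: cov_def)
  have "x \<noteq> p" using xy assms(4) by blast
  then have l: "snd x < snd p" "fst x = fst p" using xy(2) by (auto simp: covers_iff prod_eq_iff)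
  then have c: "covers (x, y) (step_before p)"
    using xy(2) by (auto simp: covers_iff step_before_def)
  have "p \<notin> Range \<mu>"
  proof
    assume "p \<in> Range \<mu>"
    then obtain w where "(w, p) \<in> \<mu>" by blast
    then have "(w, p) = (x, y)"
      using thinD[OF assms(2) _ xy(1) _ c] moving_cov_end[OF assms(1)] by blast
    then show False using xy(2) by (simp add: covers_iff)
  qed
  moreover have "pt_less x p" "pt_less p y" using l xy(2) by (simp_all add: covers_iff pt_less_def)
  moreover have "cov \<mu> (step_before p)" using xy(1) c unfolding cov_def by blast
  moreover have "0 < snd p" using l by simp
  ultimately show ?thesis using that xy c by blast
qed

lemma cov_pass_before:
  assumes "moving Z \<mu>" "thin \<mu>" "0 < snd p" "cov \<mu> (step_before p)" "p \<notin> Range \<mu>"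
  shows "cov \<mu> p" "p \<notin> Domain \<mu>"
proof -
  obtain x y where xy: "(x, y) \<in> \<mu>" "covers (x, y) (step_before p)"
    using assms(4) by (auto simp: cov_def)
  have "y \<noteq> p" using xy assms(5) by blast
  then have c: "covers (x, y) p"
    using xy(2) assms(3) by (auto simp: covers_iff step_before_def prod_eq_iff)
  then show "cov \<mu> p" using xy by (auto simp: cov_def)
  show "p \<notin> Domain \<mu>"
  proof
    assume "p \<in> Domain \<mu>"
    then obtain w where "(p, w) \<in> \<mu>" by blast
    then have "(p, w) = (x, y)"
      using thinD[OF assms(2) _ xy(1) _ c] moving_cov_start[OF assms(1)] by blast
    then show False using xy(2) assms(3) by (auto simp: covers_iff step_before_def)
  qed
qed

lemma thin_Domain_subset:
  assumes "moving Z \<mu>" "moving Z \<nu>" "thin \<mu>" "thin \<nu>" "cov \<mu> = cov \<nu>" "broken \<mu> = broken \<nu>"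
  shows "Domain \<mu> \<subseteq> Domain \<nu>"
proof
  fix x assume x: "x \<in> Domain \<mu>"
  show "x \<in> Domain \<nu>"
  proof (rule ccontr)
    assume n: "x \<notin> Domain \<nu>"
    have "cov \<nu> x" using assms(1,5) x moving_Domain_cov by metis
    then have "cov \<nu> (step_before x)" "0 < snd x" using cov_pass[OF assms(2,4) _ n] by blast+
    then have "x \<in> Range \<mu>" using cov_pass_before(2)[OF assms(1,3)] x assms(5) by metis
    then show False using x n assms(6) by (auto simp: broken_def)
  qed
qed

lemma thin_Range_subset:
  assumes "moving Z \<mu>" "moving Z \<nu>" "thin \<mu>" "thin \<nu>" "cov \<mu> = cov \<nu>" "broken \<mu> = broken \<nu>"
  shows "Range \<mu> \<subseteq> Range \<nu>"
proof
  fix x assume x: "x \<in> Range \<mu>"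
  show "x \<in> Range \<nu>"
  proof (rule ccontr)
    assume n: "x \<notin> Range \<nu>"
    have "cov \<nu> (step_before x)" "0 < snd x" using assms(1,5) x moving_Range_cov by metis+
    then have "cov \<nu> x" using cov_pass_before[OF assms(2,4) _ _ n] by blast
    then have "x \<in> Domain \<mu>" using cov_pass[OF assms(1,3), of x] x assms(5) by metis
    then show False using x n assms(6) by (auto simp: broken_def)
  qed
qed

text \<open>
  A viable diagram is determined by the steps covered and the places at which one strand ends and
  another begins: these determine all starting points and end points, and a strand which starts at
  \<open>x\<close> has to end at the next end point.
\<close>

lemma thin_subset:
  assumes "moving Z \<mu>" "moving Z \<nu>" "thin \<mu>" "thin \<nu>" "cov \<mu> = cov \<nu>" "broken \<mu> = broken \<nu>"
  shows "\<mu> \<subseteq> \<nu>"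
proof
  fix a assume "a \<in> \<mu>"
  then obtain x y where xy: "a = (x, y)" "(x, y) \<in> \<mu>" by (cases a) auto
  have D: "Domain \<mu> \<subseteq> Domain \<nu>" "Domain \<nu> \<subseteq> Domain \<mu>" and R: "Range \<mu> \<subseteq> Range \<nu>" "Range \<nu> \<subseteq> Range \<mu>"
    using thin_Domain_subset thin_Range_subset assms by metis+
  obtain y' where y': "(x, y') \<in> \<nu>" using D xy by blast
  obtain w where w: "(w, y) \<in> \<nu>" using R xy by blast
  obtain w' where w': "(w', y') \<in> \<mu>" using R y' by blast
  have l: "fst x = fst y" "snd x < snd y" "fst x = fst y'" "snd x < snd y'"
    using moving_less[OF assms(1) xy(2)] moving_less[OF assms(2) y'] by auto
  have "snd y = snd y'"
  proof (rule ccontr)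
    assume "snd y \<noteq> snd y'"
    then consider "snd y < snd y'" | "snd y' < snd y" by linarith
    then show False
    proof cases
      case 1
      have "covers (x, y') (step_before y)" using l 1 by (auto simp: covers_iff step_before_def)
      then have "(w, y) = (x, y')"
        using thinD[OF assms(4) w y'] moving_cov_end[OF assms(2) w] by blast
      then show False using 1 by simp
    next
      case 2
      have "covers (x, y) (step_before y')" using l 2 by (auto simp: covers_iff step_before_def)
      then have "(w', y') = (x, y)"
        using thinD[OF assms(3) w' xy(2)] moving_cov_end[OF assms(1) w'] by blast
      then show False using 2 by simp
    qed
  qed
  then show "a \<in> \<nu>" using l xy y' by (metis prod.expand)
qed

lemma thin_unique:
  assumes "moving Z \<mu>" "moving Z \<nu>" "thin \<mu>" "thin \<nu>" "cov \<mu> = cov \<nu>" "broken \<mu> = broken \<nu>"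
  shows "\<mu> = \<nu>"
  using thin_subset assms by (metis subset_antisym)

section \<open>The diagrams of an arc diagram\<close>

locale arc =
  fixes Z :: "'i arc_diagram"
  assumes arc: "arc_diagram Z"
begin

definition pairs_of :: "'i point set \<Rightarrow> nat set" where
  "pairs_of A = pairing Z ` (A \<inter> places Z)"

definition one_per_pair :: "'i point set \<Rightarrow> bool" where
  "one_per_pair A \<longleftrightarrow> inj_on (pairing Z) (A \<inter> places Z)"

lemma pairs_ofI: "p \<in> A \<Longrightarrow> p \<in> places Z \<Longrightarrow> pairing Z p \<in> pairs_of A"
  unfolding pairs_of_def by blast

lemma places_points: "places Z \<subseteq> points Z"
  by (auto simp: places_def points_def)

lemma finite_points: "finite (points Z)"
proof (rule finite_subset)
  show "points Z \<subseteq> (SIGMA i:ivals Z. {..nplaces Z i + 1})" by (auto simp: points_def)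
  show "finite (SIGMA i:ivals Z. {..nplaces Z i + 1})" using arc by (auto simp: arc_diagram_def)
qed

lemma finite_places: "finite (places Z)"
  using finite_subset[OF places_points finite_points] .

lemma finite_strands: "strand_diagram Z \<phi> \<Longrightarrow> finite \<phi>"
  by (rule finite_subset[of _ "points Z \<times> points Z"])
    (auto simp: strand_diagram_def finite_points)

lemma finite_strand_diagrams: "finite {\<phi>. strand_diagram Z \<phi>}"
  by (rule finite_subset[of _ "Pow (points Z \<times> points Z)"])
    (auto simp: strand_diagram_def finite_points)

lemma finite_pairs [simp]: "finite (pairs Z)"
  by (simp add: pairs_def)

lemma pairing_in: "p \<in> places Z \<Longrightarrow> pairing Z p \<in> pairs Z"
  using arc by (auto simp: arc_diagram_def)

lemma fibre_iff: "p \<in> fibre Z P \<longleftrightarrow> p \<in> places Z \<and> pairing Z p = P"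
  by (auto simp: fibre_def)

lemma place_pos: "p \<in> places Z \<Longrightarrow> 0 < snd p"
  by (auto simp: places_def)

lemma fibreE:
  assumes "P \<in> pairs Z" "p \<in> fibre Z P"
  obtains q where "fibre Z P = {p, q}" "p \<noteq> q"
proof -
  have "card (fibre Z P) = 2" using arc assms by (auto simp: arc_diagram_def)
  then obtain a b where "fibre Z P = {a, b}" "a \<noteq> b" by (auto simp: card_2_iff)
  then show ?thesis using assms(2) that by (metis doubleton_eq_iff insertE singletonD)
qed

lemma fibre_nonempty: "P \<in> pairs Z \<Longrightarrow> fibre Z P \<noteq> {}"
  using arc by (auto simp: arc_diagram_def)

lemma twin:
  assumes "p \<in> places Z"
  shows "twin Z p \<in> places Z" "twin Z p \<noteq> p" "pairing Z (twin Z p) = pairing Z p"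
    "fibre Z (pairing Z p) = {p, twin Z p}"
proof -
  obtain q where q: "fibre Z (pairing Z p) = {p, q}" "p \<noteq> q"
    using fibreE[OF pairing_in[OF assms], of p] assms fibre_iff by blast
  then have "twin Z p = q" unfolding twin_def by (intro the_equality) auto
  then show "twin Z p \<noteq> p" "fibre Z (pairing Z p) = {p, twin Z p}" using q by auto
  then show "twin Z p \<in> places Z" "pairing Z (twin Z p) = pairing Z p" using fibre_iff by blast+
qed

lemma same_pair: "p \<in> places Z \<Longrightarrow> q \<in> places Z \<Longrightarrow> pairing Z q = pairing Z p \<longleftrightarrow> q = p \<or> q = twin Z p"
  using twin[of p] fibre_iff[of q "pairing Z p"] by auto

definition compatible :: "nat set \<Rightarrow> 'i point set \<Rightarrow> bool" where
  "compatible s S \<longleftrightarrow> S \<subseteq> points Z \<and> one_per_pair S \<and> pairs_of S = s"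

lemma idem_eq: "idem Z s = (\<Sum>S\<in>{S. compatible s S}. strand_elt (Id_on S))"
  unfolding idem_def compatible_def one_per_pair_def pairs_of_def ..

lemma finite_compatible: "finite {S. compatible s S}"
  by (rule finite_subset[of _ "Pow (points Z)"]) (auto simp: compatible_def finite_points)

lemma inv_count_Id_on [simp]: "inv_count (Id_on S) = 0"
proof -
  have "crossings (Id_on S) = {}" by (auto simp: crossings_def pt_less_def)
  then show ?thesis by (simp add: inv_count_def)
qed

lemma strand_mul_Id_left: "strand_mul (Id_on S) \<phi> = (if S = Domain \<phi> then strand_elt \<phi> else 0)"
proof -
  have "Id_on (Domain \<phi>) O \<phi> = \<phi>" by auto
  then show ?thesis by (auto simp: strand_mul_def)
qed

lemma strand_mul_Id_right: "strand_mul \<phi> (Id_on S) = (if S = Range \<phi> then strand_elt \<phi> else 0)"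
proof -
  have "\<phi> O Id_on (Range \<phi>) = \<phi>" by auto
  then show ?thesis by (auto simp: strand_mul_def)
qed

lemma idem_mul: "idem Z s \<odot> strand_elt \<phi> = (if compatible s (Domain \<phi>) then strand_elt \<phi> else 0)"
  by (simp add: idem_eq mul_sum_left mul_strand_elt strand_mul_Id_left finite_compatible)

lemma mul_idem: "strand_elt \<phi> \<odot> idem Z s = (if compatible s (Range \<phi>) then strand_elt \<phi> else 0)"
  by (simp add: idem_eq mul_sum_right mul_strand_elt strand_mul_Id_right finite_compatible)

text \<open>
  The sets of horizontal strands which complete \<open>\<mu>\<close> to a term of the diagram.
\<close>

definition fillings :: "nat set \<Rightarrow> 'i strands \<Rightarrow> nat set \<Rightarrow> 'i point set set" where
  "fillings s \<mu> t = {U. U \<inter> (Domain \<mu> \<union> Range \<mu>) = {} \<and>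
     compatible s (Domain \<mu> \<union> U) \<and> compatible t (Range \<mu> \<union> U)}"

lemma fillings_points: "U \<in> fillings s \<mu> t \<Longrightarrow> U \<subseteq> points Z"
  by (auto simp: fillings_def compatible_def)

lemma finite_fillings: "finite (fillings s \<mu> t)"
  by (rule finite_subset[of _ "Pow (points Z)"]) (auto dest: fillings_points simp: finite_points)

lemma diag_eq: "diag Z s \<mu> t = (\<Sum>U\<in>fillings s \<mu> t. strand_elt (\<mu> \<union> Id_on U))"
proof -
  let ?A = "{U. U \<subseteq> points Z - (Domain \<mu> \<union> Range \<mu>)}"
  have fin: "finite ?A" using finite_points by simp
  have DR: "Domain (\<mu> \<union> Id_on U) = Domain \<mu> \<union> U" "Range (\<mu> \<union> Id_on U) = Range \<mu> \<union> U" for U by auto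
  have "diag Z s \<mu> t = (\<Sum>U\<in>?A. (if compatible s (Domain \<mu> \<union> U) then strand_elt (\<mu> \<union> Id_on U) else 0) \<odot> idem Z t)"
    by (simp add: diag_def fill_def mul_sum_right mul_sum_left idem_mul DR cong: if_cong)
  also have "\<dots> = (\<Sum>U\<in>?A. if compatible s (Domain \<mu> \<union> U) \<and> compatible t (Range \<mu> \<union> U)
      then strand_elt (\<mu> \<union> Id_on U) else 0)"
    by (rule sum.cong) (auto simp: mul_idem DR)
  also have "\<dots> = (\<Sum>U\<in>{U \<in> ?A. compatible s (Domain \<mu> \<union> U) \<and> compatible t (Range \<mu> \<union> U)}.
      strand_elt (\<mu> \<union> Id_on U))"
    by (rule sum.inter_filter[symmetric, OF fin])
  also have "{U \<in> ?A. compatible s (Domain \<mu> \<union> U) \<and> compatible t (Range \<mu> \<union> U)} = fillings s \<mu> t"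
    by (auto simp: fillings_def compatible_def)
  finally show ?thesis .
qed

lemma nonhorizontal_filling:
  assumes "moving Z \<mu>"
  shows "nonhorizontal (\<mu> \<union> Id_on U) = \<mu>"
  using assms by (auto simp: nonhorizontal_def moving_def)

lemma inj_filling:
  assumes "moving Z \<mu>"
  shows "inj_on (\<lambda>U. \<mu> \<union> Id_on U) A"
proof (rule inj_onI)
  fix U V assume e: "\<mu> \<union> Id_on U = \<mu> \<union> Id_on V"
  have "\<mu> \<inter> Id_on U = {}" "\<mu> \<inter> Id_on V = {}" using assms by (auto simp: moving_def)
  then have "Id_on U = Id_on V" using e by blast
  then show "U = V" by (metis Domain_Id_on)
qed

lemma ks_diag:
  assumes "moving Z \<mu>"
  shows "ks (diag Z s \<mu> t) = (\<lambda>U. \<mu> \<union> Id_on U) ` fillings s \<mu> t"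
  unfolding diag_eq by (rule sum_inj_strand_elt[OF finite_fillings inj_filling[OF assms]])

text \<open>
  The condition for \<open>(s, \<mu>, t)\<close> to present a diagram: no pair is used twice at either
  end, and the dotted horizontal strands lie at the same pairs at both ends.
\<close>

definition good :: "nat set \<Rightarrow> 'i strands \<Rightarrow> nat set \<Rightarrow> bool" where
  "good s \<mu> t \<longleftrightarrow> s \<subseteq> pairs Z \<and> t \<subseteq> pairs Z \<and> moving Z \<mu> \<and>
     one_per_pair (Domain \<mu>) \<and> one_per_pair (Range \<mu>) \<and>
     pairs_of (Domain \<mu>) \<subseteq> s \<and> pairs_of (Range \<mu>) \<subseteq> t \<and>
     s - pairs_of (Domain \<mu>) = t - pairs_of (Range \<mu>)"

lemma compatible_Un:
  assumes "A \<inter> U = {}"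
  shows "compatible s (A \<union> U) \<longleftrightarrow> A \<subseteq> points Z \<and> U \<subseteq> points Z \<and> one_per_pair A \<and> one_per_pair U \<and>
    pairs_of A \<subseteq> s \<and> pairs_of U = s - pairs_of A"
proof -
  have d: "A \<inter> places Z - U \<inter> places Z = A \<inter> places Z" "U \<inter> places Z - A \<inter> places Z = U \<inter> places Z"
    using assms by blast+
  have i: "inj_on (pairing Z) ((A \<union> U) \<inter> places Z) \<longleftrightarrow> inj_on (pairing Z) (A \<inter> places Z) \<and>
      inj_on (pairing Z) (U \<inter> places Z) \<and> pairs_of A \<inter> pairs_of U = {}"
    unfolding Int_Un_distrib2 inj_on_Un pairs_of_def d ..
  have p: "pairs_of (A \<union> U) = pairs_of A \<union> pairs_of U"
    unfolding pairs_of_def by blast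
  have "pairs_of A \<inter> pairs_of U = {} \<and> pairs_of A \<union> pairs_of U = s \<longleftrightarrow>
      pairs_of A \<subseteq> s \<and> pairs_of U = s - pairs_of A"
    by blast
  then show ?thesis
    unfolding compatible_def one_per_pair_def i p Un_subset_iff by argo
qed

text \<open>
  At a pair with dotted horizontal strands no strand of \<open>\<mu>\<close> begins or ends. So the
  horizontal strand can be put at either of the two places, independently for all these pairs.
\<close>

lemma fillings_good:
  assumes "good s \<mu> t"
  shows "fillings s \<mu> t = {U. U \<subseteq> points Z \<and> U \<inter> (Domain \<mu> \<union> Range \<mu>) = {} \<and> one_per_pair U \<and>
    pairs_of U = s - pairs_of (Domain \<mu>)}"
proof -
  have "Domain \<mu> \<subseteq> points Z" "Range \<mu> \<subseteq> points Z"
    using assms by (auto simp: good_def moving_def dest: strand_diagram_points)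
  note DR = this
  show ?thesis
  proof (rule set_eqI)
    fix U
    show "U \<in> fillings s \<mu> t \<longleftrightarrow> U \<in> {U. U \<subseteq> points Z \<and> U \<inter> (Domain \<mu> \<union> Range \<mu>) = {} \<and>
      one_per_pair U \<and> pairs_of U = s - pairs_of (Domain \<mu>)}"
    proof (cases "U \<inter> (Domain \<mu> \<union> Range \<mu>) = {}")
      case True
      then have "Domain \<mu> \<inter> U = {}" "Range \<mu> \<inter> U = {}" by blast+
      then show ?thesis using assms DR True unfolding fillings_def good_def mem_Collect_eq
        by (simp only: compatible_Un) argo
    qed (simp add: fillings_def)
  qed
qed

lemma filling_exists:
  assumes "good s \<mu> t" and A: "A \<subseteq> places Z" "one_per_pair A" "pairs_of A \<subseteq> s - pairs_of (Domain \<mu>)"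
  obtains U where "U \<in> fillings s \<mu> t" "A \<subseteq> U"
proof -
  define H where "H = s - pairs_of (Domain \<mu>)"
  define c where "c P = (if P \<in> pairs_of A then (THE p. p \<in> A \<and> pairing Z p = P) else (SOME p. p \<in> fibre Z P))" for P
  have cA: "c (pairing Z p) = p" if "p \<in> A" for p
  proof -
    have "pairing Z p \<in> pairs_of A" using that A(1) by (auto simp: pairs_of_def)
    moreover have "(THE q. q \<in> A \<and> pairing Z q = pairing Z p) = p"
      using that A(1,2) by (intro the_equality) (auto simp: one_per_pair_def inj_on_def)
    ultimately show ?thesis by (simp add: c_def)
  qed
  have c: "c P \<in> fibre Z P" if "P \<in> H" for P
  proof (cases "P \<in> pairs_of A")
    case True
    then obtain p where "p \<in> A" "p \<in> places Z" "P = pairing Z p" by (auto simp: pairs_of_def)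
    then show ?thesis using cA by (simp add: fibre_iff)
  next
    case False
    have "P \<in> pairs Z" using that assms by (auto simp: H_def good_def)
    then show ?thesis using False fibre_nonempty by (simp add: c_def some_in_eq)
  qed
  define U where "U = c ` H"
  have Upl: "U \<subseteq> places Z" using c by (auto simp: U_def fibre_iff)
  have "pairs_of U = pairing Z ` U" using Upl by (simp add: pairs_of_def Int_absorb2)
  also have "\<dots> = (\<lambda>P. P) ` H"
    unfolding U_def image_image using c by (intro image_cong) (auto simp: fibre_iff)
  finally have pU: "pairs_of U = H" by simp
  have H': "H = t - pairs_of (Range \<mu>)" using assms by (simp add: H_def good_def)
  have "U \<inter> (Domain \<mu> \<union> Range \<mu>) = {}"
  proof (rule ccontr)
    assume "U \<inter> (Domain \<mu> \<union> Range \<mu>) \<noteq> {}"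
    then obtain x where x: "x \<in> U" "x \<in> Domain \<mu> \<or> x \<in> Range \<mu>" by blast
    then have "pairing Z x \<in> H" "x \<in> places Z" using pairs_ofI pU Upl by blast+
    then show False using x(2) pairs_ofI H_def H' by blast
  qed
  moreover have "one_per_pair U"
  proof -
    have "inj_on (pairing Z \<circ> c) H" using c by (intro inj_onI) (simp add: fibre_iff)
    then have "inj_on (pairing Z) U" unfolding U_def by (rule inj_on_imageI)
    then show ?thesis unfolding one_per_pair_def by (rule inj_on_subset) blast
  qed
  ultimately have "U \<in> fillings s \<mu> t"
    using fillings_good[OF assms(1)] pU Upl places_points H_def by auto
  moreover have "A \<subseteq> U"
  proof
    fix p assume "p \<in> A"
    then have "pairing Z p \<in> H" using A by (auto simp: H_def pairs_of_def)
    then show "p \<in> U" using cA[OF \<open>p \<in> A\<close>] by (metis U_def image_eqI)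
  qed
  ultimately show ?thesis using that by blast
qed

text \<open>
  Together with \<open>key_props\<close> this reduces statements about diagrams to their strands: distinct
  presentations satisfying \<open>good\<close> give nonzero elements with disjoint sets of terms.
\<close>

lemma diag_nonzero_iff:
  assumes "moving Z \<mu>" "s \<subseteq> pairs Z" "t \<subseteq> pairs Z"
  shows "diag Z s \<mu> t \<noteq> 0 \<longleftrightarrow> good s \<mu> t"
proof
  assume "diag Z s \<mu> t \<noteq> 0"
  then obtain U where U: "U \<in> fillings s \<mu> t" using ks_diag[OF assms(1)]
    by (metis alg_eqI equals0I image_empty keys_zero)
  then have "Domain \<mu> \<inter> U = {}" "Range \<mu> \<inter> U = {}" by (auto simp: fillings_def)
  then show "good s \<mu> t" using U assms unfolding good_def fillings_def
    by (auto simp: compatible_Un)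
next
  assume "good s \<mu> t"
  then obtain U where "U \<in> fillings s \<mu> t"
    using filling_exists[of s \<mu> t "{}"] by (auto simp: one_per_pair_def pairs_of_def)
  then have "ks (diag Z s \<mu> t) \<noteq> {}" using ks_diag[OF assms(1)] by blast
  then show "diag Z s \<mu> t \<noteq> 0" by auto
qed

lemma presents_iff: "presents Z D (s, \<mu>, t) \<longleftrightarrow> good s \<mu> t \<and> D = diag Z s \<mu> t"
proof -
  have "good s \<mu> t \<Longrightarrow> moving Z \<mu> \<and> s \<subseteq> pairs Z \<and> t \<subseteq> pairs Z" by (simp add: good_def)
  moreover have "presents Z D (s, \<mu>, t) \<longleftrightarrow>
      s \<subseteq> pairs Z \<and> t \<subseteq> pairs Z \<and> moving Z \<mu> \<and> D = diag Z s \<mu> t \<and> diag Z s \<mu> t \<noteq> 0"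
    unfolding presents_def moving_def by auto
  ultimately show ?thesis using diag_nonzero_iff by blast
qed

lemma diagram_iff: "diagram Z D \<longleftrightarrow> (\<exists>s \<mu> t. good s \<mu> t \<and> D = diag Z s \<mu> t)"
  by (auto simp: diagram_def presents_iff)

lemma key_props:
  assumes "good s \<mu> t" "\<phi> \<in> ks (diag Z s \<mu> t)"
  shows "nonhorizontal \<phi> = \<mu>" "pairs_of (Domain \<phi>) = s" "pairs_of (Range \<phi>) = t"
    "strand_diagram Z \<phi>" "strand_chain \<phi> = strand_chain \<mu>"
proof -
  have m: "moving Z \<mu>" using assms by (simp add: good_def)
  obtain U where U: "U \<in> fillings s \<mu> t" "\<phi> = \<mu> \<union> Id_on U" using assms ks_diag[OF m] by auto
  show "nonhorizontal \<phi> = \<mu>" using U nonhorizontal_filling[OF m] by simp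
  have DR: "Domain \<phi> = Domain \<mu> \<union> U" "Range \<phi> = Range \<mu> \<union> U" using U by auto
  show "pairs_of (Domain \<phi>) = s" "pairs_of (Range \<phi>) = t"
    using U unfolding DR by (auto simp: fillings_def compatible_def)
  have dis: "U \<inter> Domain \<mu> = {}" "U \<inter> Range \<mu> = {}" "U \<subseteq> points Z"
    using U fillings_points[OF U(1)] by (auto simp: fillings_def)
  have sd: "strand_diagram Z \<mu>" using m by (simp add: moving_def)
  have "single_valued \<phi>" "single_valued (\<phi>\<inverse>)"
    unfolding U(2) single_valued_def using dis strand_diagram_fun[OF sd] strand_diagram_inj[OF sd]
    by blast+
  moreover have "\<phi> \<subseteq> points Z \<times> points Z"
    using sd dis(3) unfolding U(2) strand_diagram_def by blast
  moreover have "\<forall>(x, y)\<in>\<phi>. pt_le x y"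
  proof (clarify)
    fix x y assume "(x, y) \<in> \<phi>"
    then have "(x, y) \<in> \<mu> \<or> x = y" unfolding U(2) by blast
    then show "pt_le x y" using strand_diagram_le[OF sd, of x y] by (auto simp: pt_le_def)
  qed
  ultimately show 1: "strand_diagram Z \<phi>" by (simp add: strand_diagram_def)
  have "\<not> covers a z" if "a \<in> Id_on U" for a z using that by (auto simp: covers_iff)
  then have "{a \<in> \<phi>. covers a z} = {a \<in> \<mu>. covers a z}" for z
    unfolding U(2) by blast
  then show "strand_chain \<phi> = strand_chain \<mu>"
    using finite_strands[OF 1] finite_strands[OF sd] by (intro ext) (simp add: strand_chain_card)
qed

lemma good_keys_nonempty: "good s \<mu> t \<Longrightarrow> ks (diag Z s \<mu> t) \<noteq> {}"
  using diag_nonzero_iff[of \<mu> s t] by (auto simp: good_def)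

lemma presentation_diag:
  assumes "good s \<mu> t"
  shows "presentation Z (diag Z s \<mu> t) = (s, \<mu>, t)"
proof -
  have "presents Z (diag Z s \<mu> t) (s, \<mu>, t)" using assms by (simp add: presents_iff)
  moreover have "d = (s, \<mu>, t)" if d: "presents Z (diag Z s \<mu> t) d" for d
  proof -
    obtain s' \<mu>' t' where d': "d = (s', \<mu>', t')" by (cases d) auto
    then have g: "good s' \<mu>' t'" "diag Z s \<mu> t = diag Z s' \<mu>' t'" using d by (auto simp: presents_iff)
    obtain \<phi> where "\<phi> \<in> ks (diag Z s \<mu> t)" using good_keys_nonempty[OF assms] by blast
    then show ?thesis using key_props[OF assms] key_props[OF g(1)] g(2) d' by metis
  qed
  ultimately show ?thesis unfolding presentation_def by blast
qed

lemma hdata_diag: "good s \<mu> t \<Longrightarrow> hdata Z (diag Z s \<mu> t) = (strand_chain \<mu>, s, t)"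
  by (simp add: hdata_def presentation_diag)

text \<open>The multiplicity of a step counts the strands covering it.\<close>

lemma viable_iff_thin:
  assumes "strand_diagram Z \<mu>"
  shows "viable_chain Z (strand_chain \<mu>) \<longleftrightarrow> thin \<mu>"
proof
  assume v: "viable_chain Z (strand_chain \<mu>)"
  have fin: "finite \<mu>" using finite_strands[OF assms] .
  show "thin \<mu>" unfolding thin_def
  proof (intro ballI allI impI)
    fix a b z assume ab: "a \<in> \<mu>" "b \<in> \<mu>" "covers a z \<and> covers b z"
    obtain x y where a: "a = (x, y)" by (cases a) auto
    have "y \<in> points Z" using ab a strand_diagram_points[OF assms] by blast
    then have "z \<in> steps Z" using ab a by (cases y; cases z) (auto simp: covers_iff points_def steps_def)
    then have "card {a \<in> \<mu>. covers a z} \<le> 1"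
      using v by (auto simp: viable_chain_def strand_chain_card[OF fin])
    moreover have "{a \<in> \<mu>. covers a z} \<supseteq> {a, b}" using ab by auto
    ultimately show "a = b"
      using card_mono[of "{a \<in> \<mu>. covers a z}" "{a, b}"] fin
      by (cases "a = b") (simp_all add: card_2_iff)
  qed
next
  assume "thin \<mu>"
  then show "viable_chain Z (strand_chain \<mu>)"
    using strand_chain_thin[OF finite_strands[OF assms]] by (auto simp: viable_chain_def)
qed

end

section \<open>Products of viable diagrams\<close>

text \<open>
  The nonhorizontal strands of a product. A strand which is not continued by one of the other factor is
  continued by a horizontal one.
\<close>

definition concat_strands :: "'i strands \<Rightarrow> 'i strands \<Rightarrow> 'i strands" where
  "concat_strands \<mu> \<nu> = \<mu> O \<nu> \<union> {(x, y) \<in> \<mu>. y \<notin> Domain \<nu>} \<union> {(y, z) \<in> \<nu>. y \<notin> Range \<mu>}"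

lemma Domain_concat: "Domain (concat_strands \<mu> \<nu>) = Domain \<mu> \<union> (Domain \<nu> - Range \<mu>)"
  unfolding concat_strands_def by blast

lemma Range_concat: "Range (concat_strands \<mu> \<nu>) = Range \<nu> \<union> (Range \<mu> - Domain \<nu>)"
  unfolding concat_strands_def by blast

lemma concat_fillings:
  assumes "Range \<mu> \<union> U = Domain \<nu> \<union> V" "U \<inter> Range \<mu> = {}" "V \<inter> Domain \<nu> = {}"
  shows "(\<mu> \<union> Id_on U) O (\<nu> \<union> Id_on V) = concat_strands \<mu> \<nu> \<union> Id_on (U \<inter> V)"
proof -
  have "(\<mu> \<union> Id_on U) O (\<nu> \<union> Id_on V) =
      \<mu> O \<nu> \<union> \<mu> O Id_on V \<union> Id_on U O \<nu> \<union> Id_on U O Id_on V" by blast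
  also have "\<mu> O Id_on V = {(x, y) \<in> \<mu>. y \<notin> Domain \<nu>}" using assms(1,3) by blast
  also have "Id_on U O \<nu> = {(y, z) \<in> \<nu>. y \<notin> Range \<mu>}" using assms(1,2) by blast
  also have "Id_on U O Id_on V = Id_on (U \<inter> V)" by blast
  finally show ?thesis unfolding concat_strands_def by blast
qed

text \<open>
  Two sets of nonhorizontal strands such that no step is covered twice, neither by one of them nor by both
  together: the case in which the product of the two diagrams is viable.
\<close>

locale composable =
  fixes Z :: "'i arc_diagram" and \<mu> \<nu> :: "'i strands"
  assumes mov: "moving Z \<mu>" "moving Z \<nu>" and thin: "thin \<mu>" "thin \<nu>"
    and disj: "\<And>z. \<not> (cov \<mu> z \<and> cov \<nu> z)"
begin

lemma start_disj: "x \<in> Domain \<mu> \<Longrightarrow> x \<notin> Domain \<nu>"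
  using moving_Domain_cov mov disj by metis

lemma end_disj: "x \<in> Range \<mu> \<Longrightarrow> x \<notin> Range \<nu>"
  using moving_Range_cov mov disj by metis

lemma concat_cases:
  assumes "(x, z) \<in> concat_strands \<mu> \<nu>"
  obtains y where "(x, y) \<in> \<mu>" "(y, z) \<in> \<nu>" | "(x, z) \<in> \<mu>" "z \<notin> Domain \<nu>"
    | "(x, z) \<in> \<nu>" "x \<notin> Range \<mu>"
  using assms unfolding concat_strands_def by blast

lemma concat_less: "(x, z) \<in> concat_strands \<mu> \<nu> \<Longrightarrow> fst x = fst z \<and> snd x < snd z"
  by (erule concat_cases) (use moving_less[OF mov(1)] moving_less[OF mov(2)] in \<open>metis less_trans\<close>)+

lemma moving_concat: "moving Z (concat_strands \<mu> \<nu>)"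
proof -
  note sd = moving_diagram[OF mov(1)] moving_diagram[OF mov(2)]
  note f1 = strand_diagram_fun[OF sd(1)] and f2 = strand_diagram_fun[OF sd(2)]
    and i1 = strand_diagram_inj[OF sd(1)] and i2 = strand_diagram_inj[OF sd(2)]
  have "single_valued (concat_strands \<mu> \<nu>)"
  proof (rule single_valuedI)
    fix x z z' assume z: "(x, z) \<in> concat_strands \<mu> \<nu>" and z': "(x, z') \<in> concat_strands \<mu> \<nu>"
    show "z = z'"
    proof (cases "x \<in> Domain \<mu>")
      case True
      then have "x \<notin> Domain \<nu>" by (rule start_disj)
      then show ?thesis using z z' f1 f2 unfolding concat_strands_def by blast
    next
      case False
      then show ?thesis using z z' f1 f2 unfolding concat_strands_def by blast
    qed
  qed
  moreover have "single_valued ((concat_strands \<mu> \<nu>)\<inverse>)"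
  proof (rule single_valuedI)
    fix x z z' assume "(x, z) \<in> (concat_strands \<mu> \<nu>)\<inverse>" and "(x, z') \<in> (concat_strands \<mu> \<nu>)\<inverse>"
    then have z: "(z, x) \<in> concat_strands \<mu> \<nu>" and z': "(z', x) \<in> concat_strands \<mu> \<nu>" by auto
    show "z = z'"
    proof (cases "x \<in> Range \<mu>")
      case True
      then have "x \<notin> Range \<nu>" by (rule end_disj)
      then show ?thesis using z z' i1 i2 unfolding concat_strands_def by blast
    next
      case False
      then show ?thesis using z z' i1 i2 unfolding concat_strands_def by blast
    qed
  qed
  moreover have "concat_strands \<mu> \<nu> \<subseteq> points Z \<times> points Z"
    using sd unfolding concat_strands_def strand_diagram_def by blast
  moreover have "\<forall>(x, y)\<in>concat_strands \<mu> \<nu>. pt_le x y"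
  proof clarify
    fix x y assume "(x, y) \<in> concat_strands \<mu> \<nu>"
    then show "pt_le x y" using concat_less[of x y] by (simp add: pt_le_def)
  qed
  moreover have "(x, x) \<notin> concat_strands \<mu> \<nu>" for x
    using concat_less[of x x] by blast
  ultimately show ?thesis by (simp add: moving_def strand_diagram_def)
qed

lemma concat_covers:
  assumes "(x, z) \<in> concat_strands \<mu> \<nu>" "covers (x, z) w"
  shows "(\<exists>y. (x, y) \<in> \<mu> \<and> covers (x, y) w) \<or> (\<exists>y. (y, z) \<in> \<nu> \<and> covers (y, z) w)"
  using assms(1)
proof (cases rule: concat_cases)
  case (1 y)
  have "covers (x, y) w \<or> covers (y, z) w"
    using assms(2) moving_less[OF mov(1) 1(1)] moving_less[OF mov(2) 1(2)] by (auto simp: covers_iff)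
  then show ?thesis using 1 by blast
qed (use assms in blast)+

lemma cov_concat: "cov (concat_strands \<mu> \<nu>) w \<longleftrightarrow> cov \<mu> w \<or> cov \<nu> w"
proof
  assume "cov (concat_strands \<mu> \<nu>) w"
  then show "cov \<mu> w \<or> cov \<nu> w" unfolding cov_def using concat_covers by (metis surj_pair)
next
  assume "cov \<mu> w \<or> cov \<nu> w"
  then consider x y where "(x, y) \<in> \<mu>" "covers (x, y) w" | y z where "(y, z) \<in> \<nu>" "covers (y, z) w"
    unfolding cov_def by (metis surj_pair)
  then show "cov (concat_strands \<mu> \<nu>) w"
  proof cases
    case 1
    show ?thesis
    proof (cases "y \<in> Domain \<nu>")
      case True
      then obtain z where z: "(y, z) \<in> \<nu>" by blast
      then have "covers (x, z) w" using 1 moving_less[OF mov(2) z] by (auto simp: covers_iff)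
      then show ?thesis using 1 z unfolding cov_def concat_strands_def by blast
    next
      case False
      then show ?thesis using 1 unfolding cov_def concat_strands_def by blast
    qed
  next
    case 2
    show ?thesis
    proof (cases "y \<in> Range \<mu>")
      case True
      then obtain x where x: "(x, y) \<in> \<mu>" by blast
      then have "covers (x, z) w" using 2 moving_less[OF mov(1) x] by (auto simp: covers_iff)
      then show ?thesis using 2 x unfolding cov_def concat_strands_def by blast
    next
      case False
      then show ?thesis using 2 unfolding cov_def concat_strands_def by blast
    qed
  qed
qed

lemma thin_concat: "thin (concat_strands \<mu> \<nu>)"
  unfolding thin_def
proof (intro ballI allI impI)
  fix a b w assume a: "a \<in> concat_strands \<mu> \<nu>" and b: "b \<in> concat_strands \<mu> \<nu>"
    and ab: "covers a w \<and> covers b w"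
  obtain x z x' z' where e: "a = (x, z)" "b = (x', z')" by (metis surj_pair)
  note ca = concat_covers[OF a[unfolded e] conjunct1[OF ab, unfolded e]]
  note cb = concat_covers[OF b[unfolded e] conjunct2[OF ab, unfolded e]]
  have sd: "strand_diagram Z (concat_strands \<mu> \<nu>)" using moving_concat by (rule moving_diagram)
  show "a = b"
  proof (cases "cov \<mu> w")
    case True
    then have "\<not> cov \<nu> w" using disj by blast
    then obtain y y' where "(x, y) \<in> \<mu>" "covers (x, y) w" "(x', y') \<in> \<mu>" "covers (x', y') w"
      using ca cb unfolding cov_def by blast
    then have "x = x'" using thinD[OF thin(1)] by blast
    then show ?thesis using strand_diagram_fun[OF sd] a b e by blast
  next
    case False
    then obtain y y' where "(y, z) \<in> \<nu>" "covers (y, z) w" "(y', z') \<in> \<nu>" "covers (y', z') w"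
      using ca cb unfolding cov_def by blast
    then have "z = z'" using thinD[OF thin(2)] by blast
    then show ?thesis using strand_diagram_inj[OF sd] a b e by blast
  qed
qed

text \<open>
  A point where a strand of \<open>\<mu>\<close> begins and one of \<open>\<nu>\<close> ends is not a
  point where \<open>\<mu>\<close> and \<open>\<nu>\<close> are joined: the strand of \<open>\<nu>\<close>
  comes first along the interval.
\<close>

lemma broken_concat: "broken (concat_strands \<mu> \<nu>) = broken \<mu> \<union> broken \<nu> \<union> (Domain \<mu> \<inter> Range \<nu>)"
  unfolding broken_def Domain_concat Range_concat using start_disj end_disj by blast

end

context arc
begin

text \<open>
  If a strand of \<open>\<mu>\<close> ends at a place and a strand of \<open>\<nu>\<close> begins at its
  twin, then no term of the first diagram fits together with a term of the second. This is the only
  obstruction to composing diagrams.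
\<close>

definition matched :: "'i strands \<Rightarrow> 'i strands \<Rightarrow> bool" where
  "matched \<mu> \<nu> \<longleftrightarrow> (\<forall>p\<in>Range \<mu> \<inter> places Z. \<forall>q\<in>Domain \<nu> \<inter> places Z. pairing Z p = pairing Z q \<longrightarrow> p = q)"

lemma one_per_pairD:
  "one_per_pair A \<Longrightarrow> p \<in> A \<Longrightarrow> q \<in> A \<Longrightarrow> p \<in> places Z \<Longrightarrow> q \<in> places Z \<Longrightarrow> pairing Z p = pairing Z q \<Longrightarrow> p = q"
  unfolding one_per_pair_def inj_on_def by blast

lemma pairs_ofE: "P \<in> pairs_of A \<Longrightarrow> (\<And>p. p \<in> A \<Longrightarrow> p \<in> places Z \<Longrightarrow> P = pairing Z p \<Longrightarrow> R) \<Longrightarrow> R"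
  unfolding pairs_of_def by blast

lemma one_per_pairI:
  "(\<And>p q. p \<in> A \<Longrightarrow> q \<in> A \<Longrightarrow> p \<in> places Z \<Longrightarrow> q \<in> places Z \<Longrightarrow> pairing Z p = pairing Z q \<Longrightarrow> p = q) \<Longrightarrow> one_per_pair A"
  unfolding one_per_pair_def inj_on_def by blast

lemma pairs_of_Un: "pairs_of (A \<union> B) = pairs_of A \<union> pairs_of B"
  unfolding pairs_of_def by blast

lemma one_per_pair_Un:
  "one_per_pair A \<Longrightarrow> one_per_pair B \<Longrightarrow> pairs_of A \<inter> pairs_of B = {} \<Longrightarrow> one_per_pair (A \<union> B)"
  unfolding one_per_pair_def pairs_of_def Int_Un_distrib2 inj_on_Un by blast

lemma one_per_pair_subset: "one_per_pair A \<Longrightarrow> B \<subseteq> A \<Longrightarrow> one_per_pair B"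
  unfolding one_per_pair_def by (meson Int_mono inj_on_subset order_refl)

lemma interior_place: "moving Z \<mu> \<Longrightarrow> moving Z \<nu> \<Longrightarrow> x \<in> Domain \<mu> \<Longrightarrow> x \<in> Range \<nu> \<Longrightarrow> x \<in> places Z"
proof -
  assume m: "moving Z \<mu>" "moving Z \<nu>" and x: "x \<in> Domain \<mu>" "x \<in> Range \<nu>"
  then obtain y w where y: "(x, y) \<in> \<mu>" "(w, x) \<in> \<nu>" by blast
  have "y \<in> points Z" "x \<in> points Z"
    using strand_diagram_points[OF moving_diagram[OF m(1)] y(1)] by auto
  then show ?thesis using moving_less[OF m(1) y(1)] moving_less[OF m(2) y(2)]
    by (cases x; cases y) (auto simp: points_def places_def)
qed

lemma pairs_of_Diff:
  assumes "\<And>p q. p \<in> A \<Longrightarrow> q \<in> B \<Longrightarrow> p \<in> places Z \<Longrightarrow> q \<in> places Z \<Longrightarrow> pairing Z p = pairing Z q \<Longrightarrow> p = q"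
  shows "pairs_of (A - B) = pairs_of A - pairs_of B"
proof (intro equalityI subsetI)
  fix P assume "P \<in> pairs_of (A - B)"
  then obtain p where p: "p \<in> A" "p \<notin> B" "p \<in> places Z" "P = pairing Z p" by (blast elim: pairs_ofE)
  then have "P \<notin> pairs_of B" using assms by (metis pairs_ofE)
  then show "P \<in> pairs_of A - pairs_of B" using p pairs_ofI by blast
next
  fix P assume "P \<in> pairs_of A - pairs_of B"
  then obtain p where p: "p \<in> A" "p \<in> places Z" "P = pairing Z p" "P \<notin> pairs_of B" by (blast elim: pairs_ofE)
  then have "p \<in> A - B" using pairs_ofI[of p B] by auto
  then show "P \<in> pairs_of (A - B)" using pairs_ofI[of p "A - B"] p by simp
qed

lemma pairs_of_matched:
  assumes "matched \<mu> \<nu>"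
  shows "pairs_of (Domain \<nu> - Range \<mu>) = pairs_of (Domain \<nu>) - pairs_of (Range \<mu>)"
    and "pairs_of (Range \<mu> - Domain \<nu>) = pairs_of (Range \<mu>) - pairs_of (Domain \<nu>)"
  by (rule pairs_of_Diff; use assms in \<open>unfold matched_def, metis IntI\<close>)+

lemma goodD:
  assumes "good s \<mu> t"
  shows "s \<subseteq> pairs Z" "t \<subseteq> pairs Z" "moving Z \<mu>" "one_per_pair (Domain \<mu>)" "one_per_pair (Range \<mu>)"
    "pairs_of (Domain \<mu>) \<subseteq> s" "pairs_of (Range \<mu>) \<subseteq> t" "s - pairs_of (Domain \<mu>) = t - pairs_of (Range \<mu>)"
  using assms by (auto simp: good_def)

lemma good_concat:
  assumes g: "good s \<mu> t" "good t \<nu> u" and c: "composable Z \<mu> \<nu>" and m: "matched \<mu> \<nu>"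
  shows "good s (concat_strands \<mu> \<nu>) u"
proof -
  note g1 = goodD[OF g(1)] and g2 = goodD[OF g(2)] and pm = pairs_of_matched[OF m]
  have D: "pairs_of (Domain (concat_strands \<mu> \<nu>)) =
      pairs_of (Domain \<mu>) \<union> (pairs_of (Domain \<nu>) - pairs_of (Range \<mu>))"
    unfolding Domain_concat pairs_of_Un pm ..
  have R: "pairs_of (Range (concat_strands \<mu> \<nu>)) =
      pairs_of (Range \<nu>) \<union> (pairs_of (Range \<mu>) - pairs_of (Domain \<nu>))"
    unfolding Range_concat pairs_of_Un pm ..
  have "one_per_pair (Domain (concat_strands \<mu> \<nu>))"
    unfolding Domain_concat
  proof (rule one_per_pair_Un[OF g1(4) one_per_pair_subset[OF g2(4)]])
    show "pairs_of (Domain \<mu>) \<inter> pairs_of (Domain \<nu> - Range \<mu>) = {}" unfolding pm using g1 g2 by blast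
  qed blast
  moreover have "one_per_pair (Range (concat_strands \<mu> \<nu>))"
    unfolding Range_concat
  proof (rule one_per_pair_Un[OF g2(5) one_per_pair_subset[OF g1(5)]])
    show "pairs_of (Range \<nu>) \<inter> pairs_of (Range \<mu> - Domain \<nu>) = {}" unfolding pm using g1 g2 by blast
  qed blast
  moreover have "pairs_of (Domain (concat_strands \<mu> \<nu>)) \<subseteq> s" "pairs_of (Range (concat_strands \<mu> \<nu>)) \<subseteq> u"
    "s - pairs_of (Domain (concat_strands \<mu> \<nu>)) = u - pairs_of (Range (concat_strands \<mu> \<nu>))"
    unfolding D R using g1 g2 by blast+
  ultimately show ?thesis using g1 g2 composable.moving_concat[OF c] by (simp add: good_def)
qed

text \<open>
  Two strands that cross in both factors would run over a common step, one in each factor, but the factors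
  cover different steps. So no inversions cancel in the composite.
\<close>

lemma strand_mul_fillings:
  assumes g: "good s \<mu> t" "good t \<nu> u" and c: "composable Z \<mu> \<nu>"
    and U: "U \<in> fillings s \<mu> t" and V: "V \<in> fillings t \<nu> u"
  shows "strand_mul (\<mu> \<union> Id_on U) (\<nu> \<union> Id_on V) =
    (if Range \<mu> \<union> U = Domain \<nu> \<union> V then strand_elt (concat_strands \<mu> \<nu> \<union> Id_on (U \<inter> V)) else 0)"
proof (cases "Range \<mu> \<union> U = Domain \<nu> \<union> V")
  case True
  interpret composable Z \<mu> \<nu> by (rule c)
  have keys: "\<mu> \<union> Id_on U \<in> ks (diag Z s \<mu> t)" "\<nu> \<union> Id_on V \<in> ks (diag Z t \<nu> u)"
    using ks_diag mov U V by blast+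
  note sd = key_props(4)[OF g(1) keys(1)] key_props(4)[OF g(2) keys(2)]
  have R: "Range (\<mu> \<union> Id_on U) = Range \<mu> \<union> U" "Domain (\<nu> \<union> Id_on V) = Domain \<nu> \<union> V" by auto
  have "inv_count ((\<mu> \<union> Id_on U) O (\<nu> \<union> Id_on V)) = inv_count (\<mu> \<union> Id_on U) + inv_count (\<nu> \<union> Id_on V)"
  proof (rule inv_count_comp_eq[OF sd finite_strands[OF sd(1)] finite_strands[OF sd(2)]])
    show "Range (\<mu> \<union> Id_on U) = Domain (\<nu> \<union> Id_on V)" unfolding R using True .
    \<comment> \<open>Two strands which cross twice both run along the step after the first crossing.\<close>
    fix x y z x' y' z'
    assume a: "(x, y) \<in> \<mu> \<union> Id_on U" "(y, z) \<in> \<nu> \<union> Id_on V" "(x', y') \<in> \<mu> \<union> Id_on U"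
      "(y', z') \<in> \<nu> \<union> Id_on V" and l: "pt_less x x'" "pt_less y' y" "pt_less z z'"
    note le = strand_diagram_le[OF sd(1) a(1)] strand_diagram_le[OF sd(2) a(2)]
      strand_diagram_le[OF sd(1) a(3)] strand_diagram_le[OF sd(2) a(4)]
    have "covers (x, y) y'" "covers (y', z') y'"
      using le l by (auto simp: covers_iff pt_less_def)
    moreover have "x \<noteq> y" "y' \<noteq> z'" using le l by (auto simp: pt_less_def)
    then have "(x, y) \<in> \<mu>" "(y', z') \<in> \<nu>" using a by auto
    ultimately show False using disj unfolding cov_def by blast
  qed
  moreover have "(\<mu> \<union> Id_on U) O (\<nu> \<union> Id_on V) = concat_strands \<mu> \<nu> \<union> Id_on (U \<inter> V)"
    using concat_fillings[OF True] U V unfolding fillings_def by blast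
  ultimately show ?thesis using True R by (simp add: strand_mul_def)
next
  case False
  moreover have "Range (\<mu> \<union> Id_on U) = Range \<mu> \<union> U" "Domain (\<nu> \<union> Id_on V) = Domain \<nu> \<union> V" by auto
  ultimately show ?thesis by (simp add: strand_mul_def)
qed

text \<open>
  A horizontal strand of the product is horizontal in both factors. The other horizontal strands of each
  factor continue strands of the other one, hence are determined.
\<close>

lemma concat_fillings_bij:
  assumes g: "good s \<mu> t" "good t \<nu> u" and c: "composable Z \<mu> \<nu>" and m: "matched \<mu> \<nu>"
  defines "A \<equiv> {(U, V). U \<in> fillings s \<mu> t \<and> V \<in> fillings t \<nu> u \<and> Range \<mu> \<union> U = Domain \<nu> \<union> V}"
  shows "(\<Sum>(U, V)\<in>A. F (U \<inter> V)) = (\<Sum>W\<in>fillings s (concat_strands \<mu> \<nu>) u. (F W :: 'j alg))"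
proof (rule sum.reindex_bij_witness[where j = "\<lambda>(U, V). U \<inter> V"
      and i = "\<lambda>W. (W \<union> (Domain \<nu> - Range \<mu>), W \<union> (Range \<mu> - Domain \<nu>))"])
  interpret composable Z \<mu> \<nu> by (rule c)
  note g1 = goodD[OF g(1)] and g2 = goodD[OF g(2)] and pm = pairs_of_matched[OF m]
  note gc = good_concat[OF g c m]
  {
    fix a assume "a \<in> A"
    then obtain U V where a: "a = (U, V)" "U \<in> fillings s \<mu> t" "V \<in> fillings t \<nu> u"
      "Range \<mu> \<union> U = Domain \<nu> \<union> V" by (auto simp: A_def)
    have d: "U \<inter> (Domain \<mu> \<union> Range \<mu>) = {}" "V \<inter> (Domain \<nu> \<union> Range \<nu>) = {}"
      using a unfolding fillings_def by blast+
    have "(U \<inter> V) \<union> (Domain \<nu> - Range \<mu>) = U" "(U \<inter> V) \<union> (Range \<mu> - Domain \<nu>) = V"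
      using a(4) d by blast+
    then show "(case case a of (U, V) \<Rightarrow> U \<inter> V of W \<Rightarrow> (W \<union> (Domain \<nu> - Range \<mu>), W \<union> (Range \<mu> - Domain \<nu>))) = a"
      using a(1) by simp
    have "Domain (concat_strands \<mu> \<nu>) \<union> (U \<inter> V) = Domain \<mu> \<union> U"
      "Range (concat_strands \<mu> \<nu>) \<union> (U \<inter> V) = Range \<nu> \<union> V"
      unfolding Domain_concat Range_concat using a(4) d by blast+
    moreover have "(U \<inter> V) \<inter> (Domain (concat_strands \<mu> \<nu>) \<union> Range (concat_strands \<mu> \<nu>)) = {}"
      unfolding Domain_concat Range_concat using d by blast
    ultimately have "U \<inter> V \<in> fillings s (concat_strands \<mu> \<nu>) u"
      using a unfolding fillings_def by simp
    then show "(case a of (U, V) \<Rightarrow> U \<inter> V) \<in> fillings s (concat_strands \<mu> \<nu>) u" using a(1) by simp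
    show "F (case a of (U, V) \<Rightarrow> U \<inter> V) = (case a of (U, V) \<Rightarrow> F (U \<inter> V))" using a(1) by simp
  }
  {
    fix W assume W: "W \<in> fillings s (concat_strands \<mu> \<nu>) u"
    have D: "pairs_of (Domain (concat_strands \<mu> \<nu>)) =
        pairs_of (Domain \<mu>) \<union> (pairs_of (Domain \<nu>) - pairs_of (Range \<mu>))"
      unfolding Domain_concat pairs_of_Un pm ..
    have W': "W \<subseteq> points Z" "W \<inter> (Domain (concat_strands \<mu> \<nu>) \<union> Range (concat_strands \<mu> \<nu>)) = {}"
      "one_per_pair W" "pairs_of W = s - (pairs_of (Domain \<mu>) \<union> (pairs_of (Domain \<nu>) - pairs_of (Range \<mu>)))"
      using W unfolding fillings_good[OF gc] D by auto
    have pW: "pairs_of W = t - pairs_of (Range \<mu>) - pairs_of (Domain \<nu>)" using W'(4) g1 g2 by blast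
    have both: "x \<notin> W" if "x \<in> Range \<mu>" "x \<in> Domain \<nu>" for x
    proof
      assume "x \<in> W"
      moreover have "x \<in> places Z" using interior_place[OF mov(2,1)] that by blast
      ultimately show False using that pW pairs_ofI by blast
    qed
    have WD: "W \<inter> (Domain \<mu> \<union> Range \<mu>) = {}" "W \<inter> (Domain \<nu> \<union> Range \<nu>) = {}"
      using both W'(2) unfolding Domain_concat Range_concat by blast+
    have pts: "Domain \<nu> \<subseteq> points Z" "Range \<mu> \<subseteq> points Z"
      using strand_diagram_points[OF moving_diagram[OF mov(1)]]
        strand_diagram_points[OF moving_diagram[OF mov(2)]] by blast+
    have "one_per_pair (W \<union> (Domain \<nu> - Range \<mu>))" "one_per_pair (W \<union> (Range \<mu> - Domain \<nu>))"
      by (rule one_per_pair_Un[OF W'(3)], blast intro: one_per_pair_subset g2 g1, use pm pW in blast)+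
    moreover have "pairs_of (W \<union> (Domain \<nu> - Range \<mu>)) = s - pairs_of (Domain \<mu>)"
      "pairs_of (W \<union> (Range \<mu> - Domain \<nu>)) = t - pairs_of (Domain \<nu>)"
      unfolding pairs_of_Un pm pW using g1 g2 by blast+
    moreover have "(W \<union> (Domain \<nu> - Range \<mu>)) \<inter> (Domain \<mu> \<union> Range \<mu>) = {}"
      "(W \<union> (Range \<mu> - Domain \<nu>)) \<inter> (Domain \<nu> \<union> Range \<nu>) = {}"
      using WD start_disj end_disj by blast+
    ultimately have "W \<union> (Domain \<nu> - Range \<mu>) \<in> fillings s \<mu> t" "W \<union> (Range \<mu> - Domain \<nu>) \<in> fillings t \<nu> u"
      unfolding fillings_good[OF g(1)] fillings_good[OF g(2)] using W'(1) pts by blast+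
    then show "(W \<union> (Domain \<nu> - Range \<mu>), W \<union> (Range \<mu> - Domain \<nu>)) \<in> A"
      unfolding A_def by blast
    show "(case (W \<union> (Domain \<nu> - Range \<mu>), W \<union> (Range \<mu> - Domain \<nu>)) of (U, V) \<Rightarrow> U \<inter> V) = W"
      using WD by auto
  }
qed

text \<open>
  Sums over pairs of terms collapse by \<open>strand_mul_fillings\<close>; if the strands match, the pairs
  of terms that fit together correspond to the terms of the concatenation.
\<close>

theorem diag_mul_diag:
  assumes g: "good s \<mu> t" "good t \<nu> u" and c: "composable Z \<mu> \<nu>"
  shows "diag Z s \<mu> t \<odot> diag Z t \<nu> u = (if matched \<mu> \<nu> then diag Z s (concat_strands \<mu> \<nu>) u else 0)"
proof -
  let ?A = "{(U, V). U \<in> fillings s \<mu> t \<and> V \<in> fillings t \<nu> u \<and> Range \<mu> \<union> U = Domain \<nu> \<union> V}"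
  let ?F = "\<lambda>W. strand_elt (concat_strands \<mu> \<nu> \<union> Id_on W)"
  have "diag Z s \<mu> t \<odot> diag Z t \<nu> u =
      (\<Sum>U\<in>fillings s \<mu> t. \<Sum>V\<in>fillings t \<nu> u. strand_mul (\<mu> \<union> Id_on U) (\<nu> \<union> Id_on V))"
    unfolding diag_eq by (simp only: mul_sum_left) (simp only: mul_sum_right mul_strand_elt)
  also have "\<dots> = (\<Sum>U\<in>fillings s \<mu> t. \<Sum>V\<in>fillings t \<nu> u.
      if Range \<mu> \<union> U = Domain \<nu> \<union> V then ?F (U \<inter> V) else 0)"
    using strand_mul_fillings[OF g c] by (intro sum.cong refl) blast
  also have "\<dots> = (\<Sum>x\<in>fillings s \<mu> t \<times> fillings t \<nu> u.
      if Range \<mu> \<union> fst x = Domain \<nu> \<union> snd x then ?F (fst x \<inter> snd x) else 0)"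
    by (simp add: sum.cartesian_product case_prod_beta)
  also have "\<dots> = (\<Sum>x\<in>{x \<in> fillings s \<mu> t \<times> fillings t \<nu> u. Range \<mu> \<union> fst x = Domain \<nu> \<union> snd x}.
      ?F (fst x \<inter> snd x))"
    by (rule sum.inter_filter[symmetric]) (simp add: finite_fillings)
  also have "\<dots> = (\<Sum>(U, V)\<in>?A. ?F (U \<inter> V))"
    by (rule sum.cong) (auto simp: case_prod_beta)
  finally have eq: "diag Z s \<mu> t \<odot> diag Z t \<nu> u = (\<Sum>(U, V)\<in>?A. ?F (U \<inter> V))" .
  show ?thesis
  proof (cases "matched \<mu> \<nu>")
    case True
    then show ?thesis unfolding eq using concat_fillings_bij[OF g c True, of ?F] by (simp add: diag_eq)
  next
    case False
    then obtain p q where pq: "p \<in> Range \<mu>" "q \<in> Domain \<nu>" "p \<in> places Z" "q \<in> places Z"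
      "pairing Z p = pairing Z q" "p \<noteq> q" unfolding matched_def by blast
    have e: "?A = {}"
    proof (rule ccontr)
      assume "?A \<noteq> {}"
      then obtain U V where a: "U \<in> fillings s \<mu> t" "Range \<mu> \<union> U = Domain \<nu> \<union> V" by blast
      then have "one_per_pair (Range \<mu> \<union> U)" by (simp add: fillings_def compatible_def)
      moreover have "q \<in> Range \<mu> \<union> U" using a pq by blast
      ultimately show False using one_per_pairD pq by blast
    qed
    show ?thesis unfolding eq e using False by simp
  qed
qed

end

section \<open>Crossings and the differential\<close>

definition split_at :: "'i strands \<Rightarrow> 'i point \<Rightarrow> 'i strands" where
  "split_at \<mu> p = {a \<in> \<mu>. \<not> covers a p} \<union>
     {(x, p) |x. \<exists>y. (x, y) \<in> \<mu> \<and> covers (x, y) p} \<union> {(p, y) |y. \<exists>x. (x, y) \<in> \<mu> \<and> covers (x, y) p}"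

definition join_at :: "'i strands \<Rightarrow> 'i point \<Rightarrow> 'i strands" where
  "join_at \<mu> p = {(x, y) \<in> \<mu>. x \<noteq> p \<and> y \<noteq> p} \<union> {(x, y). (x, p) \<in> \<mu> \<and> (p, y) \<in> \<mu>}"

lemma split_at_eq:
  assumes "thin \<mu>" "(x, y) \<in> \<mu>" "covers (x, y) p"
  shows "split_at \<mu> p = \<mu> - {(x, y)} \<union> {(x, p), (p, y)}"
proof -
  have "a \<in> \<mu> \<and> covers a p \<longleftrightarrow> a = (x, y)" for a
    using thinD[OF assms(1) _ assms(2) _ assms(3)] assms by blast
  then show ?thesis unfolding split_at_def by blast
qed

lemma join_at_eq:
  assumes "moving Z \<mu>" "(x, p) \<in> \<mu>" "(p, y) \<in> \<mu>"
  shows "join_at \<mu> p = \<mu> - {(x, p), (p, y)} \<union> {(x, y)}"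
proof -
  note sd = moving_diagram[OF assms(1)]
  have "(w, p) \<in> \<mu> \<longleftrightarrow> w = x" "(p, w) \<in> \<mu> \<longleftrightarrow> w = y" for w
    using assms strand_diagram_fun[OF sd] strand_diagram_inj[OF sd] by blast+
  then show ?thesis unfolding join_at_def by blast
qed

text \<open>A strand passing a place and its two halves cover the same steps.\<close>

lemma covers_split:
  "fst x = fst p \<Longrightarrow> fst p = fst y \<Longrightarrow> snd x < snd p \<Longrightarrow> snd p < snd y \<Longrightarrow>
    covers (x, y) z \<longleftrightarrow> covers (x, p) z \<or> covers (p, y) z"
  "fst x = fst p \<Longrightarrow> fst p = fst y \<Longrightarrow> snd x < snd p \<Longrightarrow> snd p < snd y \<Longrightarrow>
    \<not> (covers (x, p) z \<and> covers (p, y) z)"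
  by (auto simp: covers_iff)

text \<open>A strand which runs past \<open>p\<close>, to be broken there by \<open>split_at\<close>.\<close>

locale passing =
  fixes Z :: "'i arc_diagram" and \<mu> :: "'i strands" and x y p :: "'i point"
  assumes mov: "moving Z \<mu>" and thin: "thin \<mu>" and xy: "(x, y) \<in> \<mu>"
    and less: "fst x = fst p" "fst p = fst y" "snd x < snd p" "snd p < snd y"
    and pt: "p \<in> points Z"
begin

lemma cov_p: "covers (x, y) p"
  using less by (simp add: covers_iff)

lemma split_eq: "split_at \<mu> p = \<mu> - {(x, y)} \<union> {(x, p), (p, y)}"
  by (rule split_at_eq[OF thin xy cov_p])

lemma not_end: "p \<notin> Domain \<mu>" "p \<notin> Range \<mu>"
proof -
  show "p \<notin> Domain \<mu>"
  proof
    assume "p \<in> Domain \<mu>"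
    then obtain w where "(p, w) \<in> \<mu>" by blast
    then have "(p, w) = (x, y)"
      using thinD[OF thin _ xy _ cov_p] moving_cov_start[OF mov] by blast
    then show False using less by simp
  qed
  show "p \<notin> Range \<mu>"
  proof
    assume "p \<in> Range \<mu>"
    then obtain w where w: "(w, p) \<in> \<mu>" by blast
    have "covers (x, y) (step_before p)" using less by (auto simp: covers_iff step_before_def)
    then have "(w, p) = (x, y)"
      using thinD[OF thin w xy] moving_cov_end[OF mov w] by blast
    then show False using less by simp
  qed
qed

lemma Domain_split: "Domain (split_at \<mu> p) = insert p (Domain \<mu>)"
  unfolding split_eq using xy strand_diagram_fun[OF moving_diagram[OF mov]] by blast

lemma Range_split: "Range (split_at \<mu> p) = insert p (Range \<mu>)"
  unfolding split_eq using xy strand_diagram_inj[OF moving_diagram[OF mov]] by blast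

lemma moving_split: "moving Z (split_at \<mu> p)"
proof -
  note sd = moving_diagram[OF mov]
  note f = strand_diagram_fun[OF sd] and i = strand_diagram_inj[OF sd]
  have "single_valued (split_at \<mu> p)"
    unfolding split_eq using f not_end xy by (intro single_valuedI) blast
  moreover have "single_valued ((split_at \<mu> p)\<inverse>)"
    unfolding split_eq using i not_end xy by (intro single_valuedI) blast
  moreover have "split_at \<mu> p \<subseteq> points Z \<times> points Z"
    unfolding split_eq using strand_diagram_points[OF sd xy] sd pt by (auto simp: strand_diagram_def)
  moreover have l: "fst u = fst v \<and> snd u < snd v" if "(u, v) \<in> split_at \<mu> p" for u v
  proof -
    have "(u, v) \<in> \<mu> \<or> (u, v) = (x, p) \<or> (u, v) = (p, y)" using that unfolding split_eq by blast
    then show ?thesis using less moving_less[OF mov, of u v] by auto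
  qed
  moreover have "\<forall>(u, v)\<in>split_at \<mu> p. pt_le u v"
    using l by (auto simp: pt_le_def dest!: l)
  moreover have "(u, u) \<notin> split_at \<mu> p" for u using l[of u u] by blast
  ultimately show ?thesis by (simp add: moving_def strand_diagram_def)
qed

lemma cov_split: "cov (split_at \<mu> p) = cov \<mu>"
proof
  fix z
  show "cov (split_at \<mu> p) z = cov \<mu> z"
    unfolding cov_def split_eq using covers_split(1)[OF less, of z] xy by blast
qed

lemma thin_split: "thin (split_at \<mu> p)"
  unfolding thin_def
proof (intro ballI allI impI)
  fix a b z assume a: "a \<in> split_at \<mu> p" and b: "b \<in> split_at \<mu> p" and ab: "covers a z \<and> covers b z"
  have *: "c = (x, p) \<or> c = (p, y) \<or> (c \<in> \<mu> \<and> c \<noteq> (x, y))" if "c \<in> split_at \<mu> p" for c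
    using that unfolding split_eq by blast
  show "a = b"
  proof (cases "covers (x, y) z")
    case True
    then have "a = (x, p) \<or> a = (p, y)" "b = (x, p) \<or> b = (p, y)"
      using *[OF a] *[OF b] ab thinD[OF thin _ xy _ True] by blast+
    then show ?thesis using ab covers_split(2)[OF less, of z] by blast
  next
    case False
    then have "a \<in> \<mu>" "b \<in> \<mu>" using *[OF a] *[OF b] ab covers_split(1)[OF less, of z] by blast+
    then show ?thesis using thinD[OF thin] ab by blast
  qed
qed

end

text \<open>
  Two strands meeting at \<open>p\<close>, to be joined by \<open>join_at\<close>, which undoes
  \<open>split_at\<close>.
\<close>

locale breaking =
  fixes Z :: "'i arc_diagram" and \<mu> :: "'i strands" and x y p :: "'i point"
  assumes mov: "moving Z \<mu>" and thin: "thin \<mu>" and xp: "(x, p) \<in> \<mu>" and py: "(p, y) \<in> \<mu>"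
begin

lemma less: "fst x = fst p" "fst p = fst y" "snd x < snd p" "snd p < snd y"
  using moving_less[OF mov xp] moving_less[OF mov py] by auto

lemma join_eq: "join_at \<mu> p = \<mu> - {(x, p), (p, y)} \<union> {(x, y)}"
  by (rule join_at_eq[OF mov xp py])

lemma ends: "(w, p) \<in> \<mu> \<Longrightarrow> w = x" "(p, w) \<in> \<mu> \<Longrightarrow> w = y" "(x, w) \<in> \<mu> \<Longrightarrow> w = p" "(w, y) \<in> \<mu> \<Longrightarrow> w = p"
  using xp py strand_diagram_fun[OF moving_diagram[OF mov]] strand_diagram_inj[OF moving_diagram[OF mov]]
  by blast+

lemma distinct: "x \<noteq> p" "p \<noteq> y" "x \<noteq> y"
  using less by auto

lemma Domain_join: "Domain (join_at \<mu> p) = Domain \<mu> - {p}"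
  unfolding join_eq using xp py ends distinct by blast

lemma Range_join: "Range (join_at \<mu> p) = Range \<mu> - {p}"
  unfolding join_eq using xp py ends distinct by blast

lemma moving_join: "moving Z (join_at \<mu> p)"
proof -
  note sd = moving_diagram[OF mov]
  note f = strand_diagram_fun[OF sd] and i = strand_diagram_inj[OF sd]
  have "single_valued (join_at \<mu> p)"
    unfolding join_eq using f ends by (intro single_valuedI) blast
  moreover have "single_valued ((join_at \<mu> p)\<inverse>)"
    unfolding join_eq using i ends by (intro single_valuedI) blast
  moreover have "join_at \<mu> p \<subseteq> points Z \<times> points Z"
    unfolding join_eq using strand_diagram_points[OF sd xp] strand_diagram_points[OF sd py] sd
    by (auto simp: strand_diagram_def)
  moreover have l: "fst u = fst v \<and> snd u < snd v" if "(u, v) \<in> join_at \<mu> p" for u v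
  proof -
    have "(u, v) \<in> \<mu> \<or> (u, v) = (x, y)" using that unfolding join_eq by blast
    then show ?thesis using less moving_less[OF mov, of u v] by auto
  qed
  moreover have "\<forall>(u, v)\<in>join_at \<mu> p. pt_le u v"
    using l by (auto simp: pt_le_def dest!: l)
  moreover have "(u, u) \<notin> join_at \<mu> p" for u using l[of u u] by blast
  ultimately show ?thesis by (simp add: moving_def strand_diagram_def)
qed

lemma cov_join: "cov (join_at \<mu> p) = cov \<mu>"
proof
  fix z
  show "cov (join_at \<mu> p) z = cov \<mu> z"
    unfolding cov_def join_eq using covers_split(1)[OF less, of z] xp py by blast
qed

lemma thin_join: "thin (join_at \<mu> p)"
  unfolding thin_def
proof (intro ballI allI impI)
  fix a b z assume a: "a \<in> join_at \<mu> p" and b: "b \<in> join_at \<mu> p" and ab: "covers a z \<and> covers b z"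
  have *: "c = (x, y) \<or> (c \<in> \<mu> \<and> c \<noteq> (x, p) \<and> c \<noteq> (p, y))" if "c \<in> join_at \<mu> p" for c
    using that unfolding join_eq by blast
  show "a = b"
  proof (cases "covers (x, y) z")
    case True
    then have "covers (x, p) z \<or> covers (p, y) z" using covers_split(1)[OF less, of z] by blast
    then have "a = (x, y)" "b = (x, y)"
      using *[OF a] *[OF b] ab thinD[OF thin _ xp] thinD[OF thin _ py] by blast+
    then show ?thesis by simp
  next
    case False
    then have "a \<in> \<mu>" "b \<in> \<mu>" using *[OF a] *[OF b] ab by blast+
    then show ?thesis using thinD[OF thin] ab by blast
  qed
qed

end

context arc
begin

lemma fillings_disjoint: "U \<in> fillings s \<mu> t \<Longrightarrow> p \<in> U \<Longrightarrow> p \<notin> Domain \<mu> \<and> p \<notin> Range \<mu> \<and> p \<in> points Z"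
  using fillings_points unfolding fillings_def by blast

text \<open>Every crossing of a viable diagram lies at a horizontal strand.\<close>

lemma crossings_filling:
  assumes g: "good s \<mu> t" and th: "thin \<mu>" and U: "U \<in> fillings s \<mu> t"
  shows "crossings (\<mu> \<union> Id_on U) = {((x, y), (p, p)) |x y p. (x, y) \<in> \<mu> \<and> p \<in> U \<and> covers (x, y) p}"
    (is "?L = ?R")
proof (intro equalityI subsetI)
  note m = goodD(3)[OF g]
  fix c assume "c \<in> ?L"
  then obtain x y x' y' where c: "c = ((x, y), (x', y'))" and a: "(x, y) \<in> \<mu> \<union> Id_on U"
    and b: "(x', y') \<in> \<mu> \<union> Id_on U" and l: "pt_less x x'" "pt_less y' y"
    unfolding crossings_def by blast
  have le: "fst x' = fst y' \<and> snd x' \<le> snd y'" using b moving_less[OF m, of x' y'] by auto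
  then have "x \<noteq> y" using l by (auto simp: pt_less_def)
  then have xy: "(x, y) \<in> \<mu>" using a by blast
  have cv: "covers (x, y) x'" using l le by (auto simp: pt_less_def covers_iff)
  have "(x', y') \<notin> \<mu>"
  proof
    assume "(x', y') \<in> \<mu>"
    then have "(x', y') = (x, y)" using thinD[OF th _ xy _ cv] moving_cov_start[OF m] by blast
    then show False using l by (simp add: pt_less_def)
  qed
  then have "x' = y'" "x' \<in> U" using b by auto
  then show "c \<in> ?R" using c xy cv by blast
next
  fix c assume "c \<in> ?R"
  then obtain x y p where c: "c = ((x, y), (p, p))" "(x, y) \<in> \<mu>" "p \<in> U" "covers (x, y) p" by blast
  have "x \<noteq> p" using c fillings_disjoint[OF U] by blast
  then have "pt_less x p" "pt_less p y" using c(4)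
    by (auto simp: covers_iff pt_less_def prod_eq_iff)
  then show "c \<in> ?L" using c unfolding crossings_def by blast
qed

lemma crossings_filling_image:
  assumes g: "good s \<mu> t" and th: "thin \<mu>" and U: "U \<in> fillings s \<mu> t"
  shows "crossings (\<mu> \<union> Id_on U) = (\<lambda>p. (THE a. a \<in> \<mu> \<and> covers a p, (p, p))) ` {p \<in> U. cov \<mu> p}"
proof -
  have the: "(THE a. a \<in> \<mu> \<and> covers a p) = a" if "a \<in> \<mu>" "covers a p" for a p
    using that thinD[OF th] by (intro the_equality) blast+
  show ?thesis unfolding crossings_filling[OF assms]
  proof (intro equalityI subsetI)
    fix c assume "c \<in> {((x, y), (p, p)) |x y p. (x, y) \<in> \<mu> \<and> p \<in> U \<and> covers (x, y) p}"
    then obtain x y p where c: "c = ((x, y), (p, p))" "(x, y) \<in> \<mu>" "p \<in> U" "covers (x, y) p" by blast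
    have "c = (THE a. a \<in> \<mu> \<and> covers a p, (p, p))" using c the by simp
    moreover have "cov \<mu> p" using c unfolding cov_def by blast
    ultimately show "c \<in> (\<lambda>p. (THE a. a \<in> \<mu> \<and> covers a p, (p, p))) ` {p \<in> U. cov \<mu> p}"
      using c(3) by blast
  next
    fix c assume "c \<in> (\<lambda>p. (THE a. a \<in> \<mu> \<and> covers a p, (p, p))) ` {p \<in> U. cov \<mu> p}"
    then obtain p where p: "p \<in> U" "cov \<mu> p" "c = (THE a. a \<in> \<mu> \<and> covers a p, (p, p))" by blast
    then obtain x y where "(x, y) \<in> \<mu>" "covers (x, y) p" unfolding cov_def by (metis surj_pair)
    then show "c \<in> {((x, y), (p, p)) |x y p. (x, y) \<in> \<mu> \<and> p \<in> U \<and> covers (x, y) p}"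
      using p the by blast
  qed
qed

lemma inv_count_filling:
  assumes "good s \<mu> t" "thin \<mu>" "U \<in> fillings s \<mu> t"
  shows "inv_count (\<mu> \<union> Id_on U) = card {p \<in> U. cov \<mu> p}"
  unfolding inv_count_def crossings_filling_image[OF assms] by (intro card_image inj_onI) auto

text \<open>The places where a horizontal strand would be crossed.\<close>

definition passed :: "'i strands \<Rightarrow> 'i point set" where
  "passed \<mu> = {p \<in> places Z. cov \<mu> p \<and> p \<notin> Domain \<mu>}"

lemma passingE:
  assumes "moving Z \<mu>" "thin \<mu>" "p \<in> points Z" "cov \<mu> p" "p \<notin> Domain \<mu>"
  obtains x y where "passing Z \<mu> x y p" "p \<in> places Z"
proof -
  obtain x y where xy: "(x, y) \<in> \<mu>" "covers (x, y) p" "pt_less x p" "pt_less p y"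
    using cov_pass[OF assms(1,2,4,5)] by blast
  then have "y \<in> points Z" using strand_diagram_points[OF moving_diagram[OF assms(1)]] by blast
  then have "p \<in> places Z" using xy(3,4) assms(3)
    by (cases p; cases y) (auto simp: points_def places_def pt_less_def)
  moreover have "passing Z \<mu> x y p"
    using assms xy by unfold_locales (auto simp: pt_less_def)
  ultimately show ?thesis using that by blast
qed

text \<open>Breaking a strand at \<open>p\<close> uses up the horizontal strand at \<open>p\<close>.\<close>

lemma fillings_split_iff:
  assumes "passing Z \<mu> x y p"
  shows "U' \<in> fillings s (split_at \<mu> p) t \<longleftrightarrow> p \<notin> U' \<and> insert p U' \<in> fillings s \<mu> t"
proof -
  interpret passing Z \<mu> x y p by (rule assms)
  have "insert p (Domain \<mu>) \<union> U' = Domain \<mu> \<union> insert p U'" "insert p (Range \<mu>) \<union> U' = Range \<mu> \<union> insert p U'"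
    by blast+
  moreover have "U' \<inter> (insert p (Domain \<mu>) \<union> insert p (Range \<mu>)) = {} \<longleftrightarrow>
      p \<notin> U' \<and> insert p U' \<inter> (Domain \<mu> \<union> Range \<mu>) = {}"
    using not_end by blast
  ultimately show ?thesis unfolding fillings_def Domain_split Range_split by auto
qed

lemma good_split:
  assumes g: "good s \<mu> t" and ps: "passing Z \<mu> x y p" and U: "U \<in> fillings s \<mu> t" "p \<in> U"
  shows "good s (split_at \<mu> p) t"
proof -
  interpret passing Z \<mu> x y p by (rule ps)
  have "U - {p} \<in> fillings s (split_at \<mu> p) t"
    unfolding fillings_split_iff[OF ps] using U by (simp add: insert_absorb)
  then have "ks (diag Z s (split_at \<mu> p) t) \<noteq> {}"
    unfolding ks_diag[OF moving_split] by blast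
  then have "diag Z s (split_at \<mu> p) t \<noteq> 0" by auto
  then show ?thesis using diag_nonzero_iff moving_split goodD[OF g] by blast
qed

text \<open>
  The crossings are those of a strand with a horizontal strand at some place \<open>p\<close>. Resolving
  such a crossing breaks the strand at \<open>p\<close>, and always removes exactly one crossing, as the
  covered steps do not change.
\<close>

lemma strand_diff_filling:
  assumes g: "good s \<mu> t" and th: "thin \<mu>" and U: "U \<in> fillings s \<mu> t"
  shows "strand_diff (\<mu> \<union> Id_on U) =
    (\<Sum>p\<in>{p \<in> passed \<mu>. p \<in> U}. strand_elt (split_at \<mu> p \<union> Id_on (U - {p})))"
proof -
  note m = goodD(3)[OF g]
  let ?c = "\<lambda>p. (THE a. a \<in> \<mu> \<and> covers a p, (p, p))"
  let ?\<phi> = "\<mu> \<union> Id_on U"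
  have finU: "finite U" using finite_subset[OF fillings_points[OF U] finite_points] .
  have pE: "\<exists>x y. passing Z \<mu> x y p \<and> p \<in> places Z" if "p \<in> U" "cov \<mu> p" for p
    using that passingE[OF m th _ that(2)] fillings_disjoint[OF U] by metis
  have set: "{p \<in> U. cov \<mu> p} = {p \<in> passed \<mu>. p \<in> U}"
    using pE fillings_disjoint[OF U] unfolding passed_def by blast
  have res: "resolve ?\<phi> (?c p) = split_at \<mu> p \<union> Id_on (U - {p}) \<and>
      inv_count (resolve ?\<phi> (?c p)) + 1 = inv_count ?\<phi>" if p: "p \<in> U" "cov \<mu> p" for p
  proof -
    obtain x y where ps: "passing Z \<mu> x y p" using pE[OF p] by blast
    interpret passing Z \<mu> x y p by (rule ps)
    have "(THE a. a \<in> \<mu> \<and> covers a p) = (x, y)"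
      using xy cov_p thinD[OF th] by (intro the_equality) blast+
    then have "resolve ?\<phi> (?c p) = ?\<phi> - {(x, y), (p, p)} \<union> {(x, p), (p, y)}" by (simp add: resolve_def)
    also have "\<dots> = split_at \<mu> p \<union> Id_on (U - {p})"
    proof -
      have "x \<noteq> y" "(p, p) \<notin> \<mu>" using less not_end by auto
      then show ?thesis unfolding split_eq using p(1) by blast
    qed
    finally have r: "resolve ?\<phi> (?c p) = split_at \<mu> p \<union> Id_on (U - {p})" .
    have U': "U - {p} \<in> fillings s (split_at \<mu> p) t"
      unfolding fillings_split_iff[OF ps] using U p by (simp add: insert_absorb)
    have "inv_count (resolve ?\<phi> (?c p)) = card {q \<in> U - {p}. cov \<mu> q}"
      unfolding r inv_count_filling[OF good_split[OF g ps U p(1)] thin_split U'] cov_split ..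
    also have "{q \<in> U - {p}. cov \<mu> q} = {q \<in> U. cov \<mu> q} - {p}" by blast
    also have "card ({q \<in> U. cov \<mu> q} - {p}) + 1 = card {q \<in> U. cov \<mu> q}"
      using card_Suc_Diff1[of "{q \<in> U. cov \<mu> q}" p] finU p by simp
    finally show ?thesis using r inv_count_filling[OF g th U] by simp
  qed
  have "{c \<in> crossings ?\<phi>. inv_count (resolve ?\<phi> c) + 1 = inv_count ?\<phi>} = ?c ` {p \<in> U. cov \<mu> p}"
  proof -
    have "\<forall>c\<in>?c ` {p \<in> U. cov \<mu> p}. inv_count (resolve ?\<phi> c) + 1 = inv_count ?\<phi>" using res by blast
    then show ?thesis unfolding crossings_filling_image[OF g th U] by blast
  qed
  then have "strand_diff ?\<phi> = (\<Sum>p\<in>{p \<in> U. cov \<mu> p}. strand_elt (resolve ?\<phi> (?c p)))"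
    unfolding strand_diff_def by (simp add: sum.reindex inj_on_def)
  also have "\<dots> = (\<Sum>p\<in>{p \<in> U. cov \<mu> p}. strand_elt (split_at \<mu> p \<union> Id_on (U - {p})))"
    using res by (intro sum.cong) auto
  finally show ?thesis unfolding set .
qed

text \<open>
  For fixed \<open>p\<close>, the terms with a horizontal strand at \<open>p\<close> turn into the terms
  of the diagram broken at \<open>p\<close>. If no term has such a strand then there is no such diagram,
  and the summand for \<open>p\<close> is zero.
\<close>

lemma diff_diag:
  assumes g: "good s \<mu> t" and th: "thin \<mu>"
  shows "diff (diag Z s \<mu> t) = (\<Sum>p\<in>passed \<mu>. diag Z s (split_at \<mu> p) t)"
proof -
  note m = goodD(3)[OF g]
  have fin: "finite (passed \<mu>)" using finite_places by (simp add: passed_def)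
  have "diff (diag Z s \<mu> t) = (\<Sum>U\<in>fillings s \<mu> t. strand_diff (\<mu> \<union> Id_on U))"
    unfolding diag_eq diff_sum by (simp add: diff_extend)
  also have "\<dots> = (\<Sum>U\<in>fillings s \<mu> t. \<Sum>p\<in>{p \<in> passed \<mu>. p \<in> U}. strand_elt (split_at \<mu> p \<union> Id_on (U - {p})))"
    using strand_diff_filling[OF g th] by (intro sum.cong) auto
  also have "\<dots> = (\<Sum>p\<in>passed \<mu>. \<Sum>U\<in>{U \<in> fillings s \<mu> t. p \<in> U}. strand_elt (split_at \<mu> p \<union> Id_on (U - {p})))"
    by (rule sum.swap_restrict[OF finite_fillings fin])
  also have "\<dots> = (\<Sum>p\<in>passed \<mu>. diag Z s (split_at \<mu> p) t)"
  proof (rule sum.cong[OF refl])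
    fix p assume p: "p \<in> passed \<mu>"
    then have p': "p \<in> points Z" "cov \<mu> p" "p \<notin> Domain \<mu>"
      using places_points unfolding passed_def by blast+
    obtain x y where ps: "passing Z \<mu> x y p" by (rule passingE[OF m th p'])
    show "(\<Sum>U\<in>{U \<in> fillings s \<mu> t. p \<in> U}. strand_elt (split_at \<mu> p \<union> Id_on (U - {p}))) =
        diag Z s (split_at \<mu> p) t"
      unfolding diag_eq
    proof (rule sum.reindex_bij_witness[where j = "\<lambda>U. U - {p}" and i = "insert p"])
      fix U assume "U \<in> {U \<in> fillings s \<mu> t. p \<in> U}"
      then have U: "U \<in> fillings s \<mu> t" "p \<in> U" by blast+
      then show "insert p (U - {p}) = U" by blast
      then show "U - {p} \<in> fillings s (split_at \<mu> p) t"
        unfolding fillings_split_iff[OF ps] using U(1) by simp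
    next
      fix W assume "W \<in> fillings s (split_at \<mu> p) t"
      then have W: "p \<notin> W" "insert p W \<in> fillings s \<mu> t" unfolding fillings_split_iff[OF ps] by blast+
      then show "insert p W - {p} = W" "insert p W \<in> {U \<in> fillings s \<mu> t. p \<in> U}" by blast+
    qed (rule refl)
  qed
  finally show ?thesis .
qed

lemma has_crossing_diag:
  assumes g: "good s \<mu> t" and th: "thin \<mu>"
  shows "has_crossing (diag Z s \<mu> t) \<longleftrightarrow> (\<exists>p\<in>passed \<mu>. pairing Z p \<in> s - pairs_of (Domain \<mu>))"
proof
  assume "has_crossing (diag Z s \<mu> t)"
  then obtain U where U: "U \<in> fillings s \<mu> t" "crossings (\<mu> \<union> Id_on U) \<noteq> {}"
    unfolding has_crossing_def ks_diag[OF goodD(3)[OF g]] by blast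
  then obtain p where p: "p \<in> U" "cov \<mu> p" using crossings_filling_image[OF g th U(1)] by blast
  then have "p \<in> places Z" "p \<notin> Domain \<mu>"
    using passingE[OF goodD(3)[OF g] th _ p(2)] fillings_disjoint[OF U(1) p(1)] by blast+
  moreover have "pairing Z p \<in> s - pairs_of (Domain \<mu>)"
    using U(1) p(1) pairs_ofI[OF p(1)] \<open>p \<in> places Z\<close> unfolding fillings_good[OF g] by blast
  ultimately show "\<exists>p\<in>passed \<mu>. pairing Z p \<in> s - pairs_of (Domain \<mu>)" using p unfolding passed_def by blast
next
  assume "\<exists>p\<in>passed \<mu>. pairing Z p \<in> s - pairs_of (Domain \<mu>)"
  then obtain p where p: "p \<in> places Z" "cov \<mu> p" "pairing Z p \<in> s - pairs_of (Domain \<mu>)"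
    unfolding passed_def by blast
  have "pairs_of {p} = {pairing Z p}" using p(1) by (auto simp: pairs_of_def)
  then obtain U where U: "U \<in> fillings s \<mu> t" "p \<in> U"
    using filling_exists[OF g, of "{p}"] p by (auto simp: one_per_pair_def)
  then have "crossings (\<mu> \<union> Id_on U) \<noteq> {}" using crossings_filling_image[OF g th U(1)] p by blast
  then show "has_crossing (diag Z s \<mu> t)"
    unfolding has_crossing_def ks_diag[OF goodD(3)[OF g]] using U(1) by blast
qed

end

section \<open>Viable H-data\<close>

text \<open>
  Diagrams with the same viable H-data are distinguished by their nonhorizontal strands. So this set tells
  which diagrams occur in an element with given H-data.
\<close>

definition support :: "'i alg \<Rightarrow> 'i strands set" where
  "support a = nonhorizontal ` ks a"

text \<open>
  The linear extension of a map given on diagrams with fixed viable H-data, see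
  \<open>extend_strands_dia\<close> and \<open>extend_strands_add\<close>.
\<close>

definition extend_strands :: "('i strands \<Rightarrow> 'j alg) \<Rightarrow> 'i alg \<Rightarrow> 'j alg" where
  "extend_strands g a = (\<Sum>\<mu>\<in>support a. g \<mu>)"

context arc
begin

text \<open>
  The nonhorizontal strands of the diagrams with H-data \<open>d\<close>, provided that \<open>d\<close>
  is viable.
\<close>

definition dgs :: "'i hdata \<Rightarrow> 'i strands set" where
  "dgs d = {\<mu>. good (fst (snd d)) \<mu> (snd (snd d)) \<and> thin \<mu> \<and> strand_chain \<mu> = fst d}"

definition dia :: "'i hdata \<Rightarrow> 'i strands \<Rightarrow> 'i alg" where
  "dia d \<mu> = diag Z (fst (snd d)) \<mu> (snd (snd d))"

text \<open>
  The occupied places of the on-on once occupied pairs, at each of which a diagram is either crossed or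
  broken.
\<close>

definition twisted_places :: "'i hdata \<Rightarrow> 'i point set" where
  "twisted_places d = {p \<in> places Z. once_occupied_at Z p d \<and> on_on (pairing Z p) d}"

definition undoubled :: "'i hdata \<Rightarrow> bool" where
  "undoubled d \<longleftrightarrow> (\<forall>P\<in>pairs Z. \<not> (on_on P d \<and> doubly_occupied Z P d))"

lemma dgsD:
  assumes "\<mu> \<in> dgs d"
  shows "good (fst (snd d)) \<mu> (snd (snd d))" "thin \<mu>" "moving Z \<mu>" "fst d = (\<lambda>z. of_bool (cov \<mu> z))"
proof -
  show g: "good (fst (snd d)) \<mu> (snd (snd d))" and th: "thin \<mu>" using assms by (auto simp: dgs_def)
  show m: "moving Z \<mu>" using goodD[OF g] by blast
  show "fst d = (\<lambda>z. of_bool (cov \<mu> z))"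
    using strand_chain_thin[OF finite_strands[OF moving_diagram[OF m]] th] assms by (simp add: dgs_def)
qed

lemma dgs_cov: "\<mu> \<in> dgs d \<Longrightarrow> fst d z = 1 \<longleftrightarrow> cov \<mu> z"
  using dgsD(4)[of \<mu> d] by simp

lemma dgs_01: "\<mu> \<in> dgs d \<Longrightarrow> fst d z = 0 \<or> fst d z = 1"
  using dgsD(4)[of \<mu> d] by simp

lemma dgs_viable: "\<mu> \<in> dgs d \<Longrightarrow> viable_chain Z (fst d)"
  using dgs_01 by (auto simp: viable_chain_def)

lemma dgsI:
  assumes "good (fst (snd d)) \<mu> (snd (snd d))" "thin \<mu>" "\<And>z. fst d z = of_bool (cov \<mu> z)"
  shows "\<mu> \<in> dgs d"
proof -
  have "fst d = (\<lambda>z. of_bool (cov \<mu> z))" using assms(3) by (rule ext)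
  then show ?thesis
    using strand_chain_thin[OF finite_strands[OF moving_diagram[OF goodD(3)[OF assms(1)]]] assms(2)] assms
    by (simp add: dgs_def)
qed

lemma dgs_Domain: "\<mu> \<in> dgs d \<Longrightarrow> p \<in> Domain \<mu> \<Longrightarrow> fst d p = 1"
  using moving_Domain_cov dgsD(3) dgs_cov by metis

lemma dgs_Range: "\<mu> \<in> dgs d \<Longrightarrow> p \<in> Range \<mu> \<Longrightarrow> fst d (step_before p) = 1"
  using moving_Range_cov dgsD(3) dgs_cov by metis

lemma dgs_start:
  assumes "\<mu> \<in> dgs d" "fst d p = 1" "p \<notin> Domain \<mu>"
  shows "fst d (step_before p) = 1" "p \<notin> Range \<mu>"
proof -
  have "cov \<mu> p" using assms dgs_cov by blast
  then show "fst d (step_before p) = 1" "p \<notin> Range \<mu>"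
    using cov_pass[OF dgsD(3,2)[OF assms(1)] _ assms(3)] dgs_cov[OF assms(1)] by blast+
qed

lemma dgs_end:
  assumes "\<mu> \<in> dgs d" "p \<in> places Z" "fst d (step_before p) = 1" "p \<notin> Range \<mu>"
  shows "fst d p = 1" "p \<notin> Domain \<mu>"
proof -
  have "cov \<mu> (step_before p)" using assms dgs_cov by blast
  then show "fst d p = 1" "p \<notin> Domain \<mu>"
    using cov_pass_before[OF dgsD(3,2)[OF assms(1)] place_pos[OF assms(2)] _ assms(4)]
      dgs_cov[OF assms(1)] by blast+
qed

lemma dgs_Domain_on: "\<mu> \<in> dgs d \<Longrightarrow> p \<in> Domain \<mu> \<Longrightarrow> p \<in> places Z \<Longrightarrow> pairing Z p \<in> fst (snd d)"
  using goodD(6)[OF dgsD(1)] pairs_ofI by blast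

lemma dgs_Range_on: "\<mu> \<in> dgs d \<Longrightarrow> p \<in> Range \<mu> \<Longrightarrow> p \<in> places Z \<Longrightarrow> pairing Z p \<in> snd (snd d)"
  using goodD(7)[OF dgsD(1)] pairs_ofI by blast

lemma dgs_Domain_inj:
  "\<mu> \<in> dgs d \<Longrightarrow> p \<in> Domain \<mu> \<Longrightarrow> q \<in> Domain \<mu> \<Longrightarrow> p \<in> places Z \<Longrightarrow> q \<in> places Z \<Longrightarrow> pairing Z p = pairing Z q \<Longrightarrow> p = q"
  using one_per_pairD[OF goodD(4)[OF dgsD(1)]] .

lemma dgs_Range_inj:
  "\<mu> \<in> dgs d \<Longrightarrow> p \<in> Range \<mu> \<Longrightarrow> q \<in> Range \<mu> \<Longrightarrow> p \<in> places Z \<Longrightarrow> q \<in> places Z \<Longrightarrow> pairing Z p = pairing Z q \<Longrightarrow> p = q"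
  using one_per_pairD[OF goodD(5)[OF dgsD(1)]] .

lemma not_pairs_of_iff: "P \<notin> pairs_of A \<longleftrightarrow> (\<forall>p\<in>fibre Z P. p \<notin> A)"
  unfolding pairs_of_def fibre_def by blast

text \<open>A pair at which no strand starts is on at the start just if it is on at the end and no strand ends there.\<close>

lemma dgs_horizontal:
  assumes "\<mu> \<in> dgs d"
  shows "P \<in> fst (snd d) \<and> (\<forall>p\<in>fibre Z P. p \<notin> Domain \<mu>) \<longleftrightarrow>
    P \<in> snd (snd d) \<and> (\<forall>p\<in>fibre Z P. p \<notin> Range \<mu>)"
  using goodD(8)[OF dgsD(1)[OF assms]] unfolding not_pairs_of_iff[symmetric] by blast

lemma broken_place: "\<mu> \<in> dgs d \<Longrightarrow> p \<in> broken \<mu> \<Longrightarrow> p \<in> places Z"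
  using interior_place[OF dgsD(3) dgsD(3)] unfolding broken_def by blast

text \<open>Diagrams with given H-data cover the same steps, so \<open>thin_unique\<close> applies.\<close>

lemma dgs_unique:
  assumes "\<mu> \<in> dgs d" "\<nu> \<in> dgs d" "broken \<mu> = broken \<nu>"
  shows "\<mu> = \<nu>"
proof (rule thin_unique)
  show "cov \<mu> = cov \<nu>" using dgs_cov[OF assms(1)] dgs_cov[OF assms(2)] by blast
qed (use assms dgsD in blast)+

lemma on_on_iff: "on_on P d \<longleftrightarrow> P \<in> fst (snd d) \<and> P \<in> snd (snd d)"
  by (simp add: on_on_def case_prod_beta)

lemma once_occupied_iff: "once_occupied_at Z p d \<longleftrightarrow> fst d (step_before p) = 1 \<and> fst d p = 1 \<and>
    fst d (step_before (twin Z p)) = 0 \<and> fst d (twin Z p) = 0"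
  by (simp add: once_occupied_at_def case_prod_beta)

lemma doubly_occupied_iff: "p \<in> places Z \<Longrightarrow> doubly_occupied Z (pairing Z p) d \<longleftrightarrow>
    fst d (step_before p) = 1 \<and> fst d p = 1 \<and> fst d (step_before (twin Z p)) = 1 \<and> fst d (twin Z p) = 1"
  using twin(4)[of p] by (auto simp: doubly_occupied_def case_prod_beta)

lemma once_occupied_if_undoubled:
  assumes "\<mu> \<in> dgs d" "undoubled d" "p \<in> places Z" "fst d p = 1" "fst d (step_before p) = 1"
    "on_on (pairing Z p) d" "twin Z p \<notin> Domain \<mu>" "twin Z p \<notin> Range \<mu>"
  shows "once_occupied_at Z p d"
proof -
  have "\<not> doubly_occupied Z (pairing Z p) d"
    using assms(2,3,6) pairing_in unfolding undoubled_def by blast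
  then have "fst d (step_before (twin Z p)) \<noteq> 1 \<or> fst d (twin Z p) \<noteq> 1"
    using assms(3,4,5) doubly_occupied_iff by blast
  moreover have "fst d (step_before (twin Z p)) = 1 \<longleftrightarrow> fst d (twin Z p) = 1"
    using dgs_start(1)[OF assms(1) _ assms(7)] dgs_end(1)[OF assms(1) twin(1)[OF assms(3)] _ assms(8)] by blast
  ultimately show ?thesis using assms(4,5) dgs_01[OF assms(1)] unfolding once_occupied_iff by metis
qed

text \<open>
  The pair of a broken place is on-on, since a strand begins and a strand ends at this place. As no pair
  is used twice, no strand begins or ends at the twin. So if a step at the twin was covered then a strand
  would pass the twin, and the pair would be doubly occupied.
\<close>

lemma broken_subset:
  assumes "\<mu> \<in> dgs d" "undoubled d"
  shows "broken \<mu> \<subseteq> twisted_places d"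
proof
  fix p assume b: "p \<in> broken \<mu>"
  then have D: "p \<in> Domain \<mu>" "p \<in> Range \<mu>" by (auto simp: broken_def)
  have p: "p \<in> places Z" using broken_place[OF assms(1) b] .
  have on: "on_on (pairing Z p) d"
    using dgs_Domain_on[OF assms(1) D(1) p] dgs_Range_on[OF assms(1) D(2) p] by (simp add: on_on_iff)
  have "twin Z p \<notin> Domain \<mu>" "twin Z p \<notin> Range \<mu>"
    using dgs_Domain_inj[OF assms(1) D(1)] dgs_Range_inj[OF assms(1) D(2)] twin[OF p] p by metis+
  then have "once_occupied_at Z p d"
    using once_occupied_if_undoubled[OF assms p _ _ on] dgs_Domain[OF assms(1) D(1)]
      dgs_Range[OF assms(1) D(2)] by blast
  then show "p \<in> twisted_places d" using p on by (simp add: twisted_places_def)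
qed

text \<open>So a diagram is either crossed or broken at each twisted place, and at no other place.\<close>

lemma passed_horizontal_iff:
  assumes "\<mu> \<in> dgs d" "undoubled d"
  shows "p \<in> passed \<mu> \<and> pairing Z p \<in> fst (snd d) - pairs_of (Domain \<mu>) \<longleftrightarrow> p \<in> twisted_places d - broken \<mu>"
proof
  assume l: "p \<in> passed \<mu> \<and> pairing Z p \<in> fst (snd d) - pairs_of (Domain \<mu>)"
  then have p: "p \<in> places Z" "fst d p = 1" "p \<notin> Domain \<mu>" unfolding passed_def using dgs_cov[OF assms(1)] by blast+
  then have p': "fst d (step_before p) = 1" "p \<notin> Range \<mu>" using dgs_start[OF assms(1)] by blast+
  have "pairing Z p \<in> snd (snd d) - pairs_of (Range \<mu>)" using l goodD(8)[OF dgsD(1)[OF assms(1)]] by blast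
  then have "on_on (pairing Z p) d" "twin Z p \<notin> Domain \<mu>" "twin Z p \<notin> Range \<mu>"
    using l twin(4)[OF p(1)] by (auto simp: on_on_iff not_pairs_of_iff)
  then show "p \<in> twisted_places d - broken \<mu>"
    using once_occupied_if_undoubled[OF assms p(1,2) p'(1)] p by (auto simp: twisted_places_def broken_def)
next
  assume l: "p \<in> twisted_places d - broken \<mu>"
  then have p: "p \<in> places Z" "fst d p = 1" "fst d (step_before p) = 1" "fst d (twin Z p) = 0"
    "pairing Z p \<in> fst (snd d)" "p \<notin> broken \<mu>"
    by (auto simp: twisted_places_def once_occupied_iff on_on_iff)
  have D: "p \<notin> Domain \<mu>" using dgs_end(2)[OF assms(1) p(1,3)] p(6) unfolding broken_def by blast
  moreover have "twin Z p \<notin> Domain \<mu>" using dgs_Domain[OF assms(1)] p(4) by fastforce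
  ultimately have "pairing Z p \<notin> pairs_of (Domain \<mu>)"
    using twin(4)[OF p(1)] by (auto simp: not_pairs_of_iff)
  then show "p \<in> passed \<mu> \<and> pairing Z p \<in> fst (snd d) - pairs_of (Domain \<mu>)"
    using D p dgs_cov[OF assms(1)] unfolding passed_def by blast
qed

lemma split_dgs:
  assumes "\<mu> \<in> dgs d" "undoubled d" "p \<in> twisted_places d - broken \<mu>"
  shows "split_at \<mu> p \<in> dgs d" "broken (split_at \<mu> p) = insert p (broken \<mu>)"
proof -
  have p: "p \<in> places Z" "cov \<mu> p" "p \<notin> Domain \<mu>" "pairing Z p \<in> fst (snd d) - pairs_of (Domain \<mu>)"
    using passed_horizontal_iff[OF assms(1,2)] assms(3) unfolding passed_def by blast+
  obtain x y where ps: "passing Z \<mu> x y p"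
    using passingE[OF dgsD(3,2)[OF assms(1)] _ p(2,3)] p(1) places_points by blast
  interpret passing Z \<mu> x y p by (rule ps)
  note g = dgsD(1)[OF assms(1)]
  have "pairs_of {p} = {pairing Z p}" using p(1) by (auto simp: pairs_of_def)
  then obtain U where U: "U \<in> fillings (fst (snd d)) \<mu> (snd (snd d))" "p \<in> U"
    using filling_exists[OF g, of "{p}"] p by (auto simp: one_per_pair_def)
  show "split_at \<mu> p \<in> dgs d"
  proof (rule dgsI)
    show "good (fst (snd d)) (split_at \<mu> p) (snd (snd d))" by (rule good_split[OF g ps U])
    show "fst d z = of_bool (cov (split_at \<mu> p) z)" for z unfolding cov_split using dgsD(4)[OF assms(1)] by simp
  qed (rule thin_split)
  show "broken (split_at \<mu> p) = insert p (broken \<mu>)"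
    unfolding broken_def Domain_split Range_split by blast
qed

lemma join_dgs:
  assumes "\<mu> \<in> dgs d" "p \<in> broken \<mu>"
  shows "join_at \<mu> p \<in> dgs d" "broken (join_at \<mu> p) = broken \<mu> - {p}"
proof -
  obtain x y where xy: "(x, p) \<in> \<mu>" "(p, y) \<in> \<mu>" using assms(2) unfolding broken_def by blast
  interpret breaking Z \<mu> x y p using dgsD[OF assms(1)] xy by unfold_locales
  note g = dgsD(1)[OF assms(1)]
  have p: "p \<in> places Z" by (rule broken_place[OF assms])
  have pp: "pairs_of {p} = {pairing Z p}" using p by (auto simp: pairs_of_def)
  have D: "pairs_of (Domain (join_at \<mu> p)) = pairs_of (Domain \<mu>) - {pairing Z p}"
    unfolding Domain_join pp[symmetric]
    using one_per_pairD[OF goodD(4)[OF g]] assms(2) unfolding broken_def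
    by (intro pairs_of_Diff) blast
  have R: "pairs_of (Range (join_at \<mu> p)) = pairs_of (Range \<mu>) - {pairing Z p}"
    unfolding Range_join pp[symmetric]
    using one_per_pairD[OF goodD(5)[OF g]] assms(2) unfolding broken_def
    by (intro pairs_of_Diff) blast
  have on: "pairing Z p \<in> fst (snd d)" "pairing Z p \<in> snd (snd d)"
    using dgs_Domain_on[OF assms(1) _ p] dgs_Range_on[OF assms(1) _ p] assms(2) unfolding broken_def by blast+
  show "join_at \<mu> p \<in> dgs d"
  proof (rule dgsI)
    show "good (fst (snd d)) (join_at \<mu> p) (snd (snd d))"
      unfolding good_def D R
    proof (intro conjI)
      show "one_per_pair (Domain (join_at \<mu> p))" "one_per_pair (Range (join_at \<mu> p))"
        unfolding Domain_join Range_join using one_per_pair_subset goodD(4,5)[OF g] by blast+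
      show "fst (snd d) - (pairs_of (Domain \<mu>) - {pairing Z p}) = snd (snd d) - (pairs_of (Range \<mu>) - {pairing Z p})"
        using goodD(8)[OF g] on by blast
    qed (use goodD[OF g] moving_join in blast)+
    show "fst d z = of_bool (cov (join_at \<mu> p) z)" for z unfolding cov_join using dgsD(4)[OF assms(1)] by simp
  qed (rule thin_join)
  show "broken (join_at \<mu> p) = broken \<mu> - {p}"
    unfolding broken_def Domain_join Range_join by blast
qed

lemma finite_twisted_places: "finite (twisted_places d)"
  using finite_places by (simp add: twisted_places_def)

text \<open>
  Identifying a diagram with its set of broken places, the differential is the sum of all ways to enlarge
  this set by one element.
\<close>

lemma diff_dia:
  assumes "\<mu> \<in> dgs d" "undoubled d"
  shows "diff (dia d \<mu>) = (\<Sum>p\<in>twisted_places d - broken \<mu>. dia d (split_at \<mu> p))"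
proof -
  have "diff (dia d \<mu>) = (\<Sum>p\<in>passed \<mu>. dia d (split_at \<mu> p))"
    unfolding dia_def by (rule diff_diag[OF dgsD(1,2)[OF assms(1)]])
  also have "\<dots> = (\<Sum>p\<in>twisted_places d - broken \<mu>. dia d (split_at \<mu> p))"
  proof (rule sum.mono_neutral_right)
    show "finite (passed \<mu>)" using finite_places by (simp add: passed_def)
    show "twisted_places d - broken \<mu> \<subseteq> passed \<mu>" using passed_horizontal_iff[OF assms] by blast
    show "\<forall>p\<in>passed \<mu> - (twisted_places d - broken \<mu>). dia d (split_at \<mu> p) = 0"
    proof
      fix p assume p: "p \<in> passed \<mu> - (twisted_places d - broken \<mu>)"
      then have p': "p \<in> places Z" "cov \<mu> p" "p \<notin> Domain \<mu>" unfolding passed_def by blast+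
      then obtain x y where ps: "passing Z \<mu> x y p"
        using passingE[OF dgsD(3,2)[OF assms(1)]] places_points by blast
      interpret passing Z \<mu> x y p by (rule ps)
      have "pairing Z p \<notin> fst (snd d) - pairs_of (Domain \<mu>)" using p passed_horizontal_iff[OF assms] by blast
      note free = this
      have "fillings (fst (snd d)) (split_at \<mu> p) (snd (snd d)) = {}"
      proof (rule ccontr)
        assume "fillings (fst (snd d)) (split_at \<mu> p) (snd (snd d)) \<noteq> {}"
        then obtain W where "insert p W \<in> fillings (fst (snd d)) \<mu> (snd (snd d))"
          using fillings_split_iff[OF ps] by blast
        then have "pairs_of (insert p W) = fst (snd d) - pairs_of (Domain \<mu>)"
          unfolding fillings_good[OF dgsD(1)[OF assms(1)]] by blast
        then show False using pairs_ofI[OF insertI1 p'(1), of W] free by blast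
      qed
      then show "dia d (split_at \<mu> p) = 0" by (simp add: dia_def diag_eq)
    qed
  qed
  finally show ?thesis .
qed

lemma has_crossing_dia:
  assumes "\<mu> \<in> dgs d" "undoubled d"
  shows "has_crossing (dia d \<mu>) \<longleftrightarrow> broken \<mu> \<noteq> twisted_places d"
  unfolding dia_def has_crossing_diag[OF dgsD(1,2)[OF assms(1)]]
  using passed_horizontal_iff[OF assms] broken_subset[OF assms] by blast

subsection \<open>Elements with given H-data\<close>

lemma finite_dgs: "finite (dgs d)"
  by (rule finite_subset[OF _ finite_strand_diagrams]) (auto dest: dgsD moving_diagram)

lemma presentation_dia: "\<mu> \<in> dgs d \<Longrightarrow> presentation Z (dia d \<mu>) = (fst (snd d), \<mu>, snd (snd d))"
  unfolding dia_def by (rule presentation_diag[OF dgsD(1)])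

lemma hdata_dia: "\<mu> \<in> dgs d \<Longrightarrow> hdata Z (dia d \<mu>) = d"
  unfolding dia_def using hdata_diag[OF dgsD(1)] by (simp add: dgs_def)

lemma diagram_dia: "\<mu> \<in> dgs d \<Longrightarrow> diagram Z (dia d \<mu>)"
  unfolding dia_def diagram_iff using dgsD(1) by blast

lemma viable_dia: "\<mu> \<in> dgs d \<Longrightarrow> viable_diagram Z (dia d \<mu>)"
  using diagram_dia hdata_dia dgs_viable by (simp add: viable_diagram_def)

lemma diagram_hdataE:
  assumes "diagram Z D" "viable_chain Z (fst (hdata Z D))"
  obtains \<mu> where "\<mu> \<in> dgs (hdata Z D)" "D = dia (hdata Z D) \<mu>"
proof -
  obtain s \<mu> t where g: "good s \<mu> t" "D = diag Z s \<mu> t" using assms(1) by (auto simp: diagram_iff)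
  have h: "hdata Z D = (strand_chain \<mu>, s, t)" using hdata_diag[OF g(1)] g(2) by simp
  have "thin \<mu>" using viable_iff_thin[OF moving_diagram[OF goodD(3)[OF g(1)]]] assms(2) h by simp
  then show ?thesis using that[of \<mu>] g h by (simp add: dgs_def dia_def)
qed

lemma ks_dia_disjoint:
  assumes "\<mu> \<in> dgs d" "\<phi> \<in> ks (dia d \<mu>)"
  shows "nonhorizontal \<phi> = \<mu>"
  using assms key_props(1)[OF dgsD(1)] unfolding dia_def by blast

lemma ks_dia_nonempty: "\<mu> \<in> dgs d \<Longrightarrow> ks (dia d \<mu>) \<noteq> {}"
  unfolding dia_def by (rule good_keys_nonempty[OF dgsD(1)])

lemma dia_nonzero: "\<mu> \<in> dgs d \<Longrightarrow> dia d \<mu> \<noteq> 0"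
  using ks_dia_nonempty by fastforce

lemma dia_inj: "\<mu> \<in> dgs d \<Longrightarrow> \<nu> \<in> dgs d \<Longrightarrow> dia d \<mu> = dia d \<nu> \<Longrightarrow> \<mu> = \<nu>"
  by (metis presentation_dia prod.inject)

lemma ks_sum_dia:
  assumes "K \<subseteq> dgs d"
  shows "ks (\<Sum>\<mu>\<in>K. dia d \<mu>) = (\<Union>\<mu>\<in>K. ks (dia d \<mu>))"
proof -
  have "finite K" using assms finite_dgs finite_subset by blast
  then show ?thesis using assms
  proof (induction K rule: finite_induct)
    case (insert \<mu> K)
    have "ks (dia d \<mu>) \<inter> ks (dia d \<nu>) = {}" if "\<nu> \<in> K" for \<nu>
    proof (rule ccontr)
      assume "ks (dia d \<mu>) \<inter> ks (dia d \<nu>) \<noteq> {}"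
      then obtain \<phi> where "\<phi> \<in> ks (dia d \<mu>)" "\<phi> \<in> ks (dia d \<nu>)" by blast
      then have "\<mu> = \<nu>" using ks_dia_disjoint insert.prems that by (metis insert_subset subsetD)
      then show False using that insert.hyps by blast
    qed
    then have "ks (dia d \<mu>) \<inter> (\<Union>\<nu>\<in>K. ks (dia d \<nu>)) = {}" by blast
    then show ?case using insert by (simp add: ks_add) blast
  qed simp
qed

lemma support_sum_dia:
  assumes "K \<subseteq> dgs d"
  shows "support (\<Sum>\<mu>\<in>K. dia d \<mu>) = K"
proof -
  have "nonhorizontal ` ks (dia d \<mu>) = {\<mu>}" if "\<mu> \<in> K" for \<mu>
    using ks_dia_disjoint[of \<mu> d] ks_dia_nonempty[of \<mu> d] that assms by blast
  then have "(\<Union>\<mu>\<in>K. nonhorizontal ` ks (dia d \<mu>)) = K" by simp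
  then show ?thesis unfolding support_def ks_sum_dia[OF assms] image_UN .
qed

text \<open>
  The diagrams with given H-data form a basis of their span, as their sets of terms are disjoint.
\<close>

lemma alg_part_eq:
  assumes "viable_chain Z (fst d)"
  shows "alg_part Z d = {\<Sum>\<mu>\<in>K. dia d \<mu> |K. K \<subseteq> dgs d}"
proof -
  have B: "{D. diagram Z D \<and> hdata Z D = d} = dia d ` dgs d"
  proof (intro equalityI subsetI)
    fix D assume "D \<in> {D. diagram Z D \<and> hdata Z D = d}"
    then have D: "diagram Z D" "hdata Z D = d" by blast+
    obtain \<mu> where "\<mu> \<in> dgs (hdata Z D)" "D = dia (hdata Z D) \<mu>"
      by (rule diagram_hdataE[OF D(1)]) (simp_all add: D(2) assms)
    then show "D \<in> dia d ` dgs d" unfolding D(2) by blast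
  next
    fix D assume "D \<in> dia d ` dgs d"
    then obtain \<mu> where "\<mu> \<in> dgs d" "D = dia d \<mu>" by blast
    then show "D \<in> {D. diagram Z D \<and> hdata Z D = d}" by (simp add: diagram_dia hdata_dia)
  qed
  have inj: "inj_on (dia d) (dgs d)" by (rule inj_onI) (rule dia_inj)
  show ?thesis
  proof (intro equalityI subsetI)
    fix a assume "a \<in> alg_part Z d"
    then obtain F where F: "finite F" "F \<subseteq> dia d ` dgs d" "a = (\<Sum>D\<in>F. D)"
      unfolding alg_part_def span2_def B by blast
    then obtain K where K: "K \<subseteq> dgs d" "F = dia d ` K" using subset_imageE by metis
    then have "a = (\<Sum>\<mu>\<in>K. dia d \<mu>)" using F(3) sum.reindex[OF inj_on_subset[OF inj K(1)]] by simp
    then show "a \<in> {\<Sum>\<mu>\<in>K. dia d \<mu> |K. K \<subseteq> dgs d}" using K by blast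
  next
    fix a assume "a \<in> {\<Sum>\<mu>\<in>K. dia d \<mu> |K. K \<subseteq> dgs d}"
    then obtain K where K: "K \<subseteq> dgs d" "a = (\<Sum>\<mu>\<in>K. dia d \<mu>)" by blast
    then have "a = (\<Sum>D\<in>dia d ` K. D)"
      using sum.reindex[OF inj_on_subset[OF inj K(1)], of "\<lambda>x. x"] by (simp add: comp_def)
    moreover have "finite (dia d ` K)" using K finite_dgs finite_subset by blast
    ultimately show "a \<in> alg_part Z d" using K(1) unfolding alg_part_def span2_def B by blast
  qed
qed

lemma alg_partE:
  assumes "viable_chain Z (fst d)" "a \<in> alg_part Z d"
  shows "support a \<subseteq> dgs d" "a = (\<Sum>\<mu>\<in>support a. dia d \<mu>)"
proof -
  obtain K where "K \<subseteq> dgs d" "a = (\<Sum>\<mu>\<in>K. dia d \<mu>)" using assms alg_part_eq by blast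
  then show "support a \<subseteq> dgs d" "a = (\<Sum>\<mu>\<in>support a. dia d \<mu>)" using support_sum_dia by auto
qed

lemma span2_0: "0 \<in> span2 B"
  unfolding span2_def by (rule CollectI, rule exI[of _ "{}"]) simp

lemma span2_add:
  assumes "a \<in> span2 B" "b \<in> span2 B"
  shows "a + b \<in> span2 B"
proof -
  obtain F G where F: "finite F" "F \<subseteq> B" "a = (\<Sum>x\<in>F. x)" and G: "finite G" "G \<subseteq> B" "b = (\<Sum>x\<in>G. x)"
    using assms unfolding span2_def by blast
  have "a + b = (\<Sum>x\<in>sym_diff F G. x)" using sum_sym_diff[OF F(1) G(1), of "\<lambda>x. x"] F G by simp
  moreover have "finite (sym_diff F G)" "sym_diff F G \<subseteq> B" using F G by auto
  ultimately show ?thesis unfolding span2_def by blast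
qed

lemma span2_sum: "(\<And>i. i \<in> I \<Longrightarrow> g i \<in> span2 B) \<Longrightarrow> (\<Sum>i\<in>I. g i) \<in> span2 B"
  by (induction I rule: infinite_finite_induct) (auto simp: span2_0 span2_add)

lemma span2_base: "b \<in> B \<Longrightarrow> b \<in> span2 B"
  unfolding span2_def by (rule CollectI, rule exI[of _ "{b}"]) simp

lemma span2_mono: "A \<subseteq> B \<Longrightarrow> span2 A \<subseteq> span2 B"
  unfolding span2_def by blast

lemmas alg_part_0 = span2_0[of "{D. diagram Z D \<and> hdata Z D = d}" for d, folded alg_part_def]
lemmas alg_part_add = span2_add[of _ "{D. diagram Z D \<and> hdata Z D = d}" for d, folded alg_part_def]
lemmas alg_part_sum = span2_sum[of _ _ "{D. diagram Z D \<and> hdata Z D = d}" for d, folded alg_part_def]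

lemma dia_alg_part: "\<mu> \<in> dgs d \<Longrightarrow> dia d \<mu> \<in> alg_part Z d"
  unfolding alg_part_def by (rule span2_base) (simp add: diagram_dia hdata_dia)

lemma alg_part_strand_alg: "alg_part Z d \<subseteq> strand_alg Z"
  unfolding alg_part_def strand_alg_def by (rule span2_mono) blast

lemma support_add:
  assumes "viable_chain Z (fst d)" "a \<in> alg_part Z d" "b \<in> alg_part Z d"
  shows "support (a + b) = sym_diff (support a) (support b)"
proof -
  note A = alg_partE[OF assms(1,2)] and B = alg_partE[OF assms(1,3)]
  have "a + b = (\<Sum>\<mu>\<in>sym_diff (support a) (support b). dia d \<mu>)"
    using sum_sym_diff[of "support a" "support b" "dia d"] A B finite_subset[OF _ finite_dgs] by metis
  moreover have "sym_diff (support a) (support b) \<subseteq> dgs d" using A B by blast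
  ultimately show ?thesis using support_sum_dia by simp
qed

lemma support_dia: "\<mu> \<in> dgs d \<Longrightarrow> support (dia d \<mu>) = {\<mu>}"
  using support_sum_dia[of "{\<mu>}" d] by simp

lemma extend_strands_dia: "\<mu> \<in> dgs d \<Longrightarrow> extend_strands g (dia d \<mu>) = g \<mu>"
  by (simp add: extend_strands_def support_dia)

lemma extend_strands_0 [simp]: "extend_strands g 0 = 0"
  by (simp add: extend_strands_def support_def)

lemma extend_strands_add:
  assumes "viable_chain Z (fst d)" "a \<in> alg_part Z d" "b \<in> alg_part Z d"
  shows "extend_strands g (a + b) = extend_strands g a + extend_strands g b"
  unfolding extend_strands_def support_add[OF assms]
  using alg_partE(1)[OF assms(1,2)] alg_partE(1)[OF assms(1,3)] finite_subset[OF _ finite_dgs]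
  by (intro sum_sym_diff) blast+

lemma extend_strands_sum:
  assumes "viable_chain Z (fst d)" "\<And>i. i \<in> I \<Longrightarrow> a i \<in> alg_part Z d"
  shows "extend_strands g (\<Sum>i\<in>I. a i) = (\<Sum>i\<in>I. extend_strands g (a i))"
  using assms(2)
proof (induction I rule: infinite_finite_induct)
  case (insert i I)
  then have "extend_strands g (a i + (\<Sum>i\<in>I. a i)) = extend_strands g (a i) + extend_strands g (\<Sum>i\<in>I. a i)"
    by (intro extend_strands_add[OF assms(1)] alg_part_sum) auto
  then show ?case using insert by simp
qed auto

section \<open>Homology of the summands\<close>

lemma diff_alg_part:
  assumes "viable_chain Z (fst d)" "undoubled d" "a \<in> alg_part Z d"
  shows "diff a \<in> alg_part Z d"
proof -
  have "diff a = (\<Sum>\<mu>\<in>support a. diff (dia d \<mu>))"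
    by (subst alg_partE(2)[OF assms(1,3)]) (rule diff_sum)
  also have "\<dots> \<in> alg_part Z d"
  proof (rule alg_part_sum)
    fix \<mu> assume "\<mu> \<in> support a"
    then have \<mu>: "\<mu> \<in> dgs d" using alg_partE(1)[OF assms(1,3)] by blast
    show "diff (dia d \<mu>) \<in> alg_part Z d"
      unfolding diff_dia[OF \<mu> assms(2)] using split_dgs(1)[OF \<mu> assms(2)] dia_alg_part
      by (intro alg_part_sum) blast
  qed
  finally show ?thesis .
qed

text \<open>
  Joining the strands broken at a fixed twisted place is a contracting homotopy of the summand.
\<close>

lemma twisted_acyclic:
  assumes v: "viable_chain Z (fst d)" and u: "undoubled d" and q: "q \<in> twisted_places d"
    and z: "z \<in> alg_part Z d" "diff z = 0"
  obtains w where "w \<in> alg_part Z d" "z = diff w"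
proof -
  define j where "j \<mu> = (if q \<in> broken \<mu> then dia d (join_at \<mu> q) else 0)" for \<mu>
  have jin: "j \<mu> \<in> alg_part Z d" if "\<mu> \<in> dgs d" for \<mu>
    using that join_dgs dia_alg_part alg_part_0 by (simp add: j_def)
  have homotopy: "diff (j \<mu>) + extend_strands j (diff (dia d \<mu>)) = dia d \<mu>" if \<mu>: "\<mu> \<in> dgs d" for \<mu>
  proof -
    let ?T = "twisted_places d - broken \<mu>"
    have fin: "finite ?T" using finite_twisted_places by simp
    have E: "extend_strands j (diff (dia d \<mu>)) = (\<Sum>p\<in>?T. j (split_at \<mu> p))"
    proof -
      have sp: "split_at \<mu> p \<in> dgs d" if "p \<in> ?T" for p using split_dgs(1)[OF \<mu> u that] .
      have "extend_strands j (diff (dia d \<mu>)) = (\<Sum>p\<in>?T. extend_strands j (dia d (split_at \<mu> p)))"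
        unfolding diff_dia[OF \<mu> u] by (rule extend_strands_sum[OF v dia_alg_part[OF sp]])
      also have "\<dots> = (\<Sum>p\<in>?T. j (split_at \<mu> p))"
        by (rule sum.cong[OF refl extend_strands_dia[OF sp]])
      finally show ?thesis .
    qed
    show ?thesis
    proof (cases "q \<in> broken \<mu>")
      case False
      have "j (split_at \<mu> p) = (if p = q then dia d \<mu> else 0)" if "p \<in> ?T" for p
      proof (cases "p = q")
        case True
        note sp = split_dgs[OF \<mu> u that]
        have "join_at (split_at \<mu> q) q = \<mu>"
        proof (rule dgs_unique[OF join_dgs(1)[OF sp(1)[unfolded True]] \<mu>])
          show "q \<in> broken (split_at \<mu> q)" using sp(2) True by simp
          then show "broken (join_at (split_at \<mu> q) q) = broken \<mu>"
            using join_dgs(2)[OF sp(1)[unfolded True]] sp(2) True False by simp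
        qed
        then show ?thesis using True sp by (simp add: j_def)
      qed (use split_dgs[OF \<mu> u that] False in \<open>simp add: j_def\<close>)
      then have "(\<Sum>p\<in>?T. j (split_at \<mu> p)) = dia d \<mu>" using q False fin by simp
      then show ?thesis unfolding E using False by (simp add: j_def)
    next
      case True
      note jn = join_dgs[OF \<mu> True]
      have T: "twisted_places d - broken (join_at \<mu> q) = insert q ?T" using jn(2) True q by auto
      have "split_at (join_at \<mu> q) q = \<mu>"
      proof (rule dgs_unique[OF _ \<mu>])
        have "q \<in> twisted_places d - broken (join_at \<mu> q)" using T by blast
        then show "split_at (join_at \<mu> q) q \<in> dgs d" "broken (split_at (join_at \<mu> q) q) = broken \<mu>"
          using split_dgs[OF jn(1) u] jn(2) True by auto
      qed
      moreover have "j (split_at \<mu> p) = dia d (split_at (join_at \<mu> q) p)" if p: "p \<in> ?T" for p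
      proof -
        note sp = split_dgs[OF \<mu> u p]
        have qs: "q \<in> broken (split_at \<mu> p)" using sp True by simp
        have ps: "p \<in> twisted_places d - broken (join_at \<mu> q)" using T p by blast
        have "join_at (split_at \<mu> p) q = split_at (join_at \<mu> q) p"
          by (rule dgs_unique[OF join_dgs(1)[OF sp(1) qs] split_dgs(1)[OF jn(1) u ps]])
            (use join_dgs(2)[OF sp(1) qs] split_dgs(2)[OF jn(1) u ps] sp(2) jn(2) p True in auto)
        then show ?thesis using qs by (simp add: j_def)
      qed
      ultimately have "diff (j \<mu>) = dia d \<mu> + (\<Sum>p\<in>?T. j (split_at \<mu> p))"
        using True diff_dia[OF jn(1) u] fin by (simp add: j_def T)
      then show ?thesis unfolding E by (simp add: add.assoc)
    qed
  qed
  define w where "w = extend_strands j z"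
  have sz: "support z \<subseteq> dgs d" by (rule alg_partE(1)[OF v z(1)])
  have din: "diff (dia d \<mu>) \<in> alg_part Z d" if "\<mu> \<in> dgs d" for \<mu>
    using diff_alg_part[OF v u] dia_alg_part that by blast
  have "diff w = (\<Sum>\<mu>\<in>support z. diff (j \<mu>))" by (simp add: w_def extend_strands_def diff_sum)
  moreover have "0 = (\<Sum>\<mu>\<in>support z. extend_strands j (diff (dia d \<mu>)))"
  proof -
    have "extend_strands j (diff z) = extend_strands j (\<Sum>\<mu>\<in>support z. diff (dia d \<mu>))"
      by (subst alg_partE(2)[OF v z(1)]) (simp add: diff_sum)
    also have "\<dots> = (\<Sum>\<mu>\<in>support z. extend_strands j (diff (dia d \<mu>)))"
      using sz din by (intro extend_strands_sum[OF v]) blast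
    finally show ?thesis using z(2) by simp
  qed
  ultimately have "diff w = (\<Sum>\<mu>\<in>support z. diff (j \<mu>) + extend_strands j (diff (dia d \<mu>)))"
    by (simp add: sum.distrib)
  also have "\<dots> = (\<Sum>\<mu>\<in>support z. dia d \<mu>)" using homotopy sz by (intro sum.cong) auto
  also have "\<dots> = z" using alg_partE(2)[OF v z(1)] by simp
  finally have "z = diff w" ..
  moreover have "w \<in> alg_part Z d" unfolding w_def extend_strands_def using sz jin by (intro alg_part_sum) blast
  ultimately show ?thesis using that by blast
qed

end

section \<open>Homology classes of diagrams\<close>

context arc
begin

lemma strand_alg_0: "0 \<in> strand_alg Z"
  unfolding strand_alg_def by (rule span2_0)

lemma strand_alg_add: "a \<in> strand_alg Z \<Longrightarrow> b \<in> strand_alg Z \<Longrightarrow> a + b \<in> strand_alg Z"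
  unfolding strand_alg_def by (rule span2_add)

lemma boundaries_0: "0 \<in> boundaries Z"
  unfolding boundaries_def using strand_alg_0 by force

lemma boundaries_add:
  assumes "a \<in> boundaries Z" "b \<in> boundaries Z"
  shows "a + b \<in> boundaries Z"
proof -
  obtain v w where "v \<in> strand_alg Z" "w \<in> strand_alg Z" "a = diff v" "b = diff w"
    using assms unfolding boundaries_def by blast
  then have "a + b = diff (v + w)" "v + w \<in> strand_alg Z" by (simp_all add: alg_diff_add strand_alg_add)
  then show ?thesis unfolding boundaries_def by blast
qed

lemma cls_mem: "x \<in> cls Z a \<longleftrightarrow> (\<exists>c\<in>boundaries Z. x = a + c)"
  unfolding cls_def elt_set_plus_def by blast

lemma cls_eq_iff: "cls Z a = cls Z b \<longleftrightarrow> a + b \<in> boundaries Z"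
proof
  assume e: "cls Z a = cls Z b"
  have "a \<in> cls Z a" unfolding cls_mem using boundaries_0 by (intro bexI[of _ 0]) simp
  then obtain c where c: "c \<in> boundaries Z" "a = b + c" unfolding e cls_mem by blast
  have "a + b = b + (b + c)" unfolding c(2) by (simp only: add_ac)
  then show "a + b \<in> boundaries Z" using c(1) by simp
next
  have sub: "cls Z a \<subseteq> cls Z b" if "a + b \<in> boundaries Z" for a b
  proof
    fix x assume "x \<in> cls Z a"
    then obtain c where c: "c \<in> boundaries Z" "x = a + c" unfolding cls_mem by blast
    have "x = b + ((a + b) + c)" unfolding c(2) by (simp add: add_ac)
    then show "x \<in> cls Z b" unfolding cls_mem using boundaries_add[OF that c(1)] by blast
  qed
  assume "a + b \<in> boundaries Z"
  then show "cls Z a = cls Z b" using sub[of a b] sub[of b a] by (simp add: add.commute)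
qed

lemma cls_0_iff: "cls Z a = cls Z 0 \<longleftrightarrow> a \<in> boundaries Z"
  by (simp add: cls_eq_iff)

lemma cls_0_plus: "cls Z 0 + cls Z 0 = cls Z 0"
proof -
  have "cls Z 0 = boundaries Z" by (auto simp: cls_def elt_set_plus_def)
  moreover have "boundaries Z + boundaries Z = boundaries Z"
  proof (intro equalityI subsetI)
    fix x assume "x \<in> boundaries Z + boundaries Z"
    then show "x \<in> boundaries Z" unfolding set_plus_def using boundaries_add by blast
  next
    fix x assume "x \<in> boundaries Z"
    then have "x + 0 \<in> boundaries Z + boundaries Z" using boundaries_0 by (rule set_plus_intro)
    then show "x \<in> boundaries Z + boundaries Z" by simp
  qed
  ultimately show ?thesis by simp
qed

text \<open>The H-data of a diagram, read off from any one of its terms.\<close>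

definition key_data :: "'i strands \<Rightarrow> 'i hdata" where
  "key_data \<phi> = (strand_chain \<phi>, pairs_of (Domain \<phi>), pairs_of (Range \<phi>))"

lemma key_data_diagram:
  assumes "diagram Z D" "\<phi> \<in> ks D"
  shows "key_data \<phi> = hdata Z D" "strand_diagram Z \<phi>"
proof -
  obtain s \<mu> t where g: "good s \<mu> t" "D = diag Z s \<mu> t" using assms(1) by (auto simp: diagram_iff)
  then show "key_data \<phi> = hdata Z D" "strand_diagram Z \<phi>"
    using key_props[OF g(1)] assms(2) hdata_diag[OF g(1)] by (auto simp: key_data_def)
qed

lemma ks_sum_subset: "ks (\<Sum>i\<in>I. g i) \<subseteq> (\<Union>i\<in>I. ks (g i))"
  by (induction I rule: infinite_finite_induct) (auto simp: ks_add)

lemma key_data_alg_part: "a \<in> alg_part Z d \<Longrightarrow> \<phi> \<in> ks a \<Longrightarrow> key_data \<phi> = d"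
proof -
  assume a: "a \<in> alg_part Z d" "\<phi> \<in> ks a"
  then obtain F where F: "F \<subseteq> {D. diagram Z D \<and> hdata Z D = d}" "a = (\<Sum>D\<in>F. D)"
    unfolding alg_part_def span2_def by blast
  then obtain D where "D \<in> F" "\<phi> \<in> ks D" using a(2) ks_sum_subset[of "\<lambda>x. x" F] by blast
  then show ?thesis using F(1) key_data_diagram(1)[of D \<phi>] by blast
qed

text \<open>
  Resolving a crossing exchanges the end points of two strands, without affecting the sum of their chains.
\<close>

lemma resolve_data:
  assumes sd: "strand_diagram Z \<phi>" and c: "c \<in> crossings \<phi>"
  shows "key_data (resolve \<phi> c) = key_data \<phi>"
proof -
  obtain x y x' y' where c': "c = ((x, y), (x', y'))" "(x, y) \<in> \<phi>" "(x', y') \<in> \<phi>"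
    "pt_less x x'" "pt_less y' y" using c unfolding crossings_def by blast
  have r: "resolve \<phi> c = \<phi> - {(x, y), (x', y')} \<union> {(x, y'), (x', y)}" by (simp add: resolve_def c')
  have ne: "x \<noteq> x'" "y \<noteq> y'" using c' by (auto simp: pt_less_def)
  then have new: "(x, y') \<notin> \<phi>" "(x', y) \<notin> \<phi>"
    using c' strand_diagram_fun[OF sd] by blast+
  have "Domain (resolve \<phi> c) = Domain \<phi>" "Range (resolve \<phi> c) = Range \<phi>"
    unfolding r using c' by blast+
  moreover have "strand_chain (resolve \<phi> c) = strand_chain \<phi>"
  proof
    fix z
    define g :: "'i point \<times> 'i point \<Rightarrow> int" where "g a = (if covers a z then 1 else 0)" for a
    have fin: "finite \<phi>" by (rule finite_strands[OF sd])
    have S: "strand_chain \<psi> z = sum g \<psi>" for \<psi>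
      unfolding strand_chain_def g_def by (rule sum.cong) (auto simp: covers_def)
    have "sum g \<phi> = sum g (\<phi> - {(x, y), (x', y')}) + sum g {(x, y), (x', y')}"
      using fin c' by (simp add: sum.subset_diff[of "{(x, y), (x', y')}" \<phi>])
    moreover have "sum g (resolve \<phi> c) = sum g (\<phi> - {(x, y), (x', y')}) + sum g {(x, y'), (x', y)}"
      unfolding r using fin new by (intro sum.union_disjoint) auto
    moreover have "sum g {(x, y), (x', y')} = sum g {(x, y'), (x', y)}"
      using ne c'(4,5) strand_diagram_le[OF sd c'(2)] strand_diagram_le[OF sd c'(3)]
      by (auto simp: g_def covers_iff pt_less_def)
    ultimately show "strand_chain (resolve \<phi> c) z = strand_chain \<phi> z" unfolding S by simp
  qed
  ultimately show ?thesis by (simp add: key_data_def)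
qed

lemma key_data_diff:
  assumes "diagram Z D" "\<phi> \<in> ks (diff D)"
  shows "key_data \<phi> = hdata Z D"
proof -
  obtain \<psi> where \<psi>: "\<psi> \<in> ks D" "\<phi> \<in> ks (strand_diff \<psi>)"
    using assms(2) ks_sum_subset unfolding diff_def by blast
  then obtain c where c': "c \<in> crossings \<psi>" "\<phi> \<in> ks (strand_elt (resolve \<psi> c))"
    using ks_sum_subset[of "\<lambda>c. strand_elt (resolve \<psi> c)"] unfolding strand_diff_def by blast
  then have c: "c \<in> crossings \<psi>" "\<phi> = resolve \<psi> c" by simp_all
  then show ?thesis using resolve_data key_data_diagram[OF assms(1) \<psi>(1)] by simp
qed

text \<open>
  The differential preserves H-data, so it commutes with the projection to the summand of
  \<open>d\<close>.
\<close>

lemma diff_part: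
  assumes "w \<in> strand_alg Z"
  obtains w' where "w' \<in> alg_part Z d" "ks (diff w') = {\<phi> \<in> ks (diff w). key_data \<phi> = d}"
proof -
  obtain F where F: "finite F" "\<And>D. D \<in> F \<Longrightarrow> diagram Z D" "w = (\<Sum>D\<in>F. D)"
    using assms unfolding strand_alg_def span2_def by blast
  let ?A = "{D \<in> F. hdata Z D = d}" and ?B = "{D \<in> F. hdata Z D \<noteq> d}"
  let ?a = "\<Sum>D\<in>?A. D" and ?b = "\<Sum>D\<in>?B. D"
  have "w = ?a + ?b"
    unfolding F(3) using F(1) by (subst sum.union_disjoint[symmetric]) (auto intro: sum.cong)
  then have "ks (diff w) = sym_diff (ks (diff ?a)) (ks (diff ?b))" by (simp add: alg_diff_add ks_add)
  moreover have sum_in: "\<exists>D\<in>A. key_data \<phi> = hdata Z D" if \<phi>: "\<phi> \<in> ks (diff (\<Sum>D\<in>A. D))" and A: "A \<subseteq> F" for A \<phi>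
  proof -
    obtain D where "D \<in> A" "\<phi> \<in> ks (diff D)" using \<phi> ks_sum_subset[of diff A] unfolding diff_sum by blast
    then show ?thesis using key_data_diff[of D \<phi>] F(2) A by blast
  qed
  moreover have "key_data \<phi> = d" if "\<phi> \<in> ks (diff ?a)" for \<phi>
    using sum_in[OF that] by auto
  moreover have "key_data \<phi> \<noteq> d" if "\<phi> \<in> ks (diff ?b)" for \<phi>
    using sum_in[OF that] by auto
  ultimately have "ks (diff ?a) = {\<phi> \<in> ks (diff w). key_data \<phi> = d}" by blast
  moreover have "?a \<in> alg_part Z d"
    unfolding alg_part_def span2_def using F(1,2) by (intro CollectI exI[of _ ?A]) auto
  ultimately show ?thesis using that by blast
qed

text \<open>
  If a class lies in two summands then it is zero: the part of a bounding element in the first summand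
  already bounds.
\<close>

lemma class_hdata_eq:
  assumes z: "z \<in> alg_part Z d" "diff z = 0" "cls Z z \<noteq> cls Z 0"
  shows "class_hdata Z (cls Z z) = d"
  unfolding class_hdata_def
proof (rule the_equality)
  show "cls Z z \<in> hom_part Z d" unfolding hom_part_def using z by blast
next
  fix d' assume "cls Z z \<in> hom_part Z d'"
  then obtain z' where z': "z' \<in> alg_part Z d'" "cls Z z = cls Z z'" unfolding hom_part_def by blast
  show "d' = d"
  proof (rule ccontr)
    assume ne: "d' \<noteq> d"
    obtain w where w: "w \<in> strand_alg Z" "z + z' = diff w"
      using z'(2) unfolding cls_eq_iff boundaries_def by blast
    obtain w' where w': "w' \<in> alg_part Z d" "ks (diff w') = {\<phi> \<in> ks (diff w). key_data \<phi> = d}"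
      by (rule diff_part[OF w(1)])
    have "ks (diff w') = ks z"
      unfolding w'(2) w(2)[symmetric] ks_add
      using key_data_alg_part[OF z(1)] key_data_alg_part[OF z'(1)] ne by blast
    then have "z = diff w'" by (intro alg_eqI) simp
    then have "cls Z z = cls Z 0" unfolding cls_0_iff boundaries_def using w'(1) alg_part_strand_alg by blast
    then show False using z(3) by contradiction
  qed
qed

text \<open>
  Without twisted places there is nothing to break, and the differential of the summand is zero.
\<close>

lemma tight_dia_cycle:
  assumes "\<mu> \<in> dgs d" "undoubled d" "twisted_places d = {}"
  shows "diff (dia d \<mu>) = 0" "cls Z (dia d \<mu>) \<noteq> cls Z 0"
proof -
  have zero: "diff (dia d \<nu>) = 0" if "\<nu> \<in> dgs d" for \<nu>
    using diff_dia[OF that assms(2)] assms(3) by simp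
  show "diff (dia d \<mu>) = 0" by (rule zero[OF assms(1)])
  note v = dgs_viable[OF assms(1)]
  show "cls Z (dia d \<mu>) \<noteq> cls Z 0"
  proof
    assume "cls Z (dia d \<mu>) = cls Z 0"
    then obtain w where w: "w \<in> strand_alg Z" "dia d \<mu> = diff w" unfolding cls_0_iff boundaries_def by blast
    obtain w' where w': "w' \<in> alg_part Z d" "ks (diff w') = {\<phi> \<in> ks (diff w). key_data \<phi> = d}"
      by (rule diff_part[OF w(1)])
    have "ks (diff w') = ks (dia d \<mu>)"
      using w'(2) w(2) key_data_alg_part[OF dia_alg_part[OF assms(1)]] by auto
    moreover have "diff w' = 0"
      by (subst alg_partE(2)[OF v w'(1)]) (use alg_partE(1)[OF v w'(1)] zero in \<open>auto simp: diff_sum intro: sum.neutral\<close>)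
    ultimately show False using ks_dia_nonempty[OF assms(1)] by simp
  qed
qed

lemma uncrossed_cycle:
  "\<mu> \<in> dgs d \<Longrightarrow> undoubled d \<Longrightarrow> broken \<mu> = twisted_places d \<Longrightarrow> diff (dia d \<mu>) = 0"
  by (simp add: diff_dia)

lemma twisted_cls:
  assumes "viable_chain Z (fst d)" "undoubled d" "twisted_places d \<noteq> {}" "z \<in> alg_part Z d" "diff z = 0"
  shows "cls Z z = cls Z 0"
proof -
  obtain q where "q \<in> twisted_places d" using assms(3) by blast
  then obtain w where "w \<in> alg_part Z d" "z = diff w" using twisted_acyclic[OF assms(1,2) _ assms(4,5)] by blast
  then show ?thesis unfolding cls_0_iff boundaries_def using alg_part_strand_alg by blast
qed

lemma broken_untwisted: "\<mu> \<in> dgs d \<Longrightarrow> undoubled d \<Longrightarrow> twisted_places d = {} \<Longrightarrow> broken \<mu> = {}"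
  using broken_subset by blast

lemma tight_dia_iff:
  assumes "\<mu> \<in> dgs d" "undoubled d"
  shows "tight Z (dia d \<mu>) \<longleftrightarrow> twisted_places d = {}"
proof
  assume t: "tight Z (dia d \<mu>)"
  then have b: "broken \<mu> = twisted_places d" using has_crossing_dia[OF assms] by (simp add: tight_def)
  show "twisted_places d = {}"
    using twisted_cls[OF dgs_viable[OF assms(1)] assms(2) _ dia_alg_part[OF assms(1)] uncrossed_cycle[OF assms b]]
      t by (auto simp: tight_def)
next
  assume "twisted_places d = {}"
  then show "tight Z (dia d \<mu>)"
    using tight_dia_cycle[OF assms] viable_dia[OF assms(1)] has_crossing_dia[OF assms] broken_untwisted[OF assms]
    by (simp add: tight_def)
qed

text \<open>A diagram is without crossings just if it is broken at all twisted places.\<close>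

lemma twisted_dia_iff:
  assumes "\<mu> \<in> dgs d" "undoubled d"
  shows "twisted Z (dia d \<mu>) \<longleftrightarrow> twisted_places d \<noteq> {} \<and> broken \<mu> = twisted_places d"
proof
  assume t: "twisted Z (dia d \<mu>)"
  then have b: "broken \<mu> = twisted_places d" using has_crossing_dia[OF assms] by (simp add: twisted_def)
  then show "twisted_places d \<noteq> {} \<and> broken \<mu> = twisted_places d"
    using t tight_dia_cycle(2)[OF assms] by (auto simp: twisted_def)
next
  assume b: "twisted_places d \<noteq> {} \<and> broken \<mu> = twisted_places d"
  then have "cls Z (dia d \<mu>) = cls Z 0"
    using twisted_cls[OF dgs_viable[OF assms(1)] assms(2) _ dia_alg_part[OF assms(1)] uncrossed_cycle[OF assms]]
    by blast
  then show "twisted Z (dia d \<mu>)"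
    using b viable_dia[OF assms(1)] has_crossing_dia[OF assms] by (simp add: twisted_def)
qed

lemma crossed_dia_iff:
  "\<mu> \<in> dgs d \<Longrightarrow> undoubled d \<Longrightarrow> crossed Z (dia d \<mu>) \<longleftrightarrow> broken \<mu> \<noteq> twisted_places d"
  by (simp add: crossed_def viable_dia has_crossing_dia)

text \<open>A nonzero class without doubled pairs is represented by exactly one tight diagram.\<close>

lemma diagram_classE:
  assumes c: "c \<in> diagram_classes Z" and v: "viable_chain Z (fst (class_hdata Z c))"
    and u: "undoubled (class_hdata Z c)"
  obtains \<mu> where "dgs (class_hdata Z c) = {\<mu>}" "c = cls Z (dia (class_hdata Z c) \<mu>)"
    "tight Z (dia (class_hdata Z c) \<mu>)" "twisted_places (class_hdata Z c) = {}"
    "\<And>D. tight Z D \<Longrightarrow> cls Z D = c \<Longrightarrow> D = dia (class_hdata Z c) \<mu>"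
proof -
  obtain D where D: "diagram Z D" "diff D = 0" "cls Z D \<noteq> cls Z 0" "c = cls Z D"
    using c unfolding diagram_classes_def by blast
  have in_part: "D \<in> alg_part Z (hdata Z D)" if "diagram Z D" for D
    unfolding alg_part_def using that by (intro span2_base) simp
  have h: "class_hdata Z c = hdata Z D" using class_hdata_eq[OF in_part] D by simp
  obtain \<mu> where \<mu>: "\<mu> \<in> dgs (class_hdata Z c)" "D = dia (class_hdata Z c) \<mu>"
    using diagram_hdataE[OF D(1)] v h by metis
  have tw: "twisted_places (class_hdata Z c) = {}"
    using twisted_cls[OF v u _ dia_alg_part[OF \<mu>(1)]] D(2,3) \<mu>(2) by argo
  have uniq: "\<nu> = \<mu>" if "\<nu> \<in> dgs (class_hdata Z c)" for \<nu>
    using dgs_unique[OF that \<mu>(1)] broken_untwisted[OF _ u tw] that \<mu>(1) by blast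
  have tight: "tight Z (dia (class_hdata Z c) \<mu>)" using tight_dia_iff[OF \<mu>(1) u] tw by simp
  have "E = dia (class_hdata Z c) \<mu>" if E: "tight Z E" "cls Z E = c" for E
  proof -
    have E': "diagram Z E" "cls Z E \<noteq> cls Z 0" "viable_chain Z (fst (hdata Z E))" "\<not> has_crossing E"
      using E(1) by (auto simp: tight_def viable_diagram_def)
    obtain s \<nu> t where g: "good s \<nu> t" "E = diag Z s \<nu> t" using E'(1) by (auto simp: diagram_iff)
    have "thin \<nu>" using E'(3) hdata_diag[OF g(1)] viable_iff_thin[OF moving_diagram[OF goodD(3)[OF g(1)]]] g(2)
      by simp
    moreover have "crossings \<phi> = {}" if "\<phi> \<in> ks E" for \<phi> using E'(4) that unfolding has_crossing_def by blast
    then have "diff E = 0" unfolding diff_def strand_diff_def by (intro sum.neutral) simp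
    ultimately have "class_hdata Z c = hdata Z E" using class_hdata_eq[OF in_part[OF E'(1)]] E'(2) E(2) by simp
    then obtain \<nu> where "\<nu> \<in> dgs (class_hdata Z c)" "E = dia (class_hdata Z c) \<nu>"
      using diagram_hdataE[OF E'(1,3)] by metis
    then show ?thesis using uniq by blast
  qed
  then show ?thesis using that[of \<mu>] uniq \<mu> D(4) tight tw by blast
qed

end

section \<open>Fragments\<close>

context arc
begin

text \<open>
  Restriction of H-data to a fragment. On the interval of \<open>p\<close> there are two steps: the one
  from the point 0 is the step of \<open>Z\<close> ending at \<open>p\<close>, the one from the point 1 is
  the step of \<open>Z\<close> starting at \<open>p\<close>.
\<close>

definition local_data :: "nat \<Rightarrow> 'i hdata \<Rightarrow> 'i point hdata" where
  "local_data P d = ((\<lambda>(p, j). if p \<notin> fibre Z P then 0 else if j = 0 then fst d (step_before p)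
     else if j = 1 then fst d p else 0), local_set P (fst (snd d)), local_set P (snd (snd d)))"

lemma places_fragment: "places (fragment Z P) = (\<lambda>p. (p, 1)) ` fibre Z P"
  by (auto simp: places_def fragment_def)

lemma fibre_fragment: "fibre (fragment Z P) Q = (if Q = 1 then (\<lambda>p. (p, 1)) ` fibre Z P else {})"
  unfolding fibre_def[of "fragment Z P"] places_fragment by (auto simp: fragment_def)

lemma pairs_fragment: "pairs (fragment Z P) = {1}"
  by (simp add: pairs_def fragment_def)

lemma pairing_fragment [simp]: "pairing (fragment Z P) x = 1"
  by (simp add: fragment_def)

lemma points_fragment: "points (fragment Z P) = fibre Z P \<times> {0, 1, 2}"
  by (auto simp: points_def fragment_def)

lemma twin_fragment:
  assumes "p \<in> fibre Z P"
  shows "twin (fragment Z P) (p, 1) = (twin Z p, 1)"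
proof -
  have p: "p \<in> places Z" "pairing Z p = P" using assms by (auto simp: fibre_iff)
  then have f: "fibre Z P = {p, twin Z p}" "twin Z p \<noteq> p" using twin(4,2)[OF p(1)] by simp_all
  show ?thesis unfolding twin_def[of "fragment Z P"] pairing_fragment fibre_fragment f(1)
    using f(2) by (intro the_equality) auto
qed

lemma arc_fragment:
  assumes "P \<in> pairs Z"
  shows "arc (fragment Z P)"
proof
  obtain p where "p \<in> fibre Z P" using fibre_nonempty[OF assms] by blast
  then obtain q where pq: "fibre Z P = {p, q}" "p \<noteq> q" using fibreE[OF assms] by blast
  show "arc_diagram (fragment Z P)"
    unfolding arc_diagram_def pairs_fragment
  proof (intro conjI ballI)
    show "finite (ivals (fragment Z P))" using pq by (simp add: fragment_def)
    show "pairing (fragment Z P) ` places (fragment Z P) \<subseteq> {1}" by auto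
    show "card (fibre (fragment Z P) Q) = 2" if "Q \<in> {1}" for Q
      using that pq by (simp add: fibre_fragment)
    have "snd a < snd b" if ab: "(a, b) \<in> surgery_rel (fragment Z P)" for a b
    proof -
      obtain i j where ij: "a = (i, j)" "b = twin (fragment Z P) (i, j + 1)" "(i, j + 1) \<in> places (fragment Z P)"
        using ab unfolding surgery_rel_def by blast
      then have "j = 0" "i \<in> fibre Z P" by (auto simp: places_fragment)
      then show ?thesis using ij twin_fragment[of i P] by simp
    qed
    then show "acyclic (surgery_rel (fragment Z P))"
      by (intro acyclicI_order[where f = "\<lambda>a. - int (snd a)"]) auto
  qed
qed

text \<open>
  The pieces on the interval of \<open>p\<close> are those of strands ending at \<open>p\<close>,
  beginning at \<open>p\<close> or passing \<open>p\<close>.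
\<close>

lemma cut_strands_eq:
  assumes m: "moving Z \<mu>" and th: "thin \<mu>"
  shows "cut_strands Z P \<mu> = {((p, 0), (p, 1)) |p. p \<in> fibre Z P \<and> p \<in> Range \<mu>} \<union>
    {((p, 1), (p, 2)) |p. p \<in> fibre Z P \<and> p \<in> Domain \<mu>} \<union>
    {((p, 0), (p, 2)) |p. p \<in> fibre Z P \<and> cov \<mu> p \<and> p \<notin> Domain \<mu>}" (is "_ = ?A \<union> ?B \<union> ?C")
proof (intro equalityI subsetI)
  fix c assume "c \<in> cut_strands Z P \<mu>"
  then obtain p x y where c: "c = (clamp p x, clamp p y)" "p \<in> fibre Z P" "(x, y) \<in> \<mu>" "fst x = fst p"
    "clamp p x \<noteq> clamp p y" unfolding cut_strands_def by blast
  have l: "fst y = fst p" "snd x < snd y" using moving_less[OF m c(3)] c(4) by auto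
  consider "snd x < snd p" "snd y = snd p" | "snd x < snd p" "snd p < snd y" | "snd x = snd p" "snd p < snd y"
    using l(2) c(5) by (auto simp: clamp_def split: if_splits)
  then show "c \<in> ?A \<union> ?B \<union> ?C"
  proof cases
    case 1
    then have "y = p" using l by (simp add: prod_eq_iff)
    then have "c = ((p, 0), (p, 1))" "p \<in> Range \<mu>" using 1 c by (auto simp: clamp_def)
    then show ?thesis using c(2) by blast
  next
    case 2
    have cv: "covers (x, y) p" using 2 l c(4) by (simp add: covers_iff)
    have "p \<notin> Domain \<mu>"
    proof
      assume "p \<in> Domain \<mu>"
      then obtain w where w: "(p, w) \<in> \<mu>" by blast
      have "(p, w) = (x, y)" by (rule thinD[OF th w c(3) moving_cov_start[OF m w] cv])
      then show False using 2 by simp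
    qed
    moreover have "cov \<mu> p" using cv c(3) unfolding cov_def by blast
    moreover have "c = ((p, 0), (p, 2))" using 2 c(1) by (simp add: clamp_def)
    ultimately show ?thesis using c(2) by blast
  next
    case 3
    then have "x = p" using c(4) by (simp add: prod_eq_iff)
    then have "c = ((p, 1), (p, 2))" "p \<in> Domain \<mu>" using 3 c by (auto simp: clamp_def)
    then show ?thesis using c(2) by blast
  qed
next
  have I: "(clamp p x, clamp p y) \<in> cut_strands Z P \<mu>"
    if "p \<in> fibre Z P" "(x, y) \<in> \<mu>" "fst x = fst p" "clamp p x \<noteq> clamp p y" for p x y
    unfolding cut_strands_def using that by blast
  fix c assume "c \<in> ?A \<union> ?B \<union> ?C"
  then consider p where "c = ((p, 0), (p, 1))" "p \<in> fibre Z P" "p \<in> Range \<mu>"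
    | p where "c = ((p, 1), (p, 2))" "p \<in> fibre Z P" "p \<in> Domain \<mu>"
    | p where "c = ((p, 0), (p, 2))" "p \<in> fibre Z P" "cov \<mu> p" "p \<notin> Domain \<mu>" by blast
  then show "c \<in> cut_strands Z P \<mu>"
  proof cases
    case 1
    then obtain x where x: "(x, p) \<in> \<mu>" by blast
    then show ?thesis using I[OF 1(2) x] 1(1) moving_less[OF m x] by (simp add: clamp_def)
  next
    case 2
    then obtain y where y: "(p, y) \<in> \<mu>" by blast
    then show ?thesis using I[OF 2(2) y] 2(1) moving_less[OF m y] by (simp add: clamp_def)
  next
    case 3
    obtain x y where xy: "(x, y) \<in> \<mu>" "covers (x, y) p" "pt_less x p" "pt_less p y"
      using cov_pass[OF m th 3(3,4)] by blast
    then show ?thesis using I[OF 3(2) xy(1)] 3(1) by (simp add: clamp_def pt_less_def)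
  qed
qed

text \<open>Cutting is compatible with the description of diagrams by H-data and broken places.\<close>

lemma cut_strands_dgs:
  assumes P: "P \<in> pairs Z" and \<mu>: "\<mu> \<in> dgs d"
  defines "F \<equiv> fragment Z P"
  shows "cut_strands Z P \<mu> \<in> arc.dgs F (local_data P d)"
    "broken (cut_strands Z P \<mu>) = (\<lambda>p. (p, 1)) ` (broken \<mu> \<inter> fibre Z P)"
    "cut Z P (dia d \<mu>) = arc.dia F (local_data P d) (cut_strands Z P \<mu>)"
proof -
  interpret F: arc F unfolding F_def by (rule arc_fragment[OF P])
  let ?c = "cut_strands Z P \<mu>"
  note m = dgsD(3)[OF \<mu>] and th = dgsD(2)[OF \<mu>]
  note ceq = cut_strands_eq[OF m th, of P]
  have fib: "p \<in> places Z" if "p \<in> fibre Z P" for p using that by (simp add: fibre_iff)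
  have passR: "p \<notin> Range \<mu>" if "cov \<mu> p" "p \<notin> Domain \<mu>" for p
    using dgs_start(2)[OF \<mu>] dgs_cov[OF \<mu>] that by blast
  have D: "Domain ?c = {(p, 0) |p. p \<in> fibre Z P \<and> (p \<in> Range \<mu> \<or> cov \<mu> p \<and> p \<notin> Domain \<mu>)} \<union>
      {(p, 1) |p. p \<in> fibre Z P \<and> p \<in> Domain \<mu>}" unfolding ceq by blast
  have R: "Range ?c = {(p, 2) |p. p \<in> fibre Z P \<and> (p \<in> Domain \<mu> \<or> cov \<mu> p \<and> p \<notin> Domain \<mu>)} \<union>
      {(p, 1) |p. p \<in> fibre Z P \<and> p \<in> Range \<mu>}" unfolding ceq by blast
  show br: "broken ?c = (\<lambda>p. (p, 1)) ` (broken \<mu> \<inter> fibre Z P)"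
    unfolding broken_def D R by auto
  have mov: "moving F ?c"
    unfolding moving_def strand_diagram_def
  proof (intro conjI)
    show "?c \<subseteq> points F \<times> points F" unfolding F_def points_fragment ceq by auto
    show "single_valued ?c" unfolding ceq single_valued_def using passR by auto
    show "single_valued (?c\<inverse>)" unfolding ceq single_valued_def using passR by auto
    show "\<forall>(x, y)\<in>?c. pt_le x y" unfolding ceq by (auto simp: pt_le_def)
    show "\<forall>x. (x, x) \<notin> ?c" unfolding ceq by auto
  qed
  have thc: "thin ?c"
    unfolding thin_def
  proof (intro ballI allI impI)
    define R D' N where RN: "R = Range \<mu>" "D' = Domain \<mu>" "N = {p. cov \<mu> p \<and> p \<notin> Domain \<mu>}"
    have c: "\<exists>p. c = ((p, 0), (p, 1)) \<and> p \<in> R \<or> c = ((p, 1), (p, 2)) \<and> p \<in> D' \<or> c = ((p, 0), (p, 2)) \<and> p \<in> N"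
      if "c \<in> ?c" for c
      using that unfolding ceq RN by blast
    fix a b z assume a: "a \<in> ?c" and b: "b \<in> ?c" and ab: "covers a z \<and> covers b z"
    have "R \<inter> N = {}" "D' \<inter> N = {}" using passR unfolding RN by blast+
    moreover have "a = ((fst z, 0), (fst z, 1)) \<and> snd z = 0 \<and> fst z \<in> R \<or> a = ((fst z, 1), (fst z, 2)) \<and> snd z = 1 \<and> fst z \<in> D' \<or>
        a = ((fst z, 0), (fst z, 2)) \<and> fst z \<in> N"
      using c[OF a] ab by (auto simp: covers_iff)
    moreover have "b = ((fst z, 0), (fst z, 1)) \<and> snd z = 0 \<and> fst z \<in> R \<or> b = ((fst z, 1), (fst z, 2)) \<and> snd z = 1 \<and> fst z \<in> D' \<or>
        b = ((fst z, 0), (fst z, 2)) \<and> fst z \<in> N"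
      using c[OF b] ab by (auto simp: covers_iff)
    ultimately show "a = b" by auto
  qed
  have before: "fst d (step_before p) = 1 \<longleftrightarrow> p \<in> Range \<mu> \<or> cov \<mu> p \<and> p \<notin> Domain \<mu>" if "p \<in> fibre Z P" for p
    using dgs_Range[OF \<mu>] dgs_start(1)[OF \<mu>] dgs_end[OF \<mu> fib[OF that]] dgs_cov[OF \<mu>] by blast
  have after: "fst d p = 1 \<longleftrightarrow> p \<in> Domain \<mu> \<or> cov \<mu> p \<and> p \<notin> Domain \<mu>" for p
    using dgs_Domain[OF \<mu>] dgs_cov[OF \<mu>] by blast
  have cv: "cov ?c (p, j) \<longleftrightarrow> p \<in> fibre Z P \<and>
      (j = 0 \<and> (p \<in> Range \<mu> \<or> cov \<mu> p \<and> p \<notin> Domain \<mu>) \<or> j = 1 \<and> (p \<in> Domain \<mu> \<or> cov \<mu> p \<and> p \<notin> Domain \<mu>))" for p j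
  proof
    assume "cov ?c (p, j)"
    then obtain a where a: "a \<in> ?c" "covers a (p, j)" unfolding cov_def by blast
    from a(1) consider q where "a = ((q, 0), (q, 1))" "q \<in> fibre Z P" "q \<in> Range \<mu>"
      | q where "a = ((q, 1), (q, 2))" "q \<in> fibre Z P" "q \<in> Domain \<mu>"
      | q where "a = ((q, 0), (q, 2))" "q \<in> fibre Z P" "cov \<mu> q" "q \<notin> Domain \<mu>"
      unfolding ceq by blast
    then show "p \<in> fibre Z P \<and>
      (j = 0 \<and> (p \<in> Range \<mu> \<or> cov \<mu> p \<and> p \<notin> Domain \<mu>) \<or> j = 1 \<and> (p \<in> Domain \<mu> \<or> cov \<mu> p \<and> p \<notin> Domain \<mu>))"
    proof cases
      case 1
      then have "q = p" "j = 0" using a(2) by (auto simp: covers_iff)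
      then show ?thesis using 1 by blast
    next
      case 2
      then have "q = p" "j = 1" using a(2) by (auto simp: covers_iff)
      then show ?thesis using 2 by blast
    next
      case 3
      then have "q = p" "j = 0 \<or> j = 1" using a(2) by (auto simp: covers_iff)
      then show ?thesis using 3 by blast
    qed
  next
    assume r: "p \<in> fibre Z P \<and>
      (j = 0 \<and> (p \<in> Range \<mu> \<or> cov \<mu> p \<and> p \<notin> Domain \<mu>) \<or> j = 1 \<and> (p \<in> Domain \<mu> \<or> cov \<mu> p \<and> p \<notin> Domain \<mu>))"
    have "covers ((p, 0), (p, 1)) (p, 0)" "covers ((p, 0), (p, 2)) (p, 0)" "covers ((p, 0), (p, 2)) (p, 1)"
      "covers ((p, 1), (p, 2)) (p, 1)" by (simp_all add: covers_iff)
    moreover have "((p, 0), (p, 1)) \<in> ?c \<or> p \<notin> Range \<mu>" "((p, 1), (p, 2)) \<in> ?c \<or> p \<notin> Domain \<mu>"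
      "((p, 0), (p, 2)) \<in> ?c \<or> \<not> cov \<mu> p \<or> p \<in> Domain \<mu>"
      unfolding ceq using r by blast+
    ultimately show "cov ?c (p, j)" using r unfolding cov_def[of ?c] by blast
  qed
  have pl: "places F = (\<lambda>p. (p, 1)) ` fibre Z P" unfolding F_def by (rule places_fragment)
  have pF [simp]: "pairing F x = 1" for x unfolding F_def by simp
  have inD: "(p, 1) \<in> Domain ?c \<longleftrightarrow> p \<in> fibre Z P \<and> p \<in> Domain \<mu>"
    and inR: "(p, 1) \<in> Range ?c \<longleftrightarrow> p \<in> fibre Z P \<and> p \<in> Range \<mu>" for p
    unfolding D R by (cases p, simp)+
  have pairs_of_F: "F.pairs_of A = (if \<exists>p\<in>fibre Z P. (p, 1) \<in> A then {1} else {})" for A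
    unfolding F.pairs_of_def pl by (auto simp: image_iff)
  have pD: "F.pairs_of (Domain ?c) = (if \<exists>p\<in>fibre Z P. p \<in> Domain \<mu> then {1} else {})"
    unfolding pairs_of_F inD by simp
  have pR: "F.pairs_of (Range ?c) = (if \<exists>p\<in>fibre Z P. p \<in> Range \<mu> then {1} else {})"
    unfolding pairs_of_F inR by simp
  have one: "F.one_per_pair A" if "\<And>p q. p \<in> fibre Z P \<Longrightarrow> q \<in> fibre Z P \<Longrightarrow> (p, 1) \<in> A \<Longrightarrow> (q, 1) \<in> A \<Longrightarrow> p = q" for A
    by (rule F.one_per_pairI) (use that in \<open>auto simp: pl\<close>)
  have "F.good (local_set P (fst (snd d))) ?c (local_set P (snd (snd d)))"
    unfolding F.good_def pD pR
  proof (intro conjI mov)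
    show "local_set P (fst (snd d)) \<subseteq> pairs F" "local_set P (snd (snd d)) \<subseteq> pairs F"
      unfolding F_def pairs_fragment by (simp_all add: local_set_def)
    show "F.one_per_pair (Domain ?c)"
      using dgs_Domain_inj[OF \<mu>] by (intro one) (unfold inD fibre_iff, blast)
    show "F.one_per_pair (Range ?c)"
      using dgs_Range_inj[OF \<mu>] by (intro one) (unfold inR fibre_iff, blast)
    show "(if \<exists>p\<in>fibre Z P. p \<in> Domain \<mu> then {1} else {}) \<subseteq> local_set P (fst (snd d))"
    proof -
      have "(\<exists>p\<in>fibre Z P. p \<in> Domain \<mu>) \<Longrightarrow> P \<in> fst (snd d)"
        unfolding fibre_def using dgs_Domain_on[OF \<mu>] by blast
      then show ?thesis by (simp add: local_set_def)
    qed
    show "(if \<exists>p\<in>fibre Z P. p \<in> Range \<mu> then {1} else {}) \<subseteq> local_set P (snd (snd d))"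
    proof -
      have "(\<exists>p\<in>fibre Z P. p \<in> Range \<mu>) \<Longrightarrow> P \<in> snd (snd d)"
        unfolding fibre_def using dgs_Range_on[OF \<mu>] by blast
      then show ?thesis by (simp add: local_set_def)
    qed
    show "local_set P (fst (snd d)) - (if \<exists>p\<in>fibre Z P. p \<in> Domain \<mu> then {1} else {}) =
        local_set P (snd (snd d)) - (if \<exists>p\<in>fibre Z P. p \<in> Range \<mu> then {1} else {})"
      using dgs_horizontal[OF \<mu>, of P]
      by (cases "P \<in> fst (snd d)"; cases "P \<in> snd (snd d)"; cases "\<exists>p\<in>fibre Z P. p \<in> Domain \<mu>";
          cases "\<exists>p\<in>fibre Z P. p \<in> Range \<mu>") (simp_all add: local_set_def)
  qed
  moreover have "fst (local_data P d) z = of_bool (cov ?c z)" for z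
  proof (cases z)
    case (Pair p j)
    show ?thesis
    proof (cases "p \<in> fibre Z P")
      case True
      then show ?thesis unfolding Pair cv using before[OF True] after[of p] dgs_01[OF \<mu>, of p] dgs_01[OF \<mu>, of "step_before p"]
        by (auto simp: local_data_def)
    qed (auto simp: Pair cv local_data_def)
  qed
  ultimately show "?c \<in> F.dgs (local_data P d)"
    using thc by (intro F.dgsI) (auto simp: local_data_def)
  show "cut Z P (dia d \<mu>) = F.dia (local_data P d) ?c"
    unfolding cut_def presentation_dia[OF \<mu>] F.dia_def by (simp add: local_data_def F_def)
qed

lemma twisted_places_fragment:
  assumes P: "P \<in> pairs Z"
  shows "arc.twisted_places (fragment Z P) (local_data P d) = (\<lambda>p. (p, 1)) ` (twisted_places d \<inter> fibre Z P)"
proof -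
  interpret F: arc "fragment Z P" by (rule arc_fragment[OF P])
  have "once_occupied_at (fragment Z P) (p, 1) (local_data P d) \<longleftrightarrow> once_occupied_at Z p d"
    "on_on 1 (local_data P d) \<longleftrightarrow> on_on P d" if p: "p \<in> fibre Z P" for p
  proof -
    have "twin Z p \<in> fibre Z P" using twin[of p] p by (auto simp: fibre_iff)
    then show "once_occupied_at (fragment Z P) (p, 1) (local_data P d) \<longleftrightarrow> once_occupied_at Z p d"
      unfolding F.once_occupied_iff once_occupied_iff twin_fragment[OF p] using p
      by (simp add: local_data_def step_before_def)
    show "on_on 1 (local_data P d) \<longleftrightarrow> on_on P d"
      unfolding F.on_on_iff on_on_iff by (auto simp: local_data_def local_set_def)
  qed
  then show ?thesis unfolding F.twisted_places_def twisted_places_def places_fragment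
    by (auto simp: fibre_iff)
qed

lemma undoubled_fragment:
  assumes P: "P \<in> pairs Z" and u: "undoubled d"
  shows "arc.undoubled (fragment Z P) (local_data P d)"
proof -
  interpret F: arc "fragment Z P" by (rule arc_fragment[OF P])
  have "on_on P d" if "on_on 1 (local_data P d)"
    using that unfolding F.on_on_iff on_on_iff by (auto simp: local_data_def local_set_def split: if_splits)
  moreover have "doubly_occupied Z P d" if d: "doubly_occupied (fragment Z P) 1 (local_data P d)"
  proof -
    have "fst d (step_before p) = 1 \<and> fst d p = 1" if p: "p \<in> fibre Z P" for p
      using d p unfolding doubly_occupied_def fibre_fragment
      by (auto simp: case_prod_beta local_data_def step_before_def)
    then show ?thesis by (auto simp: doubly_occupied_def case_prod_beta)
  qed
  ultimately show ?thesis using u P unfolding F.undoubled_def undoubled_def pairs_fragment by blast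
qed

lemma crossed_at_iff:
  assumes "P \<in> pairs Z" "\<mu> \<in> dgs d" "undoubled d"
  shows "crossed_at Z P (dia d \<mu>) \<longleftrightarrow> \<not> twisted_places d \<inter> fibre Z P \<subseteq> broken \<mu>"
proof -
  interpret F: arc "fragment Z P" by (rule arc_fragment[OF assms(1)])
  have "crossed_at Z P (dia d \<mu>) \<longleftrightarrow>
      (\<lambda>p. (p, 1::nat)) ` (broken \<mu> \<inter> fibre Z P) \<noteq> (\<lambda>p. (p, 1)) ` (twisted_places d \<inter> fibre Z P)"
    unfolding crossed_at_def cut_strands_dgs(3)[OF assms(1,2)]
      F.crossed_dia_iff[OF cut_strands_dgs(1)[OF assms(1,2)] undoubled_fragment[OF assms(1,3)]]
      cut_strands_dgs(2)[OF assms(1,2)] twisted_places_fragment[OF assms(1)] ..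
  also have "\<dots> \<longleftrightarrow> broken \<mu> \<inter> fibre Z P \<noteq> twisted_places d \<inter> fibre Z P"
    by (subst inj_image_eq_iff) (auto simp: inj_def)
  finally show ?thesis using broken_subset[OF assms(2,3)] by blast
qed

lemma tight_at_iff:
  assumes "P \<in> pairs Z" "\<mu> \<in> dgs d" "undoubled d"
  shows "tight_at Z P (dia d \<mu>) \<longleftrightarrow> twisted_places d \<inter> fibre Z P = {}"
proof -
  interpret F: arc "fragment Z P" by (rule arc_fragment[OF assms(1)])
  show ?thesis
    unfolding tight_at_def cut_strands_dgs(3)[OF assms(1,2)]
      F.tight_dia_iff[OF cut_strands_dgs(1)[OF assms(1,2)] undoubled_fragment[OF assms(1,3)]]
      twisted_places_fragment[OF assms(1)] by simp
qed

end

section \<open>The operator joining strands\<close>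

lemma least_in_linear_order:
  assumes "linear_order_on A r" "finite C" "C \<noteq> {}" "C \<subseteq> A"
  shows "\<exists>P\<in>C. \<forall>Q\<in>C. (P, Q) \<in> r"
  using assms(2,3,4)
proof (induction C rule: finite_ne_induct)
  case (singleton P)
  then show ?case using assms(1) by (auto simp: order_on_defs refl_on_def)
next
  case (insert x C)
  then obtain P where P: "P \<in> C" "\<forall>Q\<in>C. (P, Q) \<in> r" by auto
  have x: "x \<in> A" "P \<in> A" using insert P by auto
  then have *: "(x, P) \<in> r \<or> (P, x) \<in> r" "(x, x) \<in> r"
    using assms(1) unfolding order_on_defs refl_on_def total_on_def by metis+
  have tr: "trans r" using assms(1) by (simp add: order_on_defs)
  show ?case
  proof (cases "(x, P) \<in> r")
    case True
    then have "\<forall>Q\<in>insert x C. (x, Q) \<in> r" using *(2) P(2) transD[OF tr True] by blast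
    then show ?thesis by blast
  next
    case False
    then have "\<forall>Q\<in>insert x C. (P, Q) \<in> r" using *(1) P(2) by blast
    then show ?thesis using P(1) by blast
  qed
qed

context arc
begin

text \<open>The place at which the operator \<open>A\<^sup>*\<close> joins strands.\<close>

definition first_place :: "'i pair_ordering \<Rightarrow> 'i hdata \<Rightarrow> 'i point" where
  "first_place ord d = (THE p. p \<in> fibre Z (first_on_on_once_occupied Z ord d) \<and> once_occupied_at Z p d)"

lemma once_occupied_unique:
  assumes "p \<in> places Z" "q \<in> places Z" "pairing Z q = pairing Z p" "once_occupied_at Z p d" "once_occupied_at Z q d"
  shows "q = p"
  using assms same_pair[of p q] unfolding once_occupied_iff by fastforce

lemma first_place:
  assumes ord: "pair_ordering Z ord" and tw: "twisted_places d \<noteq> {}"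
  shows "first_place ord d \<in> twisted_places d"
    "first_on_on_once_occupied Z ord d = pairing Z (first_place ord d)"
proof -
  let ?C = "{P \<in> pairs Z. on_on P d \<and> (\<exists>p\<in>fibre Z P. once_occupied_at Z p d)}"
  have C: "?C = pairing Z ` twisted_places d"
    unfolding twisted_places_def using pairing_in by (auto simp: fibre_iff)
  have lin: "linear_order_on (pairs Z) (pair_order ord)" using ord by (simp add: pair_ordering_def)
  have "finite ?C" "?C \<subseteq> pairs Z" by auto
  moreover have "?C \<noteq> {}" unfolding C using tw by blast
  ultimately obtain P where P: "P \<in> ?C" "\<forall>Q\<in>?C. (P, Q) \<in> pair_order ord"
    using least_in_linear_order[OF lin, of ?C] by blast
  have "first_on_on_once_occupied Z ord d = P"
    unfolding first_on_on_once_occupied_def Let_def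
  proof (rule the_equality)
    show "P \<in> ?C \<and> (\<forall>Q\<in>?C. (P, Q) \<in> pair_order ord)" using P by blast
    show "P' = P" if "P' \<in> ?C \<and> (\<forall>Q\<in>?C. (P', Q) \<in> pair_order ord)" for P'
      using that P lin unfolding order_on_defs by (meson antisymD)
  qed
  note first = this
  obtain p where p: "p \<in> twisted_places d" "P = pairing Z p" using P(1) unfolding C by blast
  then have p': "p \<in> places Z" "once_occupied_at Z p d" by (auto simp: twisted_places_def)
  have "first_place ord d = p"
    unfolding first_place_def first p(2)
    using p' once_occupied_unique[OF p'(1)] by (intro the_equality) (auto simp: fibre_iff)
  then show "first_place ord d \<in> twisted_places d"
    "first_on_on_once_occupied Z ord d = pairing Z (first_place ord d)" using p first by auto
qed

text \<open>
  By \<open>crossed_at_iff\<close>, the diagrams which are crossed at the first pair are those which are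
  not broken at its occupied place.
\<close>

lemma A_star_diagram_dia:
  assumes ord: "pair_ordering Z ord" and tw: "twisted_places d \<noteq> {}" and u: "undoubled d" and \<mu>: "\<mu> \<in> dgs d"
  shows "A_star_diagram Z ord (dia d \<mu>) =
    (if first_place ord d \<in> broken \<mu> then dia d (join_at \<mu> (first_place ord d)) else 0)"
proof -
  let ?p = "first_place ord d"
  note fp = first_place[OF ord tw]
  have p: "?p \<in> places Z" using fp(1) by (simp add: twisted_places_def)
  have "twisted_places d \<inter> fibre Z (pairing Z ?p) = {?p}"
  proof (intro equalityI subsetI)
    fix q assume "q \<in> twisted_places d \<inter> fibre Z (pairing Z ?p)"
    then have "q \<in> places Z" "pairing Z q = pairing Z ?p" "once_occupied_at Z q d"
      by (auto simp: twisted_places_def fibre_iff)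
    then show "q \<in> {?p}" using once_occupied_unique[OF p, of q d] fp(1) unfolding twisted_places_def by blast
  qed (use fp(1) p in \<open>auto simp: fibre_iff\<close>)
  then have crossed: "crossed_at Z (pairing Z ?p) (dia d \<mu>) \<longleftrightarrow> ?p \<notin> broken \<mu>"
    using crossed_at_iff[OF pairing_in[OF p] \<mu> u] by auto
  have "diag Z (fst (snd d)) (\<mu> - {(THE x. (x, ?p) \<in> \<mu>, ?p), (?p, THE y. (?p, y) \<in> \<mu>)} \<union>
      {(THE x. (x, ?p) \<in> \<mu>, THE y. (?p, y) \<in> \<mu>)}) (snd (snd d)) = dia d (join_at \<mu> ?p)"
    if b: "?p \<in> broken \<mu>"
  proof -
    obtain x y where xy: "(x, ?p) \<in> \<mu>" "(?p, y) \<in> \<mu>" using b unfolding broken_def by blast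
    note sd = moving_diagram[OF dgsD(3)[OF \<mu>]]
    have "(THE x. (x, ?p) \<in> \<mu>) = x" "(THE y. (?p, y) \<in> \<mu>) = y"
      using xy strand_diagram_inj[OF sd] strand_diagram_fun[OF sd] by blast+
    then show ?thesis using join_at_eq[OF dgsD(3)[OF \<mu>] xy] by (simp add: dia_def)
  qed
  moreover have "(THE p. p \<in> fibre Z (first_on_on_once_occupied Z ord d) \<and> once_occupied_at Z p d) = ?p"
    by (simp only: first_place_def)
  ultimately show ?thesis
    unfolding A_star_diagram_def presentation_dia[OF \<mu>] hdata_dia[OF \<mu>] Let_def prod.case
    by (simp only: fp(2) crossed) simp
qed

text \<open>
  The diagrams whose terms all occur in an element \<open>a\<close> with given viable H-data are those of
  the expansion of \<open>a\<close>.
\<close>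

lemma A_star_alg_part:
  assumes ord: "pair_ordering Z ord" and tw: "twisted_places d \<noteq> {}" and u: "undoubled d"
    and v: "viable_chain Z (fst d)" and a: "a \<in> alg_part Z d"
  shows "A_star Z ord a = extend_strands
    (\<lambda>\<mu>. if first_place ord d \<in> broken \<mu> then dia d (join_at \<mu> (first_place ord d)) else 0) a"
proof -
  note K = alg_partE[OF v a]
  have ka: "ks a = (\<Union>\<mu>\<in>support a. ks (dia d \<mu>))"
    by (subst K(2)) (rule ks_sum_dia[OF K(1)])
  have set: "{D. diagram Z D \<and> ks D \<subseteq> ks a} = dia d ` support a"
  proof (intro equalityI subsetI)
    fix D assume D: "D \<in> {D. diagram Z D \<and> ks D \<subseteq> ks a}"
    then obtain s \<nu> t where g: "good s \<nu> t" "D = diag Z s \<nu> t" by (auto simp: diagram_iff)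
    obtain \<phi> where \<phi>: "\<phi> \<in> ks D" using good_keys_nonempty g by blast
    then obtain \<mu> where \<mu>: "\<mu> \<in> support a" "\<phi> \<in> ks (dia d \<mu>)" using D ka by blast
    have \<mu>d: "\<mu> \<in> dgs d" using \<mu>(1) K(1) by blast
    have "s = fst (snd d)" "\<nu> = \<mu>" "t = snd (snd d)"
      using key_props(1-3)[OF g(1)] key_props(1-3)[OF dgsD(1)[OF \<mu>d]] \<phi> \<mu>(2) g(2) unfolding dia_def by metis+
    then show "D \<in> dia d ` support a" using \<mu>(1) g(2) by (simp add: dia_def)
  next
    fix D assume "D \<in> dia d ` support a"
    then obtain \<mu> where \<mu>: "\<mu> \<in> support a" "D = dia d \<mu>" by blast
    then show "D \<in> {D. diagram Z D \<and> ks D \<subseteq> ks a}" using diagram_dia K(1) ka by blast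
  qed
  have "inj_on (dia d) (support a)" using K(1) dia_inj by (meson inj_onI subsetD)
  then have "A_star Z ord a = (\<Sum>\<mu>\<in>support a. A_star_diagram Z ord (dia d \<mu>))"
    unfolding A_star_def set by (simp add: sum.reindex)
  also have "\<dots> = (\<Sum>\<mu>\<in>support a. if first_place ord d \<in> broken \<mu> then dia d (join_at \<mu> (first_place ord d)) else 0)"
    using K(1) A_star_diagram_dia[OF ord tw u] by (intro sum.cong) auto
  finally show ?thesis by (simp add: extend_strands_def)
qed

context
  fixes ord d
  assumes ord: "pair_ordering Z ord" and tw: "twisted_places d \<noteq> {}" and u: "undoubled d"
    and v: "viable_chain Z (fst d)"
begin

lemma A_star_sum:
  assumes "\<And>i. i \<in> I \<Longrightarrow> a i \<in> alg_part Z d"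
  shows "A_star Z ord (\<Sum>i\<in>I. a i) = (\<Sum>i\<in>I. A_star Z ord (a i))"
proof -
  have "(\<Sum>i\<in>I. a i) \<in> alg_part Z d" using assms by (rule alg_part_sum)
  then have "A_star Z ord (\<Sum>i\<in>I. a i) = (\<Sum>i\<in>I. extend_strands
      (\<lambda>\<mu>. if first_place ord d \<in> broken \<mu> then dia d (join_at \<mu> (first_place ord d)) else 0) (a i))"
    by (subst A_star_alg_part[OF ord tw u v]) (simp_all add: extend_strands_sum[OF v assms])
  also have "\<dots> = (\<Sum>i\<in>I. A_star Z ord (a i))"
    using assms A_star_alg_part[OF ord tw u v] by (intro sum.cong) auto
  finally show ?thesis .
qed

lemma A_star_add:
  "a \<in> alg_part Z d \<Longrightarrow> b \<in> alg_part Z d \<Longrightarrow> A_star Z ord (a + b) = A_star Z ord a + A_star Z ord b"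
  using A_star_alg_part[OF ord tw u v] extend_strands_add[OF v] alg_part_add by simp

lemma A_star_0: "A_star Z ord 0 = 0"
  using A_star_alg_part[OF ord tw u v alg_part_0] by simp

lemma A_star_dia:
  "\<mu> \<in> dgs d \<Longrightarrow> A_star Z ord (dia d \<mu>) =
    (if first_place ord d \<in> broken \<mu> then dia d (join_at \<mu> (first_place ord d)) else 0)"
  using A_star_alg_part[OF ord tw u v dia_alg_part] by (simp add: extend_strands_dia)

lemma A_star_expand:
  "a \<in> alg_part Z d \<Longrightarrow> A_star Z ord a =
    (\<Sum>\<mu>\<in>{\<mu> \<in> support a. first_place ord d \<in> broken \<mu>}. dia d (join_at \<mu> (first_place ord d)))"
  using A_star_alg_part[OF ord tw u v] finite_subset[OF alg_partE(1)[OF v] finite_dgs]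
  by (simp add: extend_strands_def sum.inter_filter)

text \<open>After joining, no diagram is broken at the first twisted place any more.\<close>

lemma A_star_A_star:
  assumes "a \<in> alg_part Z d"
  shows "A_star Z ord (A_star Z ord a) = 0"
proof -
  let ?p = "first_place ord d"
  have j: "join_at \<mu> ?p \<in> dgs d" "?p \<notin> broken (join_at \<mu> ?p)" if "\<mu> \<in> {\<mu> \<in> support a. ?p \<in> broken \<mu>}" for \<mu>
  proof -
    have "\<mu> \<in> dgs d" "?p \<in> broken \<mu>" using that alg_partE(1)[OF v assms] by blast+
    then show "join_at \<mu> ?p \<in> dgs d" "?p \<notin> broken (join_at \<mu> ?p)" using join_dgs by auto
  qed
  show ?thesis
    unfolding A_star_expand[OF assms]
    by (subst A_star_sum) (use j dia_alg_part A_star_dia in \<open>auto intro!: sum.neutral\<close>)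
qed

end

section \<open>Tensor products\<close>

abbreviation td :: "'i alg set list \<Rightarrow> 'i hdata" where "td \<equiv> tensor_hdata Z"

text \<open>
  The tensor products under consideration: viable, with nonzero classes of diagrams as factors, and
  without on-on doubly occupied pairs.
\<close>

definition admissible :: "'i alg set list \<Rightarrow> bool" where
  "admissible M \<longleftrightarrow> M \<noteq> [] \<and> set M \<subseteq> diagram_classes Z \<and> viable_tensor Z M \<and> undoubled (td M)"

text \<open>The places whose outgoing step is covered by an earlier factor than their incoming step.\<close>

definition inverted :: "'i alg set list \<Rightarrow> 'i point set" where
  "inverted M = {p \<in> places Z. \<exists>A B. M = A @ B \<and> fst (td A) p = 1 \<and> fst (td B) (step_before p) = 1}"

text \<open>
  In the product of a diagram for \<open>A\<close> with one for \<open>B\<close>, these are the places at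
  which a strand of the first begins and a strand of the second ends, so that the product is broken there,
  see \<open>Domain_Int_Range\<close>.
\<close>

definition inverted_between :: "'i alg set list \<Rightarrow> 'i alg set list \<Rightarrow> 'i point set" where
  "inverted_between A B = {p \<in> places Z. fst (td A) p = 1 \<and> fst (td B) (step_before p) = 1}"

lemma td_append_chain: "fst (td (A @ B)) z = fst (td A) z + fst (td B) z"
  by (simp add: tensor_hdata_def)

lemma td_append_start: "A \<noteq> [] \<Longrightarrow> fst (snd (td (A @ B))) = fst (snd (td A))"
  by (simp add: tensor_hdata_def)

lemma td_append_end: "B \<noteq> [] \<Longrightarrow> snd (snd (td (A @ B))) = snd (snd (td B))"
  by (simp add: tensor_hdata_def)

lemma td_single: "td [c] = class_hdata Z c"
  by (simp add: tensor_hdata_def)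

lemma td_Nil_chain: "fst (td []) z = 0"
  by (simp add: tensor_hdata_def)

lemma diagram_class_hdataE:
  assumes "c \<in> diagram_classes Z"
  obtains D where "diagram Z D" "diff D = 0" "cls Z D \<noteq> cls Z 0" "c = cls Z D" "class_hdata Z c = hdata Z D"
proof -
  obtain D where D: "diagram Z D" "diff D = 0" "cls Z D \<noteq> cls Z 0" "c = cls Z D"
    using assms unfolding diagram_classes_def by blast
  have "D \<in> alg_part Z (hdata Z D)" unfolding alg_part_def using D(1) by (intro span2_base) simp
  then show ?thesis using that D class_hdata_eq by blast
qed

lemma class_chain_bounds:
  assumes "c \<in> diagram_classes Z"
  shows "0 \<le> fst (class_hdata Z c) z" "z \<notin> steps Z \<Longrightarrow> fst (class_hdata Z c) z = 0"
proof -
  obtain D where D: "diagram Z D" "class_hdata Z c = hdata Z D" using diagram_class_hdataE[OF assms] by blast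
  obtain s \<mu> t where g: "good s \<mu> t" "D = diag Z s \<mu> t" using D(1) by (auto simp: diagram_iff)
  note sd = moving_diagram[OF goodD(3)[OF g(1)]]
  have h: "fst (class_hdata Z c) z = int (card {a \<in> \<mu>. covers a z})"
    using D(2) g hdata_diag strand_chain_card[OF finite_strands[OF sd]] by simp
  then show "0 \<le> fst (class_hdata Z c) z" by simp
  assume z: "z \<notin> steps Z"
  have "\<not> covers a z" if "a \<in> \<mu>" for a
  proof
    assume c: "covers a z"
    obtain x y where a: "a = (x, y)" by (cases a)
    then have "y \<in> points Z" using strand_diagram_points[OF sd] that by blast
    then show False using z c a by (cases y; cases z) (auto simp: covers_iff points_def steps_def)
  qed
  then show "fst (class_hdata Z c) z = 0" using h by (metis (no_types, lifting) Collect_empty_eq card.empty int_ops(1))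
qed

lemma td_nonneg: "set M \<subseteq> diagram_classes Z \<Longrightarrow> 0 \<le> fst (td M) z"
  unfolding tensor_hdata_def using class_chain_bounds(1)[of _ z] by (induction M) auto

lemma td_outside: "set M \<subseteq> diagram_classes Z \<Longrightarrow> z \<notin> steps Z \<Longrightarrow> fst (td M) z = 0"
  unfolding tensor_hdata_def using class_chain_bounds(2)[of _ z] by (induction M) auto

lemma td_le_1:
  assumes "set M \<subseteq> diagram_classes Z" "viable_chain Z (fst (td M))"
  shows "fst (td M) z \<le> 1"
  using assms td_outside[of M z] unfolding viable_chain_def by (cases "z \<in> steps Z") auto

lemma mismatch_append:
  assumes "A \<noteq> []" "B \<noteq> []"
  shows "mismatch Z (A @ B) \<longleftrightarrow> mismatch Z A \<or> mismatch Z B \<or> snd (snd (td A)) \<noteq> fst (snd (td B))"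
proof -
  let ?m = "\<lambda>c c'. snd (snd (class_hdata Z c)) \<noteq> fst (snd (class_hdata Z c'))"
  have mm: "mismatch Z (c # L) \<longleftrightarrow> (L \<noteq> [] \<and> ?m c (hd L)) \<or> mismatch Z L" for c L
  proof
    assume "mismatch Z (c # L)"
    then obtain i where i: "Suc i < length (c # L)" "?m ((c # L) ! i) ((c # L) ! Suc i)"
      unfolding mismatch_def by blast
    show "(L \<noteq> [] \<and> ?m c (hd L)) \<or> mismatch Z L"
    proof (cases i)
      case 0
      then show ?thesis using i by (cases L) auto
    next
      case (Suc k)
      then have "mismatch Z L" using i unfolding mismatch_def by (intro exI[of _ k]) simp
      then show ?thesis ..
    qed
  next
    assume "(L \<noteq> [] \<and> ?m c (hd L)) \<or> mismatch Z L"
    then show "mismatch Z (c # L)"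
    proof
      assume "L \<noteq> [] \<and> ?m c (hd L)"
      then show ?thesis unfolding mismatch_def by (intro exI[of _ 0]) (cases L, auto)
    next
      assume "mismatch Z L"
      then obtain i where "Suc i < length L" "?m (L ! i) (L ! Suc i)" unfolding mismatch_def by blast
      then show ?thesis unfolding mismatch_def by (intro exI[of _ "Suc i"]) simp
    qed
  qed
  have nil: "\<not> mismatch Z []" by (simp add: mismatch_def)
  show ?thesis using assms(1)
  proof (induction A)
    case (Cons c A)
    show ?case
    proof (cases "A = []")
      case True
      then show ?thesis using assms(2) nil by (auto simp: mm tensor_hdata_def)
    next
      case False
      then have "mismatch Z (A @ B) \<longleftrightarrow> mismatch Z A \<or> mismatch Z B \<or> snd (snd (td A)) \<noteq> fst (snd (td B))"
        using Cons by simp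
      moreover have "snd (snd (td (c # A))) = snd (snd (td A))" using False by (simp add: tensor_hdata_def)
      ultimately show ?thesis using False by (auto simp: mm)
    qed
  qed simp
qed

text \<open>
  No strand acts at \<open>P\<close>, hence \<open>P\<close> is on at both ends or at neither.
\<close>

definition idle :: "nat \<Rightarrow> 'i hdata \<Rightarrow> bool" where
  "idle P d \<longleftrightarrow> (\<forall>p\<in>fibre Z P. fst d p = 0 \<and> fst d (step_before p) = 0)"

lemma class_dgs:
  assumes "c \<in> diagram_classes Z" "viable_chain Z (fst (class_hdata Z c))"
  shows "dgs (class_hdata Z c) \<noteq> {}"
proof -
  obtain D where D: "diagram Z D" "class_hdata Z c = hdata Z D" using diagram_class_hdataE[OF assms(1)] by blast
  then show ?thesis using diagram_hdataE[OF D(1)] assms(2) by (metis empty_iff)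
qed

lemma idle_dgs:
  assumes "\<mu> \<in> dgs d" "idle P d"
  shows "P \<in> fst (snd d) \<longleftrightarrow> P \<in> snd (snd d)"
proof -
  have "p \<notin> Domain \<mu> \<and> p \<notin> Range \<mu>" if "p \<in> fibre Z P" for p
    using dgs_Domain[OF assms(1), of p] dgs_Range[OF assms(1), of p] assms(2) that by (auto simp: idle_def)
  then show ?thesis using dgs_horizontal[OF assms(1), of P] by blast
qed

lemma viable_sublist:
  assumes "set (A @ B) \<subseteq> diagram_classes Z" "viable_chain Z (fst (td (A @ B)))"
  shows "viable_chain Z (fst (td A))" "viable_chain Z (fst (td B))"
proof -
  have "0 \<le> fst (td A) z" "0 \<le> fst (td B) z" "fst (td A) z + fst (td B) z \<le> 1" for z
    using assms td_nonneg[of A z] td_nonneg[of B z] td_le_1[of "A @ B" z] td_append_chain[of A B z] by auto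
  then show "viable_chain Z (fst (td A))" "viable_chain Z (fst (td B))"
    unfolding viable_chain_def by (smt (verit, ccfv_threshold) insert_iff)+
qed

lemma idle_append:
  assumes "set (A @ B) \<subseteq> diagram_classes Z"
  shows "idle P (td (A @ B)) \<longleftrightarrow> idle P (td A) \<and> idle P (td B)"
proof -
  have "fst (td (A @ B)) z = 0 \<longleftrightarrow> fst (td A) z = 0 \<and> fst (td B) z = 0" for z
    using assms td_nonneg[of A z] td_nonneg[of B z] td_append_chain[of A B z] by auto
  then show ?thesis unfolding idle_def by blast
qed

lemma idle_list:
  assumes "M \<noteq> []" "set M \<subseteq> diagram_classes Z" "viable_tensor Z M" "idle P (td M)"
  shows "P \<in> fst (snd (td M)) \<longleftrightarrow> P \<in> snd (snd (td M))"
  using assms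
proof (induction M)
  case (Cons c M)
  have v: "viable_chain Z (fst (td (c # M)))" "\<not> mismatch Z (c # M)" using Cons.prems by (auto simp: viable_tensor_def)
  have vs: "viable_chain Z (fst (td [c]))" "viable_chain Z (fst (td M))"
    using viable_sublist[of "[c]" M] Cons.prems v by auto
  obtain \<mu> where \<mu>: "\<mu> \<in> dgs (class_hdata Z c)"
    using class_dgs[of c] Cons.prems vs(1) unfolding td_single by auto
  have id: "idle P (td [c])" "idle P (td M)" using idle_append[of "[c]" M P] Cons.prems by auto
  have 1: "P \<in> fst (snd (td [c])) \<longleftrightarrow> P \<in> snd (snd (td [c]))"
    using idle_dgs[OF \<mu>] id(1) unfolding td_single by blast
  show ?case
  proof (cases "M = []")
    case False
    have "\<not> mismatch Z M" "snd (snd (td [c])) = fst (snd (td M))"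
      using mismatch_append[of "[c]" M] False v(2) by auto
    then show ?thesis
      using 1 Cons.IH[OF False] Cons.prems vs id td_append_start[of "[c]" M] td_append_end[of M "[c]"] False
      by (auto simp: viable_tensor_def)
  qed (use 1 in simp)
qed simp

text \<open>
  If \<open>A\<close> covers all steps at a pair then \<open>B\<close> covers none, so it leaves the pair
  on or off as it is; likewise with \<open>A\<close> and \<open>B\<close> exchanged.
\<close>

lemma undoubled_sublist:
  assumes ne: "A \<noteq> []" "B \<noteq> []" and cl: "set (A @ B) \<subseteq> diagram_classes Z" and v: "viable_tensor Z (A @ B)"
    and u: "undoubled (td (A @ B))"
  shows "undoubled (td A)" "undoubled (td B)"
proof -
  have vt: "viable_tensor Z A" "viable_tensor Z B" "snd (snd (td A)) = fst (snd (td B))"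
    using v viable_sublist[OF cl] mismatch_append[OF ne] by (auto simp: viable_tensor_def)
  have b: "0 \<le> fst (td A) z" "0 \<le> fst (td B) z" "fst (td A) z + fst (td B) z \<le> 1" for z
    using cl v td_nonneg[of A z] td_nonneg[of B z] td_le_1[OF cl, of z] td_append_chain[of A B z]
    by (auto simp: viable_tensor_def)
  have iff: "doubly_occupied Z P d \<longleftrightarrow> (\<forall>p\<in>fibre Z P. fst d (step_before p) = 1 \<and> fst d p = 1)" for P d
    by (simp add: doubly_occupied_def case_prod_beta)
  have A: "idle P (td B)" "doubly_occupied Z P (td (A @ B))" if "doubly_occupied Z P (td A)" for P
    unfolding iff idle_def using that b unfolding iff td_append_chain by (smt (verit))+
  have B: "idle P (td A)" "doubly_occupied Z P (td (A @ B))" if "doubly_occupied Z P (td B)" for P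
    unfolding iff idle_def using that b unfolding iff td_append_chain by (smt (verit))+
  note se = td_append_start[OF ne(1), of B] td_append_end[OF ne(2), of A]
  show "undoubled (td A)"
    using u A idle_list[OF ne(2) _ vt(2)] cl vt(3) unfolding undoubled_def on_on_iff se by auto
  show "undoubled (td B)"
    using u B idle_list[OF ne(1) _ vt(1)] cl vt(3) unfolding undoubled_def on_on_iff se by auto
qed

lemma admissible_append:
  assumes "admissible (A @ B)" "A \<noteq> []" "B \<noteq> []"
  shows "admissible A" "admissible B" "snd (snd (td A)) = fst (snd (td B))"
  using assms undoubled_sublist[OF assms(2,3)] viable_sublist[of A B] mismatch_append[OF assms(2,3)]
  by (auto simp: admissible_def viable_tensor_def)

lemma admissible_01:
  assumes "admissible (A @ B)"
  shows "0 \<le> fst (td A) z" "0 \<le> fst (td B) z" "fst (td A) z + fst (td B) z \<le> 1"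
  using assms td_nonneg[of A z] td_nonneg[of B z] td_le_1[of "A @ B" z] td_append_chain[of A B z]
  by (auto simp: admissible_def viable_tensor_def)

lemma admissible_viable: "admissible M \<Longrightarrow> viable_chain Z (fst (td M))"
  by (simp add: admissible_def viable_tensor_def)

lemma admissible_undoubled: "admissible M \<Longrightarrow> undoubled (td M)"
  by (simp add: admissible_def)

lemma singular_iff:
  assumes "viable_chain Z (fst (td M))"
  shows "singular_tensor Z M \<longleftrightarrow> dgs (td M) = {}"
proof
  assume s: "singular_tensor Z M"
  show "dgs (td M) = {}"
  proof (rule ccontr)
    assume "dgs (td M) \<noteq> {}"
    then obtain \<mu> where "\<mu> \<in> dgs (td M)" by blast
    then show False using s dia_alg_part dia_nonzero unfolding singular_tensor_def by blast
  qed
next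
  assume "dgs (td M) = {}"
  then show "singular_tensor Z M" unfolding singular_tensor_def alg_part_eq[OF assms] by auto
qed

lemma finite_inverted: "finite (inverted M)" "finite (inverted_between A B)"
  using finite_places by (auto simp: inverted_def inverted_between_def)

text \<open>
  The two steps at an inverted place are covered by two different factors, which belong both to
  \<open>A\<close>, both to \<open>B\<close>, or to one each.
\<close>

lemma inverted_append:
  assumes "admissible (A @ B)"
  shows "inverted (A @ B) = inverted A \<union> inverted B \<union> inverted_between A B"
proof (intro equalityI subsetI)
  note b = admissible_01[OF assms]
  have cl: "set A \<subseteq> diagram_classes Z" "set B \<subseteq> diagram_classes Z" using assms by (auto simp: admissible_def)
  fix p assume "p \<in> inverted (A @ B)"
  then obtain C D where p: "p \<in> places Z" "A @ B = C @ D" "fst (td C) p = 1" "fst (td D) (step_before p) = 1"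
    unfolding inverted_def by blast
  from p(2) obtain us where us: "A = C @ us \<and> us @ B = D \<or> A @ us = C \<and> B = us @ D"
    unfolding append_eq_append_conv2 by blast
  then show "p \<in> inverted A \<union> inverted B \<union> inverted_between A B"
  proof
    assume us: "A = C @ us \<and> us @ B = D"
    then have "set C \<subseteq> diagram_classes Z" "set us \<subseteq> diagram_classes Z" using cl by auto
    then have "0 \<le> fst (td us) z" for z using td_nonneg by blast
    then have "fst (td us) (step_before p) = 1 \<or> fst (td B) (step_before p) = 1" "fst (td A) p = 1"
      using us p(3,4) b td_append_chain[of us B] td_append_chain[of C us] by (smt (verit))+
    then show ?thesis using us p unfolding inverted_def inverted_between_def by blast
  next
    assume us: "A @ us = C \<and> B = us @ D"
    then have "set D \<subseteq> diagram_classes Z" "set us \<subseteq> diagram_classes Z" using cl by auto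
    then have "0 \<le> fst (td us) z" for z using td_nonneg by blast
    then have "fst (td us) p = 1 \<or> fst (td A) p = 1" "fst (td B) (step_before p) = 1"
      using us p(3,4) b td_append_chain[of A us] td_append_chain[of us D] by (smt (verit))+
    then show ?thesis using us p unfolding inverted_def inverted_between_def by blast
  qed
next
  note b = admissible_01[OF assms]
  fix p assume "p \<in> inverted A \<union> inverted B \<union> inverted_between A B"
  then consider C D where "p \<in> places Z" "A = C @ D" "fst (td C) p = 1" "fst (td D) (step_before p) = 1"
    | C D where "p \<in> places Z" "B = C @ D" "fst (td C) p = 1" "fst (td D) (step_before p) = 1"
    | "p \<in> inverted_between A B" unfolding inverted_def by blast
  then show "p \<in> inverted (A @ B)"
  proof cases
    case 1
    have "admissible (C @ D @ B)" using assms 1(2) by simp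
    then have "fst (td C) z + fst (td (D @ B)) z \<le> 1" "0 \<le> fst (td C) z" for z using admissible_01[of C "D @ B"] by auto
    then have "fst (td (D @ B)) (step_before p) = 1"
      using 1(4) b(2) td_append_chain[of D B "step_before p"] by (smt (verit))
    moreover have "A @ B = C @ (D @ B)" using 1 by simp
    ultimately show ?thesis unfolding inverted_def using 1 by blast
  next
    case 2
    have "admissible ((A @ C) @ D)" using assms 2(2) by simp
    then have "fst (td (A @ C)) z + fst (td D) z \<le> 1" "0 \<le> fst (td D) z" for z
      using admissible_01[of "A @ C" D] by auto
    then have "fst (td (A @ C)) p = 1"
      using 2(3) b(1) td_append_chain[of A C p] by (smt (verit))
    moreover have "A @ B = (A @ C) @ D" using 2 by simp
    ultimately show ?thesis unfolding inverted_def using 2 by blast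
  next
    case 3
    then show ?thesis unfolding inverted_def inverted_between_def by blast
  qed
qed

lemma inverted_occupied:
  assumes "admissible M" "p \<in> inverted M"
  shows "p \<in> places Z" "fst (td M) p = 1" "fst (td M) (step_before p) = 1"
proof -
  obtain A B where p: "p \<in> places Z" "M = A @ B" "fst (td A) p = 1" "fst (td B) (step_before p) = 1"
    using assms(2) unfolding inverted_def by blast
  then have "admissible (A @ B)" using assms(1) by simp
  from admissible_01[OF this] show "p \<in> places Z" "fst (td M) p = 1" "fst (td M) (step_before p) = 1"
    using p td_append_chain[of A B] by (smt (verit))+
qed

text \<open>The three parts are disjoint, since each step is covered only once.\<close>

lemma card_inverted_append:
  assumes "admissible (A @ B)" "A \<noteq> []" "B \<noteq> []"
  shows "card (inverted (A @ B)) = card (inverted A) + card (inverted B) + card (inverted_between A B)"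
proof -
  note ad = admissible_append[OF assms] and b = admissible_01[OF assms(1)]
  have no: "\<not> (fst (td A) z = 1 \<and> fst (td B) z = 1)" for z using b(3)[of z] by auto
  have "inverted A \<inter> inverted B = {}" "(inverted A \<union> inverted B) \<inter> inverted_between A B = {}"
    using inverted_occupied[OF ad(1)] inverted_occupied[OF ad(2)] no unfolding inverted_between_def by blast+
  then show ?thesis unfolding inverted_append[OF assms(1)] by (simp add: card_Un_disjoint finite_inverted)
qed

lemma inverted_single: "inverted [c] = {}"
proof -
  have "\<not> (fst (td A) p = 1 \<and> fst (td B) (step_before p) = 1)" if "[c] = A @ B" for A B p
    using that td_Nil_chain by (cases A) auto
  then show ?thesis unfolding inverted_def by blast
qed

end

context arc
begin

lemma td_Cons_chain: "fst (td (c # M)) z = fst (class_hdata Z c) z + fst (td M) z"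
  by (simp add: tensor_hdata_def)

lemma inverted_append_occupied:
  assumes ad: "admissible (A @ B)" and p: "p \<in> inverted (A @ B)"
  shows "p \<in> inverted A \<and> A \<noteq> [] \<or> fst (td B) (step_before p) = 1"
    "p \<in> inverted B \<and> B \<noteq> [] \<or> fst (td A) p = 1"
proof -
  have nil: "inverted [] = {}" by (auto simp: inverted_def td_Nil_chain)
  have "fst (td B) (step_before p) = 1" if "p \<in> inverted B"
  proof (cases "A = []")
    case True
    then show ?thesis using inverted_occupied(3)[of B p] ad that by simp
  next
    case False
    have "B \<noteq> []" using that nil by blast
    then show ?thesis using inverted_occupied(3)[OF admissible_append(2)[OF ad False] that] by simp
  qed
  moreover have "fst (td A) p = 1" if "p \<in> inverted A"
  proof (cases "B = []")
    case True
    then show ?thesis using inverted_occupied(2)[of A p] ad that by simp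
  next
    case False
    have "A \<noteq> []" using that nil by blast
    then show ?thesis using inverted_occupied(2)[OF admissible_append(1)[OF ad _ False] that] by simp
  qed
  moreover have "p \<in> inverted A \<or> p \<in> inverted B \<or> p \<in> inverted_between A B"
    using p unfolding inverted_append[OF ad] by blast
  ultimately show "p \<in> inverted A \<and> A \<noteq> [] \<or> fst (td B) (step_before p) = 1"
    "p \<in> inverted B \<and> B \<noteq> [] \<or> fst (td A) p = 1"
    using nil unfolding inverted_between_def by blast+
qed

text \<open>
  If both places of a pair are inverted, then the first factor that acts at the pair covers none of the
  incoming steps, hence a strand starts there; likewise a strand of the last such factor ends there.
\<close>

lemma inverted_pair_start:
  "admissible M \<Longrightarrow> {p, q} \<subseteq> inverted M \<Longrightarrow> fibre Z P = {p, q} \<Longrightarrow> P \<in> fst (snd (td M))"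
proof (induction M)
  case (Cons c M)
  show ?case
  proof (cases "M = []")
    case True
    then show ?thesis using Cons.prems(2) inverted_single by auto
  next
    case False
    have ad: "admissible ([c] @ M)" and c: "[c] \<noteq> []" using Cons.prems(1) by simp_all
    note adm = admissible_append[OF ad c False] and b = admissible_01[OF ad]
    have fib: "r \<in> places Z" "pairing Z r = P" if "r \<in> {p, q}" for r
      using that Cons.prems(3) fibre_iff[of r P] by auto
    have st: "fst (snd (td (c # M))) = fst (snd (td [c]))" using td_append_start[OF c, of M] by simp
    have zero: "fst (td [c]) (step_before r) = 0" if "r \<in> {p, q}" for r
      using inverted_append_occupied(1)[OF ad, of r] Cons.prems(2) that inverted_single
        b(1,3)[of "step_before r"] by auto
    obtain \<mu> where \<mu>: "\<mu> \<in> dgs (td [c])"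
      using class_dgs[of c] adm(1) by (auto simp: admissible_def viable_tensor_def td_single)
    show ?thesis
    proof (cases "\<exists>r\<in>{p, q}. fst (td [c]) r = 1")
      case True
      then obtain r where r: "r \<in> {p, q}" "fst (td [c]) r = 1" by blast
      then have "r \<in> Domain \<mu>" using dgs_start(1)[OF \<mu> r(2)] zero[OF r(1)] by (metis zero_neq_one)
      then show ?thesis using dgs_Domain_on[OF \<mu> _ fib(1)[OF r(1)]] fib(2)[OF r(1)] st by simp
    next
      case no: False
      have "{p, q} \<subseteq> inverted M"
        using inverted_append_occupied(2)[OF ad, of p] inverted_append_occupied(2)[OF ad, of q] Cons.prems(2) no
        by auto
      then have "P \<in> snd (snd (td [c]))" using Cons.IH adm(2,3) Cons.prems(3) by simp
      moreover have "idle P (td [c])"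
        using no zero dgs_01[OF \<mu>] Cons.prems(3) unfolding idle_def by metis
      ultimately show ?thesis using idle_dgs[OF \<mu>] st by simp
    qed
  qed
qed (simp add: admissible_def)

lemma inverted_pair_end:
  "admissible M \<Longrightarrow> {p, q} \<subseteq> inverted M \<Longrightarrow> fibre Z P = {p, q} \<Longrightarrow> P \<in> snd (snd (td M))"
proof (induction M rule: rev_induct)
  case (snoc c M)
  show ?case
  proof (cases "M = []")
    case True
    then show ?thesis using snoc.prems(2) inverted_single by auto
  next
    case False
    have ad: "admissible (M @ [c])" and c: "[c] \<noteq> []" using snoc.prems(1) by simp_all
    note adm = admissible_append[OF ad False c] and b = admissible_01[OF ad]
    have fib: "r \<in> places Z" "pairing Z r = P" if "r \<in> {p, q}" for r
      using that snoc.prems(3) fibre_iff[of r P] by auto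
    have st: "snd (snd (td (M @ [c]))) = snd (snd (td [c]))" by (rule td_append_end[OF c])
    have zero: "fst (td [c]) r = 0" if "r \<in> {p, q}" for r
      using inverted_append_occupied(2)[OF ad, of r] snoc.prems(2) that inverted_single b(2,3)[of r] by auto
    obtain \<mu> where \<mu>: "\<mu> \<in> dgs (td [c])"
      using class_dgs[of c] adm(2) by (auto simp: admissible_def viable_tensor_def td_single)
    show ?thesis
    proof (cases "\<exists>r\<in>{p, q}. fst (td [c]) (step_before r) = 1")
      case True
      then obtain r where r: "r \<in> {p, q}" "fst (td [c]) (step_before r) = 1" by blast
      then have "r \<in> Range \<mu>"
        using dgs_end(1)[OF \<mu> fib(1)[OF r(1)] r(2)] zero[OF r(1)] by (metis zero_neq_one)
      then show ?thesis using dgs_Range_on[OF \<mu> _ fib(1)[OF r(1)]] fib(2)[OF r(1)] st by simp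
    next
      case no: False
      have "{p, q} \<subseteq> inverted M"
        using inverted_append_occupied(1)[OF ad, of p] inverted_append_occupied(1)[OF ad, of q] snoc.prems(2) no
        by auto
      then have "P \<in> fst (snd (td [c]))" using snoc.IH adm(1,3) snoc.prems(3) by simp
      moreover have "idle P (td [c])"
        using no zero dgs_01[OF \<mu>] snoc.prems(3) unfolding idle_def by metis
      ultimately show ?thesis using idle_dgs[OF \<mu>] st by simp
    qed
  qed
qed (simp add: admissible_def)

text \<open>
  Hence counting inverted places is counting pairs: a pair with two inverted places would be on-on and
  doubly occupied.
\<close>

lemma inverted_inj:
  assumes ad: "admissible M"
  shows "inj_on (pairing Z) (inverted M)"
proof (rule inj_onI, rule ccontr)
  fix p q assume pq: "p \<in> inverted M" "q \<in> inverted M" "pairing Z p = pairing Z q" "p \<noteq> q"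
  let ?P = "pairing Z p"
  note op = inverted_occupied[OF ad pq(1)] and oq = inverted_occupied[OF ad pq(2)]
  have fib: "fibre Z ?P = {p, q}" using twin(4)[OF op(1)] same_pair[OF op(1) oq(1)] pq(3,4) by auto
  have "on_on ?P (td M)"
    using inverted_pair_start[OF ad _ fib] inverted_pair_end[OF ad _ fib] pq(1,2) by (simp add: on_on_iff)
  moreover have "doubly_occupied Z ?P (td M)"
    unfolding doubly_occupied_def case_prod_beta fib using op oq by simp
  ultimately show False using ad pairing_in[OF op(1)] unfolding admissible_def undoubled_def by blast
qed

section \<open>Products along tensor products\<close>

context
  fixes A B \<mu> \<nu>
  assumes ad: "admissible (A @ B)" and ne: "A \<noteq> []" "B \<noteq> []"
    and \<mu>: "\<mu> \<in> dgs (td A)" and \<nu>: "\<nu> \<in> dgs (td B)"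
begin

lemma chains_disjoint: "\<not> (fst (td A) z = 1 \<and> fst (td B) z = 1)"
  using admissible_01(3)[OF ad, of z] by auto

lemma composable_dgs: "composable Z \<mu> \<nu>"
  using dgsD[OF \<mu>] dgsD[OF \<nu>] chains_disjoint dgs_cov[OF \<mu>] dgs_cov[OF \<nu>] by unfold_locales blast+

lemma Domain_Int_Range: "Domain \<mu> \<inter> Range \<nu> = inverted_between A B"
proof (intro equalityI subsetI)
  fix x assume x: "x \<in> Domain \<mu> \<inter> Range \<nu>"
  then have "x \<in> places Z" using interior_place[OF dgsD(3)[OF \<mu>] dgsD(3)[OF \<nu>]] by blast
  then show "x \<in> inverted_between A B"
    using x dgs_Domain[OF \<mu>] dgs_Range[OF \<nu>] unfolding inverted_between_def by blast
next
  fix x assume "x \<in> inverted_between A B"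
  then have x: "x \<in> places Z" "fst (td A) x = 1" "fst (td B) (step_before x) = 1"
    unfolding inverted_between_def by blast+
  have "x \<in> Domain \<mu>" using dgs_start(1)[OF \<mu> x(2)] chains_disjoint x(3) by blast
  moreover have "x \<in> Range \<nu>" using dgs_end(1)[OF \<nu> x(1,3)] chains_disjoint x(2) by blast
  ultimately show "x \<in> Domain \<mu> \<inter> Range \<nu>" by blast
qed

lemma good_factors: "good (fst (snd (td A))) \<mu> (snd (snd (td A)))" "good (snd (snd (td A))) \<nu> (snd (snd (td B)))"
  using dgsD(1)[OF \<mu>] dgsD(1)[OF \<nu>] admissible_append(3)[OF ad ne] by simp_all

lemma dia_mul: "dia (td A) \<mu> \<odot> dia (td B) \<nu> = (if matched \<mu> \<nu> then dia (td (A @ B)) (concat_strands \<mu> \<nu>) else 0)"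
  using diag_mul_diag[OF good_factors composable_dgs] admissible_append(3)[OF ad ne]
    td_append_start[OF ne(1), of B] td_append_end[OF ne(2), of A]
  by (simp add: dia_def)

lemma concat_dgs:
  assumes "matched \<mu> \<nu>"
  shows "concat_strands \<mu> \<nu> \<in> dgs (td (A @ B))"
proof (rule dgsI)
  interpret composable Z \<mu> \<nu> by (rule composable_dgs)
  show "good (fst (snd (td (A @ B)))) (concat_strands \<mu> \<nu>) (snd (snd (td (A @ B))))"
    unfolding td_append_start[OF ne(1)] td_append_end[OF ne(2)]
    by (rule good_concat[OF good_factors composable_dgs assms])
  show "thin (concat_strands \<mu> \<nu>)" by (rule thin_concat)
  fix z
  show "fst (td (A @ B)) z = of_bool (cov (concat_strands \<mu> \<nu>) z)"
    unfolding td_append_chain cov_concat dgsD(4)[OF \<mu>] dgsD(4)[OF \<nu>] using disj[of z] by auto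
qed

lemma broken_concat_dgs:
  "broken (concat_strands \<mu> \<nu>) = broken \<mu> \<union> broken \<nu> \<union> inverted_between A B"
  using composable.broken_concat[OF composable_dgs] unfolding Domain_Int_Range .

lemma finite_broken: "finite (broken \<mu>)" "finite (broken \<nu>)"
  using finite_subset[OF _ finite_places] broken_place[OF \<mu>] broken_place[OF \<nu>] by blast+

lemma broken_occupied:
  "p \<in> broken \<mu> \<Longrightarrow> fst (td A) p = 1 \<and> fst (td A) (step_before p) = 1"
  "p \<in> broken \<nu> \<Longrightarrow> fst (td B) p = 1 \<and> fst (td B) (step_before p) = 1"
  using dgs_Domain[OF \<mu>] dgs_Range[OF \<mu>] dgs_Domain[OF \<nu>] dgs_Range[OF \<nu>] unfolding broken_def by blast+

text \<open>
  Both steps at a broken place of one factor are covered by this factor, so the three sets are disjoint.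
\<close>

lemma card_broken_concat:
  "card (broken (concat_strands \<mu> \<nu>)) = card (broken \<mu>) + card (broken \<nu>) + card (inverted_between A B)"
proof -
  have "broken \<mu> \<inter> broken \<nu> = {}" "(broken \<mu> \<union> broken \<nu>) \<inter> inverted_between A B = {}"
    using broken_occupied chains_disjoint unfolding inverted_between_def by blast+
  then show ?thesis unfolding broken_concat_dgs
    by (simp add: card_Un_disjoint finite_broken finite_inverted)
qed

text \<open>
  If two diagrams without broken places are not composable, one of them ends at a place and the
  other begins at its twin, and neither acts otherwise at this pair. No diagram has these H-data.
\<close>

lemma unmatched_unbroken:
  assumes "\<not> matched \<mu> \<nu>" "broken \<mu> = {}" "broken \<nu> = {}"
  obtains p where "p \<in> places Z" "fst (td A) (step_before p) = 1" "fst (td A) p = 0" "fst (td B) p = 0"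
    "fst (td B) (twin Z p) = 1" "fst (td A) (step_before (twin Z p)) = 0" "fst (td B) (step_before (twin Z p)) = 0"
    "pairing Z p \<notin> fst (snd (td A))" "pairing Z p \<notin> snd (snd (td B))"
proof -
  obtain p q where pq': "p \<in> Range \<mu>" "q \<in> Domain \<nu>" "p \<in> places Z" "q \<in> places Z"
    "pairing Z p = pairing Z q" "p \<noteq> q" using assms(1) unfolding matched_def by blast
  note pq = pq'(1-4) pq'(5)[symmetric] pq'(6)
  have q: "q = twin Z p" using same_pair[OF pq(3,4)] pq(5,6) by blast
  have fib: "fibre Z (pairing Z p) = {p, q}" using twin(4)[OF pq(3)] q by simp
  have Ap: "fst (td A) (step_before p) = 1" and Bq: "fst (td B) q = 1"
    using dgs_Range[OF \<mu> pq(1)] dgs_Domain[OF \<nu> pq(2)] by auto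
  have pD: "p \<notin> Domain \<mu>" and qR: "q \<notin> Range \<nu>" using assms(2,3) pq(1,2) unfolding broken_def by blast+
  have Ap0: "fst (td A) p \<noteq> 1" using dgs_start(2)[OF \<mu> _ pD] pq(1) by blast
  have Bq0: "fst (td B) (step_before q) \<noteq> 1" using dgs_end(2)[OF \<nu> pq(4) _ qR] pq(2) by blast
  have Aq: "fst (td A) q \<noteq> 1" and Bp: "fst (td B) (step_before p) \<noteq> 1"
    using chains_disjoint Ap Bq by blast+
  have Bp0: "fst (td B) p \<noteq> 1"
    using dgs_start(1)[OF \<nu>, of p] dgs_Domain_inj[OF \<nu> _ pq(2) pq(3,4)] Bp pq(5,6) by metis
  have Aq0: "fst (td A) (step_before q) \<noteq> 1"
    using dgs_end(1)[OF \<mu> pq(4)] dgs_Range_inj[OF \<mu> pq(1) _ pq(3,4)] Aq pq(5,6) by metis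
  have "pairing Z p \<notin> fst (snd (td A))"
    using dgs_horizontal[OF \<mu>, of "pairing Z p"] dgs_Domain[OF \<mu>, of q] pD Aq pq(1) unfolding fib by blast
  moreover have "pairing Z p \<notin> snd (snd (td B))"
    using dgs_horizontal[OF \<nu>, of "pairing Z p"] dgs_Range[OF \<nu>, of p] qR Bp pq(2) unfolding fib by blast
  ultimately show ?thesis
    using that[of p] pq(3) Ap Bq Ap0 Bq0 Bp0 Aq0 dgs_01[OF \<mu>] dgs_01[OF \<nu>] unfolding q[symmetric] by metis
qed

text \<open>
  Otherwise take a place \<open>p\<close> as in \<open>unmatched_unbroken\<close>. A diagram with the
  H-data of the product covers the step before \<open>p\<close> but not the one after, so a strand has to
  end at \<open>p\<close>, although the pair of \<open>p\<close> is off at the end.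
\<close>

lemma matched_if_unbroken:
  assumes "dgs (td (A @ B)) \<noteq> {}" "broken \<mu> = {}" "broken \<nu> = {}"
  shows "matched \<mu> \<nu>"
proof (rule ccontr)
  assume "\<not> matched \<mu> \<nu>"
  then obtain p where p: "p \<in> places Z" "fst (td A) (step_before p) = 1" "fst (td A) p = 0" "fst (td B) p = 0"
    "pairing Z p \<notin> snd (snd (td B))"
    by (rule unmatched_unbroken[OF _ assms(2,3)])
  obtain \<rho> where \<rho>: "\<rho> \<in> dgs (td (A @ B))" using assms(1) by blast
  have "fst (td (A @ B)) (step_before p) = 1"
    using p(2) admissible_01[OF ad, of "step_before p"] by (simp add: td_append_chain)
  moreover have "fst (td (A @ B)) p \<noteq> 1" using p(3,4) by (simp add: td_append_chain)
  ultimately have "p \<in> Range \<rho>" using dgs_end(1)[OF \<rho> p(1)] by blast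
  then have "pairing Z p \<in> snd (snd (td (A @ B)))" using dgs_Range_on[OF \<rho> _ p(1)] by blast
  then show False using p(5) td_append_end[OF ne(2)] by simp
qed

end

lemma admissible_parts:
  assumes "admissible (A @ B @ C)" "B \<noteq> []"
  shows "admissible B"
proof -
  have "admissible (B @ C)" using assms admissible_append(2)[of A "B @ C"] by (cases "A = []") auto
  then show ?thesis using admissible_append(1)[of B C] assms(2) by (cases "C = []") auto
qed

lemma support_sum_subset: "support (\<Sum>i\<in>I. g i) \<subseteq> (\<Union>i\<in>I. support (g i))"
  unfolding support_def using ks_sum_subset[of g I] by blast

lemma mul_alg_part:
  assumes ad: "admissible (A @ B)" and ne: "A \<noteq> []" "B \<noteq> []"
    and a: "a \<in> alg_part Z (td A)" and b: "b \<in> alg_part Z (td B)"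
  shows "a \<odot> b \<in> alg_part Z (td (A @ B))"
    "support (a \<odot> b) \<subseteq> {concat_strands \<mu> \<nu> |\<mu> \<nu>. \<mu> \<in> support a \<and> \<nu> \<in> support b \<and> matched \<mu> \<nu>}"
proof -
  note adm = admissible_append[OF ad ne]
  note Ka = alg_partE[OF admissible_viable[OF adm(1)] a] and Kb = alg_partE[OF admissible_viable[OF adm(2)] b]
  have m: "dia (td A) \<mu> \<odot> dia (td B) \<nu> = (if matched \<mu> \<nu> then dia (td (A @ B)) (concat_strands \<mu> \<nu>) else 0)"
    "matched \<mu> \<nu> \<Longrightarrow> concat_strands \<mu> \<nu> \<in> dgs (td (A @ B))"
    if "\<mu> \<in> support a" "\<nu> \<in> support b" for \<mu> \<nu>
    using that Ka(1) Kb(1) dia_mul[OF ad ne] concat_dgs[OF ad ne] by blast+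
  have e: "a \<odot> b = (\<Sum>\<mu>\<in>support a. \<Sum>\<nu>\<in>support b. dia (td A) \<mu> \<odot> dia (td B) \<nu>)"
    by (subst Ka(2), subst Kb(2), simp only: mul_sum_left, simp only: mul_sum_right)
  show "a \<odot> b \<in> alg_part Z (td (A @ B))"
    unfolding e using m dia_alg_part alg_part_0 by (intro alg_part_sum) simp
  show "support (a \<odot> b) \<subseteq> {concat_strands \<mu> \<nu> |\<mu> \<nu>. \<mu> \<in> support a \<and> \<nu> \<in> support b \<and> matched \<mu> \<nu>}"
  proof
    fix \<rho> assume "\<rho> \<in> support (a \<odot> b)"
    then obtain \<mu> where "\<mu> \<in> support a" "\<rho> \<in> support (\<Sum>\<nu>\<in>support b. dia (td A) \<mu> \<odot> dia (td B) \<nu>)"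
      unfolding e using support_sum_subset by blast
    moreover from this(2) obtain \<nu> where "\<nu> \<in> support b" "\<rho> \<in> support (dia (td A) \<mu> \<odot> dia (td B) \<nu>)"
      using support_sum_subset by blast
    moreover have "support (0 :: 'i alg) = {}" by (simp add: support_def)
    ultimately show "\<rho> \<in> {concat_strands \<mu> \<nu> |\<mu> \<nu>. \<mu> \<in> support a \<and> \<nu> \<in> support b \<and> matched \<mu> \<nu>}"
      using m support_dia by (auto split: if_splits)
  qed
qed

text \<open>Join the strands at one broken place after the other.\<close>

lemma ex_unbroken:
  assumes "dgs d \<noteq> {}"
  obtains \<mu> where "\<mu> \<in> dgs d" "broken \<mu> = {}"
proof -
  obtain \<mu> where \<mu>: "\<mu> \<in> dgs d" "\<And>\<nu>. \<nu> \<in> dgs d \<Longrightarrow> card (broken \<mu>) \<le> card (broken \<nu>)"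
    using assms ex_has_least_nat[of "\<lambda>\<mu>. \<mu> \<in> dgs d" _ "\<lambda>\<mu>. card (broken \<mu>)"] by blast
  have fin: "finite (broken \<mu>)" using finite_subset[OF _ finite_places] broken_place[OF \<mu>(1)] by blast
  have "broken \<mu> = {}"
  proof (rule ccontr)
    assume "broken \<mu> \<noteq> {}"
    then obtain p where p: "p \<in> broken \<mu>" by blast
    have "card (broken \<mu> - {p}) < card (broken \<mu>)" by (rule card_Diff1_less[OF fin p])
    then show False using \<mu>(2)[OF join_dgs(1)[OF \<mu>(1) p]] join_dgs(2)[OF \<mu>(1) p] by simp
  qed
  then show ?thesis using that \<mu>(1) by blast
qed

text \<open>Break the strands at one twisted place after the other.\<close>

lemma ex_uncrossed:
  assumes "dgs d \<noteq> {}" "undoubled d"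
  obtains \<mu> where "\<mu> \<in> dgs d" "broken \<mu> = twisted_places d"
proof -
  have bound: "card (broken \<nu>) \<le> card (twisted_places d)" if "\<nu> \<in> dgs d" for \<nu>
    using card_mono[OF finite_twisted_places broken_subset[OF that assms(2)]] .
  obtain \<mu>0 where "\<mu>0 \<in> dgs d" using assms(1) by blast
  then obtain \<mu> where \<mu>: "\<mu> \<in> dgs d" "\<And>\<nu>. \<nu> \<in> dgs d \<Longrightarrow> card (broken \<nu>) \<le> card (broken \<mu>)"
    using ex_has_greatest_nat[of "\<lambda>\<mu>. \<mu> \<in> dgs d" \<mu>0 "\<lambda>\<mu>. card (broken \<mu>)" "card (twisted_places d) + 1"] bound
    by (metis le_imp_less_Suc Suc_eq_plus1)
  have fin: "finite (broken \<mu>)" using finite_subset[OF _ finite_places] broken_place[OF \<mu>(1)] by blast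
  have "broken \<mu> = twisted_places d"
  proof (rule ccontr)
    assume "broken \<mu> \<noteq> twisted_places d"
    then obtain p where p: "p \<in> twisted_places d - broken \<mu>" using broken_subset[OF \<mu>(1) assms(2)] by blast
    then have "card (broken \<mu>) < card (insert p (broken \<mu>))" using fin by simp
    then show False using \<mu>(2)[OF split_dgs(1)[OF \<mu>(1) assms(2) p]] split_dgs(2)[OF \<mu>(1) assms(2) p] by simp
  qed
  then show ?thesis using that \<mu>(1) by blast
qed

end

section \<open>The recursion for the operations\<close>

locale operations = arc Z for Z :: "'i arc_diagram" +
  fixes ord :: "'i pair_ordering" and X :: "'i alg set list \<Rightarrow> 'i alg set" and f :: "'i alg set list \<Rightarrow> 'i alg"
  assumes ord: "pair_ordering Z ord" and arises: "arises_from Z ord X f"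
begin

lemma classes_homology: "diagram_classes Z \<subseteq> homology Z"
proof
  fix c assume "c \<in> diagram_classes Z"
  then obtain D where D: "diagram Z D" "diff D = 0" "c = cls Z D" unfolding diagram_classes_def by blast
  then have "D \<in> strand_alg Z" unfolding strand_alg_def by (intro span2_base) simp
  then show "c \<in> homology Z" unfolding homology_def using D by blast
qed

lemma zero_homology: "cls Z 0 \<in> homology Z"
  unfolding homology_def using strand_alg_0 diff_0 by blast

lemmas axioms_tl = arises[unfolded arises_from_def, THEN conjunct2]
lemmas morphism = axioms_tl[THEN conjunct1]
lemmas X_single = axioms_tl[THEN conjunct2, THEN conjunct1, rule_format]
lemmas f_preferred = axioms_tl[THEN conjunct2, THEN conjunct2, THEN conjunct2, THEN conjunct1, rule_format]

text \<open>
  By additivity, since the zero class is its own double and \<open>a + a = 0\<close> in the algebra.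
\<close>

lemma f_zero:
  assumes "set K \<subseteq> homology Z" "set L \<subseteq> homology Z"
  shows "f (K @ [cls Z 0] @ L) = 0"
proof -
  have "multilinear Z (strand_alg Z) f"
    using morphism by (simp add: A_infinity_morphism_def)
  then have "f (K @ [cls Z 0 + cls Z 0] @ L) = f (K @ [cls Z 0] @ L) + f (K @ [cls Z 0] @ L)"
    using assms zero_homology unfolding multilinear_def by blast
  then show ?thesis using cls_0_plus by simp
qed

lemma arises_at:
  assumes "M \<noteq> []" "set M \<subseteq> diagram_classes Z"
  shows "f M \<in> alg_part Z (td M)"
    "\<exists>z. z \<in> alg_part Z (td M) \<and> diff z = 0 \<and> X M = cls Z z"
    "2 \<le> length M \<Longrightarrow> f [X M] + U_op X f M = 0 \<Longrightarrow> f M = 0"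
    "2 \<le> length M \<Longrightarrow> viable_tensor Z M \<Longrightarrow> twisted_hdata Z (td M) \<Longrightarrow>
       f M = A_star Z ord (f [X M] + U_op X f M)"
    "X M = cls Z (U_op X f M)"
proof -
  have "set M \<subseteq> homology Z" using assms classes_homology by blast
  then show "X M = cls Z (U_op X f M)" using arises assms(1) unfolding arises_from_def by blast
  note props = arises[unfolded arises_from_def, THEN conjunct2, THEN conjunct2, THEN conjunct2,
      THEN conjunct2, THEN conjunct2, THEN conjunct2, THEN spec, THEN mp, OF conjI[OF assms],
      THEN conjunct2, THEN conjunct2]
  show "f M \<in> alg_part Z (td M)" using props by (rule conjunct1)
  note props2 = props[THEN conjunct2, THEN conjunct2]
  show "\<exists>z. z \<in> alg_part Z (td M) \<and> diff z = 0 \<and> X M = cls Z z" using conjunct1[OF props2] by blast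
  show "2 \<le> length M \<Longrightarrow> f [X M] + U_op X f M = 0 \<Longrightarrow> f M = 0"
    using props2[THEN conjunct2, THEN conjunct1] by simp
  show "2 \<le> length M \<Longrightarrow> viable_tensor Z M \<Longrightarrow> twisted_hdata Z (td M) \<Longrightarrow>
       f M = A_star Z ord (f [X M] + U_op X f M)"
    using props2[THEN conjunct2, THEN conjunct2] by simp
qed

lemma insert_opE:
  assumes "j + k \<le> length M"
  obtains A B C where "M = A @ B @ C" "length A = k" "length B = j" "insert_op X k j M = A @ [X B] @ C"
proof -
  have "M = take k M @ take j (drop k M) @ drop (k + j) M"
    by (metis append_take_drop_id drop_drop add.commute)
  moreover have "length (take k M) = k" "length (take j (drop k M)) = j" using assms by auto
  ultimately show ?thesis using that by (metis insert_op_def)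
qed

text \<open>
  The relations of a morphism, with the terms that contain the zero operation \<open>X\<^sub>1\<close>
  removed. Signs do not matter over the field with two elements.
\<close>

lemma morphism_relation:
  assumes M: "set M \<subseteq> diagram_classes Z" "2 \<le> length M"
  shows "f [X M] + U_op X f M = diff (f M)"
proof -
  let ?n = "length M"
  let ?F = "\<lambda>(j, k). f (insert_op X k j M)"
  let ?S = "\<Sum>j\<in>{1..<?n}. f (take j M) \<odot> f (drop j M)"
  define S where "S = {(j, k). 2 \<le> j \<and> j < ?n \<and> j + k \<le> ?n}"
  have MH: "set M \<subseteq> homology Z" "M \<noteq> []" using M classes_homology by auto
  note X1 = X_single
  have rel: "(\<Sum>x\<in>{(j, k). 1 \<le> j \<and> j + k \<le> ?n}. ?F x) = diff (f M) + ?S"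
    using morphism[unfolded A_infinity_morphism_def, THEN conjunct2, THEN spec, THEN mp, of M] MH by simp
  have one: "f (insert_op X k 1 M) = 0" if "k < ?n" for k
  proof -
    have jk: "1 + k \<le> ?n" using that by simp
    obtain A B C where ABC: "M = A @ B @ C" "length A = k" "length B = 1" "insert_op X k 1 M = A @ [X B] @ C"
      by (rule insert_opE[OF jk])
    obtain b where b: "B = [b]" using ABC(3) by (auto simp: length_Suc_conv)
    have "set A \<subseteq> homology Z" "set C \<subseteq> homology Z" "b \<in> homology Z" using MH(1) ABC(1) b by auto
    then show ?thesis unfolding ABC(4) b using X1 f_zero by metis
  qed
  have finS: "finite S" by (rule finite_subset[of _ "{..?n} \<times> {..?n}"]) (auto simp: S_def)
  have set: "{(j, k). 1 \<le> j \<and> j + k \<le> ?n} = ({1} \<times> {..<?n}) \<union> (S \<union> {(?n, 0)})"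
    using M(2) by (auto simp: S_def)
  have "(\<Sum>x\<in>{(j, k). 1 \<le> j \<and> j + k \<le> ?n}. ?F x) = (\<Sum>x\<in>{1} \<times> {..<?n}. ?F x) + (\<Sum>x\<in>S \<union> {(?n, 0)}. ?F x)"
    unfolding set by (rule sum.union_disjoint) (use finS M(2) in \<open>auto simp: S_def\<close>)
  also have "(\<Sum>x\<in>{1} \<times> {..<?n}. ?F x) = 0" using one by (intro sum.neutral) auto
  also have "(\<Sum>x\<in>S \<union> {(?n, 0)}. ?F x) = (\<Sum>x\<in>S. ?F x) + f [X M]"
    using finS by (subst sum.union_disjoint) (auto simp: S_def insert_op_def)
  finally have fin: "(\<Sum>x\<in>S. ?F x) + f [X M] = diff (f M) + ?S" using rel by simp
  have "f [X M] + (?S + (\<Sum>x\<in>S. ?F x)) = ((\<Sum>x\<in>S. ?F x) + f [X M]) + ?S" by (simp only: ac_simps)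
  also have "\<dots> = diff (f M)" unfolding fin by (simp add: add.assoc)
  finally show ?thesis unfolding U_op_def S_def .
qed

text \<open>
  A nonzero class without on-on doubly occupied pairs is the class of exactly one diagram, which is its
  preferred representative, whatever the pair ordering is.
\<close>

lemma admissible_dgs_single:
  assumes "admissible [c]"
  obtains \<mu> where "dgs (td [c]) = {\<mu>}" "broken \<mu> = {}" "c = cls Z (dia (td [c]) \<mu>)" "tight Z (dia (td [c]) \<mu>)"
    "f [c] = dia (td [c]) \<mu>" "\<And>D. tight Z D \<Longrightarrow> cls Z D = c \<Longrightarrow> D = dia (td [c]) \<mu>" "twisted_places (td [c]) = {}"
proof -
  have c: "c \<in> diagram_classes Z" "viable_chain Z (fst (class_hdata Z c))" "undoubled (class_hdata Z c)"
    using assms by (auto simp: admissible_def viable_tensor_def td_single)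
  obtain \<mu> where \<mu>: "dgs (class_hdata Z c) = {\<mu>}" "c = cls Z (dia (class_hdata Z c) \<mu>)"
    "tight Z (dia (class_hdata Z c) \<mu>)" "twisted_places (class_hdata Z c) = {}"
    "\<And>D. tight Z D \<Longrightarrow> cls Z D = c \<Longrightarrow> D = dia (class_hdata Z c) \<mu>"
    using diagram_classE[OF c] by metis
  have \<mu>d: "\<mu> \<in> dgs (class_hdata Z c)" using \<mu>(1) by blast
  have "preferred Z ord (dia (class_hdata Z c) \<mu>)"
    unfolding preferred_def hdata_dia[OF \<mu>d] using \<mu>(3) c(3) unfolding undoubled_def by blast
  then have "f [cls Z (dia (class_hdata Z c) \<mu>)] = dia (class_hdata Z c) \<mu>"
    by (rule f_preferred)
  then have "f [c] = dia (class_hdata Z c) \<mu>" using \<mu>(2) by simp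
  then show ?thesis using that \<mu> broken_untwisted[OF \<mu>d c(3)] unfolding td_single by blast
qed

text \<open>
  A nonzero value of \<open>X\<close> is again an admissible factor, with the H-data of the factors that
  it replaces.
\<close>

lemma X_class:
  assumes ad: "admissible M"
  shows "X M = cls Z 0 \<or> X M \<in> diagram_classes Z \<and> class_hdata Z (X M) = td M"
    "twisted_places (td M) \<noteq> {} \<Longrightarrow> X M = cls Z 0"
proof -
  note v = admissible_viable[OF ad] and u = admissible_undoubled[OF ad]
  obtain z where z: "z \<in> alg_part Z (td M)" "diff z = 0" "X M = cls Z z"
    using arises_at(2)[of M] ad unfolding admissible_def by blast
  show tw: "X M = cls Z 0" if "twisted_places (td M) \<noteq> {}"
    using twisted_cls[OF v u that z(1,2)] z(3) by simp
  show "X M = cls Z 0 \<or> X M \<in> diagram_classes Z \<and> class_hdata Z (X M) = td M"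
  proof (cases "twisted_places (td M) = {} \<and> X M \<noteq> cls Z 0")
    case True
    note K = alg_partE[OF v z(1)]
    have "support z \<noteq> {}" using K(2) True z(3) by auto
    then obtain \<mu> where \<mu>: "\<mu> \<in> support z" by blast
    have "\<nu> = \<mu>" if "\<nu> \<in> support z" for \<nu>
      using dgs_unique[of \<nu> "td M" \<mu>] K(1) that \<mu> broken_untwisted[OF _ u] True by blast
    then have "support z = {\<mu>}" using \<mu> by blast
    then have zd: "z = dia (td M) \<mu>" using K(2) by simp
    have \<mu>d: "\<mu> \<in> dgs (td M)" using K(1) \<mu> by blast
    have "X M \<in> diagram_classes Z"
      unfolding z(3) zd diagram_classes_def using diagram_dia[OF \<mu>d] tight_dia_cycle[OF \<mu>d u] True by blast
    moreover have "class_hdata Z (X M) = td M" using class_hdata_eq[OF z(1,2)] z(3) True by simp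
    ultimately show ?thesis by blast
  qed (use tw in blast)
qed

text \<open>
  The differential vanishes on a summand without twisted places. So the right-hand side of the structure
  equation is zero, and then \<open>f\<close> is normalised to be zero.
\<close>

lemma f_untwisted:
  assumes ad: "admissible M" and n: "2 \<le> length M" and tw: "twisted_places (td M) = {}"
  shows "f M = 0"
proof -
  have M: "M \<noteq> []" "set M \<subseteq> diagram_classes Z" using ad by (auto simp: admissible_def)
  note K = alg_partE[OF admissible_viable[OF ad] arises_at(1)[OF M]]
  have "diff (f M) = 0"
    by (subst K(2)) (use K(1) diff_dia[OF _ admissible_undoubled[OF ad]] tw in \<open>auto simp: diff_sum intro!: sum.neutral\<close>)
  then have "f [X M] + U_op X f M = 0" using morphism_relation[OF M(2) n] by simp
  then show ?thesis using arises_at(3)[OF M n] by blast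
qed

lemma twisted_hdata_if:
  assumes "dgs d \<noteq> {}" "undoubled d" "twisted_places d \<noteq> {}"
  shows "twisted_hdata Z d"
proof -
  obtain \<mu> where \<mu>: "\<mu> \<in> dgs d" "broken \<mu> = twisted_places d" using ex_uncrossed[OF assms(1,2)] .
  then have "twisted Z (dia d \<mu>)" "hdata Z (dia d \<mu>) = d" "viable_chain Z (fst d)"
    using twisted_dia_iff[OF \<mu>(1) assms(2)] assms(3) hdata_dia dgs_viable by auto
  then show ?thesis unfolding twisted_hdata_def by blast
qed

lemma admissible_replace:
  assumes ad: "admissible (A @ B @ C)" and B: "B \<noteq> []" and c: "c \<in> diagram_classes Z" "class_hdata Z c = td B"
  shows "admissible (A @ [c] @ C)" "td (A @ [c] @ C) = td (A @ B @ C)"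
proof -
  have tc: "td [c] = td B" using c by (simp add: td_single)
  have "fst (td (A @ [c] @ C)) = fst (td (A @ B @ C))"
    by (rule ext) (simp add: td_append_chain tc td_Cons_chain c(2))
  moreover have "fst (snd (td (A @ [c] @ C))) = fst (snd (td (A @ B @ C)))"
    using td_append_start[of A] td_append_start[of "[c]" C] td_append_start[of B C] B tc by (cases "A = []") auto
  moreover have e: "snd (snd (td ([c] @ C))) = snd (snd (td (B @ C)))"
    using td_append_end[of C "[c]"] td_append_end[of C B] tc by (cases "C = []") auto
  then have "snd (snd (td (A @ [c] @ C))) = snd (snd (td (A @ B @ C)))"
    using td_append_end[of "[c] @ C" A] td_append_end[of "B @ C" A] B by simp
  ultimately show td: "td (A @ [c] @ C) = td (A @ B @ C)" by (simp add: prod_eq_iff)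
  have nm: "\<not> mismatch Z (A @ B @ C)" using ad by (simp add: admissible_def viable_tensor_def)
  have s: "fst (snd (td ([c] @ C))) = fst (snd (td (B @ C)))"
    using td_append_start[of "[c]" C] td_append_start[of B C] B tc by simp
  have c1: "\<not> mismatch Z [c]" by (simp add: mismatch_def)
  have "\<not> mismatch Z (B @ C)" using nm mismatch_append[of A "B @ C"] B by (cases "A = []") auto
  then have "\<not> mismatch Z ([c] @ C)"
    using mismatch_append[of B C] mismatch_append[of "[c]" C] B tc c1 by (cases "C = []") auto
  then have "\<not> mismatch Z (A @ [c] @ C)"
    using nm mismatch_append[of A "B @ C"] mismatch_append[of A "[c] @ C"] B s by (cases "A = []") auto
  then show "admissible (A @ [c] @ C)"
    using ad td c by (auto simp: admissible_def viable_tensor_def)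
qed

text \<open>
  A term of the structure equation containing an operation \<open>X\<close> is itself a value of
  \<open>f\<close> on an admissible tensor product with the same H-data and at least two factors. So it
  vanishes if there are no twisted places, and otherwise it is in the image of \<open>A\<^sup>*\<close>,
  whose square is zero.
\<close>

lemma inserted_term:
  assumes ad: "admissible M" and j: "2 \<le> j" "j < length M" "j + k \<le> length M"
  shows "f (insert_op X k j M) \<in> alg_part Z (td M)"
    "twisted_places (td M) = {} \<Longrightarrow> f (insert_op X k j M) = 0"
    "twisted_places (td M) \<noteq> {} \<Longrightarrow> A_star Z ord (f (insert_op X k j M)) = 0"
proof -
  obtain A B C where ABC: "M = A @ B @ C" "length A = k" "length B = j" "insert_op X k j M = A @ [X B] @ C"
    by (rule insert_opE[OF j(3)])
  have B: "B \<noteq> []" using ABC(3) j(1) by auto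
  have adB: "admissible B" using admissible_parts ad B ABC(1) by blast
  note v = admissible_viable[OF ad] and u = admissible_undoubled[OF ad]
  have "f (A @ [X B] @ C) \<in> alg_part Z (td M) \<and>
      (twisted_places (td M) = {} \<longrightarrow> f (A @ [X B] @ C) = 0) \<and>
      (twisted_places (td M) \<noteq> {} \<longrightarrow> A_star Z ord (f (A @ [X B] @ C)) = 0)"
  proof (cases "X B = cls Z 0")
    case True
    have "set A \<subseteq> homology Z" "set C \<subseteq> homology Z" using ad ABC(1) classes_homology by (auto simp: admissible_def)
    then have "f (A @ [X B] @ C) = 0" unfolding True by (rule f_zero)
    then show ?thesis using A_star_0[OF ord _ u v] alg_part_0 by metis
  next
    case False
    then have XB: "X B \<in> diagram_classes Z" "class_hdata Z (X B) = td B" using X_class(1)[OF adB] by blast+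
    let ?M = "A @ [X B] @ C"
    have adM: "admissible ?M" and tdM: "td ?M = td M"
      using admissible_replace[OF _ B XB] ad ABC(1) by auto
    have "length M = length A + length B + length C" using ABC(1) by simp
    then have "1 \<le> length A + length C" using ABC(3) j(2) by linarith
    then have n: "2 \<le> length ?M" unfolding length_append list.size by linarith
    have cl: "?M \<noteq> []" "set ?M \<subseteq> diagram_classes Z" using adM by (auto simp: admissible_def)
    have fin: "f ?M \<in> alg_part Z (td M)" using arises_at(1)[OF cl] tdM by simp
    moreover have "A_star Z ord (f ?M) = 0" if tw: "twisted_places (td M) \<noteq> {}"
    proof (cases "dgs (td M) = {}")
      case True
      then have "f ?M = 0" using fin alg_part_eq[OF v] by auto
      then show ?thesis using A_star_0[OF ord tw u v] by simp
    next
      case False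
      have vt: "viable_tensor Z ?M" using adM by (simp add: admissible_def)
      have "f ?M = A_star Z ord (diff (f ?M))"
        using arises_at(4)[OF cl n vt] twisted_hdata_if[OF False u tw] tdM morphism_relation[OF cl(2) n] by simp
      then show ?thesis using A_star_A_star[OF ord tw u v diff_alg_part[OF v u fin]] by simp
    qed
    ultimately show ?thesis using f_untwisted[OF adM n] tdM by simp
  qed
  then show "f (insert_op X k j M) \<in> alg_part Z (td M)"
    "twisted_places (td M) = {} \<Longrightarrow> f (insert_op X k j M) = 0"
    "twisted_places (td M) \<noteq> {} \<Longrightarrow> A_star Z ord (f (insert_op X k j M)) = 0"
    unfolding ABC(4) by blast+
qed

lemma product_term:
  assumes ad: "admissible M" and j: "j \<in> {1..<length M}"
  shows "f (take j M) \<odot> f (drop j M) \<in> alg_part Z (td M)"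
    "support (f (take j M) \<odot> f (drop j M)) \<subseteq>
      {concat_strands \<mu> \<nu> |\<mu> \<nu>. \<mu> \<in> support (f (take j M)) \<and> \<nu> \<in> support (f (drop j M)) \<and> matched \<mu> \<nu>}"
proof -
  have ne: "take j M \<noteq> []" "drop j M \<noteq> []" using j by auto
  have ad': "admissible (take j M @ drop j M)" using ad by simp
  note adm = admissible_append[OF ad' ne]
  have "f (take j M) \<in> alg_part Z (td (take j M))" "f (drop j M) \<in> alg_part Z (td (drop j M))"
    using arises_at(1) adm(1,2) unfolding admissible_def by blast+
  from mul_alg_part[OF ad' ne this] show "f (take j M) \<odot> f (drop j M) \<in> alg_part Z (td M)"
    "support (f (take j M) \<odot> f (drop j M)) \<subseteq>
      {concat_strands \<mu> \<nu> |\<mu> \<nu>. \<mu> \<in> support (f (take j M)) \<and> \<nu> \<in> support (f (drop j M)) \<and> matched \<mu> \<nu>}"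
    by simp_all
qed

text \<open>
  In the twisted case \<open>X M\<close> is zero, and the terms with an inner operation \<open>X\<close>
  are killed by \<open>A\<^sup>*\<close>.
\<close>

theorem f_twisted:
  assumes ad: "admissible M" and n: "2 \<le> length M" and tw: "twisted_places (td M) \<noteq> {}" and ns: "dgs (td M) \<noteq> {}"
  shows "f M = A_star Z ord (\<Sum>j\<in>{1..<length M}. f (take j M) \<odot> f (drop j M))"
proof -
  note v = admissible_viable[OF ad] and u = admissible_undoubled[OF ad]
  have M: "M \<noteq> []" "set M \<subseteq> diagram_classes Z" "viable_tensor Z M" using ad by (auto simp: admissible_def)
  let ?S = "\<Sum>j\<in>{1..<length M}. f (take j M) \<odot> f (drop j M)"
  let ?I = "{(j, k). 2 \<le> j \<and> j < length M \<and> j + k \<le> length M}"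
  let ?T = "\<Sum>x\<in>?I. f (insert_op X (snd x) (fst x) M)"
  have T: "(\<Sum>(j, k)\<in>?I. f (insert_op X k j M)) = ?T" by (simp add: case_prod_beta)
  have "f [X M] = 0" using X_class(2)[OF ad tw] f_zero[of "[]" "[]"] by simp
  then have "f M = A_star Z ord (?S + ?T)"
    using arises_at(4)[OF M(1,2) n M(3) twisted_hdata_if[OF ns u tw]] unfolding U_op_def T by simp
  also have "\<dots> = A_star Z ord ?S + A_star Z ord ?T"
    using product_term(1)[OF ad] inserted_term(1)[OF ad]
    by (intro A_star_add[OF ord tw u v] alg_part_sum) auto
  also have "A_star Z ord ?T = (\<Sum>x\<in>?I. A_star Z ord (f (insert_op X (snd x) (fst x) M)))"
    using inserted_term(1)[OF ad] by (intro A_star_sum[OF ord tw u v]) auto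
  also have "\<dots> = 0" using inserted_term(3)[OF ad _ _ _ tw] by (intro sum.neutral) auto
  finally show ?thesis by simp
qed

theorem X_untwisted:
  assumes ad: "admissible M" and tw: "twisted_places (td M) = {}"
  shows "X M = cls Z (\<Sum>j\<in>{1..<length M}. f (take j M) \<odot> f (drop j M))"
proof -
  have M: "M \<noteq> []" "set M \<subseteq> diagram_classes Z" using ad by (auto simp: admissible_def)
  have "(\<Sum>(j, k)\<in>{(j, k). 2 \<le> j \<and> j < length M \<and> j + k \<le> length M}. f (insert_op X k j M)) = 0"
    using inserted_term(2)[OF ad _ _ _ tw] by (intro sum.neutral) auto
  then show ?thesis using arises_at(5)[OF M] by (simp add: U_op_def)
qed

text \<open>Every splitting adds its newly inverted places to the broken ones, and joining removes one.\<close>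

lemma broken_count:
  assumes "admissible M" "\<mu> \<in> support (f M)"
  shows "card (broken \<mu>) + length M = card (inverted M) + 1"
  using assms
proof (induction "length M" arbitrary: M \<mu> rule: less_induct)
  case less
  note ad = less.prems(1)
  have M: "M \<noteq> []" "set M \<subseteq> diagram_classes Z" using ad by (auto simp: admissible_def)
  note K = alg_partE[OF admissible_viable[OF ad] arises_at(1)[OF M]]
  have \<mu>: "\<mu> \<in> dgs (td M)" using K(1) less.prems(2) by blast
  show ?case
  proof (cases "length M = 1")
    case True
    then obtain c where c: "M = [c]" by (cases M) auto
    obtain \<nu> where "dgs (td [c]) = {\<nu>}" "broken \<nu> = {}" using admissible_dgs_single ad c by metis
    then show ?thesis using \<mu> c inverted_single by auto
  next
    case False
    then have n: "2 \<le> length M" using M(1) by (cases M) (auto simp: Suc_le_eq)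
    have "f M \<noteq> 0" using less.prems(2) by (auto simp: support_def)
    then have tw: "twisted_places (td M) \<noteq> {}" using f_untwisted[OF ad n] by blast
    have ns: "dgs (td M) \<noteq> {}" using \<mu> by blast
    note v = admissible_viable[OF ad] and u = admissible_undoubled[OF ad]
    let ?p = "first_place ord (td M)"
    let ?S = "\<Sum>j\<in>{1..<length M}. f (take j M) \<odot> f (drop j M)"
    have Sin: "?S \<in> alg_part Z (td M)" by (rule alg_part_sum) (rule product_term(1)[OF ad])
    have fM: "f M = (\<Sum>\<mu>\<in>{\<mu> \<in> support ?S. ?p \<in> broken \<mu>}. dia (td M) (join_at \<mu> ?p))"
      unfolding f_twisted[OF ad n tw ns] by (rule A_star_expand[OF ord tw u v Sin])
    have "support (f M) \<subseteq> (\<Union>\<mu>\<in>{\<mu> \<in> support ?S. ?p \<in> broken \<mu>}. support (dia (td M) (join_at \<mu> ?p)))"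
      unfolding fM by (rule support_sum_subset)
    then obtain \<rho> where \<rho>: "\<rho> \<in> support ?S" "?p \<in> broken \<rho>" "\<mu> \<in> support (dia (td M) (join_at \<rho> ?p))"
      using less.prems(2) by blast
    have \<rho>d: "\<rho> \<in> dgs (td M)" using \<rho>(1) alg_partE(1)[OF v Sin] by blast
    have "\<mu> = join_at \<rho> ?p" using \<rho>(3) support_dia[OF join_dgs(1)[OF \<rho>d \<rho>(2)]] by simp
    then have "broken \<mu> = broken \<rho> - {?p}" using join_dgs(2)[OF \<rho>d \<rho>(2)] by simp
    moreover have "finite (broken \<rho>)" using finite_subset[OF _ finite_places] broken_place[OF \<rho>d] by blast
    ultimately have c1: "card (broken \<mu>) + 1 = card (broken \<rho>)"
      using card_Suc_Diff1[of "broken \<rho>" ?p] \<rho>(2) by simp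
    obtain j where j: "j \<in> {1..<length M}" "\<rho> \<in> support (f (take j M) \<odot> f (drop j M))"
      using \<rho>(1) support_sum_subset by blast
    then obtain \<mu>1 \<mu>2 where m: "\<rho> = concat_strands \<mu>1 \<mu>2" "\<mu>1 \<in> support (f (take j M))" "\<mu>2 \<in> support (f (drop j M))"
      using product_term(2)[OF ad j(1)] by blast
    have ne: "take j M \<noteq> []" "drop j M \<noteq> []" using j(1) by auto
    have ad': "admissible (take j M @ drop j M)" using ad by simp
    note adm = admissible_append[OF ad' ne]
    have md: "\<mu>1 \<in> dgs (td (take j M))" "\<mu>2 \<in> dgs (td (drop j M))"
      using alg_partE(1)[OF admissible_viable[OF adm(1)] arises_at(1)] m(2)
        alg_partE(1)[OF admissible_viable[OF adm(2)] arises_at(1)] m(3) adm ne unfolding admissible_def by blast+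
    have "card (broken \<mu>1) + length (take j M) = card (inverted (take j M)) + 1"
      "card (broken \<mu>2) + length (drop j M) = card (inverted (drop j M)) + 1"
      using less.hyps[OF _ adm(1) m(2)] less.hyps[OF _ adm(2) m(3)] j(1) by auto
    moreover have "card (broken \<rho>) = card (broken \<mu>1) + card (broken \<mu>2) + card (inverted_between (take j M) (drop j M))"
      unfolding m(1) by (rule card_broken_concat[OF ad' ne md])
    moreover have "card (inverted M) = card (inverted (take j M)) + card (inverted (drop j M)) +
        card (inverted_between (take j M) (drop j M))"
      using card_inverted_append[OF ad' ne] by simp
    moreover have "length (take j M) + length (drop j M) = length M" by simp
    ultimately show ?thesis using c1 by linarith
  qed
qed

end

section \<open>Products of tight representatives\<close>

context arc
begin

text \<open>The unique tight diagram representing a class, see \<open>rep\<close>.\<close>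

definition rep :: "'i alg set \<Rightarrow> 'i alg" where
  "rep c = dia (class_hdata Z c) (THE \<mu>. \<mu> \<in> dgs (class_hdata Z c))"

definition rep_product :: "'i alg set list \<Rightarrow> 'i alg" where
  "rep_product M = prod_alg (map rep M)"

lemma rep:
  assumes "admissible [c]"
  obtains \<mu> where "\<mu> \<in> dgs (td [c])" "rep c = dia (td [c]) \<mu>" "broken \<mu> = {}" "twisted_places (td [c]) = {}"
    "\<And>D. tight Z D \<and> cls Z D = c \<longleftrightarrow> D = rep c"
proof -
  have c: "c \<in> diagram_classes Z" "viable_chain Z (fst (class_hdata Z c))" "undoubled (class_hdata Z c)"
    using assms by (auto simp: admissible_def viable_tensor_def td_single)
  obtain \<mu> where \<mu>: "dgs (class_hdata Z c) = {\<mu>}" "c = cls Z (dia (class_hdata Z c) \<mu>)"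
    "tight Z (dia (class_hdata Z c) \<mu>)" "twisted_places (class_hdata Z c) = {}"
    "\<And>D. tight Z D \<Longrightarrow> cls Z D = c \<Longrightarrow> D = dia (class_hdata Z c) \<mu>"
    using diagram_classE[OF c] by metis
  have r: "rep c = dia (class_hdata Z c) \<mu>" using \<mu>(1) by (simp add: rep_def)
  have "tight Z D \<and> cls Z D = c \<longleftrightarrow> D = rep c" for D
    using \<mu>(2,3,5) r by metis
  moreover have "\<mu> \<in> dgs (class_hdata Z c)" using \<mu>(1) by blast
  ultimately show ?thesis using that[of \<mu>] \<mu>(4) r broken_untwisted[OF _ c(3)] by (simp add: td_single)
qed

lemma admissible_single:
  assumes "admissible M" "c \<in> set M"
  shows "admissible [c]"
proof -
  obtain A B where "M = A @ [c] @ B" using assms(2) by (metis append_Cons append_Nil split_list)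
  then show ?thesis using admissible_parts[of A "[c]" B] assms(1) by simp
qed

text \<open>
  So the quantification over representatives in the definitions of tight, twisted and critical tensor
  products collapses.
\<close>

lemma represents_iff:
  assumes "admissible M"
  shows "represents Z Ds M \<longleftrightarrow> Ds = map rep M"
proof -
  have "\<And>c D. c \<in> set M \<Longrightarrow> tight Z D \<and> cls Z D = c \<longleftrightarrow> D = rep c"
    using rep[OF admissible_single[OF assms]] by metis
  then have "list_all2 (\<lambda>D c. tight Z D \<and> cls Z D = c) Ds M \<longleftrightarrow> list_all2 (\<lambda>D c. D = rep c) Ds M"
    by (intro list.rel_cong refl) blast
  also have "\<dots> \<longleftrightarrow> Ds = map rep M"
    by (simp add: list_all2_conv_all_nth list_eq_iff_nth_eq) auto
  finally show ?thesis unfolding represents_def .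
qed

definition strand_elements :: "'i alg set" where
  "strand_elements = {a. \<forall>\<phi>\<in>ks a. strand_diagram Z \<phi>}"

lemma strand_elements_mul:
  assumes "a \<in> strand_elements" "b \<in> strand_elements"
  shows "a \<odot> b \<in> strand_elements"
  unfolding strand_elements_def
proof (intro CollectI ballI)
  fix \<theta> assume "\<theta> \<in> ks (a \<odot> b)"
  then obtain \<phi> where \<phi>: "\<phi> \<in> ks a" "\<theta> \<in> ks (\<Sum>\<psi>\<in>ks b. strand_mul \<phi> \<psi>)"
    unfolding mul_def using ks_sum_subset by blast
  then obtain \<psi> where \<psi>: "\<psi> \<in> ks b" "\<theta> \<in> ks (strand_mul \<phi> \<psi>)" using ks_sum_subset by blast
  then have "\<theta> = \<phi> O \<psi>" by (auto simp: strand_mul_def split: if_splits)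
  then show "strand_diagram Z \<theta>"
    using assms \<phi>(1) \<psi>(1) strand_diagram_comp unfolding strand_elements_def by blast
qed

lemma strand_elements_assoc:
  assumes "a \<in> strand_elements" "b \<in> strand_elements" "c \<in> strand_elements"
  shows "(a \<odot> b) \<odot> c = a \<odot> (b \<odot> c)"
  using assms finite_strands unfolding strand_elements_def by (intro mul_assoc[of a b c Z]) blast

lemma foldl_mul_in:
  "a \<in> strand_elements \<Longrightarrow> set as \<subseteq> strand_elements \<Longrightarrow> foldl (\<odot>) a as \<in> strand_elements"
  by (induction as arbitrary: a) (auto intro: strand_elements_mul)

lemma foldl_mul:
  assumes "a \<in> strand_elements" "b \<in> strand_elements" "set bs \<subseteq> strand_elements"
  shows "foldl (\<odot>) a (b # bs) = a \<odot> foldl (\<odot>) b bs"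
  using assms
proof (induction bs arbitrary: a b)
  case (Cons c bs)
  then have c: "c \<in> strand_elements" "set bs \<subseteq> strand_elements" by auto
  have "foldl (\<odot>) a (b # c # bs) = foldl (\<odot>) (a \<odot> b) (c # bs)" by simp
  also have "\<dots> = (a \<odot> b) \<odot> foldl (\<odot>) c bs"
    by (rule Cons.IH[OF strand_elements_mul[OF Cons.prems(1,2)] c])
  also have "\<dots> = a \<odot> (b \<odot> foldl (\<odot>) c bs)"
    by (rule strand_elements_assoc[OF Cons.prems(1,2) foldl_mul_in[OF c]])
  also have "b \<odot> foldl (\<odot>) c bs = foldl (\<odot>) b (c # bs)" by (rule Cons.IH[OF Cons.prems(2) c, symmetric])
  finally show ?case .
qed simp

text \<open>
  Products of representatives are bracketed to the left, while trees split them in the middle.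
\<close>

lemma prod_alg_append:
  assumes "as \<noteq> []" "bs \<noteq> []" "set as \<subseteq> strand_elements" "set bs \<subseteq> strand_elements"
  shows "prod_alg (as @ bs) = prod_alg as \<odot> prod_alg bs"
proof -
  obtain b bs' where b: "bs = b # bs'" using assms(2) by (cases bs) auto
  obtain a as' where a: "as = a # as'" using assms(1) by (cases as) auto
  have "prod_alg (as @ bs) = foldl (\<odot>) (foldl (\<odot>) a as') (b # bs')" by (simp add: prod_alg_def a b)
  also have "\<dots> = foldl (\<odot>) a as' \<odot> foldl (\<odot>) b bs'"
    using assms(3,4) a b by (intro foldl_mul foldl_mul_in) auto
  finally show ?thesis by (simp add: prod_alg_def a b)
qed

lemma rep_strand_element:
  assumes "admissible [c]"
  shows "rep c \<in> strand_elements"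
proof -
  obtain \<mu> where \<mu>: "\<mu> \<in> dgs (td [c])" "rep c = dia (td [c]) \<mu>" using rep[OF assms] by metis
  show ?thesis unfolding \<mu>(2) strand_elements_def using key_data_diagram(2)[OF diagram_dia[OF \<mu>(1)]] by blast
qed

lemma rep_product_append:
  assumes "admissible (A @ B)" "A \<noteq> []" "B \<noteq> []"
  shows "rep_product (A @ B) = rep_product A \<odot> rep_product B"
proof -
  have "rep c \<in> strand_elements" if "c \<in> set (A @ B)" for c
    using rep_strand_element[OF admissible_single[OF assms(1) that]] .
  then show ?thesis unfolding rep_product_def map_append using assms(2,3) by (intro prod_alg_append) auto
qed

lemma rep_product_single: "rep_product [c] = rep c"
  by (simp add: rep_product_def prod_alg_def)

text \<open>
  If one factor covers both steps at a twisted place of the product, then the other is idle at this pair,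
  and the place is twisted for the factor. If \<open>A\<close> covers the incoming step and
  \<open>B\<close> the outgoing one, then \<open>A\<close> has a strand ending at a pair where none
  begins, so the pair is off at the start, contrary to being on-on.
\<close>

lemma twisted_places_append:
  assumes ad: "admissible (A @ B)" and ne: "A \<noteq> []" "B \<noteq> []"
    and \<mu>: "\<mu> \<in> dgs (td A)" and \<nu>: "\<nu> \<in> dgs (td B)"
  shows "twisted_places (td (A @ B)) \<subseteq> twisted_places (td A) \<union> twisted_places (td B) \<union> inverted_between A B"
proof
  note b = admissible_01[OF ad] and adm = admissible_append[OF ad ne]
  fix p assume "p \<in> twisted_places (td (A @ B))"
  then have p: "p \<in> places Z" and o: "fst (td A) p + fst (td B) p = 1"
      "fst (td A) (step_before p) + fst (td B) (step_before p) = 1"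
      "fst (td A) (twin Z p) + fst (td B) (twin Z p) = 0"
      "fst (td A) (step_before (twin Z p)) + fst (td B) (step_before (twin Z p)) = 0"
    and on: "pairing Z p \<in> fst (snd (td A))" "pairing Z p \<in> snd (snd (td B))"
    unfolding twisted_places_def once_occupied_iff on_on_iff td_append_chain td_append_start[OF ne(1)] td_append_end[OF ne(2)]
    by auto
  have tz: "fst (td A) (twin Z p) = 0" "fst (td B) (twin Z p) = 0"
    "fst (td A) (step_before (twin Z p)) = 0" "fst (td B) (step_before (twin Z p)) = 0"
    using o(3,4) b[of "twin Z p"] b[of "step_before (twin Z p)"] by auto
  have fib: "fibre Z (pairing Z p) = {p, twin Z p}" by (rule twin(4)[OF p])
  consider "fst (td A) p = 1" "fst (td A) (step_before p) = 1" "fst (td B) p = 0" "fst (td B) (step_before p) = 0"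
    | "fst (td B) p = 1" "fst (td B) (step_before p) = 1" "fst (td A) p = 0" "fst (td A) (step_before p) = 0"
    | "fst (td A) p = 1" "fst (td B) (step_before p) = 1"
    | "fst (td A) p = 0" "fst (td A) (step_before p) = 1"
    using o(1,2) b[of p] b[of "step_before p"] by linarith
  then show "p \<in> twisted_places (td A) \<union> twisted_places (td B) \<union> inverted_between A B"
  proof cases
    case 1
    then have "idle (pairing Z p) (td B)" using tz fib by (simp add: idle_def)
    then have "pairing Z p \<in> snd (snd (td A))" using idle_dgs[OF \<nu>] on(2) adm(3) by simp
    then have "p \<in> twisted_places (td A)"
      using 1 tz p on unfolding twisted_places_def once_occupied_iff on_on_iff by simp
    then show ?thesis by blast
  next
    case 2
    then have "idle (pairing Z p) (td A)" using tz fib by (simp add: idle_def)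
    then have "pairing Z p \<in> fst (snd (td B))" using idle_dgs[OF \<mu>] on(1) adm(3) by simp
    then have "p \<in> twisted_places (td B)"
      using 2 tz p on unfolding twisted_places_def once_occupied_iff on_on_iff by simp
    then show ?thesis by blast
  next
    case 3
    then show ?thesis using p unfolding inverted_between_def by blast
  next
    case 4
    have "p \<in> Range \<mu>" using dgs_end(1)[OF \<mu> p 4(2)] 4(1) by fastforce
    moreover have "p \<notin> Domain \<mu>" "twin Z p \<notin> Domain \<mu>"
      using dgs_Domain[OF \<mu>, of p] dgs_Domain[OF \<mu>, of "twin Z p"] 4(1) tz(1) by auto
    ultimately have False using dgs_horizontal[OF \<mu>, of "pairing Z p"] on(1) unfolding fib by blast
    then show ?thesis ..
  qed
qed

text \<open>
  The product of tight representatives is zero or a diagram without crossings. It is zero or twisted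
  just if some place is inverted: a product of diagrams without broken places can only vanish if
  there are no diagrams with its H-data.
\<close>

definition product_status :: "'i alg set list \<Rightarrow> bool" where
  "product_status M \<longleftrightarrow>
     (rep_product M = 0 \<or> (\<exists>\<mu>\<in>dgs (td M). rep_product M = dia (td M) \<mu> \<and> broken \<mu> = twisted_places (td M))) \<and>
     (rep_product M = 0 \<or> twisted_places (td M) \<noteq> {} \<longleftrightarrow> inverted M \<noteq> {})"

lemma product_status_single:
  assumes "admissible [c]"
  shows "product_status [c]"
proof -
  obtain \<mu> where \<mu>: "\<mu> \<in> dgs (td [c])" "rep c = dia (td [c]) \<mu>" "broken \<mu> = {}" "twisted_places (td [c]) = {}"
    using rep[OF assms] by metis
  then show ?thesis using dia_nonzero[OF \<mu>(1)] inverted_single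
    unfolding product_status_def rep_product_single by auto
qed

text \<open>
  If the diagrams of the factors do not match then one of them is broken, by
  \<open>matched_if_unbroken\<close>, and there is an inverted place.
\<close>

lemma product_status_append:
  assumes ad: "admissible (A @ B)" and ne: "A \<noteq> []" "B \<noteq> []" and ns: "dgs (td (A @ B)) \<noteq> {}"
    and st: "product_status A" "product_status B"
  shows "product_status (A @ B)"
proof (cases "rep_product A = 0 \<or> rep_product B = 0")
  case True
  then have "rep_product (A @ B) = 0" unfolding rep_product_append[OF ad ne] by auto
  moreover have "inverted (A @ B) \<noteq> {}" using True st unfolding product_status_def inverted_append[OF ad] by blast
  ultimately show ?thesis unfolding product_status_def by blast
next
  case False
  obtain \<mu> where \<mu>: "\<mu> \<in> dgs (td A)" "rep_product A = dia (td A) \<mu>" "broken \<mu> = twisted_places (td A)"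
    using st(1) False unfolding product_status_def by blast
  obtain \<nu> where \<nu>: "\<nu> \<in> dgs (td B)" "rep_product B = dia (td B) \<nu>" "broken \<nu> = twisted_places (td B)"
    using st(2) False unfolding product_status_def by blast
  have inv: "broken \<mu> \<noteq> {} \<longleftrightarrow> inverted A \<noteq> {}" "broken \<nu> \<noteq> {} \<longleftrightarrow> inverted B \<noteq> {}"
    using st False \<mu>(3) \<nu>(3) unfolding product_status_def by auto
  note prod = dia_mul[OF ad ne \<mu>(1) \<nu>(1), folded \<mu>(2) \<nu>(2), folded rep_product_append[OF ad ne]]
  show ?thesis
  proof (cases "matched \<mu> \<nu>")
    case False
    then have "broken \<mu> \<noteq> {} \<or> broken \<nu> \<noteq> {}" using matched_if_unbroken[OF ad ne \<mu>(1) \<nu>(1) ns] by blast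
    then have "inverted (A @ B) \<noteq> {}" using inv unfolding inverted_append[OF ad] by blast
    then show ?thesis using prod False unfolding product_status_def by auto
  next
    case True
    let ?c = "concat_strands \<mu> \<nu>"
    have c: "?c \<in> dgs (td (A @ B))" by (rule concat_dgs[OF ad ne \<mu>(1) \<nu>(1) True])
    have bc: "broken ?c = broken \<mu> \<union> broken \<nu> \<union> inverted_between A B" by (rule broken_concat_dgs[OF ad ne \<mu>(1) \<nu>(1)])
    have tw: "broken ?c = twisted_places (td (A @ B))"
      using broken_subset[OF c admissible_undoubled[OF ad]] twisted_places_append[OF ad ne \<mu>(1) \<nu>(1)]
      unfolding bc \<mu>(3) \<nu>(3) by blast
    have "rep_product (A @ B) = dia (td (A @ B)) ?c" using prod True by simp
    moreover have "twisted_places (td (A @ B)) \<noteq> {} \<longleftrightarrow> inverted (A @ B) \<noteq> {}"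
      unfolding tw[symmetric] bc inverted_append[OF ad] using inv by blast
    ultimately show ?thesis unfolding product_status_def using c tw dia_nonzero[OF c] by auto
  qed
qed

text \<open>A mismatch between two diagrams requires strands at both places of a pair.\<close>

lemma rep_product_one_place:
  assumes "admissible M" "\<And>p. p \<in> places Z \<Longrightarrow> p \<noteq> q \<Longrightarrow> fst (td M) p = 0 \<and> fst (td M) (step_before p) = 0"
  shows "\<exists>\<mu>\<in>dgs (td M). rep_product M = dia (td M) \<mu>"
  using assms
proof (induction M rule: rev_induct)
  case Nil
  then show ?case by (simp add: admissible_def)
next
  case (snoc c M)
  show ?case
  proof (cases "M = []")
    case True
    then show ?thesis using snoc.prems(1) rep[of c] by (metis append_Nil rep_product_single)
  next
    case False
    note ad = snoc.prems(1) and b = admissible_01[OF snoc.prems(1)]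
    have c: "[c] \<noteq> []" by simp
    note adm = admissible_append[OF ad False c]
    have z: "fst (td M) p = 0 \<and> fst (td M) (step_before p) = 0 \<and> fst (td [c]) p = 0 \<and> fst (td [c]) (step_before p) = 0"
      if p: "p \<in> places Z" "p \<noteq> q" for p
      using snoc.prems(2)[OF p] b[of p] b[of "step_before p"] unfolding td_append_chain by auto
    obtain \<mu> where \<mu>: "\<mu> \<in> dgs (td M)" "rep_product M = dia (td M) \<mu>" using snoc.IH[OF adm(1)] z by blast
    obtain \<nu> where \<nu>: "\<nu> \<in> dgs (td [c])" "rep c = dia (td [c]) \<nu>" using rep[OF adm(2)] by metis
    have "p = q" if p: "p \<in> Range \<mu>" "p \<in> places Z" for p
      using dgs_Range[OF \<mu>(1) p(1)] z[OF p(2)] by fastforce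
    moreover have "p = q" if p: "p \<in> Domain \<nu>" "p \<in> places Z" for p
      using dgs_Domain[OF \<nu>(1) p(1)] z[OF p(2)] by fastforce
    ultimately have m: "matched \<mu> \<nu>" unfolding matched_def by blast
    have "rep_product (M @ [c]) = dia (td (M @ [c])) (concat_strands \<mu> \<nu>)"
      using dia_mul[OF ad False c \<mu>(1) \<nu>(1)] m unfolding rep_product_append[OF ad False c] \<mu>(2) rep_product_single \<nu>(2)
      by simp
    then show ?thesis using concat_dgs[OF ad False c \<mu>(1) \<nu>(1) m] by blast
  qed
qed

text \<open>By \<open>product_status\<close>, a product of representatives is never crossed.\<close>

lemma tensor_status:
  assumes ad: "admissible M" and ns: "dgs (td M) \<noteq> {}" and st: "product_status M"
  shows "tight_tensor Z M \<longleftrightarrow> rep_product M \<noteq> 0 \<and> twisted_places (td M) = {}"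
    "twisted_tensor Z M \<longleftrightarrow> rep_product M \<noteq> 0 \<and> twisted_places (td M) \<noteq> {}"
    "critical_tensor Z M \<longleftrightarrow> rep_product M = 0"
proof -
  note u = admissible_undoubled[OF ad]
  have "rep_product M \<noteq> 0 \<Longrightarrow> tight Z (rep_product M) \<longleftrightarrow> twisted_places (td M) = {}"
    "rep_product M \<noteq> 0 \<Longrightarrow> twisted Z (rep_product M) \<longleftrightarrow> twisted_places (td M) \<noteq> {}"
    using st tight_dia_iff[OF _ u] twisted_dia_iff[OF _ u] unfolding product_status_def by auto
  then show "tight_tensor Z M \<longleftrightarrow> rep_product M \<noteq> 0 \<and> twisted_places (td M) = {}"
    "twisted_tensor Z M \<longleftrightarrow> rep_product M \<noteq> 0 \<and> twisted_places (td M) \<noteq> {}"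
    unfolding tight_tensor_def twisted_tensor_def represents_iff[OF ad] rep_product_def by auto
  have "\<not> singular_tensor Z M" using singular_iff[OF admissible_viable[OF ad]] ns by blast
  then show "critical_tensor Z M \<longleftrightarrow> rep_product M = 0"
    unfolding critical_tensor_def represents_iff[OF ad] rep_product_def singular_tensor_def by auto
qed

section \<open>Restriction to fragments\<close>

text \<open>
  Since tight representatives are unique, the restriction of a class to a fragment is defined by cutting
  its representative.
\<close>

definition local_class :: "nat \<Rightarrow> 'i alg set \<Rightarrow> 'i point alg set" where
  "local_class P c = cls (fragment Z P) (cut Z P (rep c))"

context
  fixes P
  assumes P: "P \<in> pairs Z"
begin

interpretation F: arc "fragment Z P" by (rule arc_fragment[OF P])

lemma local_class_single:
  assumes "admissible [c]"
  shows "local_class P c \<in> diagram_classes (fragment Z P)"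
    "class_hdata (fragment Z P) (local_class P c) = local_data P (class_hdata Z c)"
    "arc.rep (fragment Z P) (local_class P c) = cut Z P (rep c)"
proof -
  obtain \<mu> where \<mu>: "\<mu> \<in> dgs (td [c])" "rep c = dia (td [c]) \<mu>" "twisted_places (td [c]) = {}"
    using rep[OF assms] by metis
  note cut = cut_strands_dgs[OF P \<mu>(1)]
  let ?d = "local_data P (td [c])" and ?c = "cut_strands Z P \<mu>"
  have u: "F.undoubled ?d" by (rule undoubled_fragment[OF P admissible_undoubled[OF assms]])
  have tw: "F.twisted_places ?d = {}" using twisted_places_fragment[OF P] \<mu>(3) by simp
  have lc: "local_class P c = cls (fragment Z P) (F.dia ?d ?c)" unfolding local_class_def \<mu>(2) cut(3) ..
  note cyc = F.tight_dia_cycle[OF cut(1) u tw]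
  show "local_class P c \<in> diagram_classes (fragment Z P)"
    unfolding lc diagram_classes_def using F.diagram_dia[OF cut(1)] cyc by blast
  show h: "class_hdata (fragment Z P) (local_class P c) = local_data P (class_hdata Z c)"
    unfolding lc using F.class_hdata_eq[OF F.dia_alg_part[OF cut(1)] cyc] by (simp add: td_single)
  have "(THE \<nu>. \<nu> \<in> F.dgs ?d) = ?c"
    using cut(1) F.dgs_unique[OF _ cut(1)] F.broken_untwisted[OF _ u tw] by (intro the_equality) blast+
  then show "F.rep (local_class P c) = cut Z P (rep c)"
    unfolding F.rep_def h \<mu>(2) cut(3) by (simp add: td_single)
qed

lemma local_chain:
  assumes ad: "admissible M" and L: "set L \<subseteq> set M"
  shows "fst (F.td (map (local_class P) L)) z = fst (local_data P (td L)) z"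
  using L
proof (induction L)
  case Nil
  then show ?case by (cases z) (simp add: F.td_Nil_chain local_data_def td_Nil_chain)
next
  case (Cons c L)
  then have "class_hdata (fragment Z P) (local_class P c) = local_data P (class_hdata Z c)"
    using local_class_single(2)[OF admissible_single[OF ad]] by simp
  then show ?case using Cons
    by (cases z) (simp add: F.td_Cons_chain local_data_def td_Cons_chain)
qed

lemma local_td:
  assumes "admissible M"
  shows "F.td (map (local_class P) M) = local_data P (td M)"
proof -
  have h: "class_hdata (fragment Z P) (local_class P c) = local_data P (class_hdata Z c)" if "c \<in> set M" for c
    using local_class_single(2)[OF admissible_single[OF assms that]] .
  have ne: "M \<noteq> []" using assms by (simp add: admissible_def)
  have "fst (F.td (map (local_class P) M)) = fst (local_data P (td M))" using local_chain[OF assms] by (intro ext) simp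
  moreover have "fst (snd (F.td (map (local_class P) M))) = fst (snd (local_data P (td M)))"
    using ne h[of "hd M"] by (simp add: tensor_hdata_def list.map_sel local_data_def)
  moreover have "snd (snd (F.td (map (local_class P) M))) = snd (snd (local_data P (td M)))"
    using ne h[of "last M"] by (simp add: tensor_hdata_def last_map local_data_def)
  ultimately show ?thesis by (simp add: prod_eq_iff)
qed

lemma local_admissible:
  assumes ad: "admissible M"
  shows "F.admissible (map (local_class P) M)"
proof -
  have h: "class_hdata (fragment Z P) (local_class P c) = local_data P (class_hdata Z c)" if "c \<in> set M" for c
    using local_class_single(2)[OF admissible_single[OF ad that]] .
  have "set (map (local_class P) M) \<subseteq> diagram_classes (fragment Z P)"
    using local_class_single(1)[OF admissible_single[OF ad]] by auto
  moreover have "\<not> mismatch (fragment Z P) (map (local_class P) M)"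
  proof
    assume "mismatch (fragment Z P) (map (local_class P) M)"
    then obtain i where "Suc i < length (map (local_class P) M)"
      "snd (snd (class_hdata (fragment Z P) (map (local_class P) M ! i))) \<noteq>
        fst (snd (class_hdata (fragment Z P) (map (local_class P) M ! Suc i)))"
      unfolding mismatch_def by blast
    then have i: "Suc i < length M" "snd (snd (local_data P (class_hdata Z (M ! i)))) \<noteq>
        fst (snd (local_data P (class_hdata Z (M ! Suc i))))"
      using h[of "M ! i"] h[of "M ! Suc i"] by simp_all
    then have "snd (snd (class_hdata Z (M ! i))) \<noteq> fst (snd (class_hdata Z (M ! Suc i)))"
      by (auto simp: local_data_def)
    then show False using ad i(1) unfolding admissible_def viable_tensor_def mismatch_def by blast
  qed
  moreover have "viable_chain (fragment Z P) (fst (local_data P (td M)))"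
  proof -
    have "0 \<le> fst (td M) z \<and> fst (td M) z \<le> 1" for z
      using admissible_01[of M "[]" z] ad by (simp add: td_Nil_chain)
    then have v: "fst (td M) z \<in> {0, 1}" for z by (smt (verit) insert_iff)
    have "fst (local_data P (td M)) z \<in> {0, 1}" for z
      using v by (cases z) (simp add: local_data_def)
    then show ?thesis unfolding viable_chain_def by blast
  qed
  ultimately show ?thesis
    using ad undoubled_fragment[OF P admissible_undoubled[OF ad]] local_td[OF ad]
    unfolding F.admissible_def viable_tensor_def by (auto simp: admissible_def)
qed

lemma local_inverted:
  assumes ad: "admissible M"
  shows "F.inverted (map (local_class P) M) = (\<lambda>p. (p, 1)) ` (inverted M \<inter> fibre Z P)"
proof -
  have td: "fst (F.td (map (local_class P) A)) (p, 1) = fst (td A) p"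
    "fst (F.td (map (local_class P) A)) (p, 0) = fst (td A) (step_before p)"
    if A: "set A \<subseteq> set M" and p: "p \<in> fibre Z P" for A p
    using local_chain[OF ad A] p by (simp_all add: local_data_def)
  have "(p, 1) \<in> F.inverted (map (local_class P) M) \<longleftrightarrow> p \<in> inverted M" if p: "p \<in> fibre Z P" for p
  proof -
    have pl: "(p, 1) \<in> places (fragment Z P)" "p \<in> places Z"
      using p by (auto simp: places_fragment fibre_iff)
    have sb: "step_before (p, 1) = (p, 0)" by (simp add: step_before_def)
    have "(\<exists>A' B'. map (local_class P) M = A' @ B' \<and> fst (F.td A') (p, 1) = 1 \<and> fst (F.td B') (p, 0) = 1) \<longleftrightarrow>
        (\<exists>A B. M = A @ B \<and> fst (td A) p = 1 \<and> fst (td B) (step_before p) = 1)"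
    proof
      assume "\<exists>A' B'. map (local_class P) M = A' @ B' \<and> fst (F.td A') (p, 1) = 1 \<and> fst (F.td B') (p, 0) = 1"
      then obtain A B where "M = A @ B" "fst (F.td (map (local_class P) A)) (p, 1) = 1"
        "fst (F.td (map (local_class P) B)) (p, 0) = 1" unfolding map_eq_append_conv by blast
      then show "\<exists>A B. M = A @ B \<and> fst (td A) p = 1 \<and> fst (td B) (step_before p) = 1"
        using td[OF _ p] by auto
    next
      assume "\<exists>A B. M = A @ B \<and> fst (td A) p = 1 \<and> fst (td B) (step_before p) = 1"
      then obtain A B where "M = A @ B" "fst (td A) p = 1" "fst (td B) (step_before p) = 1" by blast
      then show "\<exists>A' B'. map (local_class P) M = A' @ B' \<and> fst (F.td A') (p, 1) = 1 \<and> fst (F.td B') (p, 0) = 1"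
        using td[OF _ p] by (intro exI[of _ "map (local_class P) A"] exI[of _ "map (local_class P) B"]) simp
    qed
    then show ?thesis unfolding F.inverted_def inverted_def mem_Collect_eq sb using pl by blast
  qed
  moreover have "F.inverted (map (local_class P) M) \<subseteq> (\<lambda>p. (p, 1)) ` fibre Z P"
    unfolding F.inverted_def places_fragment by blast
  ultimately show ?thesis by blast
qed

lemma local_dgs: "admissible M \<Longrightarrow> dgs (td M) \<noteq> {} \<Longrightarrow> F.dgs (F.td (map (local_class P) M)) \<noteq> {}"
  using cut_strands_dgs(1)[OF P] local_td by fastforce

text \<open>
  The local properties of \<open>M\<close> are the global ones of its restriction, an admissible tensor
  product on the fragment, to which all the previous results apply.
\<close>

lemma tensor_at_iff:
  assumes "admissible M"
  shows "tensor_at \<Phi> Z P M \<longleftrightarrow> \<Phi> (fragment Z P) (map (local_class P) M)"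
proof -
  have e: "map (\<lambda>D. cls (fragment Z P) (cut Z P D)) (map rep M) = map (local_class P) M"
    by (simp add: local_class_def)
  show ?thesis unfolding tensor_at_def represents_iff[OF assms] by (simp only: simp_thms e)
qed

text \<open>
  At an on-on once occupied pair all strands lie at one place, where products cannot vanish.
\<close>

lemma local_twisted_product:
  assumes ad: "admissible M" and tw: "twisted_places (td M) \<inter> fibre Z P \<noteq> {}"
  shows "F.rep_product (map (local_class P) M) \<noteq> 0"
proof -
  obtain p where p: "p \<in> twisted_places (td M)" "p \<in> fibre Z P" using tw by blast
  then have o: "once_occupied_at Z p (td M)" "p \<in> places Z" "pairing Z p = P"
    by (auto simp: twisted_places_def fibre_iff)
  have fib: "fibre Z P = {p, twin Z p}" using twin(4)[OF o(2)] o(3) by simp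
  have "\<exists>\<mu>\<in>F.dgs (F.td (map (local_class P) M)). F.rep_product (map (local_class P) M) = F.dia (F.td (map (local_class P) M)) \<mu>"
  proof (rule F.rep_product_one_place[OF local_admissible[OF ad], of "(p, 1)"])
    fix x assume "x \<in> places (fragment Z P)" "x \<noteq> (p, 1)"
    then have x: "x = (twin Z p, 1)" unfolding places_fragment fib by blast
    show "fst (F.td (map (local_class P) M)) x = 0 \<and> fst (F.td (map (local_class P) M)) (step_before x) = 0"
      using o(1) unfolding local_td[OF ad] x once_occupied_iff by (simp add: local_data_def step_before_def fib)
  qed
  then show ?thesis using F.dia_nonzero by metis
qed

end

end

section \<open>Operation trees\<close>

lemma label_nonempty [simp]: "label T \<noteq> []"
  by (induction T) auto

lemma root_in_subtrees [simp]: "T \<in> subtrees T"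
  by (cases T) auto

lemma subtree_label: "v \<in> subtrees T \<Longrightarrow> \<exists>A C. label T = A @ label v @ C"
proof (induction T)
  case (Leaf c)
  then show ?case by (intro exI[of _ "[]"]) simp
next
  case (Node l r)
  consider "v = Node l r" | "v \<in> subtrees l" | "v \<in> subtrees r" using Node.prems by auto
  then show ?case
  proof cases
    case 1
    then show ?thesis by (intro exI[of _ "[]"]) simp
  next
    case 2
    then obtain A C where "label l = A @ label v @ C" using Node.IH by blast
    then show ?thesis by (intro exI[of _ A] exI[of _ "C @ label r"]) simp
  next
    case 3
    then obtain A C where "label r = A @ label v @ C" using Node.IH by blast
    then show ?thesis by (intro exI[of _ "label l @ A"] exI[of _ C]) simp
  qed
qed

lemma subtree_size: "v \<in> subtrees T \<Longrightarrow> size v \<le> size T"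
  by (induction T) auto

context arc
begin

text \<open>Validity of a tree, in terms of diagrams, see \<open>valid_tree_iff\<close>.\<close>

definition nonsingular_tree :: "'i alg set op_tree \<Rightarrow> bool" where
  "nonsingular_tree T \<longleftrightarrow> (\<forall>v\<in>subtrees T. dgs (td (label v)) \<noteq> {})"

text \<open>
  These two notions count inverted places instead of pairs with a twisted or critical product, see
  \<open>valid_distributive_iff\<close> and \<open>strictly_f_distributive_iff\<close>.
\<close>

definition distributive :: "'i alg set op_tree \<Rightarrow> bool" where
  "distributive T \<longleftrightarrow> nonsingular_tree T \<and> (\<forall>v\<in>subtrees T. length (label v) \<le> card (inverted (label v)) + 2)"

definition strict :: "'i alg set op_tree \<Rightarrow> bool" where
  "strict T \<longleftrightarrow> nonsingular_tree T \<and> (\<forall>v\<in>subtrees T. length (label v) = card (inverted (label v)) + 1)"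

lemma nonsingular_Node: "nonsingular_tree (Node l r) \<longleftrightarrow>
    nonsingular_tree l \<and> nonsingular_tree r \<and> dgs (td (label l @ label r)) \<noteq> {}"
  by (auto simp: nonsingular_tree_def)

lemma distributive_Node: "distributive (Node l r) \<longleftrightarrow> distributive l \<and> distributive r \<and>
    dgs (td (label l @ label r)) \<noteq> {} \<and> length (label l @ label r) \<le> card (inverted (label l @ label r)) + 2"
  unfolding distributive_def nonsingular_Node by auto

lemma strict_Node: "strict (Node l r) \<longleftrightarrow> strict l \<and> strict r \<and>
    dgs (td (label l @ label r)) \<noteq> {} \<and> length (label l @ label r) = card (inverted (label l @ label r)) + 1"
  unfolding strict_def nonsingular_Node by auto

lemma strict_distributive: "strict T \<Longrightarrow> distributive T"
  by (auto simp: strict_def distributive_def)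

lemma strict_root: "strict T \<Longrightarrow> length (label T) = card (inverted (label T)) + 1"
  by (simp add: strict_def)

lemma root_nonsingular: "nonsingular_tree T \<Longrightarrow> dgs (td (label T)) \<noteq> {}"
  by (simp add: nonsingular_tree_def)

lemma distributive_nonsingular: "distributive T \<Longrightarrow> nonsingular_tree T"
  by (simp add: distributive_def)

lemma admissible_subtree: "admissible (label T) \<Longrightarrow> v \<in> subtrees T \<Longrightarrow> admissible (label v)"
  using subtree_label[of v T] admissible_parts[OF _ label_nonempty] by metis

text \<open>
  Induction along the tree: no vertex is singular on the fragment, since diagrams can be cut.
\<close>

lemma local_status:
  assumes P: "P \<in> pairs Z"
  shows "admissible (label T) \<Longrightarrow> nonsingular_tree T \<Longrightarrow>
    arc.product_status (fragment Z P) (map (local_class P) (label T))"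
proof (induction T)
  interpret F: arc "fragment Z P" by (rule arc_fragment[OF P])
  {
    case (Leaf c)
    then show ?case using F.product_status_single[of "local_class P c"] local_admissible[OF P, of "[c]"] by simp
  next
    case (Node l r)
    have ad: "admissible (label l @ label r)" using Node.prems by simp
    note adm = admissible_append[OF ad label_nonempty label_nonempty]
    have lad: "F.admissible (map (local_class P) (label l) @ map (local_class P) (label r))"
      using local_admissible[OF P ad] by simp
    have ns: "dgs (td (label l @ label r)) \<noteq> {}" "nonsingular_tree l" "nonsingular_tree r"
      using Node.prems(2) by (simp_all add: nonsingular_Node)
    have "F.dgs (F.td (map (local_class P) (label l) @ map (local_class P) (label r))) \<noteq> {}"
      using local_dgs[OF P ad ns(1)] by simp
    then show ?case
      using F.product_status_append[OF lad] Node.IH adm ns by simp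
  }
qed

text \<open>
  Locally at \<open>P\<close>, a product of representatives with a twisted place does not vanish, by
  \<open>local_twisted_product\<close>. So vanishing (critical) products have no twisted place, and by
  \<open>product_status\<close> the twisted and critical products are those with an inverted place.
\<close>

lemma tensor_at_status:
  assumes ad: "admissible (label T)" and ns: "nonsingular_tree T" and P: "P \<in> pairs Z"
  shows "tensor_at twisted_tensor Z P (label T) \<longleftrightarrow> twisted_places (td (label T)) \<inter> fibre Z P \<noteq> {}"
    "tensor_at tight_tensor Z P (label T) \<or> tensor_at critical_tensor Z P (label T) \<Longrightarrow>
      twisted_places (td (label T)) \<inter> fibre Z P = {}"
    "tensor_at twisted_tensor Z P (label T) \<or> tensor_at critical_tensor Z P (label T) \<longleftrightarrow>
      inverted (label T) \<inter> fibre Z P \<noteq> {}"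
proof -
  interpret F: arc "fragment Z P" by (rule arc_fragment[OF P])
  let ?M = "map (local_class P) (label T)"
  note st = local_status[OF P ad ns] and lad = local_admissible[OF P ad]
  note status = F.tensor_status[OF lad local_dgs[OF P ad root_nonsingular[OF ns]] st]
  have tw: "F.twisted_places (F.td ?M) \<noteq> {} \<longleftrightarrow> twisted_places (td (label T)) \<inter> fibre Z P \<noteq> {}"
    unfolding local_td[OF P ad] twisted_places_fragment[OF P] by blast
  have inv: "F.inverted ?M \<noteq> {} \<longleftrightarrow> inverted (label T) \<inter> fibre Z P \<noteq> {}"
    unfolding local_inverted[OF P ad] by blast
  note nz = local_twisted_product[OF P ad]
  show "tensor_at twisted_tensor Z P (label T) \<longleftrightarrow> twisted_places (td (label T)) \<inter> fibre Z P \<noteq> {}"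
    unfolding tensor_at_iff[OF P ad] status(2) using tw nz by blast
  show "twisted_places (td (label T)) \<inter> fibre Z P = {}"
    if "tensor_at tight_tensor Z P (label T) \<or> tensor_at critical_tensor Z P (label T)"
    using that unfolding tensor_at_iff[OF P ad] status(1,3) using tw nz by blast
  show "tensor_at twisted_tensor Z P (label T) \<or> tensor_at critical_tensor Z P (label T) \<longleftrightarrow>
      inverted (label T) \<inter> fibre Z P \<noteq> {}"
    unfolding tensor_at_iff[OF P ad] status(2,3) inv[symmetric]
    using st unfolding F.product_status_def by blast
qed

text \<open>Each of these pairs has exactly one inverted place, by \<open>inverted_inj\<close>.\<close>

lemma twisted_critical_count:
  assumes ad: "admissible (label T)" and ns: "nonsingular_tree T"
  shows "twisted_critical_count Z (label T) = card (inverted (label T))"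
proof -
  have pl: "inverted (label T) \<subseteq> places Z" by (auto simp: inverted_def)
  have "{P \<in> pairs Z. tensor_at twisted_tensor Z P (label T) \<or> tensor_at critical_tensor Z P (label T)} =
      {P \<in> pairs Z. inverted (label T) \<inter> fibre Z P \<noteq> {}}"
    using tensor_at_status(3)[OF ad ns] by blast
  also have "\<dots> = pairing Z ` inverted (label T)"
    using pl pairing_in unfolding fibre_def by blast
  finally show ?thesis
    unfolding twisted_critical_count_def using card_image[OF inverted_inj[OF ad]] by simp
qed

lemma valid_tree_iff:
  assumes "admissible M"
  shows "valid_tree Z M T \<longleftrightarrow> label T = M \<and> nonsingular_tree T"
proof (cases "label T = M")
  case True
  have "admissible (label v)" if "v \<in> subtrees T" for v
    using admissible_subtree[OF _ that] assms True by blast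
  then have "viable_tensor Z (label v) \<and> (\<not> singular_tensor Z (label v) \<longleftrightarrow> dgs (td (label v)) \<noteq> {})"
    if "v \<in> subtrees T" for v
    using that singular_iff[OF admissible_viable] unfolding admissible_def by blast
  then show ?thesis using True unfolding valid_tree_def operation_tree_def nonsingular_tree_def by blast
qed (simp add: valid_tree_def operation_tree_def)

lemma count_subtree:
  assumes "admissible (label T)" "nonsingular_tree T" "v \<in> subtrees T"
  shows "twisted_critical_count Z (label v) = card (inverted (label v))"
proof (rule twisted_critical_count[OF admissible_subtree[OF assms(1,3)]])
  have "subtrees v \<subseteq> subtrees T" using assms(3) by (induction T) auto
  then show "nonsingular_tree v" using assms(2) unfolding nonsingular_tree_def by blast
qed

lemma valid_distributive_iff:
  assumes ad: "admissible M"
  shows "valid_distributive Z M T \<longleftrightarrow> label T = M \<and> distributive T"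
  using count_subtree[of T] ad
  unfolding valid_distributive_def valid_tree_iff[OF ad] distributive_def distributive_vertex_def by auto

lemma strictly_f_distributive_iff:
  assumes ad: "admissible M"
  shows "strictly_f_distributive Z M T \<longleftrightarrow> label T = M \<and> strict T"
  using count_subtree[of T] ad
  unfolding strictly_f_distributive_def valid_tree_iff[OF ad] strict_def strictly_distributive_vertex_def
  by (auto simp: eq_commute)

definition children_strict :: "'i alg set op_tree \<Rightarrow> bool" where
  "children_strict T \<longleftrightarrow> (\<forall>l r. T = Node l r \<longrightarrow> strict l \<and> strict r)"

lemma strictly_X_distributiveD:
  assumes ad: "admissible M" and T: "strictly_X_distributive Z M T"
  shows "children_strict T" "length M = card (inverted M) + 2"
proof -
  have l: "label T = M" "nonsingular_tree T"
    using T valid_tree_iff[OF ad] by (auto simp: strictly_X_distributive_def)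
  note count = count_subtree[of T, unfolded l(1), OF ad l(2)]
  show "length M = card (inverted M) + 2"
    using T count[of T] l(1) unfolding strictly_X_distributive_def by simp
  have "strict l \<and> strict r" if "T = Node l r" for l r
  proof -
    have v: "length (label v) = card (inverted (label v)) + 1" if v: "v \<in> subtrees l \<union> subtrees r" for v
    proof -
      have v': "v \<in> subtrees T" "v \<noteq> T" using v \<open>T = Node l r\<close> subtree_size[of v l] subtree_size[of v r] by auto
      then have "strictly_distributive_vertex Z v" using T unfolding strictly_X_distributive_def by blast
      then show ?thesis using count[OF v'(1)] unfolding strictly_distributive_vertex_def by simp
    qed
    then show ?thesis using l(2) that unfolding strict_def by (simp add: nonsingular_Node)
  qed
  then show "children_strict T" by (simp add: children_strict_def)
qed

subsection \<open>Rigid tensor products\<close>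

text \<open>
  The hypotheses on the trees of a tensor product, in a form which the two factors of a splitting inherit.
\<close>

definition rigid :: "'i alg set list \<Rightarrow> bool" where
  "rigid M \<longleftrightarrow> (\<exists>T. label T = M \<and> distributive T) \<and> (\<forall>T. label T = M \<and> distributive T \<longrightarrow> strict T)"

text \<open>
  The version of \<open>rigid\<close> for the operation \<open>X\<close>, which does not constrain the
  root.
\<close>

definition rigid_below :: "'i alg set list \<Rightarrow> bool" where
  "rigid_below M \<longleftrightarrow> (\<forall>T. label T = M \<and> distributive T \<longrightarrow> children_strict T)"

lemma rigid_rigid_below: "rigid M \<Longrightarrow> rigid_below M"
  unfolding rigid_def rigid_below_def children_strict_def using strict_Node by metis

text \<open>
  A distributive tree for a factor can be substituted into a distributive tree for the whole product,
  since the condition at the root only depends on the label.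
\<close>

lemma rigid_factors:
  assumes r: "rigid_below M" and lr: "label l @ label r = M" "distributive (Node l r)"
  shows "rigid (label l)" "rigid (label r)"
proof -
  have "strict T" if "label T = label l" "distributive T" for T
  proof -
    have "distributive (Node T r)" "label (Node T r) = M" using lr that by (simp_all add: distributive_Node)
    then show ?thesis using r unfolding rigid_below_def children_strict_def by blast
  qed
  then show "rigid (label l)" unfolding rigid_def using lr(2) by (auto simp: distributive_Node)
  have "strict T" if "label T = label r" "distributive T" for T
  proof -
    have "distributive (Node l T)" "label (Node l T) = M" using lr that by (simp_all add: distributive_Node)
    then show ?thesis using r unfolding rigid_below_def children_strict_def by blast
  qed
  then show "rigid (label r)" unfolding rigid_def using lr(2) by (auto simp: distributive_Node)
qed

lemma inverted_between_mono:
  assumes "admissible (A @ B @ C @ D)"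
  shows "inverted_between B C \<subseteq> inverted_between (A @ B) (C @ D)"
proof
  have "admissible ((A @ B) @ (C @ D))" "admissible ((A @ B @ C) @ D)" using assms by simp_all
  note b = admissible_01[OF this(1)] admissible_01[OF assms] admissible_01(2)[OF this(2)]
  fix p assume p: "p \<in> inverted_between B C"
  have "fst (td (A @ B)) p = 1"
    using p b(1)[of p] b(2)[of p] b(3)[of p] b(4)[of p] unfolding inverted_between_def td_append_chain by auto
  moreover have "fst (td (C @ D)) (step_before p) = 1"
    using p b(1)[of "step_before p"] b(3)[of "step_before p"] b(7)[of "step_before p"]
    unfolding inverted_between_def td_append_chain by auto
  ultimately show "p \<in> inverted_between (A @ B) (C @ D)" using p unfolding inverted_between_def by blast
qed

lemma inverted_between_skip:
  assumes "admissible (A @ B @ C)"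
  shows "inverted_between A C \<subseteq> inverted_between (A @ B) C" "inverted_between A C \<subseteq> inverted_between A (B @ C)"
proof -
  have "admissible ((A @ B) @ C)" using assms by simp
  note b = admissible_01[OF assms] admissible_01[OF this]
  have nB: "0 \<le> fst (td B) z" for z using assms by (intro td_nonneg) (simp add: admissible_def)
  have "fst (td (A @ B)) z = 1" if "fst (td A) z = 1" for z
    using that b(3)[of z] nB[of z] b(5)[of z] unfolding td_append_chain by linarith
  moreover have "fst (td (B @ C)) z = 1" if "fst (td C) z = 1" for z
    using that b(1)[of z] b(3)[of z] nB[of z] unfolding td_append_chain by linarith
  ultimately show "inverted_between A C \<subseteq> inverted_between (A @ B) C" "inverted_between A C \<subseteq> inverted_between A (B @ C)"
    unfolding inverted_between_def by blast+
qed

lemma inverted_between_Un: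
  assumes "admissible (A @ B @ C)"
  shows "inverted_between A (B @ C) \<subseteq> inverted_between A B \<union> inverted_between A C"
    "inverted_between (A @ B) C \<subseteq> inverted_between A C \<union> inverted_between B C"
proof -
  have "admissible ((A @ B) @ C)" using assms by simp
  note b = admissible_01[OF assms] admissible_01[OF this]
  have 1: "fst (td B) z = 1 \<or> fst (td C) z = 1" if "fst (td (B @ C)) z = 1" for z
    using that b(1,3)[of z] b(4,5,6)[of z] unfolding td_append_chain by (smt (verit))
  have 2: "fst (td A) z = 1 \<or> fst (td B) z = 1" if "fst (td (A @ B)) z = 1" for z
    using that b(1,2,3)[of z] b(5,6)[of z] unfolding td_append_chain by (smt (verit))
  show "inverted_between A (B @ C) \<subseteq> inverted_between A B \<union> inverted_between A C"
    "inverted_between (A @ B) C \<subseteq> inverted_between A C \<union> inverted_between B C"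
    unfolding inverted_between_def using 1 2 by blast+
qed

text \<open>
  In particular the factors of a strict root invert exactly one place across the root, and those of a root
  with \<open>length M = card (inverted M) + 2\<close> invert none.
\<close>

lemma card_between_strict:
  assumes "admissible (A @ B)" "A \<noteq> []" "B \<noteq> []"
    "length A = card (inverted A) + 1" "length B = card (inverted B) + 1"
  shows "card (inverted (A @ B)) + 2 = length (A @ B) + card (inverted_between A B)"
  using card_inverted_append[OF assms(1-3)] assms(4,5) by simp

text \<open>
  The gap between two neighbouring leaves is the one between the two children of some vertex, and a strict
  vertex inverts a place between its children.
\<close>

lemma gap:
  "strict T \<Longrightarrow> label T = A @ B \<Longrightarrow> A \<noteq> [] \<Longrightarrow> B \<noteq> [] \<Longrightarrow> admissible (A @ B) \<Longrightarrow> inverted_between A B \<noteq> {}"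
proof (induction T arbitrary: A B)
  case (Leaf c)
  then show ?case by (cases A) auto
next
  case (Node l r)
  have st: "strict l" "strict r" "length (label l @ label r) = card (inverted (label l @ label r)) + 1"
    using Node.prems(1) by (auto simp: strict_Node)
  have e: "label l @ label r = A @ B" using Node.prems(2) by simp
  then obtain us where us: "label l = A @ us \<and> us @ label r = B \<or> label l @ us = A \<and> label r = us @ B"
    unfolding append_eq_append_conv2 by blast
  show ?case
  proof (cases "us = []")
    case True
    then have AB: "label l = A" "label r = B" using us by auto
    then have "card (inverted_between A B) = 1"
      using card_between_strict[OF Node.prems(5,3,4)] strict_root[OF st(1)] strict_root[OF st(2)] st(3) by simp
    then show ?thesis by auto
  next
    case ne: False
    show ?thesis using us
    proof
      assume us: "label l = A @ us \<and> us @ label r = B"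
      have "admissible (A @ us @ label r)" using Node.prems(5) us by simp
      moreover from this have "admissible (A @ us)" using admissible_append(1)[of "A @ us" "label r"] Node.prems(3) by simp
      ultimately show ?thesis
        using Node.IH(1)[OF st(1) _ Node.prems(3) ne] us inverted_between_mono[of "[]" A us "label r"] by auto
    next
      assume us: "label l @ us = A \<and> label r = us @ B"
      have ad: "admissible (label l @ us @ B)" using Node.prems(5) us by auto
      then have "admissible (us @ B)" using admissible_append(2)[of "label l" "us @ B"] ne by simp
      then show ?thesis
        using Node.IH(2)[OF st(2) _ ne Node.prems(4)] us inverted_between_mono[of "label l" us B "[]"] ad by auto
    qed
  qed
qed

text \<open>Tight classes have no twisted places, so that every twisted place arises at some vertex.\<close>

lemma twisted_places_inverted:
  "admissible (label T) \<Longrightarrow> nonsingular_tree T \<Longrightarrow> twisted_places (td (label T)) \<subseteq> inverted (label T)"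
proof (induction T)
  case (Leaf c)
  then show ?case using rep[of c] by (metis empty_subsetI label.simps(1))
next
  case (Node l r)
  have ad: "admissible (label l @ label r)" using Node.prems by simp
  note adm = admissible_append[OF ad label_nonempty label_nonempty]
  have ns: "nonsingular_tree l" "nonsingular_tree r" using Node.prems by (simp_all add: nonsingular_Node)
  obtain \<mu> \<nu> where "\<mu> \<in> dgs (td (label l))" "\<nu> \<in> dgs (td (label r))"
    using root_nonsingular[OF ns(1)] root_nonsingular[OF ns(2)] by blast
  from twisted_places_append[OF ad label_nonempty label_nonempty this] show ?case
    using Node.IH(1)[OF adm(1) ns(1)] Node.IH(2)[OF adm(2) ns(2)] inverted_append[OF ad] by auto
qed

text \<open>
  The factor \<open>A\<close> covers both steps at \<open>p\<close>, so \<open>B\<close> is idle at the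
  pair of \<open>p\<close>.
\<close>

lemma twisted_place_left:
  assumes ad: "admissible (A @ B)" and ne: "A \<noteq> []" "B \<noteq> []" and \<nu>: "\<nu> \<in> dgs (td B)"
    and p: "p \<in> twisted_places (td (A @ B))" "p \<in> inverted A"
  shows "p \<in> twisted_places (td A)"
proof -
  note b = admissible_01[OF ad] and adm = admissible_append[OF ad ne]
  note occ = inverted_occupied[OF adm(1) p(2)]
  have fib: "fibre Z (pairing Z p) = {p, twin Z p}" by (rule twin(4)[OF occ(1)])
  have tw: "fst (td A) (twin Z p) + fst (td B) (twin Z p) = 0"
      "fst (td A) (step_before (twin Z p)) + fst (td B) (step_before (twin Z p)) = 0"
    and on: "pairing Z p \<in> fst (snd (td A))" "pairing Z p \<in> snd (snd (td B))"
    using p(1) unfolding twisted_places_def once_occupied_iff on_on_iff td_append_chain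
      td_append_start[OF ne(1)] td_append_end[OF ne(2)] by auto
  have z: "fst (td A) (twin Z p) = 0" "fst (td A) (step_before (twin Z p)) = 0"
    "fst (td B) (twin Z p) = 0" "fst (td B) (step_before (twin Z p)) = 0"
    "fst (td B) p = 0" "fst (td B) (step_before p) = 0"
    using tw occ b[of "twin Z p"] b[of "step_before (twin Z p)"] b[of p] b[of "step_before p"] by auto
  then have "idle (pairing Z p) (td B)" using fib by (simp add: idle_def)
  then have "pairing Z p \<in> snd (snd (td A))" using idle_dgs[OF \<nu>] on(2) adm(3) by simp
  then show ?thesis using occ z on unfolding twisted_places_def once_occupied_iff on_on_iff by simp
qed

lemma twisted_place_right:
  assumes ad: "admissible (A @ B)" and ne: "A \<noteq> []" "B \<noteq> []" and \<mu>: "\<mu> \<in> dgs (td A)"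
    and p: "p \<in> twisted_places (td (A @ B))" "p \<in> inverted B"
  shows "p \<in> twisted_places (td B)"
proof -
  note b = admissible_01[OF ad] and adm = admissible_append[OF ad ne]
  note occ = inverted_occupied[OF adm(2) p(2)]
  have fib: "fibre Z (pairing Z p) = {p, twin Z p}" by (rule twin(4)[OF occ(1)])
  have tw: "fst (td A) (twin Z p) + fst (td B) (twin Z p) = 0"
      "fst (td A) (step_before (twin Z p)) + fst (td B) (step_before (twin Z p)) = 0"
    and on: "pairing Z p \<in> fst (snd (td A))" "pairing Z p \<in> snd (snd (td B))"
    using p(1) unfolding twisted_places_def once_occupied_iff on_on_iff td_append_chain
      td_append_start[OF ne(1)] td_append_end[OF ne(2)] by auto
  have z: "fst (td A) (twin Z p) = 0" "fst (td A) (step_before (twin Z p)) = 0"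
    "fst (td B) (twin Z p) = 0" "fst (td B) (step_before (twin Z p)) = 0"
    "fst (td A) p = 0" "fst (td A) (step_before p) = 0"
    using tw occ b[of "twin Z p"] b[of "step_before (twin Z p)"] b[of p] b[of "step_before p"] by auto
  then have "idle (pairing Z p) (td A)" using fib by (simp add: idle_def)
  then have "pairing Z p \<in> fst (snd (td B))" using idle_dgs[OF \<mu>] on(1) adm(3) by simp
  then show ?thesis using occ z on unfolding twisted_places_def once_occupied_iff on_on_iff by simp
qed

text \<open>
  If there was no diagram for \<open>B @ C\<close>, then a strand of \<open>B\<close> would end at a place
  \<open>x\<close>, with a strand of \<open>C\<close> beginning at the twin of \<open>x\<close> and the
  pair being off at the end. A diagram for \<open>A @ B @ C\<close> then has to pass \<open>x\<close>, so
  the step after \<open>x\<close> is covered by \<open>A\<close>, and \<open>x\<close> is inverted between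
  \<open>A\<close> and \<open>B\<close>. But \<open>p\<close>, the only such place, has no covered step at
  its twin.
\<close>

lemma rotate_nonsingular_right:
  assumes ad: "admissible (A @ B @ C)" and ne: "A \<noteq> []" "B \<noteq> []" "C \<noteq> []"
    and ns: "dgs (td (A @ B @ C)) \<noteq> {}" "dgs (td B) \<noteq> {}" "dgs (td C) \<noteq> {}"
    and p: "p \<in> twisted_places (td (A @ B @ C))" "inverted_between A B = {p}"
  shows "dgs (td (B @ C)) \<noteq> {}"
proof -
  have adBC: "admissible (B @ C)" using admissible_append(2)[OF ad ne(1)] ne by simp
  note b = admissible_01[OF ad]
  obtain \<mu> where \<mu>: "\<mu> \<in> dgs (td B)" "broken \<mu> = {}" using ex_unbroken[OF ns(2)] .
  obtain \<nu> where \<nu>: "\<nu> \<in> dgs (td C)" "broken \<nu> = {}" using ex_unbroken[OF ns(3)] .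
  have "matched \<mu> \<nu>"
  proof (rule ccontr)
    assume "\<not> matched \<mu> \<nu>"
    then obtain x where x: "x \<in> places Z" "fst (td B) (step_before x) = 1" "fst (td B) x = 0" "fst (td C) x = 0"
      "fst (td C) (twin Z x) = 1" "pairing Z x \<notin> snd (snd (td C))"
      using unmatched_unbroken[OF adBC ne(2,3) \<mu>(1) \<nu>(1) _ \<mu>(2) \<nu>(2)] by metis
    obtain \<rho> where \<rho>: "\<rho> \<in> dgs (td (A @ B @ C))" using ns(1) by blast
    have chain: "fst (td (A @ B @ C)) z = fst (td A) z + fst (td B) z + fst (td C) z" for z
      by (simp add: td_append_chain)
    have "x \<notin> Range \<rho>"
      using dgs_Range_on[OF \<rho> _ x(1)] x(6) td_append_end[of "B @ C" A] td_append_end[OF ne(3), of B] ne by auto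
    moreover have "fst (td (A @ B @ C)) (step_before x) = 1"
      using x(2) dgs_01[OF \<rho>, of "step_before x"] b(1)[of "step_before x"] admissible_01(2)[OF adBC, of "step_before x"]
      unfolding chain by linarith
    ultimately have "fst (td (A @ B @ C)) x = 1" using dgs_end(1)[OF \<rho> x(1)] by blast
    then have "fst (td A) x = 1" using x(3,4) unfolding chain by simp
    then have "x = p" using x(1,2) p(2) unfolding inverted_between_def by blast
    then have "fst (td (A @ B @ C)) (twin Z x) = 0" using p(1) by (simp add: twisted_places_def once_occupied_iff)
    then show False
      using x(5) b(1)[of "twin Z x"] admissible_01(1)[OF adBC, of "twin Z x"] unfolding chain by linarith
  qed
  then show ?thesis using concat_dgs[OF adBC ne(2,3) \<mu>(1) \<nu>(1)] by blast
qed

text \<open>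
  The mirror image of \<open>rotate_nonsingular_right\<close>: here the diagram for \<open>A @ B @
  C\<close> has to pass the place at which the strand of \<open>B\<close> begins.
\<close>

lemma rotate_nonsingular_left:
  assumes ad: "admissible (A @ B @ C)" and ne: "A \<noteq> []" "B \<noteq> []" "C \<noteq> []"
    and ns: "dgs (td (A @ B @ C)) \<noteq> {}" "dgs (td A) \<noteq> {}" "dgs (td B) \<noteq> {}"
    and p: "p \<in> twisted_places (td (A @ B @ C))" "inverted_between B C = {p}"
  shows "dgs (td (A @ B)) \<noteq> {}"
proof -
  have ad2: "admissible ((A @ B) @ C)" using ad by simp
  then have adAB: "admissible (A @ B)" using admissible_append(1) ne by blast
  note b = admissible_01[OF ad2] and ab = admissible_01[OF adAB]
  obtain \<mu> where \<mu>: "\<mu> \<in> dgs (td A)" "broken \<mu> = {}" using ex_unbroken[OF ns(2)] .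
  obtain \<nu> where \<nu>: "\<nu> \<in> dgs (td B)" "broken \<nu> = {}" using ex_unbroken[OF ns(3)] .
  have "matched \<mu> \<nu>"
  proof (rule ccontr)
    assume "\<not> matched \<mu> \<nu>"
    then obtain x where x: "x \<in> places Z" "fst (td A) (step_before x) = 1"
      "fst (td B) (twin Z x) = 1" "fst (td A) (step_before (twin Z x)) = 0" "fst (td B) (step_before (twin Z x)) = 0"
      "pairing Z x \<notin> fst (snd (td A))"
      using unmatched_unbroken[OF adAB ne(1,2) \<mu>(1) \<nu>(1) _ \<mu>(2) \<nu>(2)] by metis
    note tx = twin[OF x(1)]
    obtain \<rho> where \<rho>: "\<rho> \<in> dgs (td (A @ B @ C))" using ns(1) by blast
    have chain: "fst (td (A @ B @ C)) z = fst (td A) z + fst (td B) z + fst (td C) z" for z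
      by (simp add: td_append_chain)
    have "twin Z x \<notin> Domain \<rho>"
      using dgs_Domain_on[OF \<rho> _ tx(1)] x(6) tx(3) td_append_start[OF ne(1), of "B @ C"] by auto
    moreover have "fst (td (A @ B @ C)) (twin Z x) = 1"
      using x(3) dgs_01[OF \<rho>, of "twin Z x"] b(2)[of "twin Z x"] ab(1)[of "twin Z x"] unfolding chain by linarith
    ultimately have "fst (td (A @ B @ C)) (step_before (twin Z x)) = 1" using dgs_start(1)[OF \<rho>] by blast
    then have "fst (td C) (step_before (twin Z x)) = 1" using x(4,5) unfolding chain by simp
    then have tp: "twin Z x = p" using tx(1) x(3) p(2) unfolding inverted_between_def by blast
    have "twin Z (twin Z x) = x" using same_pair[OF tx(1) x(1)] tx(2,3) by metis
    then have "fst (td (A @ B @ C)) (step_before x) = 0"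
      using p(1) tp by (auto simp: twisted_places_def once_occupied_iff)
    then show False
      using x(2) b(2)[of "step_before x"] ab(2)[of "step_before x"] unfolding chain by linarith
  qed
  then show ?thesis using concat_dgs[OF adAB ne(1,2) \<mu>(1) \<nu>(1)] by blast
qed

text \<open>
  The vertex of a strict tree at which the twisted place \<open>p\<close> gets inverted can be rotated to
  the root. By induction it is the root of one of the two subtrees, say of the left one, so the tree has
  the form \<open>(A B) C\<close> with \<open>p\<close> inverted between \<open>A\<close> and
  \<open>B\<close>. The tree \<open>A (B C)\<close> is valid by \<open>rotate_nonsingular_right\<close>.
  Besides \<open>p\<close>, a place inverted between \<open>A\<close> and \<open>B C\<close> can only be
  the one that was inverted between \<open>A B\<close> and \<open>C\<close>, so \<open>B C\<close> inverts
  sufficiently many places for the new tree to be distributive. By rigidity it is strict, so that only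
  \<open>p\<close> is inverted at its root.
\<close>

lemma rotate_to_root:
  assumes "admissible M" "rigid M" "p \<in> twisted_places (td M)"
  obtains TA TB where "label TA @ label TB = M" "strict TA" "strict TB" "inverted_between (label TA) (label TB) = {p}"
  using assms
proof (induction "length M" arbitrary: M thesis rule: less_induct)
  case less
  note ad = less.prems(2) and rig = less.prems(3) and p = less.prems(4)
  obtain T where T: "label T = M" "distributive T" "strict T" using rig unfolding rigid_def by blast
  have pin: "p \<in> inverted M"
    using twisted_places_inverted[of T] ad p T distributive_nonsingular by blast
  have single: "X = {p}" if "card X = 1" "p \<in> X" for X
    using that by (metis card_1_singletonE singletonD)
  show ?case
  proof (cases T)
    case (Leaf c)
    then show ?thesis using pin T(1) inverted_single by auto
  next
    case (Node l r)
    have M: "M = label l @ label r" using T(1) Node by simp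
    have st: "strict l" "strict r" "dgs (td M) \<noteq> {}" "length M = card (inverted M) + 1"
      using T(3) Node M by (auto simp: strict_Node)
    have dN: "distributive (Node l r)" using T(2) Node by simp
    note adM = ad[unfolded M] and len = strict_root[OF st(1)] strict_root[OF st(2)]
    note adm = admissible_append[OF adM label_nonempty label_nonempty]
    have btw: "card (inverted_between (label l) (label r)) = 1"
      using card_between_strict[OF adM label_nonempty label_nonempty len] st(4) M by simp
    note rg = rigid_factors[OF rigid_rigid_below[OF rig] M[symmetric] dN]
    have nsl: "dgs (td (label l)) \<noteq> {}" and nsr: "dgs (td (label r)) \<noteq> {}"
      using st(1,2) root_nonsingular by (auto simp: strict_def)
    consider "p \<in> inverted_between (label l) (label r)" | "p \<in> inverted (label l)" | "p \<in> inverted (label r)"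
      using pin inverted_append[OF adM] M by auto
    then show ?thesis
    proof cases
      case 1
      then show ?thesis using less.prems(1)[OF M[symmetric] st(1,2)] single[OF btw] by blast
    next
      case 2
      obtain \<nu> where "\<nu> \<in> dgs (td (label r))" using nsr by blast
      then have pl: "p \<in> twisted_places (td (label l))"
        using twisted_place_left[OF adM label_nonempty label_nonempty] p 2 M by blast
      have "length (label l) < length M" using M by simp
      then obtain TA TB where AB: "label TA @ label TB = label l" "strict TA" "strict TB"
        "inverted_between (label TA) (label TB) = {p}" using less.hyps[OF _ _ adm(1) rg(1) pl] by blast
      let ?A = "label TA" and ?B = "label TB" and ?C = "label r"
      have M3: "M = ?A @ ?B @ ?C" using M AB(1) by (metis append.assoc)
      note ad3 = ad[unfolded M3]
      have nsAB: "dgs (td ?A) \<noteq> {}" "dgs (td ?B) \<noteq> {}"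
        using AB(2,3) root_nonsingular by (auto simp: strict_def)
      have nsBC: "dgs (td (?B @ ?C)) \<noteq> {}"
        using rotate_nonsingular_right[OF ad3 _ _ _ _ nsAB(2) nsr _ AB(4)] st(3) p M3 by simp
      have ca: "card (inverted M) = card (inverted ?A) + card (inverted (?B @ ?C)) + card (inverted_between ?A (?B @ ?C))"
        unfolding M3 by (rule card_inverted_append[OF ad3]) simp_all
      have "inverted_between ?A (?B @ ?C) \<subseteq> {p} \<union> inverted_between (label l) ?C"
        using inverted_between_Un(1)[OF ad3] inverted_between_skip(1)[OF ad3] AB(1,4) by auto
      then have "card (inverted_between ?A (?B @ ?C)) \<le> card ({p} \<union> inverted_between (label l) ?C)"
        by (intro card_mono) (simp_all add: finite_inverted)
      also have "\<dots> \<le> 2" using card_Un_le[of "{p}" "inverted_between (label l) ?C"] btw by simp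
      finally have "length (?B @ ?C) \<le> card (inverted (?B @ ?C)) + 2"
        using ca st(4) strict_root[OF AB(2)] M3 by simp
      then have "distributive (Node TB r)"
        unfolding distributive_Node using AB(3) st(2) strict_distributive nsBC by blast
      moreover have "dgs (td (?A @ label (Node TB r))) \<noteq> {}"
        "length (?A @ label (Node TB r)) \<le> card (inverted (?A @ label (Node TB r))) + 2"
        using st(3,4) M3 by simp_all
      ultimately have "distributive (Node TA (Node TB r))"
        using AB(2) strict_distributive unfolding distributive_Node[of TA] by blast
      moreover have "label (Node TA (Node TB r)) = M" using M3 by simp
      ultimately have stN: "strict (Node TA (Node TB r))" using rig unfolding rigid_def by blast
      then have sBC: "strict (Node TB r)" by (simp add: strict_Node)
      have "card (inverted_between ?A (label (Node TB r))) = 1"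
        using card_between_strict[of ?A "label (Node TB r)"] strict_root[OF AB(2)] strict_root[OF sBC] ad3 st(4) M3 by simp
      moreover have "p \<in> inverted_between ?A (label (Node TB r))"
        using inverted_between_mono[of "[]" ?A ?B ?C] ad3 AB(4) by auto
      ultimately show ?thesis
        using less.prems(1)[of TA "Node TB r"] AB(2) sBC single M3 by simp
    next
      case 3
      obtain \<mu> where "\<mu> \<in> dgs (td (label l))" using nsl by blast
      then have pr: "p \<in> twisted_places (td (label r))"
        using twisted_place_right[OF adM label_nonempty label_nonempty] p 3 M by blast
      have "length (label r) < length M" using M by simp
      then obtain TB TC where BC: "label TB @ label TC = label r" "strict TB" "strict TC"
        "inverted_between (label TB) (label TC) = {p}" using less.hyps[OF _ _ adm(2) rg(2) pr] by blast
      let ?A = "label l" and ?B = "label TB" and ?C = "label TC"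
      have M3: "M = ?A @ ?B @ ?C" using M BC(1) by simp
      note ad3 = ad[unfolded M3]
      have ad3': "admissible ((?A @ ?B) @ ?C)" using ad3 by simp
      have nsBC: "dgs (td ?B) \<noteq> {}" "dgs (td ?C) \<noteq> {}"
        using BC(2,3) root_nonsingular by (auto simp: strict_def)
      have nsAB: "dgs (td (?A @ ?B)) \<noteq> {}"
        using rotate_nonsingular_left[OF ad3 _ _ _ _ nsl nsBC(1) _ BC(4)] st(3) p M3 by simp
      have ca: "card (inverted M) = card (inverted (?A @ ?B)) + card (inverted ?C) + card (inverted_between (?A @ ?B) ?C)"
        using card_inverted_append[OF ad3'] M3 by simp
      have "inverted_between (?A @ ?B) ?C \<subseteq> {p} \<union> inverted_between ?A (label r)"
        using inverted_between_Un(2)[OF ad3] inverted_between_skip(2)[OF ad3] BC(1,4) by auto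
      then have "card (inverted_between (?A @ ?B) ?C) \<le> card ({p} \<union> inverted_between ?A (label r))"
        by (intro card_mono) (simp_all add: finite_inverted)
      also have "\<dots> \<le> 2" using card_Un_le[of "{p}" "inverted_between ?A (label r)"] btw by simp
      finally have "length (?A @ ?B) \<le> card (inverted (?A @ ?B)) + 2"
        using ca st(4) strict_root[OF BC(3)] M3 by simp
      then have "distributive (Node l TB)"
        unfolding distributive_Node using BC(2) st(1) strict_distributive nsAB by blast
      moreover have "dgs (td (label (Node l TB) @ ?C)) \<noteq> {}"
        "length (label (Node l TB) @ ?C) \<le> card (inverted (label (Node l TB) @ ?C)) + 2"
        using st(3,4) M3 by simp_all
      ultimately have "distributive (Node (Node l TB) TC)"
        using BC(3) strict_distributive unfolding distributive_Node[of "Node l TB"] by blast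
      moreover have "label (Node (Node l TB) TC) = M" using M3 by simp
      ultimately have stN: "strict (Node (Node l TB) TC)" using rig unfolding rigid_def by blast
      then have sAB: "strict (Node l TB)" by (simp add: strict_Node)
      have "card (inverted_between (label (Node l TB)) ?C) = 1"
        using card_between_strict[of "label (Node l TB)" ?C] strict_root[OF BC(3)] strict_root[OF sAB] ad3 st(4) M3 by simp
      moreover have "p \<in> inverted_between (label (Node l TB)) ?C"
        using inverted_between_mono[of ?A ?B ?C "[]"] ad3 BC(4) by auto
      ultimately show ?thesis
        using less.prems(1)[of "Node l TB" TC] BC(3) sAB single M3 by simp
    qed
  qed
qed

end

section \<open>Nonvanishing operations\<close>

context operations
begin

lemma f_in: "admissible M \<Longrightarrow> f M \<in> alg_part Z (td M)"
  using arises_at(1) by (simp add: admissible_def)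

lemma f_support: "admissible M \<Longrightarrow> support (f M) \<subseteq> dgs (td M)" "admissible M \<Longrightarrow> f M = (\<Sum>\<mu>\<in>support (f M). dia (td M) \<mu>)"
  using alg_partE[OF admissible_viable f_in] by blast+

lemma f_nonzero_support: "admissible M \<Longrightarrow> f M \<noteq> 0 \<Longrightarrow> support (f M) \<noteq> {}"
  using f_support(2) by force

lemma length_cases: "admissible M \<Longrightarrow> (\<And>c. M = [c] \<Longrightarrow> R) \<Longrightarrow> (2 \<le> length M \<Longrightarrow> R) \<Longrightarrow> R"
  unfolding admissible_def by (cases M; cases "tl M") auto

text \<open>
  A nonzero value of \<open>f\<close> comes from a nonzero product in the recursion, whose factors have
  distributive trees by induction. The root is distributive by \<open>broken_count\<close>.
\<close>

lemma distributive_tree_if_nonzero: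
  "admissible M \<Longrightarrow> f M \<noteq> 0 \<Longrightarrow> \<exists>T. label T = M \<and> distributive T"
proof (induction "length M" arbitrary: M rule: less_induct)
  case less
  note ad = less.prems(1)
  obtain \<mu> where \<mu>: "\<mu> \<in> support (f M)" using f_nonzero_support[OF less.prems] by blast
  have ns: "dgs (td M) \<noteq> {}" using f_support(1)[OF ad] \<mu> by blast
  have len: "length M \<le> card (inverted M) + 2" using broken_count[OF ad \<mu>] by simp
  show ?case
  proof (rule length_cases[OF ad])
    fix c assume c: "M = [c]"
    have "distributive (Leaf c)" using ns c by (simp add: distributive_def nonsingular_tree_def)
    then show ?thesis using c by (intro exI[of _ "Leaf c"]) simp
  next
    assume n: "2 \<le> length M"
    have tw: "twisted_places (td M) \<noteq> {}" using f_untwisted[OF ad n] less.prems(2) by blast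
    have "(\<Sum>j\<in>{1..<length M}. f (take j M) \<odot> f (drop j M)) \<noteq> 0"
      using f_twisted[OF ad n tw ns] less.prems(2)
        A_star_0[OF ord tw admissible_undoubled[OF ad] admissible_viable[OF ad]] by auto
    then obtain j where j: "j \<in> {1..<length M}" "f (take j M) \<odot> f (drop j M) \<noteq> 0"
      by (meson sum.neutral)
    then have ne: "take j M \<noteq> []" "drop j M \<noteq> []" by auto
    have ad': "admissible (take j M @ drop j M)" using ad by simp
    note adm = admissible_append[OF ad' ne]
    have "f (take j M) \<noteq> 0" "f (drop j M) \<noteq> 0" using j(2) by auto
    then obtain TA TB where T: "label TA = take j M" "distributive TA" "label TB = drop j M" "distributive TB"
      using less.hyps[OF _ adm(1)] less.hyps[OF _ adm(2)] j(1) by fastforce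
    have "distributive (Node TA TB)" using T ns len by (simp add: distributive_Node)
    then show ?thesis using T by (intro exI[of _ "Node TA TB"]) simp
  qed
qed

text \<open>
  By \<open>broken_count\<close> no diagram in \<open>f M\<close> is broken, and there is only one such
  diagram with the H-data of \<open>M\<close>.
\<close>

lemma f_single_term:
  assumes ad: "admissible M" and len: "length M = card (inverted M) + 1" and nz: "f M \<noteq> 0"
  obtains \<mu> where "\<mu> \<in> dgs (td M)" "f M = dia (td M) \<mu>" "broken \<mu> = {}"
proof -
  have br: "broken \<mu> = {}" if "\<mu> \<in> support (f M)" for \<mu>
  proof -
    have \<mu>: "\<mu> \<in> dgs (td M)" using that f_support(1)[OF ad] by blast
    have "finite (broken \<mu>)" using finite_subset[OF _ finite_places] broken_place[OF \<mu>] by blast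
    then show ?thesis using broken_count[OF ad that] len by simp
  qed
  obtain \<mu> where \<mu>: "\<mu> \<in> support (f M)" using f_nonzero_support[OF ad nz] by blast
  have "\<nu> = \<mu>" if "\<nu> \<in> support (f M)" for \<nu>
    using dgs_unique[of \<nu> "td M" \<mu>] f_support(1)[OF ad] that \<mu> br by blast
  then have "support (f M) = {\<mu>}" using \<mu> by blast
  then have "f M = dia (td M) \<mu>" using f_support(2)[OF ad] by simp
  then show ?thesis using that f_support(1)[OF ad] \<mu> br by blast
qed

text \<open>
  Both values are single diagrams without broken places, so their product cannot vanish if the H-data
  admit a diagram at all.
\<close>

lemma product_of_unbroken:
  assumes ad: "admissible (A @ B)" and ne: "A \<noteq> []" "B \<noteq> []" and ns: "dgs (td (A @ B)) \<noteq> {}"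
    and len: "length A = card (inverted A) + 1" "length B = card (inverted B) + 1" and nz: "f A \<noteq> 0" "f B \<noteq> 0"
  obtains \<mu> where "\<mu> \<in> dgs (td (A @ B))" "f A \<odot> f B = dia (td (A @ B)) \<mu>" "broken \<mu> = inverted_between A B"
proof -
  note adm = admissible_append[OF ad ne]
  obtain \<mu> where \<mu>: "\<mu> \<in> dgs (td A)" "f A = dia (td A) \<mu>" "broken \<mu> = {}"
    using f_single_term[OF adm(1) len(1) nz(1)] .
  obtain \<nu> where \<nu>: "\<nu> \<in> dgs (td B)" "f B = dia (td B) \<nu>" "broken \<nu> = {}"
    using f_single_term[OF adm(2) len(2) nz(2)] .
  have m: "matched \<mu> \<nu>" by (rule matched_if_unbroken[OF ad ne \<mu>(1) \<nu>(1) ns \<mu>(3) \<nu>(3)])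
  show ?thesis
  proof (rule that)
    show "concat_strands \<mu> \<nu> \<in> dgs (td (A @ B))" by (rule concat_dgs[OF ad ne \<mu>(1) \<nu>(1) m])
    show "f A \<odot> f B = dia (td (A @ B)) (concat_strands \<mu> \<nu>)"
      using dia_mul[OF ad ne \<mu>(1) \<nu>(1)] m \<mu>(2) \<nu>(2) by simp
    show "broken (concat_strands \<mu> \<nu>) = inverted_between A B"
      using broken_concat_dgs[OF ad ne \<mu>(1) \<nu>(1)] \<mu>(3) \<nu>(3) by simp
  qed
qed

text \<open>
  The two factors have distributive trees, which combine to a tree for \<open>M\<close>; its children are
  strict by assumption.
\<close>

lemma nonzero_term:
  assumes ad: "admissible M" and rb: "rigid_below M" and ns: "dgs (td M) \<noteq> {}"
    and len: "length M \<le> card (inverted M) + 2" and j: "j \<in> {1..<length M}"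
    and nz: "f (take j M) \<odot> f (drop j M) \<noteq> 0"
  obtains TA TB \<mu> where "label TA = take j M" "strict TA" "label TB = drop j M" "strict TB"
    "\<mu> \<in> dgs (td M)" "f (take j M) \<odot> f (drop j M) = dia (td M) \<mu>"
    "broken \<mu> = inverted_between (take j M) (drop j M)"
proof -
  have ne: "take j M \<noteq> []" "drop j M \<noteq> []" using j by auto
  have ad': "admissible (take j M @ drop j M)" using ad by simp
  note adm = admissible_append[OF ad' ne]
  have nz': "f (take j M) \<noteq> 0" "f (drop j M) \<noteq> 0" using nz by auto
  obtain TA TB where T: "label TA = take j M" "distributive TA" "label TB = drop j M" "distributive TB"
    using distributive_tree_if_nonzero[OF adm(1) nz'(1)] distributive_tree_if_nonzero[OF adm(2) nz'(2)] by blast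
  have "distributive (Node TA TB)" "label (Node TA TB) = M" using T ns len by (simp_all add: distributive_Node)
  then have st: "strict TA" "strict TB" using rb unfolding rigid_below_def children_strict_def by blast+
  have l: "length (take j M) = card (inverted (take j M)) + 1" "length (drop j M) = card (inverted (drop j M)) + 1"
    using strict_root[OF st(1)] strict_root[OF st(2)] T by simp_all
  have ns': "dgs (td (take j M @ drop j M)) \<noteq> {}" using ns by simp
  obtain \<mu> where \<mu>: "\<mu> \<in> dgs (td (take j M @ drop j M))"
    "f (take j M) \<odot> f (drop j M) = dia (td (take j M @ drop j M)) \<mu>"
    "broken \<mu> = inverted_between (take j M) (drop j M)"
    using product_of_unbroken[OF ad' ne ns' l nz'] .
  show ?thesis
    by (rule that[OF T(1) st(1) T(3) st(2) _ _ \<mu>(3)]) (use \<mu>(1,2) in simp_all)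
qed

text \<open>
  By \<open>gap\<close>, some place is inverted between the two parts \<open>take j M\<close> and
  \<open>drop j (take j' M)\<close> of \<open>take j' M\<close>. Its incoming step is covered by the
  second part, hence not by \<open>drop j' M\<close>.
\<close>

lemma separate_splittings:
  assumes ad: "admissible M" and j: "1 \<le> j" "j < j'" "j' < length M" and T: "label T = take j' M" "strict T"
  obtains x where "x \<in> inverted_between (take j M) (drop j M)" "x \<notin> inverted_between (take j' M) (drop j' M)"
proof -
  define A B C where ABC: "A = take j M" "B = drop j (take j' M)" "C = drop j' M"
  have AB: "take j' M = A @ B" using j(2) unfolding ABC by (metis append_take_drop_id less_imp_le_nat min.absorb1 take_take)
  have BC: "drop j M = B @ C"
    unfolding ABC using j(2) by (metis append_take_drop_id drop_take le_add_diff_inverse2 less_imp_le_nat drop_drop)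
  have M: "M = A @ B @ C" using BC ABC(1) by (metis append_take_drop_id)
  have ne: "A \<noteq> []" "B \<noteq> []" using j unfolding ABC by auto
  have ad3: "admissible (A @ B @ C)" using ad M by simp
  have C: "C \<noteq> []" using j(3) unfolding ABC by simp
  have adAB: "admissible (A @ B)" using admissible_append(1)[of "A @ B" C] ad3 ne C by simp
  obtain x where x: "x \<in> inverted_between A B" using gap[OF T(2) _ ne adAB] T(1) AB by auto
  have "x \<in> inverted_between A (B @ C)" using inverted_between_mono[of "[]" A B C] ad3 x by auto
  moreover have "x \<notin> inverted_between (A @ B) C"
  proof
    assume "x \<in> inverted_between (A @ B) C"
    then have "fst (td C) (step_before x) = 1" "fst (td B) (step_before x) = 1"
      using x unfolding inverted_between_def by blast+
    then show False using admissible_01[OF ad3, of "step_before x"] by (simp add: td_append_chain)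
  qed
  ultimately show ?thesis using that unfolding AB BC ABC(1)[symmetric] ABC(3)[symmetric] by blast
qed

text \<open>
  Exactly one product in the recursion is broken at the first twisted place: there is one by
  \<open>rotate_to_root\<close>, and no other by \<open>separate_splittings\<close>, as each of them is
  broken at one place only.
\<close>

theorem f_nonzero:
  "admissible M \<Longrightarrow> rigid M \<Longrightarrow> f M \<noteq> 0"
proof (induction "length M" arbitrary: M rule: less_induct)
  case less
  note ad = less.prems(1) and rig = less.prems(2)
  obtain T where T: "label T = M" "distributive T" "strict T" using rig unfolding rigid_def by blast
  have ns: "dgs (td M) \<noteq> {}" using T root_nonsingular by (auto simp: strict_def)
  have len: "length M = card (inverted M) + 1" using strict_root[OF T(3)] T(1) by simp
  show ?case
  proof (cases T)
    case (Leaf c)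
    then have c: "M = [c]" using T(1) by simp
    obtain \<mu> where \<mu>: "dgs (td [c]) = {\<mu>}" "f [c] = dia (td [c]) \<mu>" using admissible_dgs_single ad c by metis
    then show ?thesis using c dia_nonzero[of \<mu> "td [c]"] by simp
  next
    case (Node l r)
    note rb = rigid_rigid_below[OF rig] and u = admissible_undoubled[OF ad] and v = admissible_viable[OF ad]
    \<comment> \<open>The product of the values on the factors of a strict splitting is broken just at the inverted place.\<close>
    have split: "\<exists>\<mu>\<in>dgs (td M). f (label TA) \<odot> f (label TB) = dia (td M) \<mu> \<and> broken \<mu> = inverted_between (label TA) (label TB)"
      if TT: "label TA @ label TB = M" "strict TA" "strict TB" for TA TB
    proof -
      have ad': "admissible (label TA @ label TB)" using ad TT(1) by simp
      note adm = admissible_append[OF ad' label_nonempty label_nonempty]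
      have "distributive (Node TA TB)" using TT ns len strict_distributive by (simp add: distributive_Node)
      note rg = rigid_factors[OF rb TT(1) this]
      have "length M = length (label TA) + length (label TB)" using TT(1) by (metis length_append)
      then have "f (label TA) \<noteq> 0" "f (label TB) \<noteq> 0"
        using less.hyps[OF _ adm(1) rg(1)] less.hyps[OF _ adm(2) rg(2)] by simp_all
      moreover have "dgs (td (label TA @ label TB)) \<noteq> {}" using ns TT(1) by simp
      ultimately show ?thesis
        using product_of_unbroken[OF ad' label_nonempty label_nonempty _ strict_root[OF TT(2)] strict_root[OF TT(3)]]
        unfolding TT(1) by blast
    qed
    have lr: "label l @ label r = M" "strict l" "strict r" using T(1,3) Node by (auto simp: strict_Node)
    have one: "card (inverted_between (label TA) (label TB)) = 1"
      if TT: "label TA @ label TB = M" "strict TA" "strict TB" for TA TB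
      using card_between_strict[of "label TA" "label TB"] strict_root[OF TT(2)] strict_root[OF TT(3)] ad TT(1) len
      by simp
    have tw: "twisted_places (td M) \<noteq> {}"
      using split[OF lr] one[OF lr] broken_subset[OF _ u] by fastforce
    let ?p = "first_place ord (td M)"
    let ?t = "\<lambda>j. f (take j M) \<odot> f (drop j M)"
    obtain TA TB where AB: "label TA @ label TB = M" "strict TA" "strict TB"
      "inverted_between (label TA) (label TB) = {?p}"
      using rotate_to_root[OF ad rig first_place(1)[OF ord tw]] .
    define i where "i = length (label TA)"
    have i: "take i M = label TA" "drop i M = label TB" "i \<in> {1..<length M}"
      unfolding i_def AB(1)[symmetric] by (simp_all add: Suc_le_eq)
    obtain \<mu> where \<mu>: "\<mu> \<in> dgs (td M)" "?t i = dia (td M) \<mu>" "broken \<mu> = {?p}"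
      using split[OF AB(1-3)] AB(4) i by auto
    \<comment> \<open>Any other nonzero product is broken at one place only, which is not the first twisted place.\<close>
    have others: "A_star Z ord (?t j) = 0" if j: "j \<in> {1..<length M}" "j \<noteq> i" for j
    proof (cases "?t j = 0")
      case True
      then show ?thesis using A_star_0[OF ord tw u v] by simp
    next
      case False
      obtain SA SB \<nu> where S: "label SA = take j M" "strict SA" "label SB = drop j M" "strict SB"
        "\<nu> \<in> dgs (td M)" "?t j = dia (td M) \<nu>" "broken \<nu> = inverted_between (take j M) (drop j M)"
        using nonzero_term[OF ad rb ns _ j(1) False] len by auto
      have SM: "label SA @ label SB = M" using S(1,3) by simp
      have "card (broken \<nu>) = 1" using one[OF SM S(2,4)] S(1,3,7) by simp
      then obtain y where y: "broken \<nu> = {y}" by (auto simp: card_1_singleton_iff)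
      have "?p \<noteq> y"
      proof (cases "j < i")
        case True
        obtain x where "x \<in> inverted_between (take j M) (drop j M)" "x \<notin> inverted_between (take i M) (drop i M)"
          by (rule separate_splittings[OF ad _ True _ i(1)[symmetric] AB(2)]) (use i(3) j(1) in auto)
        then show ?thesis using y S(7) AB(4) i by auto
      next
        case False
        then have "i < j" using j(2) by simp
        obtain x where "x \<in> inverted_between (take i M) (drop i M)" "x \<notin> inverted_between (take j M) (drop j M)"
          by (rule separate_splittings[OF ad _ \<open>i < j\<close> _ S(1,2)]) (use i(3) j(1) in auto)
        then show ?thesis using y S(7) AB(4) i by auto
      qed
      then have "?p \<notin> broken \<nu>" using y by simp
      then show ?thesis using A_star_dia[OF ord tw u v S(5)] S(6) by simp
    qed
    have "length M = length (label l) + length (label r)" using lr(1) by (metis length_append)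
    then have n: "2 \<le> length M"
      using label_nonempty[of l] label_nonempty[of r] by (metis One_nat_def Suc_1 Suc_leI add_mono length_greater_0_conv one_add_one)
    have "f M = (\<Sum>j\<in>{1..<length M}. A_star Z ord (?t j))"
      unfolding f_twisted[OF ad n tw ns] by (rule A_star_sum[OF ord tw u v product_term(1)[OF ad]])
    also have "\<dots> = A_star Z ord (?t i) + (\<Sum>j\<in>{1..<length M} - {i}. A_star Z ord (?t j))"
      by (rule sum.remove[OF _ i(3)]) simp
    also have "(\<Sum>j\<in>{1..<length M} - {i}. A_star Z ord (?t j)) = 0"
      using others by (intro sum.neutral) blast
    also have "A_star Z ord (?t i) = dia (td M) (join_at \<mu> ?p)"
      using A_star_dia[OF ord tw u v \<mu>(1)] \<mu>(2,3) by simp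
    finally have "f M = dia (td M) (join_at \<mu> ?p)" by simp
    moreover have "join_at \<mu> ?p \<in> dgs (td M)" using join_dgs(1)[OF \<mu>(1)] \<mu>(3) by simp
    ultimately show ?thesis using dia_nonzero by simp
  qed
qed

text \<open>
  All nonzero products come from splittings that invert no place, and by
  \<open>separate_splittings\<close> there is at most one such splitting. The given tree provides one.
\<close>

theorem X_value:
  assumes ad: "admissible M" and untw: "twisted_places (td M) = {}" and rb: "rigid_below M"
    and T: "label T = M" "distributive T" and len: "length M = card (inverted M) + 2"
  obtains \<mu> where "\<mu> \<in> dgs (td M)" "X M = cls Z (dia (td M) \<mu>)"
proof (cases T)
  case (Leaf c)
  then show ?thesis using T(1) len inverted_single by auto
next
  case (Node l r)
  have ns: "dgs (td M) \<noteq> {}" using root_nonsingular[OF distributive_nonsingular[OF T(2)]] T(1) by simp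
  have "children_strict T" using T rb unfolding rigid_below_def by blast
  then have lr: "label l @ label r = M" "strict l" "strict r"
    using T(1) Node by (simp_all add: children_strict_def)
  have ad': "admissible (label l @ label r)" using ad lr(1) by simp
  note adm = admissible_append[OF ad' label_nonempty label_nonempty]
  note rg = rigid_factors[OF rb lr(1) T(2)[unfolded Node]]
  let ?t = "\<lambda>j. f (take j M) \<odot> f (drop j M)"
  define i where "i = length (label l)"
  have i: "take i M = label l" "drop i M = label r" "i \<in> {1..<length M}"
    unfolding i_def lr(1)[symmetric] by (simp_all add: Suc_le_eq)
  have zero: "inverted_between (take j M) (drop j M) = {}"
    if TT: "label TA = take j M" "strict TA" "label TB = drop j M" "strict TB" for TA TB j
  proof -
    have e: "label TA @ label TB = M" using TT(1,3) by simp
    have "card (inverted_between (label TA) (label TB)) = 0"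
      using card_between_strict[OF _ label_nonempty label_nonempty strict_root[OF TT(2)] strict_root[OF TT(4)],
          unfolded e, OF ad] len by linarith
    then show ?thesis using TT(1,3) finite_inverted(2)[of "label TA" "label TB"] by simp
  qed
  obtain \<mu> where \<mu>: "\<mu> \<in> dgs (td M)" "?t i = dia (td M) \<mu>"
    using product_of_unbroken[OF ad' label_nonempty label_nonempty _ strict_root[OF lr(2)] strict_root[OF lr(3)]
        f_nonzero[OF adm(1) rg(1)] f_nonzero[OF adm(2) rg(2)]] ns i unfolding lr(1) by metis
  have others: "?t j = 0" if j: "j \<in> {1..<length M}" "j \<noteq> i" for j
  proof (rule ccontr)
    assume nz: "?t j \<noteq> 0"
    have len': "length M \<le> card (inverted M) + 2" using len by simp
    obtain SA SB where S: "label SA = take j M" "strict SA" "label SB = drop j M" "strict SB"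
      using nonzero_term[OF ad rb ns len' j(1) nz] by blast
    show False
    proof (cases "j < i")
      case True
      obtain x where "x \<in> inverted_between (take j M) (drop j M)"
        by (rule separate_splittings[OF ad _ True _ i(1)[symmetric] lr(2)]) (use i(3) j(1) in auto)
      then show False using zero[OF S] by blast
    next
      case False
      then have "i < j" using j(2) by simp
      obtain x where "x \<in> inverted_between (take i M) (drop i M)"
        by (rule separate_splittings[OF ad _ \<open>i < j\<close> _ S(1,2)]) (use i(3) j(1) in auto)
      then show False using zero[OF i(1)[symmetric] lr(2) i(2)[symmetric] lr(3)] by blast
    qed
  qed
  have "(\<Sum>j\<in>{1..<length M}. ?t j) = ?t i + (\<Sum>j\<in>{1..<length M} - {i}. ?t j)"
    by (rule sum.remove[OF _ i(3)]) simp
  also have "(\<Sum>j\<in>{1..<length M} - {i}. ?t j) = 0" using others by (intro sum.neutral) blast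
  finally have "X M = cls Z (dia (td M) \<mu>)" using X_untwisted[OF ad untw] \<mu>(2) by simp
  then show ?thesis using that \<mu>(1) by blast
qed

end

context arc
begin

text \<open>
  The ideal is spanned by diagrams with pairwise disjoint sets of terms. A diagram in it is therefore one
  of the spanning diagrams, and being viable it would be crossed at a doubly occupied pair, which is
  on-on.
\<close>

lemma not_in_crossing_ideal:
  assumes \<mu>: "\<mu> \<in> dgs d" and u: "undoubled d"
  shows "mod_F Z (dia d \<mu>) \<noteq> mod_F Z 0"
proof
  let ?B = "{D. diagram Z D \<and> (\<not> viable_diagram Z D \<or>
      (\<exists>P \<in> pairs Z. doubly_occupied Z P (hdata Z D) \<and> crossed_at Z P D))}"
  have "0 \<in> crossing_ideal Z" unfolding crossing_ideal_def by (rule span2_0)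
  then have "dia d \<mu> + 0 \<in> mod_F Z (dia d \<mu>)" unfolding mod_F_def by (rule set_plus_intro2)
  moreover assume "mod_F Z (dia d \<mu>) = mod_F Z 0"
  ultimately have "dia d \<mu> \<in> crossing_ideal Z" unfolding mod_F_def elt_set_plus_def by auto
  then obtain F where F: "F \<subseteq> ?B" "dia d \<mu> = (\<Sum>D\<in>F. D)" unfolding crossing_ideal_def span2_def by blast
  obtain \<phi> where \<phi>: "\<phi> \<in> ks (dia d \<mu>)" using ks_dia_nonempty[OF \<mu>] by blast
  then obtain D where D: "D \<in> F" "\<phi> \<in> ks D" using ks_sum_subset[of "\<lambda>x. x" F] unfolding F(2) by blast
  then have "diagram Z D" using F(1) by blast
  then obtain s \<nu> t where g: "good s \<nu> t" "D = diag Z s \<nu> t" by (auto simp: diagram_iff)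
  have "s = fst (snd d)" "\<nu> = \<mu>" "t = snd (snd d)"
    using key_props(1-3)[OF g(1)] key_props(1-3)[OF dgsD(1)[OF \<mu>]] \<phi> D(2) g(2) unfolding dia_def by metis+
  then have De: "D = dia d \<mu>" using g(2) by (simp add: dia_def)
  obtain P where P: "P \<in> pairs Z" "doubly_occupied Z P d" "crossed_at Z P (dia d \<mu>)"
    using F(1) D(1) viable_dia[OF \<mu>] hdata_dia[OF \<mu>] unfolding De by auto
  then obtain p where "p \<in> twisted_places d" "p \<in> fibre Z P" using crossed_at_iff[OF P(1) \<mu> u] by blast
  then have "on_on P d" by (simp add: twisted_places_def fibre_iff)
  then show False using u P unfolding undoubled_def by blast
qed

end

theorem theorem1p4:
  fixes Z :: "'i arc_diagram" and ord :: "'i pair_ordering"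
    and X :: "'i alg set list \<Rightarrow> 'i alg set" and f :: "'i alg set list \<Rightarrow> 'i alg"
    and M :: "'i alg set list"
  assumes "arc_diagram Z" and "pair_ordering Z ord" and "arises_from Z ord X f"
    and "M \<noteq> []" and "set M \<subseteq> diagram_classes Z" and "viable_tensor Z M"
  shows "((\<forall>P \<in> pairs Z. \<not> (on_on P (tensor_hdata Z M) \<and> doubly_occupied Z P (tensor_hdata Z M))) \<and>
      (\<forall>T. valid_distributive Z M T \<longrightarrow> strictly_f_distributive Z M T) \<and>
      (\<exists>T. valid_distributive Z M T) \<longrightarrow>
        mod_F Z (f M) \<noteq> mod_F Z 0 \<and>
        (\<exists>D. diagram Z D \<and> mod_F Z (f M) = mod_F Z D \<and>
          (\<forall>P \<in> pairs Z. (tensor_at tight_tensor Z P M \<or> tensor_at critical_tensor Z P M \<longrightarrow> tight_at Z P D) \<and>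
             (tensor_at twisted_tensor Z P M \<longrightarrow> crossed_at Z P D))))
    \<and> ((\<forall>P \<in> pairs Z. \<not> tensor_at twisted_tensor Z P M \<and>
           \<not> (on_on P (tensor_hdata Z M) \<and> doubly_occupied Z P (tensor_hdata Z M))) \<and>
      (\<forall>T. valid_distributive Z M T \<longrightarrow> strictly_X_distributive Z M T) \<and>
      (\<exists>T. valid_distributive Z M T) \<longrightarrow>
        X M \<noteq> cls Z 0 \<and>
        (\<exists>D. tight Z D \<and> hdata Z D = tensor_hdata Z M \<and>
          (\<forall>D'. tight Z D' \<and> hdata Z D' = tensor_hdata Z M \<longrightarrow> D' = D) \<and>
          X M = cls Z D))"
proof -
  interpret operations Z ord X f using assms(1-3) by unfold_locales
  have adI: "admissible M" if "\<forall>P \<in> pairs Z. \<not> (on_on P (td M) \<and> doubly_occupied Z P (td M))"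
    using assms(4-6) that by (simp add: admissible_def undoubled_def)
  show ?thesis
  proof (intro conjI impI)
    assume h: "(\<forall>P \<in> pairs Z. \<not> (on_on P (td M) \<and> doubly_occupied Z P (td M))) \<and>
      (\<forall>T. valid_distributive Z M T \<longrightarrow> strictly_f_distributive Z M T) \<and>
      (\<exists>T. valid_distributive Z M T)"
    then have ad: "admissible M" using adI by blast
    have rig: "rigid M"
      using h unfolding valid_distributive_iff[OF ad] strictly_f_distributive_iff[OF ad] rigid_def by blast
    then obtain T where T: "label T = M" "distributive T" "strict T" unfolding rigid_def by blast
    have "length M = card (inverted M) + 1" using strict_root[OF T(3)] T(1) by simp
    then obtain \<mu> where \<mu>: "\<mu> \<in> dgs (td M)" "f M = dia (td M) \<mu>" "broken \<mu> = {}"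
      using f_single_term[OF ad _ f_nonzero[OF ad rig]] by blast
    note u = admissible_undoubled[OF ad]
    show "mod_F Z (f M) \<noteq> mod_F Z 0" unfolding \<mu>(2) by (rule not_in_crossing_ideal[OF \<mu>(1) u])
    note status = tensor_at_status[OF _ distributive_nonsingular[OF T(2)], unfolded T(1), OF ad]
    have "\<forall>P \<in> pairs Z. (tensor_at tight_tensor Z P M \<or> tensor_at critical_tensor Z P M \<longrightarrow> tight_at Z P (f M)) \<and>
             (tensor_at twisted_tensor Z P M \<longrightarrow> crossed_at Z P (f M))"
      unfolding \<mu>(2)
      using status tight_at_iff[OF _ \<mu>(1) u] crossed_at_iff[OF _ \<mu>(1) u] \<mu>(3) by blast
    then show "\<exists>D. diagram Z D \<and> mod_F Z (f M) = mod_F Z D \<and>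
          (\<forall>P \<in> pairs Z. (tensor_at tight_tensor Z P M \<or> tensor_at critical_tensor Z P M \<longrightarrow> tight_at Z P D) \<and>
             (tensor_at twisted_tensor Z P M \<longrightarrow> crossed_at Z P D))"
      using diagram_dia[OF \<mu>(1)] \<mu>(2) by (intro exI[of _ "f M"]) simp
  next
    assume h: "(\<forall>P \<in> pairs Z. \<not> tensor_at twisted_tensor Z P M \<and>
           \<not> (on_on P (td M) \<and> doubly_occupied Z P (td M))) \<and>
      (\<forall>T. valid_distributive Z M T \<longrightarrow> strictly_X_distributive Z M T) \<and>
      (\<exists>T. valid_distributive Z M T)"
    then have ad: "admissible M" using adI by blast
    note u = admissible_undoubled[OF ad]
    obtain T where T: "label T = M" "distributive T" "strictly_X_distributive Z M T"
      using h valid_distributive_iff[OF ad] by blast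
    have "twisted_places (td M) \<inter> fibre Z P = {}" if "P \<in> pairs Z" for P
      using tensor_at_status(1)[OF _ distributive_nonsingular[OF T(2)] that, unfolded T(1), OF ad] h that by blast
    then have untw: "twisted_places (td M) = {}"
      using pairing_in unfolding twisted_places_def fibre_def by blast
    have rb: "rigid_below M"
      using h strictly_X_distributiveD(1)[OF ad] valid_distributive_iff[OF ad] unfolding rigid_below_def by blast
    obtain \<mu> where \<mu>: "\<mu> \<in> dgs (td M)" "X M = cls Z (dia (td M) \<mu>)"
      using X_value[OF ad untw rb T(1,2) strictly_X_distributiveD(2)[OF ad T(3)]] .
    show "X M \<noteq> cls Z 0" unfolding \<mu>(2) by (rule tight_dia_cycle(2)[OF \<mu>(1) u untw])
    have "D' = dia (td M) \<mu>" if D': "tight Z D'" "hdata Z D' = td M" for D'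
    proof -
      have "diagram Z D'" "viable_chain Z (fst (hdata Z D'))" using D'(1) by (auto simp: tight_def viable_diagram_def)
      then obtain \<nu> where "\<nu> \<in> dgs (td M)" "D' = dia (td M) \<nu>" using diagram_hdataE[of D'] D'(2) by metis
      then show ?thesis using dgs_unique[OF _ \<mu>(1)] broken_untwisted[OF _ u untw] \<mu>(1) by metis
    qed
    moreover have "tight Z (dia (td M) \<mu>)" using tight_dia_iff[OF \<mu>(1) u] untw by blast
    ultimately show "\<exists>D. tight Z D \<and> hdata Z D = td M \<and>
          (\<forall>D'. tight Z D' \<and> hdata Z D' = td M \<longrightarrow> D' = D) \<and> X M = cls Z D"
      using hdata_dia[OF \<mu>(1)] \<mu>(2) by blast
  qed
qed

end
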